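(* Let $k\geq 3$ be an integer and $N>0$ be such that $k^2=3N^2+4$. Let $\phi\in\mathcal{A}$ be an admissible function and let $v_0,w_0$ be the limiting eigenfunctions on $R(N)=[0,N]\times[0,1]$ of the upper and lower eigenvalue branches, respectively. There exists a constant $c_0\in\left(0,\frac12\right)$, dependent only on $\Lambda_\phi$, such that the following holds: (i) If $k\geq 4$ is even, then the nodal set of $v_0$ separates four nodal domains and features a crossing at $\left(\frac N2,\overline{y}\right)$, where the height satisfies $c_0\leq\overline{y}\leq 1-c_0$. (ii) If $k\geq 5$ is odd, then the nodal set of $v_0$ separates three nodal domains and lies outside $\left\{\left|x-\frac N2\right|<c_0\right\}$. (iii) If $k\geq 8$, then the nodal set of $w_0$ consists of $(k-1)$ disjoint curves that separate $k$ nodal domains and lie outside $$\bigcup_{j=1,\ j\text{ odd}}^{2k-1}\left\{\left|x-\frac{jN}{2k}\right|<c_0\right\}.$$ Each curve intersects the top and bottom boundary. (iv) If $k=5,6,7$, then the nodal set of $w_0$ separates either $k$ or $(k-2)$ nodal domains. In each case, every intersection of the nodal set with the boundary $\partial R(N)$ is orthogonal.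
   Context: Admissible functions: $\mathcal{A}$ is the set of $\phi\in C^5([0,1],[0,1])$ with $\phi(0)=\phi(1)=0$, $\|\phi^{(\ell)}\|_{L^\infty}\leq 1$ for $1\leq\ell\leq 5$, and $\Lambda_\phi:=\int_0^1\phi(y)\sin(2\pi y)\sin(\pi y)\,dy\neq 0$. Domains: $R(N)=[0,N]\times[0,1]$, and for $\eta\geq 0$, $\Omega=\Omega_\phi(\eta,N)=\{(x,y)\in\mathbb{R}^2:\ 0\leq y\leq 1,\ -\eta\phi(y)\leq x\leq N\}$, so $\Omega_\phi(0,N)=R(N)$. Eigenfunctions: on $R(N)$ the Dirichlet eigenpairs (for $\Delta=\partial_x^2+\partial_y^2$, $(\Delta+\lambda)u=0$) are $\psi_{m,n}(x,y)=\frac{2}{\sqrt N}\sin\left(\frac{m\pi}{N}x\right)\sin(n\pi y)$, $\lambda_{m,n}=\pi^2\left(\frac{m^2}{N^2}+n^2\right)$. When $k^2=3N^2+4$ the eigenvalue $\lambda_{2,2}=\lambda_{k,1}$ has multiplicity 2. For small $\eta>0$ it splits into two simple Dirichlet eigenvalue branches $\mu(\eta)>\gamma(\eta)$ of $\Omega_\phi(\eta,N)$ with $\mu(0)=\gamma(0)=\lambda_{2,2}$. Let $v(x,y;\eta)$, $w(x,y;\eta)$ be the $L^2(\Omega)$-normalized eigenfunctions: $(\Delta+\mu)v=0$, $(\Delta+\gamma)w=0$ in $\Omega$, $v=w=0$ on $\partial\Omega$ (unique up to sign, signs chosen so that they depend smoothly on $\eta$). Define $v_0=\lim_{\eta\to0}v$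 and $w_0=\lim_{\eta\to0}w$ on $R(N)$. The nodal set of an eigenfunction $u$ on a domain is the closure of the set of interior points where $u=0$; the nodal domains are the connected components of the interior of the domain minus this zero set.
   Formalization: In case (iv) orthogonality at the boundary is claimed except at points where two nodal arcs with independent tangents meet on the boundary; such points do occur (for k=6, at angles π/3, for some admissible φ), so the literal claim fails there. *)

theory Defs
  imports "HOL-Analysis.Analysis"
begin

subsection \<open>Admissible functions and domains\<close>

definition Lam :: "(real \<Rightarrow> real) \<Rightarrow> real" where
  "Lam \<phi> = integral {0..1} (\<lambda>y. \<phi> y * sin (2 * pi * y) * sin (pi * y))"

text \<open>Here \<open>d l\<close> is the \<open>l\<close>-th derivative of \<open>\<phi>\<close> on \<open>[0,1]\<close>, one-sided at the endpoints. Values of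
  \<open>\<phi>\<close> outside \<open>[0,1]\<close> play no role anywhere.\<close>

definition admissible :: "(real \<Rightarrow> real) \<Rightarrow> bool" where
  "admissible \<phi> \<longleftrightarrow>
     (\<exists>d :: nat \<Rightarrow> real \<Rightarrow> real.
        d 0 = \<phi> \<and>
        (\<forall>l<5. \<forall>y\<in>{0..1}. (d l has_real_derivative d (Suc l) y) (at y within {0..1})) \<and>
        continuous_on {0..1} (d 5) \<and>
        (\<forall>l\<in>{1..5}. \<forall>y\<in>{0..1}. \<bar>d l y\<bar> \<le> 1)) \<and>
     \<phi> ` {0..1} \<subseteq> {0..1} \<and> \<phi> 0 = 0 \<and> \<phi> 1 = 0 \<and> Lam \<phi> \<noteq> 0"

definition rect :: "real \<Rightarrow> (real \<times> real) set" where
  "rect N = {0..N} \<times> {0..1}"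

definition Omega :: "(real \<Rightarrow> real) \<Rightarrow> real \<Rightarrow> real \<Rightarrow> (real \<times> real) set" where
  "Omega \<phi> \<eta> N = {(x, y). 0 \<le> y \<and> y \<le> 1 \<and> - \<eta> * \<phi> y \<le> x \<and> x \<le> N}"

subsection \<open>Dirichlet eigenfunctions\<close>

definition partial_x :: "(real \<times> real \<Rightarrow> real) \<Rightarrow> real \<times> real \<Rightarrow> real" where
  "partial_x u p = deriv (\<lambda>x. u (x, snd p)) (fst p)"

definition partial_y :: "(real \<times> real \<Rightarrow> real) \<Rightarrow> real \<times> real \<Rightarrow> real" where
  "partial_y u p = deriv (\<lambda>y. u (fst p, y)) (snd p)"

definition laplacian :: "(real \<times> real \<Rightarrow> real) \<Rightarrow> real \<times> real \<Rightarrow> real" where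
  "laplacian u p = partial_x (partial_x u) p + partial_y (partial_y u) p"

text \<open>Only meant for open \<open>S\<close>.\<close>

definition C2_on :: "(real \<times> real) set \<Rightarrow> (real \<times> real \<Rightarrow> real) \<Rightarrow> bool" where
  "C2_on S u \<longleftrightarrow>
     u differentiable_on S \<and> partial_x u differentiable_on S \<and> partial_y u differentiable_on S \<and>
     continuous_on S (partial_x (partial_x u)) \<and> continuous_on S (partial_y (partial_x u)) \<and>
     continuous_on S (partial_x (partial_y u)) \<and> continuous_on S (partial_y (partial_y u))"

definition dirichlet_eigenfunction ::
    "(real \<times> real) set \<Rightarrow> real \<Rightarrow> (real \<times> real \<Rightarrow> real) \<Rightarrow> bool" where
  "dirichlet_eigenfunction D lam u \<longleftrightarrow>
     continuous_on D u \<and> C2_on (interior D) u \<and>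
     (\<forall>p\<in>interior D. laplacian u p + lam * u p = 0) \<and>
     (\<forall>p\<in>frontier D. u p = 0) \<and> (\<exists>p\<in>D. u p \<noteq> 0)"

definition simple_dirichlet_eigenvalue :: "(real \<times> real) set \<Rightarrow> real \<Rightarrow> bool" where
  "simple_dirichlet_eigenvalue D lam \<longleftrightarrow>
     (\<exists>u. dirichlet_eigenfunction D lam u \<and>
        (\<forall>f. dirichlet_eigenfunction D lam f \<longrightarrow> (\<exists>c. \<forall>p\<in>D. f p = c * u p)))"

definition normalized_eigenfunction ::
    "(real \<times> real) set \<Rightarrow> real \<Rightarrow> (real \<times> real \<Rightarrow> real) \<Rightarrow> bool" where
  "normalized_eigenfunction D lam u \<longleftrightarrow>
     dirichlet_eigenfunction D lam u \<and> integral D (\<lambda>p. (u p)\<^sup>2) = 1"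

definition rect_eigenvalue :: "real \<Rightarrow> nat \<Rightarrow> nat \<Rightarrow> real" where
  "rect_eigenvalue N m n = pi\<^sup>2 * ((real m)\<^sup>2 / N\<^sup>2 + (real n)\<^sup>2)"

text \<open>\<open>v0\<close> and \<open>w0\<close> are the limits, as \<open>\<eta>\<close> decreases to 0, of the normalized eigenfunctions on the
  upper branch \<open>\<mu>\<close> and the lower branch \<open>\<gamma>\<close> emanating from the double eigenvalue
  \<open>\<lambda>\<^sub>2\<^sub>,\<^sub>2\<close>. The smooth choice of signs enters only through the existence of
  the limits, which are taken uniformly on the rectangle (contained in every \<open>\<Omega>\<close>, as \<open>\<phi> \<ge> 0\<close>).\<close>

definition limiting_eigenfunctions ::
    "(real \<Rightarrow> real) \<Rightarrow> real \<Rightarrow> (real \<times> real \<Rightarrow> real) \<Rightarrow> (real \<times> real \<Rightarrow> real) \<Rightarrow> bool" where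
  "limiting_eigenfunctions \<phi> N v0 w0 \<longleftrightarrow>
     (\<exists>(\<eta>0::real) (\<mu> :: real \<Rightarrow> real) (\<gamma> :: real \<Rightarrow> real)
        (v :: real \<Rightarrow> real \<times> real \<Rightarrow> real) (w :: real \<Rightarrow> real \<times> real \<Rightarrow> real).
        \<eta>0 > 0 \<and>
        continuous_on {0..<\<eta>0} \<mu> \<and> continuous_on {0..<\<eta>0} \<gamma> \<and>
        \<mu> 0 = rect_eigenvalue N 2 2 \<and> \<gamma> 0 = rect_eigenvalue N 2 2 \<and>
        (\<forall>\<eta>\<in>{0<..<\<eta>0}.
           \<gamma> \<eta> < \<mu> \<eta> \<and>
           simple_dirichlet_eigenvalue (Omega \<phi> \<eta> N) (\<mu> \<eta>) \<and>
           simple_dirichlet_eigenvalue (Omega \<phi> \<eta> N) (\<gamma> \<eta>) \<and>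
           normalized_eigenfunction (Omega \<phi> \<eta> N) (\<mu> \<eta>) (v \<eta>) \<and>
           normalized_eigenfunction (Omega \<phi> \<eta> N) (\<gamma> \<eta>) (w \<eta>)) \<and>
        uniform_limit (rect N) v v0 (at_right 0) \<and>
        uniform_limit (rect N) w w0 (at_right 0))"

subsection \<open>Nodal sets and their geometry\<close>

definition nodal_set :: "(real \<times> real) set \<Rightarrow> (real \<times> real \<Rightarrow> real) \<Rightarrow> (real \<times> real) set" where
  "nodal_set D u = closure {p \<in> interior D. u p = 0}"

definition nodal_domains ::
    "(real \<times> real) set \<Rightarrow> (real \<times> real \<Rightarrow> real) \<Rightarrow> (real \<times> real) set set" where
  "nodal_domains D u = components (interior D - nodal_set D u)"

definition C1_arc :: "(real \<Rightarrow> real \<times> real) \<Rightarrow> (real \<Rightarrow> real \<times> real) \<Rightarrow> bool" where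
  "C1_arc g g' \<longleftrightarrow>
     arc g \<and> continuous_on {0..1} g' \<and>
     (\<forall>t\<in>{0..1}. (g has_vector_derivative g' t) (at t within {0..1}) \<and> g' t \<noteq> 0)"

text \<open>Near \<open>p\<close> the set \<open>Z\<close> is the union of two arcs which pass through \<open>p\<close>, at an inner parameter,
  with linearly independent tangents.\<close>

definition crossing_at :: "(real \<times> real) set \<Rightarrow> real \<times> real \<Rightarrow> bool" where
  "crossing_at Z p \<longleftrightarrow>
     (\<exists>g g' h h' U.
        C1_arc g g' \<and> C1_arc h h' \<and> g (1/2) = p \<and> h (1/2) = p \<and>
        path_image g \<inter> path_image h = {p} \<and>
        \<not> collinear {0, g' (1/2), h' (1/2)} \<and>
        open U \<and> p \<in> U \<and> Z \<inter> U = (path_image g \<union> path_image h) \<inter> U)"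

text \<open>For a boundary point \<open>p\<close> of \<open>rect N\<close>: near \<open>p\<close> the set \<open>Z\<close> is a single arc which leaves \<open>p\<close>
  perpendicularly to the side containing \<open>p\<close>. This is never the case at a corner, where
  both coordinates of the nonzero tangent would have to vanish.\<close>

definition meets_orthogonally :: "real \<Rightarrow> (real \<times> real) set \<Rightarrow> real \<times> real \<Rightarrow> bool" where
  "meets_orthogonally N Z p \<longleftrightarrow>
     (\<exists>g g' U.
        C1_arc g g' \<and> pathstart g = p \<and>
        open U \<and> p \<in> U \<and> Z \<inter> U = path_image g \<inter> U \<and>
        (fst p \<in> {0, N} \<longrightarrow> snd (g' 0) = 0) \<and>
        (snd p \<in> {0, 1} \<longrightarrow> fst (g' 0) = 0))"

text \<open>For a boundary point \<open>p\<close>: near \<open>p\<close> the set \<open>Z\<close> consists of two arcs leaving \<open>p\<close> in linearly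
  independent directions. For \<open>k = 5, 6, 7\<close> this does occur: at the transition between \<open>k\<close> and \<open>k - 2\<close>
  nodal domains two nodal curves of \<open>w0\<close> meet on the top or bottom side, at angles
  \<open>\<pi>/3\<close>, and such a point has to be exempted from orthogonality. For \<open>k = 6\<close> and
  \<open>w0 = C * sin (\<pi> y) * sin (2 \<pi> x / N) * (4 (cos (2 \<pi> x / N))\<^sup>2 - 1 - cos (\<pi> y))\<close>,
  which arises from some admissible \<open>\<phi>\<close>, it happens at \<open>(N/4, 1)\<close>.\<close>

definition boundary_branch_point :: "(real \<times> real) set \<Rightarrow> real \<times> real \<Rightarrow> bool" where
  "boundary_branch_point Z p \<longleftrightarrow>
     (\<exists>g g' h h' U.
        C1_arc g g' \<and> C1_arc h h' \<and> pathstart g = p \<and> pathstart h = p \<and>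
        path_image g \<inter> path_image h = {p} \<and>
        \<not> collinear {0, g' 0, h' 0} \<and>
        open U \<and> p \<in> U \<and> Z \<inter> U = (path_image g \<union> path_image h) \<inter> U)"

end

theory Submission
 imports Defs
begin

text \<open>Sine modes stretched to the width of the perturbed domain satisfy its boundary condition. Green's
 identity between such a trial function and an eigenfunction therefore has no boundary term, and
 divided by \<open>\<eta>\<close> it passes to the limit \<open>\<eta> \<rightarrow> 0\<close>. Testing with all modes puts \<open>v0\<close> and \<open>w0\<close> into the
 span of the two resonant modes, since products of sines are complete. Testing with the resonant modes
 makes their coefficient vectors eigenvectors of a symmetric 2x2 matrix with off-diagonal entry
 proportional to \<open>Lam \<phi>\<close>, and the order of the eigenvalues tells the two apart. Up to factors,
 \<open>v0 = sin (2X) sin (2Y) - \<tau> sin (kX) sin Y\<close> and \<open>w0 = sin (kX) sin Y + \<tau> sin (2X) sin (2Y)\<close> with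
 \<open>X = \<pi> x / N\<close>, \<open>Y = \<pi> y\<close>, and bounding the matrix entries gives \<open>\<bar>Lam \<phi>\<bar> \<le> k \<bar>\<tau>\<bar> \<le> 4 - (Lam \<phi>)^2 / 6\<close>.

 Divided by \<open>sin X sin Y\<close> both functions have the form \<open>r D(X) + 4 s cos X cos Y\<close> with
 \<open>D(X) = sin (kX) / sin X\<close>. This is affine in \<open>cos Y\<close>, so the components of its sign regions
 correspond to the intervals on which \<open>\<plusminus> r D(X) + 4 \<bar>s cos X\<bar> > 0\<close>. These intervals are found by
 computing the sign of the derivative at the zeros of a function of \<open>X\<close>.\<close>

subsection \<open>Green's identity for functions decaying at the boundary\<close>

text \<open>The obstacle is regularity: an eigenfunction is only continuous up to the boundary of a
  domain with corners, so neither its gradient there nor its derivative in \<eta> is at hand.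
  Green's identity is therefore proved with a cut-off, at the price of a linear decay of both
  functions towards every side. Eigenfunctions obtain it from explicit barriers, trial functions
  from their formula. The same decay, uniform in \<eta>, makes the strip added on the left
  negligible in the limit. Continuity of the two branches then suffices: differentiability of the
  eigenvalues at 0 comes out of the identity, because some resonant moment of a normalized limit is
  nonzero.

  The geometry rests on k |\<tau>| < 4. It decides which frequency dominates the derivative at a
  zero, and for k \<ge> 8 it implies 2 |\<tau>| < 1, which separates the curves of
  \<open>w0\<close>. For k = 5, 6, 7 it does not, hence the two possible counts and the separate
  treatment through polynomials in cos X. The gap below 4 is quadratic in \<open>Lam \<phi>\<close>,
  and k |\<tau>| is also bounded below by |\<open>Lam \<phi>\<close>|, so that all widths depend on
  \<open>Lam \<phi>\<close> alone.\<close>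

definition C2_partials :: "(real \<times> real) set => (real \<times> real => real) => (real \<times> real => real) =>
  (real \<times> real => real) => (real \<times> real => real) => (real \<times> real => real) => bool" where
 "C2_partials W u ux uy uxx uyy \<longleftrightarrow>
   continuous_on W u \<and> continuous_on W ux \<and> continuous_on W uy \<and>
   continuous_on W uxx \<and> continuous_on W uyy \<and>
   (\<forall>x y. (x, y) \<in> W \<longrightarrow>
    ((\<lambda>x. u (x, y)) has_real_derivative ux (x, y)) (at x) \<and>
    ((\<lambda>y. u (x, y)) has_real_derivative uy (x, y)) (at y) \<and>
    ((\<lambda>x. ux (x, y)) has_real_derivative uxx (x, y)) (at x) \<and>
    ((\<lambda>y. uy (x, y)) has_real_derivative uyy (x, y)) (at y))"

lemma integral_eq_iterated:
 fixes G :: "real \<times> real => real" and a b c d :: real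
 assumes cont: "continuous_on (cbox (a, c) (b, d)) G" and zero: "\<And>p. p \<notin> cbox (a, c) (b, d) ==> G p = 0"
 shows "integrable lborel G"
  and "(\<integral>p. G p \<partial>lborel) = integral {a..b} (\<lambda>x. integral {c..d} (\<lambda>y. G (x, y)))"
  and "(\<integral>p. G p \<partial>lborel) = integral {c..d} (\<lambda>y. integral {a..b} (\<lambda>x. G (x, y)))"
proof -
 let ?B = "cbox (a, c) (b, d)"
 have eq: "(\<lambda>p. indicator ?B p *\<^sub>R G p) = G"
 proof
  show "indicator ?B p *\<^sub>R G p = G p" for p
   using zero[of p] by (cases "p \<in> ?B") simp_all
 qed
 have int: "integrable lborel (\<lambda>p. indicator ?B p *\<^sub>R G p)"
  using cont by (intro borel_integrable_compact) auto
 then show "integrable lborel G" unfolding eq .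
 have "set_integrable lborel ?B G" using int by (simp add: set_integrable_def)
 then have "(LINT p : ?B | lborel. G p) = integral ?B G" by (rule set_borel_integral_eq_integral)
 then have 1: "(\<integral>p. G p \<partial>lborel) = integral ?B G"
  unfolding set_lebesgue_integral_def eq .
 also have 2: "... = integral (cbox a b) (\<lambda>x. integral (cbox c d) (\<lambda>y. G (x, y)))"
  by (rule integral_prod_continuous [OF cont])
 finally show "(\<integral>p. G p \<partial>lborel) = integral {a..b} (\<lambda>x. integral {c..d} (\<lambda>y. G (x, y)))" by simp
 have "integral (cbox a b) (\<lambda>x. integral (cbox c d) (\<lambda>y. G (x, y))) =
   integral (cbox c d) (\<lambda>y. integral (cbox a b) (\<lambda>x. G (x, y)))"
  using integral_swap_continuous[of a c b d "\<lambda>x y. G (x, y)"] cont by simp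
 with 1 2 show "(\<integral>p. G p \<partial>lborel) = integral {c..d} (\<lambda>y. integral {a..b} (\<lambda>x. G (x, y)))"
  by simp
qed

lemma has_real_derivative_zero_on_open:
 fixes f :: "real => real"
 assumes "open S" "x \<in> S" "\<And>y. y \<in> S ==> f y = 0"
 shows "(f has_real_derivative 0) (at x)"
 by (rule has_field_derivative_transform_within_open[OF _ assms(1,2), of "\<lambda>_. 0"])
   (use assms(3) in auto)

lemma open_slice:
 assumes "open (W :: (real \<times> real) set)"
 shows "open {x. (x, y) \<in> W}" "open {y. (x, y) \<in> W}"
proof -
 have "open ((\<lambda>x. (x, y)) -` W)" by (rule open_vimage[OF assms]) (auto intro!: continuous_intros)
 then show "open {x. (x, y) \<in> W}" by (simp add: vimage_def)
 have "open ((\<lambda>y. (x, y)) -` W)" by (rule open_vimage[OF assms]) (auto intro!: continuous_intros)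
 then show "open {y. (x, y) \<in> W}" by (simp add: vimage_def)
qed

lemma continuous_on_indicator_mult:
 fixes f :: "'a::t2_space => real"
 assumes W: "open W" and K: "compact K" "K \<subseteq> W" and c: "continuous_on W f"
  and z: "\<And>p. p \<in> W - K ==> f p = 0"
 shows "continuous_on UNIV (\<lambda>p. indicator W p * f p)"
proof -
 have K': "open (- K)" using K(1) by (simp add: compact_imp_closed open_Compl)
 have 1: "continuous_on W (\<lambda>p. indicator W p * f p)"
  by (rule continuous_on_eq[OF c]) auto
 have 2: "continuous_on (- K) (\<lambda>p. indicator W p * f p)"
  by (rule continuous_on_eq[of _ "\<lambda>_. 0"]) (use z in \<open>auto simp: indicator_def\<close>)
 have "W \<union> - K = UNIV" using K(2) by auto
 with continuous_on_open_Un[OF W K' 1 2] show ?thesis by simp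
qed

lemma integrable_compact_support:
 fixes f :: "real \<times> real => real"
 assumes W: "open W" and K: "compact K" "K \<subseteq> W" and c: "continuous_on W f"
  and z: "\<And>p. p \<in> W - K ==> f p = 0"
 shows "integrable lborel (\<lambda>p. indicator W p * f p)"
proof -
 have "integrable lborel (\<lambda>p. indicator K p *\<^sub>R f p)"
  using K c by (intro borel_integrable_compact) (auto intro: continuous_on_subset)
 moreover have "(\<lambda>p. indicator K p *\<^sub>R f p) = (\<lambda>p. indicator W p * f p)"
  using z K(2) by (auto simp: indicator_def fun_eq_iff)
 ultimately show ?thesis by simp
qed

text \<open>Extended by zero, \<open>F\<close> is differentiable on the whole plane and vanishes on
  the edges of a box around \<open>K\<close>, so every line integral of its derivative telescopes to
  0. The two claims are the halves of a divergence theorem without boundary term.\<close>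

lemma integral_partial_zero:
 fixes F :: "real \<times> real => real"
 assumes W: "open W" and K: "compact K" "K \<subseteq> W"
  and z: "\<And>p. p \<in> W - K ==> F p = 0"
 shows "\<lbrakk>continuous_on W Fx;
   \<And>x y. (x, y) \<in> W ==> ((\<lambda>x. F (x, y)) has_real_derivative Fx (x, y)) (at x)\<rbrakk>
  \<Longrightarrow> integrable lborel (\<lambda>p. indicator W p * Fx p) \<and> (\<integral>p. indicator W p * Fx p \<partial>lborel) = 0"
  and "\<lbrakk>continuous_on W Fy;
   \<And>x y. (x, y) \<in> W ==> ((\<lambda>y. F (x, y)) has_real_derivative Fy (x, y)) (at y)\<rbrakk>
  \<Longrightarrow> integrable lborel (\<lambda>p. indicator W p * Fy p) \<and> (\<integral>p. indicator W p * Fy p \<partial>lborel) = 0"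
proof -
 define F' where "F' p = indicator W p * F p" for p
 have K': "open (- K)" using K(1) by (simp add: compact_imp_closed open_Compl)
 have WK: "open (W - K)" using W K(1) by (simp add: compact_imp_closed open_Diff)
 have F'0: "F' p = 0" if "p \<notin> K" for p using that z by (auto simp: F'_def indicator_def)
 obtain e where e: "K \<subseteq> box (- e) e"
  using bounded_subset_box_symmetric[OF compact_imp_bounded[OF K(1)]] by blast
 obtain a b where ab: "e = (a, b)" by (cases e)
 have sub: "K \<subseteq> box (-a, -b) (a, b)" using e ab by simp
 have sub': "K \<subseteq> cbox (-a, -b) (a, b)" using sub box_subset_cbox by blast
 {
  assume c: "continuous_on W Fx" and d: "\<And>x y. (x, y) \<in> W ==>
   ((\<lambda>x. F (x, y)) has_real_derivative Fx (x, y)) (at x)"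
  define G where "G p = indicator W p * Fx p" for p
  \<comment> \<open>\<open>F\<close> vanishes on the open set \<open>W - K\<close>, hence so does
    its derivative; this is what makes \<open>G\<close> continuous across the boundary of
    \<open>W\<close>.\<close>
  have Fz: "Fx p = 0" if "p \<in> W - K" for p
  proof (cases p)
   case (Pair x y)
   have "((\<lambda>x. F (x, y)) has_real_derivative 0) (at x)"
    by (rule has_real_derivative_zero_on_open[OF open_slice(1)[OF WK, of y]])
      (use that Pair z in auto)
   with d[of x y] that Pair show ?thesis by (auto dest: DERIV_unique)
  qed
  have G0: "G p = 0" if "p \<notin> K" for p using that Fz by (auto simp: G_def indicator_def)
  have cG: "continuous_on UNIV G"
   unfolding G_def by (rule continuous_on_indicator_mult[OF W K c Fz])
  have d': "((\<lambda>x. F' (x, y)) has_real_derivative G (x, y)) (at x)" for x y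
  proof (cases "(x, y) \<in> W")
   case True
   have "((\<lambda>x. F' (x, y)) has_real_derivative Fx (x, y)) (at x)"
    by (rule has_field_derivative_transform_within_open[OF d[OF True] open_slice(1)[OF W, of y]])
      (use True in \<open>auto simp: F'_def\<close>)
   then show ?thesis using True by (simp add: G_def)
  next
   case False
   then have *: "(x, y) \<in> - K" using K(2) by auto
   have "((\<lambda>x. F' (x, y)) has_real_derivative 0) (at x)"
    by (rule has_real_derivative_zero_on_open[OF open_slice(1)[OF K', of y]])
      (use * F'0 in auto)
   then show ?thesis using False by (simp add: G_def)
  qed
  have G1: "continuous_on (cbox (-a, -b) (a, b)) G" using cG continuous_on_subset by blast
  have G2: "G p = 0" if "p \<notin> cbox (-a, -b) (a, b)" for p using G0 sub' that by blast
  have "integral {-a..a} (\<lambda>x. G (x, y)) = 0" for y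
  proof (cases "-a \<le> a")
   case True
   have "((\<lambda>x. G (x, y)) has_integral (F' (a, y) - F' (-a, y))) {-a..a}"
    by (rule fundamental_theorem_of_calculus[OF True])
      (use d' in \<open>auto simp: has_real_derivative_iff_has_vector_derivative[symmetric]
       intro: has_field_derivative_at_within\<close>)
   moreover have "F' (a, y) = 0" "F' (-a, y) = 0"
    using sub subsetD[OF sub] by (auto intro!: F'0 dest!: subsetD[OF sub] simp: mem_box Basis_prod_def)
   ultimately show ?thesis by (simp add: integral_unique)
  qed simp
  then have "(\<integral>p. G p \<partial>lborel) = 0" using integral_eq_iterated(3)[OF G1 G2] by simp
  with integral_eq_iterated(1)[OF G1 G2]
  show "integrable lborel (\<lambda>p. indicator W p * Fx p) \<and> (\<integral>p. indicator W p * Fx p \<partial>lborel) = 0"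
   unfolding G_def by blast
 }
 {
  assume c: "continuous_on W Fy" and d: "\<And>x y. (x, y) \<in> W ==>
   ((\<lambda>y. F (x, y)) has_real_derivative Fy (x, y)) (at y)"
  define G where "G p = indicator W p * Fy p" for p
  have Fz: "Fy p = 0" if "p \<in> W - K" for p
  proof (cases p)
   case (Pair x y)
   have "((\<lambda>y. F (x, y)) has_real_derivative 0) (at y)"
    by (rule has_real_derivative_zero_on_open[OF open_slice(2)[OF WK, of x]])
      (use that Pair z in auto)
   with d[of x y] that Pair show ?thesis by (auto dest: DERIV_unique)
  qed
  have G0: "G p = 0" if "p \<notin> K" for p using that Fz by (auto simp: G_def indicator_def)
  have cG: "continuous_on UNIV G"
   unfolding G_def by (rule continuous_on_indicator_mult[OF W K c Fz])
  have d': "((\<lambda>y. F' (x, y)) has_real_derivative G (x, y)) (at y)" for x y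
  proof (cases "(x, y) \<in> W")
   case True
   have "((\<lambda>y. F' (x, y)) has_real_derivative Fy (x, y)) (at y)"
    by (rule has_field_derivative_transform_within_open[OF d[OF True] open_slice(2)[OF W, of x]])
      (use True in \<open>auto simp: F'_def\<close>)
   then show ?thesis using True by (simp add: G_def)
  next
   case False
   then have *: "(x, y) \<in> - K" using K(2) by auto
   have "((\<lambda>y. F' (x, y)) has_real_derivative 0) (at y)"
    by (rule has_real_derivative_zero_on_open[OF open_slice(2)[OF K', of x]])
      (use * F'0 in auto)
   then show ?thesis using False by (simp add: G_def)
  qed
  have G1: "continuous_on (cbox (-a, -b) (a, b)) G" using cG continuous_on_subset by blast
  have G2: "G p = 0" if "p \<notin> cbox (-a, -b) (a, b)" for p using G0 sub' that by blast
  have "integral {-b..b} (\<lambda>y. G (x, y)) = 0" for x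
  proof (cases "-b \<le> b")
   case True
   have "((\<lambda>y. G (x, y)) has_integral (F' (x, b) - F' (x, -b))) {-b..b}"
    by (rule fundamental_theorem_of_calculus[OF True])
      (use d' in \<open>auto simp: has_real_derivative_iff_has_vector_derivative[symmetric]
       intro: has_field_derivative_at_within\<close>)
   moreover have "F' (x, b) = 0" "F' (x, -b) = 0"
    using sub subsetD[OF sub] by (auto intro!: F'0 dest!: subsetD[OF sub] simp: mem_box Basis_prod_def)
   ultimately show ?thesis by (simp add: integral_unique)
  qed simp
  then have "(\<integral>p. G p \<partial>lborel) = 0" using integral_eq_iterated(2)[OF G1 G2] by simp
  with integral_eq_iterated(1)[OF G1 G2]
  show "integrable lborel (\<lambda>p. indicator W p * Fy p) \<and> (\<integral>p. indicator W p * Fy p \<partial>lborel) = 0"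
   unfolding G_def by blast
 }
qed

text \<open>Squaring removes the kink of the positive part. This is why the cut-off in
  \<open>green_zero\<close> enters squared.\<close>

lemma has_real_derivative_positive_part_square:
 fixes f :: "real => real"
 assumes "(f has_real_derivative f') (at x)"
 shows "((\<lambda>x. (max 0 (f x))^2) has_real_derivative 2 * max 0 (f x) * f') (at x)"
proof -
 have *: "((\<lambda>s. (max 0 s)^2) has_real_derivative 2 * max 0 s) (at s)" for s :: real
 proof -
  consider "s > 0" | "s < 0" | "s = 0" by linarith
  then show ?thesis
  proof cases
   case 1
   have "((\<lambda>s. s^2) has_real_derivative 2 * s) (at s)" by (auto intro!: derivative_eq_intros)
   then have "((\<lambda>s. (max 0 s)^2) has_real_derivative 2 * s) (at s)"
    by (rule has_field_derivative_transform_within_open[of _ _ _ "{0<..}"]) (use 1 in auto)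
   then show ?thesis using 1 by simp
  next
   case 2
   have "((\<lambda>s. (max 0 s)^2) has_real_derivative 0) (at s)"
    by (rule has_real_derivative_zero_on_open[of "{..<0}"]) (use 2 in auto)
   then show ?thesis using 2 by simp
  next
   case 3
   have "((\<lambda>h. ((max 0 (0 + h))^2 - (max 0 0)^2) / h) \<longlongrightarrow> (0::real)) (at 0)"
   proof (rule Lim_null_comparison[where g = "\<lambda>h. \<bar>h\<bar>"])
    show "\<forall>\<^sub>F h in at 0. norm (((max 0 (0 + h))^2 - (max 0 0)^2) / h) \<le> \<bar>h::real\<bar>"
     by (intro always_eventually allI) (auto simp: max_def power2_eq_square)
    show "((\<lambda>h. \<bar>h\<bar>) \<longlongrightarrow> (0::real)) (at 0)" by (intro tendsto_eq_intros) auto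
   qed
   then show ?thesis using 3 by (simp add: DERIV_def)
  qed
 qed
 have "((\<lambda>x. (\<lambda>s. (max 0 s)^2) (f x)) has_real_derivative (2 * max 0 (f x)) * f') (at x)"
  by (rule DERIV_chain2[OF * assms])
 then show ?thesis by simp
qed

text \<open>The divergence identity is multiplied by the square of \<kappa> = max 0 (1 - e /
  \<rho>), which has compact support. Where \<kappa> > 0, its gradient is e grad \<rho> / \<rho>^2,
  and the bounds on \<open>u p * \<rho>x p\<close> and \<open>u p * \<rho>y p\<close> turn u times
  this gradient into something of size C e / \<rho>, which is at most C on the support and tends to
  0 pointwise. The gradients of u and v, about which nothing is assumed near the boundary, are
  controlled in mean square by a Caccioppoli estimate.\<close>

lemma green_zero:
 fixes \<rho> u v :: "real \<times> real => real"
 assumes W: "open W" "bounded W"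
  and \<rho>: "continuous_on W \<rho>" "continuous_on W \<rho>x" "continuous_on W \<rho>y"
   "\<And>x y. (x, y) \<in> W ==> ((\<lambda>x. \<rho> (x, y)) has_real_derivative \<rho>x (x, y)) (at x)"
   "\<And>x y. (x, y) \<in> W ==> ((\<lambda>y. \<rho> (x, y)) has_real_derivative \<rho>y (x, y)) (at y)"
   "\<And>p. p \<in> W ==> \<rho> p > 0"
   "\<And>e. e > 0 ==> compact {p\<in>W. e \<le> \<rho> p}"
  and u: "C2_partials W u ux uy uxx uyy"
   "\<And>p. p \<in> W ==> \<bar>u p\<bar> \<le> C" "\<And>p. p \<in> W ==> \<bar>uxx p + uyy p\<bar> \<le> C"
   "\<And>p. p \<in> W ==> \<bar>u p * \<rho>x p\<bar> \<le> C * \<rho> p" "\<And>p. p \<in> W ==> \<bar>u p * \<rho>y p\<bar> \<le> C * \<rho> p"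
  and v: "C2_partials W v vx vy vxx vyy"
   "\<And>p. p \<in> W ==> \<bar>v p\<bar> \<le> C" "\<And>p. p \<in> W ==> \<bar>vxx p + vyy p\<bar> \<le> C"
   "\<And>p. p \<in> W ==> \<bar>v p * \<rho>x p\<bar> \<le> C * \<rho> p" "\<And>p. p \<in> W ==> \<bar>v p * \<rho>y p\<bar> \<le> C * \<rho> p"
 shows "(\<integral>p. indicator W p * (u p * (vxx p + vyy p) - v p * (uxx p + uyy p)) \<partial>lborel) = 0"
proof (cases "W = {}")
 case False
 then have C0: "C \<ge> 0" using u(2) by force
 define \<kappa> where "\<kappa> e p = max 0 (1 - e / \<rho> p)" for e p
 define K where "K e = {p\<in>W. e \<le> \<rho> p}" for e
 have K: "compact (K e)" "K e \<subseteq> W" if "e > 0" for e using \<rho>(7)[OF that] by (auto simp: K_def)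
 have \<rho>nz: "\<rho> p \<noteq> 0" if "p \<in> W" for p using \<rho>(6)[OF that] by simp
 have \<kappa>c: "continuous_on W (\<kappa> e)" for e
  unfolding \<kappa>_def by (intro continuous_intros \<rho>) (use \<rho>nz in auto)
 have \<kappa>0: "\<kappa> e p = 0" if "p \<in> W - K e" "e > 0" for e p
  using that \<rho>(6)[of p] by (auto simp: \<kappa>_def K_def max_def field_simps)
 have \<kappa>le: "0 \<le> \<kappa> e p" "\<kappa> e p \<le> 1" if "p \<in> W" "e > 0" for e p
  using that \<rho>(6)[of p] by (auto simp: \<kappa>_def)
 have d\<kappa>x: "((\<lambda>x. (\<kappa> e (x, y))^2) has_real_derivative
   2 * \<kappa> e (x, y) * (e * \<rho>x (x, y) / (\<rho> (x, y))^2)) (at x)" if "(x, y) \<in> W" for e x y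
  unfolding \<kappa>_def
  by (rule has_real_derivative_positive_part_square)
    (use \<rho>nz[OF that] in \<open>auto intro!: derivative_eq_intros \<rho>(4)[OF that] simp: power2_eq_square\<close>)
 have d\<kappa>y: "((\<lambda>y. (\<kappa> e (x, y))^2) has_real_derivative
   2 * \<kappa> e (x, y) * (e * \<rho>y (x, y) / (\<rho> (x, y))^2)) (at y)" if "(x, y) \<in> W" for e x y
  unfolding \<kappa>_def
  by (rule has_real_derivative_positive_part_square)
    (use \<rho>nz[OF that] in \<open>auto intro!: derivative_eq_intros \<rho>(5)[OF that] simp: power2_eq_square\<close>)
 have cu: "continuous_on W u" "continuous_on W ux" "continuous_on W uy" "continuous_on W uxx"
   "continuous_on W uyy"
  and cv: "continuous_on W v" "continuous_on W vx" "continuous_on W vy" "continuous_on W vxx"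
   "continuous_on W vyy"
  using u(1) v(1) by (auto simp: C2_partials_def)
 define J where "J f = (\<integral>p. indicator W p * f p \<partial>lborel)" for f :: "real \<times> real => real"
 have int\<kappa>: "integrable lborel (\<lambda>p. indicator W p * (\<kappa> e p * f p))"
  if "continuous_on W f" "e > 0" for f e
  by (rule integrable_compact_support[OF W(1) K[OF that(2)]])
    (use \<kappa>0 that in \<open>auto intro!: continuous_intros \<kappa>c\<close>)
 have intb: "integrable lborel (\<lambda>p. indicator W p * f p)"
  if "continuous_on W f" "\<And>p. p \<in> W ==> \<bar>f p\<bar> \<le> B" for f :: "real \<times> real => real" and B :: real
 proof -
  have "integrable lborel (\<lambda>p. indicator W p *\<^sub>R f p)"
   by (rule integrableI_bounded_set[where A = W and B = B])
     (use that W emeasure_bounded_finite[OF W(2)] in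
      \<open>auto intro!: borel_measurable_continuous_on_indicator simp del: real_scaleR_def\<close>)
  then show ?thesis by simp
 qed
 \<comment> \<open>Divergence theorem for the field (P, Q) times the squared cut-off. One factor
   \<kappa> stays on the right, to be paired with the gradient contained in P and Q.\<close>
 have div: "J (\<lambda>p. \<kappa> e p * (\<kappa> e p * (Px p + Qy p))) =
   - J (\<lambda>p. \<kappa> e p * (2 * (e / (\<rho> p)^2) * (\<rho>x p * P p + \<rho>y p * Q p)))"
  if e: "e > 0" and c: "continuous_on W P" "continuous_on W Q" "continuous_on W Px" "continuous_on W Qy"
   and d: "\<And>x y. (x, y) \<in> W ==> ((\<lambda>x. P (x, y)) has_real_derivative Px (x, y)) (at x)"
     "\<And>x y. (x, y) \<in> W ==> ((\<lambda>y. Q (x, y)) has_real_derivative Qy (x, y)) (at y)"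
  for e P Q Px Qy
 proof -
  let ?A = "\<lambda>p. 2 * \<kappa> e p * (e * \<rho>x p / (\<rho> p)^2) * P p + (\<kappa> e p)^2 * Px p"
  let ?B = "\<lambda>p. 2 * \<kappa> e p * (e * \<rho>y p / (\<rho> p)^2) * Q p + (\<kappa> e p)^2 * Qy p"
  have A: "integrable lborel (\<lambda>p. indicator W p * ?A p) \<and> (\<integral>p. indicator W p * ?A p \<partial>lborel) = 0"
  proof (rule integral_partial_zero(1)[OF W(1) K[OF e], where F = "\<lambda>p. (\<kappa> e p)^2 * P p"])
   show "continuous_on W ?A" by (intro continuous_intros \<kappa>c c \<rho>) (use \<rho>nz in auto)
   fix x y assume xy: "(x, y) \<in> W"
   show "((\<lambda>x. (\<kappa> e (x, y))^2 * P (x, y)) has_real_derivative ?A (x, y)) (at x)"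
    by (rule DERIV_cong[OF DERIV_mult[OF d\<kappa>x[OF xy] d(1)[OF xy]]]) simp
  qed (use \<kappa>0 e in auto)
  have B: "integrable lborel (\<lambda>p. indicator W p * ?B p) \<and> (\<integral>p. indicator W p * ?B p \<partial>lborel) = 0"
  proof (rule integral_partial_zero(2)[OF W(1) K[OF e], where F = "\<lambda>p. (\<kappa> e p)^2 * Q p"])
   show "continuous_on W ?B" by (intro continuous_intros \<kappa>c c \<rho>) (use \<rho>nz in auto)
   fix x y assume xy: "(x, y) \<in> W"
   show "((\<lambda>y. (\<kappa> e (x, y))^2 * Q (x, y)) has_real_derivative ?B (x, y)) (at y)"
    by (rule DERIV_cong[OF DERIV_mult[OF d\<kappa>y[OF xy] d(2)[OF xy]]]) simp
  qed (use \<kappa>0 e in auto)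
  let ?F = "\<lambda>p. indicator W p * (\<kappa> e p * (\<kappa> e p * (Px p + Qy p)))"
  let ?G = "\<lambda>p. indicator W p * (\<kappa> e p * (2 * (e / (\<rho> p)^2) * (\<rho>x p * P p + \<rho>y p * Q p)))"
  have iF: "integrable lborel ?F"
   by (rule int\<kappa>[OF _ e]) (intro continuous_intros \<kappa>c c \<rho>)
  have iG: "integrable lborel ?G"
   by (rule int\<kappa>[OF _ e]) (intro continuous_intros \<kappa>c c \<rho>, use \<rho>nz in auto)
  have "(\<integral>p. ?F p \<partial>lborel) + (\<integral>p. ?G p \<partial>lborel) = (\<integral>p. ?F p + ?G p \<partial>lborel)"
   using iF iG by simp
  also have "... = (\<integral>p. indicator W p * ?A p + indicator W p * ?B p \<partial>lborel)"
   by (rule Bochner_Integration.integral_cong) (auto simp: power2_eq_square divide_inverse algebra_simps)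
  also have "... = 0" using A B by (subst Bochner_Integration.integral_add) auto
  finally show ?thesis by (simp add: J_def)
 qed
 define V where "V = J (\<lambda>_. 1)"
 have intc: "integrable lborel (\<lambda>p. indicator W p * (c::real))" for c
  by (rule intb[where B = "\<bar>c\<bar>"]) auto
 have Jc: "J (\<lambda>_. c) = c * V" for c
  unfolding V_def J_def by (simp add: mult.commute)
 have V0: "V \<ge> 0" unfolding V_def J_def by (intro Bochner_Integration.integral_nonneg) auto
 \<comment> \<open>Where \<open>\<kappa> e p\<close> is nonzero one has e < \<rho>, so the minimum
   is e / \<rho>. Taking the minimum with 1 keeps the majorant bounded on all of \<open>W\<close>,
   as dominated convergence requires.\<close>
 have small: "(e / (\<rho> p)^2 * w)^2 \<le> C^2 * (min 1 (e / \<rho> p))^2"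
  if p: "p \<in> W" and e: "e > 0" and \<kappa>p: "\<kappa> e p \<noteq> 0" and wle: "\<bar>w\<bar> \<le> C * \<rho> p" for e p w
 proof -
  have "e < \<rho> p" using \<kappa>p \<rho>(6)[OF p] by (auto simp: \<kappa>_def max_def field_simps split: if_splits)
  then have m: "min 1 (e / \<rho> p) = e / \<rho> p" using e by (simp add: min_def field_simps)
  have "\<bar>e / (\<rho> p)^2 * w\<bar> = e / (\<rho> p)^2 * \<bar>w\<bar>" using e by (simp add: abs_mult)
  also have "... \<le> e / (\<rho> p)^2 * (C * \<rho> p)" using e wle by (intro mult_left_mono) auto
  also have "... = C * (e / \<rho> p)" using \<rho>nz[OF p] by (simp add: power2_eq_square)
  finally have "\<bar>e / (\<rho> p)^2 * w\<bar> \<le> \<bar>C * (e / \<rho> p)\<bar>" by linarith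
  then show ?thesis unfolding m power_mult_distrib[symmetric] by (rule abs_le_square_iff[THEN iffD1])
 qed
 \<comment> \<open>Caccioppoli estimate with the field f grad f. The constant 10 is twice 1 + 4: the
   1 comes from f times its Laplacian, the 4 from two Young inequalities, and the factor 2 from
   absorbing half of the Dirichlet integral.\<close>
 have energy: "J (\<lambda>p. \<kappa> e p * (\<kappa> e p * ((fx p)^2 + (fy p)^2))) \<le> 10 * C^2 * V"
  if e: "e > 0" and f: "C2_partials W f fx fy fxx fyy"
   "\<And>p. p \<in> W ==> \<bar>f p\<bar> \<le> C" "\<And>p. p \<in> W ==> \<bar>fxx p + fyy p\<bar> \<le> C"
   "\<And>p. p \<in> W ==> \<bar>f p * \<rho>x p\<bar> \<le> C * \<rho> p" "\<And>p. p \<in> W ==> \<bar>f p * \<rho>y p\<bar> \<le> C * \<rho> p"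
  for e f fx fy fxx fyy
 proof -
  have cf: "continuous_on W f" "continuous_on W fx" "continuous_on W fy" "continuous_on W fxx"
   "continuous_on W fyy" using f(1) by (auto simp: C2_partials_def)
  let ?D = "\<lambda>p. \<kappa> e p * (\<kappa> e p * ((fx p)^2 + (fy p)^2))"
  let ?E = "\<lambda>p. \<kappa> e p * (\<kappa> e p * (f p * (fxx p + fyy p)))"
  let ?G = "\<lambda>p. \<kappa> e p * (2 * (e / (\<rho> p)^2) * (\<rho>x p * (f p * fx p) + \<rho>y p * (f p * fy p)))"
  have iD: "integrable lborel (\<lambda>p. indicator W p * ?D p)"
   by (rule int\<kappa>[OF _ e]) (intro continuous_intros \<kappa>c cf)
  have iE: "integrable lborel (\<lambda>p. indicator W p * ?E p)"
   by (rule int\<kappa>[OF _ e]) (intro continuous_intros \<kappa>c cf)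
  have iG: "integrable lborel (\<lambda>p. indicator W p * ?G p)"
   by (rule int\<kappa>[OF _ e]) (intro continuous_intros \<kappa>c cf \<rho>, use \<rho>nz in auto)
  have "J (\<lambda>p. \<kappa> e p * (\<kappa> e p * (((fx p)^2 + f p * fxx p) + ((fy p)^2 + f p * fyy p)))) = - J ?G"
  proof (rule div[OF e, of "\<lambda>p. f p * fx p" "\<lambda>p. f p * fy p"])
   fix x y assume xy: "(x, y) \<in> W"
   have d: "((\<lambda>x. f (x, y)) has_real_derivative fx (x, y)) (at x)"
    "((\<lambda>y. f (x, y)) has_real_derivative fy (x, y)) (at y)"
    "((\<lambda>x. fx (x, y)) has_real_derivative fxx (x, y)) (at x)"
    "((\<lambda>y. fy (x, y)) has_real_derivative fyy (x, y)) (at y)"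
    using f(1) xy by (auto simp: C2_partials_def)
   show "((\<lambda>x. f (x, y) * fx (x, y)) has_real_derivative (fx (x, y))\<^sup>2 + f (x, y) * fxx (x, y)) (at x)"
    by (rule DERIV_cong[OF DERIV_mult[OF d(1) d(3)]]) (simp add: power2_eq_square)
   show "((\<lambda>y. f (x, y) * fy (x, y)) has_real_derivative (fy (x, y))\<^sup>2 + f (x, y) * fyy (x, y)) (at y)"
    by (rule DERIV_cong[OF DERIV_mult[OF d(2) d(4)]]) (simp add: power2_eq_square)
  qed (intro continuous_intros cf)+
  moreover have "J (\<lambda>p. \<kappa> e p * (\<kappa> e p * (((fx p)^2 + f p * fxx p) + ((fy p)^2 + f p * fyy p)))) = J ?D + J ?E"
   unfolding J_def using iD iE
   by (subst Bochner_Integration.integral_add[symmetric]) (auto simp: algebra_simps)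
  ultimately have "J ?D = - J ?E - J ?G" by simp
  also have "... = (\<integral>p. - (indicator W p * ?E p) - indicator W p * ?G p \<partial>lborel)"
   unfolding J_def using iE iG by simp
  also have "... \<le> (\<integral>p. indicator W p * (5 * C^2) + 1/2 * (indicator W p * ?D p) \<partial>lborel)"
  proof (rule Bochner_Integration.integral_mono)
   show "integrable lborel (\<lambda>p. - (indicator W p * ?E p) - indicator W p * ?G p)"
    using iE iG by simp
   show "integrable lborel (\<lambda>p. indicator W p * (5 * C^2) + 1/2 * (indicator W p * ?D p))"
    using iD intc by simp
   fix p
   show "- (indicator W p * ?E p) - indicator W p * ?G p \<le>
     indicator W p * (5 * C^2) + 1/2 * (indicator W p * ?D p)"
   proof (cases "p \<in> W \<and> \<kappa> e p \<noteq> 0")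
    case True
    then have p: "p \<in> W" and \<kappa>p: "\<kappa> e p \<noteq> 0" by auto
    have "\<bar>f p * (fxx p + fyy p)\<bar> \<le> C * C"
     unfolding abs_mult using f(2,3)[OF p] by (intro mult_mono) auto
    moreover have "\<kappa> e p * \<kappa> e p \<le> 1" using \<kappa>le[OF p e] by (simp add: mult_le_one)
    ultimately have 1: "\<bar>?E p\<bar> \<le> C^2"
     using \<kappa>le[OF p e] mult_mono[of "\<kappa> e p * \<kappa> e p" 1 "\<bar>f p * (fxx p + fyy p)\<bar>" "C * C"]
     by (simp add: abs_mult power2_eq_square mult.assoc)
    have *: "- (2 * a * b) \<le> 1/2 * a^2 + 2 * b^2" for a b :: real
     using zero_le_power2[of "a + 2 * b"] by (simp add: power2_eq_square algebra_simps)
    have m1: "C^2 * (min 1 (e / \<rho> p))^2 \<le> C^2 * 1"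
     using e \<rho>(6)[OF p] by (intro mult_left_mono) (auto simp: power_le_one)
    have 2: "(e / (\<rho> p)^2 * (f p * \<rho>x p))^2 \<le> C^2" "(e / (\<rho> p)^2 * (f p * \<rho>y p))^2 \<le> C^2"
     using small[OF p e \<kappa>p f(4)[OF p]] small[OF p e \<kappa>p f(5)[OF p]] m1 by linarith+
    have "- ?G p = - (2 * (\<kappa> e p * fx p) * (e / (\<rho> p)^2 * (f p * \<rho>x p)))
      - (2 * (\<kappa> e p * fy p) * (e / (\<rho> p)^2 * (f p * \<rho>y p)))"
     by (simp add: algebra_simps)
    also have "... \<le> 1/2 * (\<kappa> e p * fx p)^2 + 1/2 * (\<kappa> e p * fy p)^2 + 4 * C^2"
     using *[of "\<kappa> e p * fx p" "e / (\<rho> p)^2 * (f p * \<rho>x p)"]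
      *[of "\<kappa> e p * fy p" "e / (\<rho> p)^2 * (f p * \<rho>y p)"] 2 by linarith
    also have "... = 1/2 * ?D p + 4 * C^2" by (simp add: power2_eq_square algebra_simps)
    finally show ?thesis using 1 p by simp
   qed (auto simp: indicator_def)
  qed
  also have "... = 5 * C^2 * V + 1/2 * J ?D"
   using intc iD Jc[of "5 * C^2"] by (simp add: J_def)
  finally show ?thesis by simp
 qed
 define I where "I = J (\<lambda>p. u p * (vxx p + vyy p) - v p * (uxx p + uyy p))"
 define R where "R e = J (\<lambda>p. (min 1 (e / \<rho> p))^2)" for e
 have cR: "continuous_on W (\<lambda>p. (min 1 (e / \<rho> p))^2)" for e
  by (intro continuous_intros \<rho>) (use \<rho>nz in auto)
 have iR: "integrable lborel (\<lambda>p. indicator W p * (min 1 (e / \<rho> p))^2)" if "e > 0" for e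
  by (rule intb[OF cR, where B = 1]) (use \<rho>(6) that in \<open>force simp: power_le_one\<close>)
 \<comment> \<open>Young's inequality with a free weight s: the two energies enter with the factor
   s, the error of the cut-off with 1 / s.\<close>
 have main: "\<bar>J (\<lambda>p. \<kappa> e p * (\<kappa> e p * (u p * (vxx p + vyy p) - v p * (uxx p + uyy p))))\<bar>
   \<le> s * (20 * C^2 * V) + 4 * C^2 / s * R e" if e: "e > 0" and s: "s > 0" for e s
 proof -
  let ?Du = "\<lambda>p. \<kappa> e p * (\<kappa> e p * ((ux p)^2 + (uy p)^2))"
  let ?Dv = "\<lambda>p. \<kappa> e p * (\<kappa> e p * ((vx p)^2 + (vy p)^2))"
  let ?P = "\<lambda>p. u p * vx p - v p * ux p" and ?Q = "\<lambda>p. u p * vy p - v p * uy p"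
  let ?G = "\<lambda>p. \<kappa> e p * (2 * (e / (\<rho> p)^2) * (\<rho>x p * ?P p + \<rho>y p * ?Q p))"
  have iDu: "integrable lborel (\<lambda>p. indicator W p * ?Du p)"
   by (rule int\<kappa>[OF _ e]) (intro continuous_intros \<kappa>c cu)
  have iDv: "integrable lborel (\<lambda>p. indicator W p * ?Dv p)"
   by (rule int\<kappa>[OF _ e]) (intro continuous_intros \<kappa>c cv)
  have iG: "integrable lborel (\<lambda>p. indicator W p * ?G p)"
   by (rule int\<kappa>[OF _ e]) (intro continuous_intros \<kappa>c cu cv \<rho>, use \<rho>nz in auto)
  have "J (\<lambda>p. \<kappa> e p * (\<kappa> e p * ((u p * vxx p - v p * uxx p) + (u p * vyy p - v p * uyy p)))) = - J ?G"
  proof (rule div[OF e, of ?P ?Q])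
   fix x y assume xy: "(x, y) \<in> W"
   have d: "((\<lambda>x. u (x, y)) has_real_derivative ux (x, y)) (at x)"
    "((\<lambda>y. u (x, y)) has_real_derivative uy (x, y)) (at y)"
    "((\<lambda>x. ux (x, y)) has_real_derivative uxx (x, y)) (at x)"
    "((\<lambda>y. uy (x, y)) has_real_derivative uyy (x, y)) (at y)"
    "((\<lambda>x. v (x, y)) has_real_derivative vx (x, y)) (at x)"
    "((\<lambda>y. v (x, y)) has_real_derivative vy (x, y)) (at y)"
    "((\<lambda>x. vx (x, y)) has_real_derivative vxx (x, y)) (at x)"
    "((\<lambda>y. vy (x, y)) has_real_derivative vyy (x, y)) (at y)"
    using u(1) v(1) xy by (auto simp: C2_partials_def)
   show "((\<lambda>x. ?P (x, y)) has_real_derivative (u (x, y) * vxx (x, y) - v (x, y) * uxx (x, y))) (at x)"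
    by (rule DERIV_cong[OF DERIV_diff[OF DERIV_mult[OF d(1) d(7)] DERIV_mult[OF d(5) d(3)]]])
      (simp add: algebra_simps)
   show "((\<lambda>y. ?Q (x, y)) has_real_derivative (u (x, y) * vyy (x, y) - v (x, y) * uyy (x, y))) (at y)"
    by (rule DERIV_cong[OF DERIV_diff[OF DERIV_mult[OF d(2) d(8)] DERIV_mult[OF d(6) d(4)]]])
      (simp add: algebra_simps)
  qed (intro continuous_intros cu cv)+
  moreover have "(\<lambda>p. \<kappa> e p * (\<kappa> e p * ((u p * vxx p - v p * uxx p) + (u p * vyy p - v p * uyy p)))) =
    (\<lambda>p. \<kappa> e p * (\<kappa> e p * (u p * (vxx p + vyy p) - v p * (uxx p + uyy p))))"
   by (simp add: algebra_simps)
  ultimately have "\<bar>J (\<lambda>p. \<kappa> e p * (\<kappa> e p * (u p * (vxx p + vyy p) - v p * (uxx p + uyy p))))\<bar> = \<bar>J ?G\<bar>"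
   by simp
  also have "... \<le> (\<integral>p. \<bar>indicator W p * ?G p\<bar> \<partial>lborel)"
   unfolding J_def by (rule integral_abs_bound)
  also have "... \<le> (\<integral>p. s * (indicator W p * ?Du p) + s * (indicator W p * ?Dv p) +
    4 * C^2 / s * (indicator W p * (min 1 (e / \<rho> p))^2) \<partial>lborel)"
  proof (rule Bochner_Integration.integral_mono)
   show "integrable lborel (\<lambda>p. \<bar>indicator W p * ?G p\<bar>)" using iG by (rule integrable_abs)
   show "integrable lborel (\<lambda>p. s * (indicator W p * ?Du p) + s * (indicator W p * ?Dv p) +
    4 * C^2 / s * (indicator W p * (min 1 (e / \<rho> p))^2))"
    using iDu iDv iR[OF e] by (intro Bochner_Integration.integrable_add integrable_mult_right)
   fix p
   show "\<bar>indicator W p * ?G p\<bar> \<le> s * (indicator W p * ?Du p) + s * (indicator W p * ?Dv p) +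
    4 * C^2 / s * (indicator W p * (min 1 (e / \<rho> p))^2)"
   proof (cases "p \<in> W \<and> \<kappa> e p \<noteq> 0")
    case True
    then have p: "p \<in> W" and \<kappa>p: "\<kappa> e p \<noteq> 0" by auto
    define M where "M = C^2 * (min 1 (e / \<rho> p))^2"
    have *: "\<bar>2 * a * b\<bar> \<le> s * a^2 + 1 / s * b^2" for a b :: real
    proof -
     have "0 \<le> (s * \<bar>a\<bar> - \<bar>b\<bar>)^2 / s" using s by simp
     also have "... = s * a^2 + 1 / s * b^2 - \<bar>2 * a * b\<bar>"
      using s by (simp add: power2_eq_square field_simps abs_mult)
     finally show ?thesis by simp
    qed
    have **: "\<bar>2 * a * b\<bar> \<le> s * a^2 + 1 / s * M" if "b^2 \<le> M" for a b
     using *[of a b] mult_left_mono[OF that, of "1 / s"] s by simp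
    let ?r = "e / (\<rho> p)^2"
    have "\<bar>?G p\<bar> = \<bar>2 * (\<kappa> e p * vx p) * (?r * (u p * \<rho>x p)) - 2 * (\<kappa> e p * ux p) * (?r * (v p * \<rho>x p))
      + 2 * (\<kappa> e p * vy p) * (?r * (u p * \<rho>y p)) - 2 * (\<kappa> e p * uy p) * (?r * (v p * \<rho>y p))\<bar>"
     by (rule arg_cong[where f = abs]) (simp add: algebra_simps)
    also have "... \<le> s * (\<kappa> e p * vx p)^2 + s * (\<kappa> e p * ux p)^2 + s * (\<kappa> e p * vy p)^2
      + s * (\<kappa> e p * uy p)^2 + 4 * (1 / s * M)"
     using **[OF small[OF p e \<kappa>p u(4)[OF p], folded M_def], of "\<kappa> e p * vx p"]
      **[OF small[OF p e \<kappa>p v(4)[OF p], folded M_def], of "\<kappa> e p * ux p"]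
      **[OF small[OF p e \<kappa>p u(5)[OF p], folded M_def], of "\<kappa> e p * vy p"]
      **[OF small[OF p e \<kappa>p v(5)[OF p], folded M_def], of "\<kappa> e p * uy p"] by linarith
    also have "... = s * ?Du p + s * ?Dv p + 4 * C^2 / s * (min 1 (e / \<rho> p))^2"
     by (simp add: M_def power2_eq_square algebra_simps)
    finally show ?thesis using p by simp
   qed (use s e in \<open>auto simp: indicator_def\<close>)
  qed
  also have "... = s * J ?Du + s * J ?Dv + 4 * C^2 / s * R e"
   unfolding J_def R_def using iDu iDv iR[OF e] by simp
  also have "... \<le> s * (20 * C^2 * V) + 4 * C^2 / s * R e"
  proof -
   have "s * J ?Du \<le> s * (10 * C^2 * V)" using energy[OF e u] s by (intro mult_left_mono) auto
   moreover have "s * J ?Dv \<le> s * (10 * C^2 * V)" using energy[OF e v] s by (intro mult_left_mono) auto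
   ultimately show ?thesis by (simp add: algebra_simps)
  qed
  finally show ?thesis .
 qed
 define \<epsilon> where "\<epsilon> n = 1 / real (Suc n)" for n
 have \<epsilon>: "\<epsilon> n > 0" for n by (simp add: \<epsilon>_def)
 have \<epsilon>0: "\<epsilon> \<longlonglongrightarrow> 0" unfolding \<epsilon>_def using LIMSEQ_inverse_real_of_nat by (simp add: inverse_eq_divide)
 let ?L = "\<lambda>p. u p * (vxx p + vyy p) - v p * (uxx p + uyy p)"
 have Lb: "\<bar>?L p\<bar> \<le> 2 * C^2" if p: "p \<in> W" for p
 proof -
  have "\<bar>u p * (vxx p + vyy p)\<bar> \<le> C * C" "\<bar>v p * (uxx p + uyy p)\<bar> \<le> C * C"
   unfolding abs_mult using u(2,3)[OF p] v(2,3)[OF p] by (auto intro!: mult_mono)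
  then show ?thesis unfolding power2_eq_square by linarith
 qed
 have cL: "continuous_on W ?L" by (intro continuous_intros cu cv)
 have lim\<rho>: "(\<lambda>n. \<epsilon> n / \<rho> p) \<longlonglongrightarrow> 0" for p
  using tendsto_divide_zero[OF \<epsilon>0] by simp
 have lim\<kappa>: "(\<lambda>n. \<kappa> (\<epsilon> n) p) \<longlonglongrightarrow> 1" for p
 proof -
  have "(\<lambda>n. \<kappa> (\<epsilon> n) p) \<longlonglongrightarrow> max 0 (1 - 0)" unfolding \<kappa>_def by (intro tendsto_intros lim\<rho>)
  then show ?thesis by simp
 qed
 have limI: "(\<lambda>n. J (\<lambda>p. \<kappa> (\<epsilon> n) p * (\<kappa> (\<epsilon> n) p * ?L p))) \<longlonglongrightarrow> I"
  unfolding I_def J_def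
 proof (rule integral_dominated_convergence[where w = "\<lambda>p. indicator W p * (2 * C^2)"])
  show "(\<lambda>p. indicator W p * ?L p) \<in> borel_measurable lborel"
   using intb[OF cL Lb] by (rule borel_measurable_integrable)
  show "(\<lambda>p. indicator W p * (\<kappa> (\<epsilon> n) p * (\<kappa> (\<epsilon> n) p * ?L p))) \<in> borel_measurable lborel" for n
   by (rule borel_measurable_integrable, rule int\<kappa>[OF _ \<epsilon>]) (intro continuous_intros \<kappa>c cu cv)
  show "integrable lborel (\<lambda>p. indicator W p * (2 * C^2))" by (rule intc)
  show "AE p in lborel. (\<lambda>n. indicator W p * (\<kappa> (\<epsilon> n) p * (\<kappa> (\<epsilon> n) p * ?L p)))
    \<longlonglongrightarrow> indicator W p * ?L p"
  proof (rule AE_I2)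
   fix p
   have "(\<lambda>n. indicator W p * (\<kappa> (\<epsilon> n) p * (\<kappa> (\<epsilon> n) p * ?L p))) \<longlonglongrightarrow> indicator W p * (1 * (1 * ?L p))"
    by (intro tendsto_intros lim\<kappa>)
   then show "(\<lambda>n. indicator W p * (\<kappa> (\<epsilon> n) p * (\<kappa> (\<epsilon> n) p * ?L p))) \<longlonglongrightarrow> indicator W p * ?L p" by simp
  qed
  show "AE p in lborel. norm (indicator W p * (\<kappa> (\<epsilon> n) p * (\<kappa> (\<epsilon> n) p * ?L p))) \<le> indicator W p * (2 * C^2)" for n
  proof (rule AE_I2)
   fix p
   show "norm (indicator W p * (\<kappa> (\<epsilon> n) p * (\<kappa> (\<epsilon> n) p * ?L p))) \<le> indicator W p * (2 * C^2)"
   proof (cases "p \<in> W")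
    case True
    have "(\<kappa> (\<epsilon> n) p * \<kappa> (\<epsilon> n) p) * \<bar>?L p\<bar> \<le> 1 * (2 * C^2)"
     using \<kappa>le[OF True \<epsilon>[of n]] Lb[OF True] by (intro mult_mono) (auto simp: mult_le_one)
    then show ?thesis using True \<kappa>le[OF True \<epsilon>[of n]] by (simp add: abs_mult mult.assoc)
   qed simp
  qed
 qed
 have limR: "(\<lambda>n. R (\<epsilon> n)) \<longlonglongrightarrow> (\<integral>p. 0 \<partial>(lborel :: (real \<times> real) measure))"
  unfolding R_def J_def
 proof (rule integral_dominated_convergence[where w = "\<lambda>p. indicator W p * 1"])
  show "(\<lambda>p. indicator W p * (min 1 (\<epsilon> n / \<rho> p))^2) \<in> borel_measurable lborel" for n
   using iR[OF \<epsilon>] by (rule borel_measurable_integrable)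
  show "integrable lborel (\<lambda>p. indicator W p * (1::real))" by (rule intc)
  show "AE p in lborel. (\<lambda>n. indicator W p * (min 1 (\<epsilon> n / \<rho> p))^2) \<longlonglongrightarrow> 0"
  proof (rule AE_I2)
   fix p
   have "(\<lambda>n. indicator W p * (min 1 (\<epsilon> n / \<rho> p))^2) \<longlonglongrightarrow> indicator W p * (min 1 0)^2"
    by (intro tendsto_intros lim\<rho>)
   then show "(\<lambda>n. indicator W p * (min 1 (\<epsilon> n / \<rho> p))^2) \<longlonglongrightarrow> 0" by simp
  qed
  show "AE p in lborel. norm (indicator W p * (min 1 (\<epsilon> n / \<rho> p))^2) \<le> indicator W p * 1" for n
  proof (rule AE_I2)
   fix p
   show "norm (indicator W p * (min 1 (\<epsilon> n / \<rho> p))^2) \<le> indicator W p * 1"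
    using \<rho>(6)[of p] \<epsilon>[of n] by (cases "p \<in> W") (auto intro!: power_le_one)
  qed
 qed simp
 \<comment> \<open>First e tends to 0 with s fixed, which removes the term with \<open>R\<close>;
   only afterwards does s tend to 0.\<close>
 have bound: "\<bar>I\<bar> \<le> s * (20 * C^2 * V)" if s: "s > 0" for s
 proof (rule LIMSEQ_le)
  show "(\<lambda>n. \<bar>J (\<lambda>p. \<kappa> (\<epsilon> n) p * (\<kappa> (\<epsilon> n) p * ?L p))\<bar>) \<longlonglongrightarrow> \<bar>I\<bar>" by (intro tendsto_intros limI)
  have "(\<lambda>n. s * (20 * C^2 * V) + 4 * C^2 / s * R (\<epsilon> n)) \<longlonglongrightarrow>
    s * (20 * C^2 * V) + 4 * C^2 / s * (\<integral>p. 0 \<partial>(lborel :: (real \<times> real) measure))"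
   by (intro tendsto_intros limR)
  then show "(\<lambda>n. s * (20 * C^2 * V) + 4 * C^2 / s * R (\<epsilon> n)) \<longlonglongrightarrow> s * (20 * C^2 * V)" by simp
  show "\<exists>N. \<forall>n\<ge>N. \<bar>J (\<lambda>p. \<kappa> (\<epsilon> n) p * (\<kappa> (\<epsilon> n) p * ?L p))\<bar> \<le>
    s * (20 * C^2 * V) + 4 * C^2 / s * R (\<epsilon> n)"
   using main[OF \<epsilon> s] by blast
 qed
 have "\<bar>I\<bar> \<le> 0"
 proof (rule field_le_epsilon)
  fix \<delta> :: real assume \<delta>: "\<delta> > 0"
  \<comment> \<open>The summand 1 keeps the divisor positive when \<open>C\<close> or
    \<open>V\<close> is zero.\<close>
  define T where "T = 20 * C^2 * V + 1"
  have T: "T > 0" using V0 by (auto simp: T_def intro!: add_nonneg_pos)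
  have "\<bar>I\<bar> \<le> \<delta> / T * (20 * C^2 * V)" using \<delta> T by (intro bound) auto
  also have "... \<le> \<delta> / T * T" using \<delta> T by (intro mult_left_mono) (auto simp: T_def)
  finally show "\<bar>I\<bar> \<le> 0 + \<delta>" using T by simp
 qed
 then show ?thesis by (simp add: I_def J_def)
qed simp

subsection \<open>Maximum principle and perturbed domains\<close>

lemma C2_partials_lincomb:
 assumes "C2_partials W u ux uy uxx uyy" "C2_partials W v vx vy vxx vyy"
 shows "C2_partials W (\<lambda>p. a * u p + b * v p) (\<lambda>p. a * ux p + b * vx p) (\<lambda>p. a * uy p + b * vy p)
  (\<lambda>p. a * uxx p + b * vxx p) (\<lambda>p. a * uyy p + b * vyy p)"
proof -
 have c: "continuous_on W u" "continuous_on W ux" "continuous_on W uy" "continuous_on W uxx"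
   "continuous_on W uyy" "continuous_on W v" "continuous_on W vx" "continuous_on W vy"
   "continuous_on W vxx" "continuous_on W vyy"
  using assms by (auto simp: C2_partials_def)
 show ?thesis unfolding C2_partials_def
 proof (intro conjI allI impI)
  fix x y assume xy: "(x, y) \<in> W"
  then show "((\<lambda>x. a * u (x, y) + b * v (x, y)) has_real_derivative a * ux (x, y) + b * vx (x, y)) (at x)"
   "((\<lambda>y. a * u (x, y) + b * v (x, y)) has_real_derivative a * uy (x, y) + b * vy (x, y)) (at y)"
   "((\<lambda>x. a * ux (x, y) + b * vx (x, y)) has_real_derivative a * uxx (x, y) + b * vxx (x, y)) (at x)"
   "((\<lambda>y. a * uy (x, y) + b * vy (x, y)) has_real_derivative a * uyy (x, y) + b * vyy (x, y)) (at y)"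
   using assms unfolding C2_partials_def by (auto intro!: DERIV_add DERIV_cmult)
 qed (intro continuous_intros c)+
qed

lemma second_derivative_nonpos_at_local_max:
 fixes f f' :: "real => real"
 assumes S: "open S" "a \<in> S" and f: "\<And>x. x \<in> S ==> (f has_real_derivative f' x) (at x)"
  and f': "(f' has_real_derivative D) (at a)" and max: "\<And>x. x \<in> S ==> f x \<le> f a"
 shows "D \<le> 0"
proof (rule ccontr)
 assume D: "\<not> D \<le> 0"
 obtain e where e: "e > 0" "\<And>x. \<bar>x - a\<bar> < e ==> x \<in> S"
  using S by (auto simp: open_dist dist_real_def)
 have "f' a = 0"
  by (rule DERIV_local_max[OF f[OF S(2)] e(1)]) (metis abs_minus_commute e(2) max)
 moreover obtain d where d: "d > 0" "\<And>h. h > 0 ==> h < d ==> f' a < f' (a + h)"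
  using DERIV_pos_inc_right[OF f'] D by auto
 ultimately have pos: "f' (a + h) > 0" if "0 < h" "h < d" for h using that by metis
 define h where "h = min d e / 2"
 have h: "h > 0" "h < d" "h < e" using d(1) e(1) by (auto simp: h_def)
 have "f a < f (a + h)"
 proof (rule DERIV_pos_imp_increasing_open[where f = f and a = a and b = "a + h"])
  have S': "x \<in> S" if "a \<le> x" "x \<le> a + h" for x by (rule e(2)) (use that h in auto)
  show "\<exists>y. (f has_real_derivative y) (at x) \<and> 0 < y" if "a < x" "x < a + h" for x
  proof (intro exI conjI)
   show "(f has_real_derivative f' x) (at x)" by (rule f[OF S']) (use that in auto)
   show "0 < f' x" using pos[of "x - a"] that h by simp
  qed
  show "continuous_on {a..a + h} f"
   using DERIV_isCont[OF f[OF S']] by (intro continuous_at_imp_continuous_on) auto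
 qed (use h in simp)
 moreover have "f (a + h) \<le> f a" by (rule max[OF e(2)]) (use h in simp)
 ultimately show False by simp
qed

text \<open>Because the inequality is strict, the second derivative test decides: at an interior
  maximum both pure second derivatives would be at most 0. So the maximum over the compact set lies
  outside \<open>W\<close>.\<close>

lemma maximum_principle:
 fixes z :: "real \<times> real => real"
 assumes D: "compact D" "continuous_on D z" and W: "open W" "W \<subseteq> D"
  and z: "C2_partials W z zx zy zxx zyy" "\<And>p. p \<in> W ==> zxx p + zyy p > 0"
  and bdry: "\<And>p. p \<in> D - W ==> z p \<le> 0" and p: "p \<in> D"
 shows "z p \<le> 0"
proof -
 obtain q where q: "q \<in> D" "\<And>p. p \<in> D ==> z p \<le> z q"
  using continuous_attains_sup[OF D(1) _ D(2)] p by blast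
 have "q \<notin> W"
 proof
  assume qW: "q \<in> W"
  obtain x y where xy: "q = (x, y)" by (cases q)
  have d: "((\<lambda>x. z (x, y)) has_real_derivative zx (x, y)) (at x)"
    "((\<lambda>y. z (x, y)) has_real_derivative zy (x, y)) (at y)"
    "((\<lambda>x. zx (x, y)) has_real_derivative zxx (x, y)) (at x)"
    "((\<lambda>y. zy (x, y)) has_real_derivative zyy (x, y)) (at y)" if "(x, y) \<in> W" for x y
   using z(1) that by (auto simp: C2_partials_def)
  have S: "x \<in> {x. (x, y) \<in> W}" "y \<in> {y. (x, y) \<in> W}" using qW xy by auto
  have m: "z p \<le> z (x, y)" if "p \<in> W" for p using q(2)[of p] that W(2) xy by blast
  have "zxx (x, y) \<le> 0"
  proof (rule second_derivative_nonpos_at_local_max[OF open_slice(1)[OF W(1)] S(1)])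
   show "((\<lambda>x. z (x, y)) has_real_derivative zx (x', y)) (at x')" if "x' \<in> {x. (x, y) \<in> W}" for x'
    using d(1) that by simp
   show "((\<lambda>x. zx (x, y)) has_real_derivative zxx (x, y)) (at x)" using d(3) S by simp
   show "z (x', y) \<le> z (x, y)" if "x' \<in> {x. (x, y) \<in> W}" for x' using m that by simp
  qed
  moreover have "zyy (x, y) \<le> 0"
  proof (rule second_derivative_nonpos_at_local_max[OF open_slice(2)[OF W(1)] S(2)])
   show "((\<lambda>y. z (x, y)) has_real_derivative zy (x, y')) (at y')" if "y' \<in> {y. (x, y) \<in> W}" for y'
    using d(2) that by simp
   show "((\<lambda>y. zy (x, y)) has_real_derivative zyy (x, y)) (at y)" using d(4) S by simp
   show "z (x, y') \<le> z (x, y)" if "y' \<in> {y. (x, y) \<in> W}" for y' using m that by simp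
  qed
  ultimately show False using z(2)[OF qW] xy by auto
 qed
 then have "z q \<le> 0" using bdry[of q] q(1) by simp
 then show ?thesis using q(2)[OF p] by simp
qed

text \<open>Removes the slack that \<open>barrier_bound\<close> adds in order to get a strict
  inequality. As c may be 0, the slack is divided by c + 1.\<close>

lemma le_mult_if_le_mult_add:
 fixes a b c :: real
 assumes "c \<ge> 0" "\<And>e. e > 0 ==> a \<le> (b + e) * c"
 shows "a \<le> b * c"
proof (rule field_le_epsilon)
 fix e :: real assume e: "e > 0"
 have "a \<le> (b + e / (c + 1)) * c" using e assms by auto
 also have "... = b * c + e * (c / (c + 1))" by (simp add: algebra_simps)
 also have "... \<le> b * c + e * 1" using e assms(1) by (intro add_left_mono mult_left_mono) auto
 finally show "a \<le> b * c + e" by simp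
qed

text \<open>Comparison with a supersolution: for s = 1 and s = -1 the function s u -
  (\<open>\<bar>lam\<bar> * S\<close> + e) f has positive Laplacian, because |lam u| is at most
  \<open>\<bar>lam\<bar> * S\<close> and f has Laplacian at most -1. In this way u inherits the
  decay of f at the boundary.\<close>

lemma barrier_bound:
 fixes u f :: "real \<times> real => real"
 assumes D: "compact D" "continuous_on D u" "continuous_on D f" and W: "open W" "W \<subseteq> D"
  and u: "C2_partials W u ux uy uxx uyy" "\<And>p. p \<in> W ==> uxx p + uyy p = - lam * u p"
   "\<And>p. p \<in> D - W ==> u p = 0" "\<And>p. p \<in> D ==> \<bar>u p\<bar> \<le> S"
  and f: "C2_partials W f fx fy fxx fyy" "\<And>p. p \<in> W ==> fxx p + fyy p \<le> - 1"
   "\<And>p. p \<in> D ==> f p \<ge> 0" and p: "p \<in> D"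
 shows "\<bar>u p\<bar> \<le> \<bar>lam\<bar> * S * f p"
proof (rule le_mult_if_le_mult_add[OF f(3)[OF p]])
 fix e :: real assume e: "e > 0"
 define K where "K = \<bar>lam\<bar> * S + e"
 have S: "S \<ge> 0" using u(4)[OF p] by linarith
 have K0: "K \<ge> 0" unfolding K_def using S e by simp
 have *: "s * u p + (- K) * f p \<le> 0" if s: "\<bar>s\<bar> = 1" for s
 proof (rule maximum_principle[OF D(1) _ W C2_partials_lincomb[OF u(1) f(1)] _ _ p])
  show "continuous_on D (\<lambda>p. s * u p + (- K) * f p)" by (intro continuous_intros D)
  fix q assume q: "q \<in> W"
  have "\<bar>s * lam * u q\<bar> \<le> \<bar>lam\<bar> * S"
   unfolding abs_mult s mult_1 using u(4)[OF subsetD[OF W(2) q]] by (rule mult_left_mono) simp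
  moreover have "K * (fxx q + fyy q) \<le> K * (-1)" using K0 f(2)[OF q] by (intro mult_left_mono)
  moreover have SU: "s * uxx q + s * uyy q = - (s * lam * u q)"
   using u(2)[OF q] by (simp add: distrib_left[symmetric])
  moreover have "s * uxx q + (- K) * fxx q + (s * uyy q + (- K) * fyy q) =
    - (s * lam * u q) - K * (fxx q + fyy q)"
   using SU by (simp add: algebra_simps)
  ultimately show "s * uxx q + (- K) * fxx q + (s * uyy q + (- K) * fyy q) > 0"
   using e K_def by linarith
 next
  fix q assume q: "q \<in> D - W"
  have "u q = 0" using u(3)[OF q] .
  moreover have "K * f q \<ge> 0" using f(3)[of q] K0 q by simp
  ultimately show "s * u q + (- K) * f q \<le> 0" by simp
 qed
 from *[of 1] *[of "-1"] show "\<bar>u p\<bar> \<le> (\<bar>lam\<bar> * S + e) * f p"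
  unfolding K_def[symmetric] abs_le_iff by linarith
qed

lemma differentiable_has_partials:
 fixes u :: "real \<times> real => real"
 assumes "u differentiable at (x, y)"
 shows "((\<lambda>x. u (x, y)) has_real_derivative partial_x u (x, y)) (at x)"
  and "((\<lambda>y. u (x, y)) has_real_derivative partial_y u (x, y)) (at y)"
proof -
 have "(\<lambda>x. u (x, y)) differentiable at x"
  using differentiable_chain_at[of "\<lambda>x. (x, y)" x u] assms by (simp add: o_def)
 then show "((\<lambda>x. u (x, y)) has_real_derivative partial_x u (x, y)) (at x)"
  by (simp add: partial_x_def DERIV_deriv_iff_real_differentiable)
 have "(\<lambda>y. u (x, y)) differentiable at y"
  using differentiable_chain_at[of "\<lambda>y. (x, y)" y u] assms by (simp add: o_def)
 then show "((\<lambda>y. u (x, y)) has_real_derivative partial_y u (x, y)) (at y)"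
  by (simp add: partial_y_def DERIV_deriv_iff_real_differentiable)
qed

lemma C2_on_imp_C2_partials:
 assumes "open W" "C2_on W u"
 shows "C2_partials W u (partial_x u) (partial_y u) (partial_x (partial_x u)) (partial_y (partial_y u))"
proof -
 have D: "f differentiable at (x, y)" if "f differentiable_on W" "(x, y) \<in> W" for f :: "real \<times> real => real" and x y
  using that assms(1) differentiable_on_eq_differentiable_at by blast
 have on: "u differentiable_on W" "partial_x u differentiable_on W" "partial_y u differentiable_on W"
  and c: "continuous_on W (partial_x (partial_x u))" "continuous_on W (partial_y (partial_y u))"
  using assms(2) unfolding C2_on_def by simp_all
 show ?thesis unfolding C2_partials_def
 proof (intro conjI allI impI)
  fix x y assume xy: "(x, y) \<in> W"
  show "((\<lambda>x. u (x, y)) has_real_derivative partial_x u (x, y)) (at x)"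
   by (rule differentiable_has_partials(1)[OF D[OF on(1) xy]])
  show "((\<lambda>y. u (x, y)) has_real_derivative partial_y u (x, y)) (at y)"
   by (rule differentiable_has_partials(2)[OF D[OF on(1) xy]])
  show "((\<lambda>x. partial_x u (x, y)) has_real_derivative partial_x (partial_x u) (x, y)) (at x)"
   by (rule differentiable_has_partials(1)[OF D[OF on(2) xy]])
  show "((\<lambda>y. partial_y u (x, y)) has_real_derivative partial_y (partial_y u) (x, y)) (at y)"
   by (rule differentiable_has_partials(2)[OF D[OF on(3) xy]])
 qed (use on c in \<open>simp_all add: differentiable_imp_continuous_on\<close>)
qed

section \<open>The perturbed domains and the decay of eigenfunctions at their sides\<close>

locale profile =
 fixes \<phi> \<phi>1 \<phi>2 :: "real => real" and N :: real
 assumes N: "N > 0"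
  and \<phi>: "\<And>y. y \<in> {0..1} ==> (\<phi> has_real_derivative \<phi>1 y) (at y within {0..1})"
  and \<phi>1: "\<And>y. y \<in> {0..1} ==> (\<phi>1 has_real_derivative \<phi>2 y) (at y within {0..1})"
  and \<phi>2: "continuous_on {0..1} \<phi>2"
  and \<phi>_bounds: "\<And>y. y \<in> {0..1} ==> 0 \<le> \<phi> y" "\<And>y. y \<in> {0..1} ==> \<phi> y \<le> 1"
   "\<And>y. y \<in> {0..1} ==> \<bar>\<phi>1 y\<bar> \<le> 1" "\<And>y. y \<in> {0..1} ==> \<bar>\<phi>2 y\<bar> \<le> 1"
  and \<phi>_ends: "\<phi> 0 = 0" "\<phi> 1 = 0"
begin

definition dom :: "real => (real \<times> real) set" where
 "dom \<eta> = {(x, y). 0 < y \<and> y < 1 \<and> - \<eta> * \<phi> y < x \<and> x < N}"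

abbreviation Om :: "real => (real \<times> real) set" where "Om \<eta> \<equiv> Omega \<phi> \<eta> N"

lemma continuous_\<phi>: "continuous_on {0..1} \<phi>" "continuous_on {0..1} \<phi>1"
 using DERIV_continuous_on \<phi> \<phi>1 by blast+

lemma continuous_on_snd_compose:
 assumes "continuous_on {0..1} g" "snd ` S \<subseteq> {0..1::real}"
 shows "continuous_on S (\<lambda>p :: real \<times> real. g (snd p))"
 using continuous_on_compose2[OF assms(1) _ assms(2)] by (simp add: continuous_on_snd)

lemma DERIV_\<phi>:
 assumes "0 < y" "y < 1"
 shows "(\<phi> has_real_derivative \<phi>1 y) (at y)" "(\<phi>1 has_real_derivative \<phi>2 y) (at y)"
 using \<phi>[of y] \<phi>1[of y] assms at_within_Icc_at[of 0 y 1] by auto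

lemma dom_subset: "dom \<eta> \<subseteq> Om \<eta>" by (auto simp: dom_def Omega_def)

lemma compact_Om: assumes "0 \<le> \<eta>" shows "compact (Om \<eta>)"
proof -
 have 1: "Om \<eta> = {p \<in> {-\<eta>..N} \<times> {0..1}. - \<eta> * \<phi> (snd p) \<le> fst p}"
 proof -
  have "-\<eta> \<le> x" if "- \<eta> * \<phi> y \<le> x" "y \<in> {0..1}" for x y
   using mult_left_mono[OF \<phi>_bounds(2)[OF that(2)] assms] that(1) by simp
  then show ?thesis by (auto simp: Omega_def)
 qed
 have "closed {p \<in> {-\<eta>..N} \<times> {0..1}. - \<eta> * \<phi> (snd p) \<le> fst p}"
 proof (rule continuous_on_closed_Collect_le)
  show "continuous_on ({-\<eta>..N} \<times> {0..1}) (\<lambda>p. - \<eta> * \<phi> (snd p))"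
   by (intro continuous_on_mult continuous_on_const continuous_on_snd_compose[OF continuous_\<phi>(1)]) auto
  show "closed ({-\<eta>..N} \<times> {0..1::real})" by (intro closed_Times) auto
 qed (intro continuous_intros)
 moreover have "bounded {p \<in> {-\<eta>..N} \<times> {0..1}. - \<eta> * \<phi> (snd p) \<le> fst p}"
  by (rule bounded_subset[of "{-\<eta>..N} \<times> {0..1}"]) (auto intro: bounded_Times)
 ultimately show ?thesis unfolding 1 by (simp add: compact_eq_bounded_closed)
qed

lemma open_dom: "open (dom \<eta>)"
proof -
 let ?S = "{..<N} \<times> {0<..<1::real}"
 have "open (?S \<inter> (\<lambda>p. fst p + \<eta> * \<phi> (snd p)) -` {0<..})"
  by (intro continuous_open_preimage continuous_intros open_Times
    continuous_on_snd_compose[OF continuous_\<phi>(1)]) auto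
 moreover have "?S \<inter> (\<lambda>p. fst p + \<eta> * \<phi> (snd p)) -` {0<..} = dom \<eta>"
  by (auto simp: dom_def)
 ultimately show ?thesis by simp
qed

lemma bounded_dom: "0 \<le> \<eta> ==> bounded (dom \<eta>)"
 using bounded_subset[OF compact_imp_bounded[OF compact_Om] dom_subset] .

text \<open>An interior point can be moved a little along both axes without leaving the domain, and
  this turns each of the four weak inequalities into a strict one.\<close>

lemma interior_Om: "interior (Om \<eta>) = dom \<eta>"
proof
 show "dom \<eta> \<subseteq> interior (Om \<eta>)" by (rule interior_maximal[OF dom_subset open_dom])
 show "interior (Om \<eta>) \<subseteq> dom \<eta>"
 proof
  fix p assume p: "p \<in> interior (Om \<eta>)"
  obtain x y where xy: "p = (x, y)" by (cases p)
  obtain e where e: "e > 0" "\<And>x'. \<bar>x' - x\<bar> < e ==> (x', y) \<in> interior (Om \<eta>)"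
   using open_slice(1)[OF open_interior, of y "Om \<eta>"] p xy by (auto simp: open_dist dist_real_def)
  obtain d where d: "d > 0" "\<And>y'. \<bar>y' - y\<bar> < d ==> (x, y') \<in> interior (Om \<eta>)"
   using open_slice(2)[OF open_interior, of x "Om \<eta>"] p xy by (auto simp: open_dist dist_real_def)
  have "(x - e/2, y) \<in> interior (Om \<eta>)" "(x + e/2, y) \<in> interior (Om \<eta>)"
   using e by simp_all
  moreover have "(x, y - d/2) \<in> interior (Om \<eta>)" "(x, y + d/2) \<in> interior (Om \<eta>)"
   using d by simp_all
  ultimately have "(x - e/2, y) \<in> Om \<eta>" "(x + e/2, y) \<in> Om \<eta>" "(x, y - d/2) \<in> Om \<eta>" "(x, y + d/2) \<in> Om \<eta>"
   using interior_subset by blast+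
  then show "p \<in> dom \<eta>" using e(1) d(1) xy by (simp add: Omega_def dom_def)
 qed
qed

lemma frontier_Om: "0 \<le> \<eta> ==> frontier (Om \<eta>) = Om \<eta> - dom \<eta>"
 using compact_imp_closed[OF compact_Om] by (simp add: frontier_def interior_Om)

lemma eigenfunction_facts:
 assumes "0 \<le> \<eta>" "dirichlet_eigenfunction (Om \<eta>) lam u"
 shows "continuous_on (Om \<eta>) u"
  "C2_partials (dom \<eta>) u (partial_x u) (partial_y u) (partial_x (partial_x u)) (partial_y (partial_y u))"
  "\<And>p. p \<in> dom \<eta> ==> partial_x (partial_x u) p + partial_y (partial_y u) p = - lam * u p"
  "\<And>p. p \<in> Om \<eta> - dom \<eta> ==> u p = 0"
proof -
 show "continuous_on (Om \<eta>) u" using assms(2) by (simp add: dirichlet_eigenfunction_def)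
 show "C2_partials (dom \<eta>) u (partial_x u) (partial_y u) (partial_x (partial_x u)) (partial_y (partial_y u))"
  using assms(2) by (intro C2_on_imp_C2_partials open_dom) (simp add: dirichlet_eigenfunction_def interior_Om)
 show "partial_x (partial_x u) p + partial_y (partial_y u) p = - lam * u p" if "p \<in> dom \<eta>" for p
 proof -
  have "laplacian u p + lam * u p = 0"
   using assms(2) that unfolding dirichlet_eigenfunction_def interior_Om by blast
  then show ?thesis unfolding laplacian_def by linarith
 qed
 show "u p = 0" if "p \<in> Om \<eta> - dom \<eta>" for p
  using assms(2) that unfolding dirichlet_eigenfunction_def frontier_Om[OF assms(1)] by blast
qed

end

context profile begin

lemma Om_bounds:
 assumes "0 \<le> \<eta>" "(x, y) \<in> Om \<eta>"
 shows "0 \<le> x + \<eta> * \<phi> y" "x + \<eta> * \<phi> y \<le> N + \<eta>" "-\<eta> \<le> x" "x \<le> N" "0 \<le> y" "y \<le> 1"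
 using assms mult_left_mono[OF \<phi>_bounds(2)[of y] assms(1)] by (auto simp: Omega_def)

text \<open>The curved side, the two horizontal sides and the right side have one barrier each. For
  the curved side it is s (N + 1 - s) with s = x + \<eta> \<phi> y. Its Laplacian exceeds -2 by at
  most \<eta> (N + 1), hence by at most 1. Using N + 1 instead of N leaves room for widths up to N +
  \<eta>. For the right side the factor x + N + 1 is positive since x \<ge> -1.\<close>

lemma eigenfunction_boundary_decay:
 assumes \<eta>: "0 \<le> \<eta>" "\<eta> * (N + 1) \<le> 1" and u: "dirichlet_eigenfunction (Om \<eta>) lam u"
  and S: "\<And>p. p \<in> Om \<eta> ==> \<bar>u p\<bar> \<le> S" and p: "(x, y) \<in> Om \<eta>"
 shows "\<bar>u (x, y)\<bar> \<le> \<bar>lam\<bar> * S * (N + 1) * (x + \<eta> * \<phi> y)"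
  and "\<bar>u (x, y)\<bar> \<le> \<bar>lam\<bar> * S * (y * (1 - y))"
  and "\<bar>u (x, y)\<bar> \<le> \<bar>lam\<bar> * S * (2 * N + 1) * (N - x)"
proof -
 have S0: "S \<ge> 0" using S[OF p] by linarith
 have \<eta>1: "\<eta> \<le> 1" using \<eta> N mult_left_mono[of 1 "N + 1" \<eta>] by simp
 note B = barrier_bound[OF compact_Om[OF \<eta>(1)] eigenfunction_facts(1)[OF \<eta>(1) u] _ open_dom dom_subset
   eigenfunction_facts(2-4)[OF \<eta>(1) u] S _ _ _ p]
 define s where "s p = fst p + \<eta> * \<phi> (snd p)" for p :: "real \<times> real"
 note cs = continuous_on_snd_compose[OF continuous_\<phi>(1)] continuous_on_snd_compose[OF continuous_\<phi>(2)]
  continuous_on_snd_compose[OF \<phi>2]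
 have sub: "snd ` dom \<eta> \<subseteq> {0..1}" "snd ` Om \<eta> \<subseteq> {0..1}" by (auto simp: dom_def Omega_def)
 let ?f = "\<lambda>p. s p * (N + 1 - s p)"
 have "\<bar>u (x, y)\<bar> \<le> \<bar>lam\<bar> * S * ?f (x, y)"
 proof (rule B[where f = ?f and fx = "\<lambda>p. N + 1 - 2 * s p" and fy = "\<lambda>p. \<eta> * \<phi>1 (snd p) * (N + 1 - 2 * s p)"
    and fxx = "\<lambda>p. - 2" and fyy = "\<lambda>p. \<eta> * \<phi>2 (snd p) * (N + 1 - 2 * s p) - 2 * \<eta>^2 * (\<phi>1 (snd p))^2"])
  show "continuous_on (Om \<eta>) ?f" unfolding s_def by (intro continuous_intros cs sub)
  show "C2_partials (dom \<eta>) ?f (\<lambda>p. N + 1 - 2 * s p) (\<lambda>p. \<eta> * \<phi>1 (snd p) * (N + 1 - 2 * s p))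
    (\<lambda>p. - 2) (\<lambda>p. \<eta> * \<phi>2 (snd p) * (N + 1 - 2 * s p) - 2 * \<eta>^2 * (\<phi>1 (snd p))^2)"
   unfolding C2_partials_def s_def
  proof (intro conjI allI impI)
   fix x y assume "(x, y) \<in> dom \<eta>"
   then have y: "0 < y" "y < 1" by (auto simp: dom_def)
   note d = DERIV_\<phi>[OF y]
   show "((\<lambda>x. (fst (x, y) + \<eta> * \<phi> (snd (x, y))) * (N + 1 - (fst (x, y) + \<eta> * \<phi> (snd (x, y)))))
     has_real_derivative N + 1 - 2 * (fst (x, y) + \<eta> * \<phi> (snd (x, y)))) (at x)"
    by (auto intro!: derivative_eq_intros simp: algebra_simps)
   show "((\<lambda>y. (fst (x, y) + \<eta> * \<phi> (snd (x, y))) * (N + 1 - (fst (x, y) + \<eta> * \<phi> (snd (x, y)))))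
     has_real_derivative \<eta> * \<phi>1 (snd (x, y)) * (N + 1 - 2 * (fst (x, y) + \<eta> * \<phi> (snd (x, y))))) (at y)"
    by (auto intro!: derivative_eq_intros d simp: algebra_simps)
   show "((\<lambda>x. N + 1 - 2 * (fst (x, y) + \<eta> * \<phi> (snd (x, y)))) has_real_derivative - 2) (at x)"
    by (auto intro!: derivative_eq_intros simp: algebra_simps)
   show "((\<lambda>y. \<eta> * \<phi>1 (snd (x, y)) * (N + 1 - 2 * (fst (x, y) + \<eta> * \<phi> (snd (x, y)))))
     has_real_derivative \<eta> * \<phi>2 (snd (x, y)) * (N + 1 - 2 * (fst (x, y) + \<eta> * \<phi> (snd (x, y))))
      - 2 * \<eta>^2 * (\<phi>1 (snd (x, y)))^2) (at y)"
    by (auto intro!: derivative_eq_intros d simp: algebra_simps power2_eq_square)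
  qed (intro continuous_intros cs sub)+
  fix q assume q: "q \<in> dom \<eta>"
  obtain x y where xy: "q = (x, y)" by (cases q)
  have qO: "(x, y) \<in> Om \<eta>" and y: "y \<in> {0..1}" using q xy dom_subset by (auto simp: dom_def)
  have "\<bar>N + 1 - 2 * s q\<bar> \<le> N + 1" using Om_bounds[OF \<eta>(1) qO] \<eta>1 xy by (auto simp: s_def)
  then have "\<eta> * \<bar>\<phi>2 y\<bar> * \<bar>N + 1 - 2 * s q\<bar> \<le> \<eta> * 1 * (N + 1)"
   using \<phi>_bounds(4)[OF y] \<eta>(1) N by (intro mult_mono) auto
  moreover have "\<bar>\<eta> * \<phi>2 y * (N + 1 - 2 * s q)\<bar> = \<eta> * \<bar>\<phi>2 y\<bar> * \<bar>N + 1 - 2 * s q\<bar>"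
   using \<eta>(1) by (simp add: abs_mult)
  ultimately have "\<eta> * \<phi>2 y * (N + 1 - 2 * s q) \<le> 1" using \<eta>(2) by linarith
  moreover have "0 \<le> 2 * \<eta>^2 * (\<phi>1 y)^2" by simp
  ultimately have "- 2 + (\<eta> * \<phi>2 y * (N + 1 - 2 * s q) - 2 * \<eta>^2 * (\<phi>1 y)^2) \<le> - 1" by linarith
  then show "- 2 + (\<eta> * \<phi>2 (snd q) * (N + 1 - 2 * s q) - 2 * \<eta>^2 * (\<phi>1 (snd q))^2) \<le> - 1"
   unfolding xy by simp
 next
  fix q assume q: "q \<in> Om \<eta>"
  then show "0 \<le> ?f q" using Om_bounds[OF \<eta>(1), of "fst q" "snd q"] \<eta>1 by (auto simp: s_def)
 qed
 also have "... \<le> \<bar>lam\<bar> * S * (s (x, y) * (N + 1))"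
  using Om_bounds[OF \<eta>(1) p] S0 by (intro mult_left_mono) (auto simp: s_def)
 finally show "\<bar>u (x, y)\<bar> \<le> \<bar>lam\<bar> * S * (N + 1) * (x + \<eta> * \<phi> y)" by (simp add: s_def algebra_simps)
 let ?g = "\<lambda>p :: real \<times> real. snd p * (1 - snd p)"
 have "\<bar>u (x, y)\<bar> \<le> \<bar>lam\<bar> * S * ?g (x, y)"
 proof (rule B[where f = ?g and fx = "\<lambda>p. 0" and fy = "\<lambda>p. 1 - 2 * snd p"
    and fxx = "\<lambda>p. 0" and fyy = "\<lambda>p. - 2"])
  show "C2_partials (dom \<eta>) ?g (\<lambda>p. 0) (\<lambda>p. 1 - 2 * snd p) (\<lambda>p. 0) (\<lambda>p. - 2)"
   unfolding C2_partials_def by (auto intro!: continuous_intros derivative_eq_intros)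
  show "continuous_on (Om \<eta>) ?g" by (intro continuous_intros)
 qed (auto simp: Omega_def)
 then show "\<bar>u (x, y)\<bar> \<le> \<bar>lam\<bar> * S * (y * (1 - y))" by simp
 let ?h = "\<lambda>p :: real \<times> real. (N - fst p) * (fst p + N + 1)"
 have "\<bar>u (x, y)\<bar> \<le> \<bar>lam\<bar> * S * ?h (x, y)"
 proof (rule B[where f = ?h and fx = "\<lambda>p. - 2 * fst p - 1" and fy = "\<lambda>p. 0"
    and fxx = "\<lambda>p. - 2" and fyy = "\<lambda>p. 0"])
  show "C2_partials (dom \<eta>) ?h (\<lambda>p. - 2 * fst p - 1) (\<lambda>p. 0) (\<lambda>p. - 2) (\<lambda>p. 0)"
   unfolding C2_partials_def by (auto intro!: continuous_intros derivative_eq_intros)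
  show "continuous_on (Om \<eta>) ?h" by (intro continuous_intros)
  fix q assume q: "q \<in> Om \<eta>"
  then show "0 \<le> ?h q" using Om_bounds[OF \<eta>(1), of "fst q" "snd q"] \<eta>1 N by auto
 qed auto
 also have "... \<le> \<bar>lam\<bar> * S * ((N - x) * (2 * N + 1))"
 proof (rule mult_left_mono)
  show "(N - fst (x, y)) * (fst (x, y) + N + 1) \<le> (N - x) * (2 * N + 1)"
   using Om_bounds[OF \<eta>(1) p] by (intro mult_mono) (use N \<eta>1 in auto)
 qed (use S0 in simp)
 finally show "\<bar>u (x, y)\<bar> \<le> \<bar>lam\<bar> * S * (2 * N + 1) * (N - x)" by (simp add: algebra_simps)
qed

text \<open>Convergence is known on the rectangle only, so a bound found there has to be carried to
  the strip x < 0. If the maximum of |u| sat at a point q of the strip, the boundary decay with |u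
  q| itself as \<open>S\<close> would bound |u q| by a multiple of |u q| with factor less than 1, so
  u q would vanish.\<close>

lemma eigenfunction_sup_bound:
 assumes \<eta>: "0 \<le> \<eta>" "\<eta> * (N + 1) \<le> 1" "\<bar>lam\<bar> * (N + 1) * \<eta> < 1"
  and u: "dirichlet_eigenfunction (Om \<eta>) lam u"
  and M: "\<And>p. p \<in> rect N ==> \<bar>u p\<bar> \<le> M" and p: "p \<in> Om \<eta>"
 shows "\<bar>u p\<bar> \<le> M"
proof -
 have "continuous_on (Om \<eta>) (\<lambda>p. \<bar>u p\<bar>)" by (intro continuous_intros eigenfunction_facts(1)[OF \<eta>(1) u])
 then obtain q where q: "q \<in> Om \<eta>" "\<And>p. p \<in> Om \<eta> ==> \<bar>u p\<bar> \<le> \<bar>u q\<bar>"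
  using continuous_attains_sup[OF compact_Om[OF \<eta>(1)]] p by blast
 obtain x y where xy: "q = (x, y)" by (cases q)
 have "\<bar>u q\<bar> \<le> M"
 proof (cases "x \<ge> 0")
  case True
  then have "q \<in> rect N" using q(1) xy by (auto simp: rect_def Omega_def)
  then show ?thesis by (rule M)
 next
  case False
  have y: "y \<in> {0..1}" using q(1) xy by (auto simp: Omega_def)
  have s: "x + \<eta> * \<phi> y \<le> \<eta>" using False mult_left_mono[OF \<phi>_bounds(2)[OF y] \<eta>(1)] by simp
  have "\<bar>u q\<bar> \<le> \<bar>lam\<bar> * \<bar>u q\<bar> * (N + 1) * (x + \<eta> * \<phi> y)"
   using eigenfunction_boundary_decay(1)[OF \<eta>(1,2) u q(2), of x y] q(1) xy by simp
  also have "... \<le> \<bar>lam\<bar> * \<bar>u q\<bar> * (N + 1) * \<eta>" using s N by (intro mult_left_mono) auto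
  also have "... = (\<bar>lam\<bar> * (N + 1) * \<eta>) * \<bar>u q\<bar>" by simp
  finally have "(1 - \<bar>lam\<bar> * (N + 1) * \<eta>) * \<bar>u q\<bar> \<le> 0" by (simp add: algebra_simps)
  then have "u q = 0" using \<eta>(3) by (simp add: mult_le_0_iff)
  moreover have "0 \<le> M" using M[of "(0, 0)"] N by (auto simp: rect_def)
  ultimately show ?thesis by simp
 qed
 then show ?thesis using q(2)[OF p] by simp
qed

text \<open>The weight \<rho> is the product of the horizontal distances to the left and right sides
  with y (1 - y). Each term of a derivative of \<rho> lacks one factor, and the decay of u towards
  the corresponding side supplies it. Two such terms lead to the constant 2 C.\<close>

lemma green_dom:
 assumes \<eta>: "0 \<le> \<eta>" "\<eta> \<le> 1"
  and u: "C2_partials (dom \<eta>) u ux uy uxx uyy"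
   "\<And>p. p \<in> dom \<eta> ==> \<bar>u p\<bar> \<le> C" "\<And>p. p \<in> dom \<eta> ==> \<bar>uxx p + uyy p\<bar> \<le> C"
   "\<And>x y. (x, y) \<in> dom \<eta> ==> \<bar>u (x, y)\<bar> \<le> C * (x + \<eta> * \<phi> y)"
   "\<And>x y. (x, y) \<in> dom \<eta> ==> \<bar>u (x, y)\<bar> \<le> C * (y * (1 - y))"
   "\<And>x y. (x, y) \<in> dom \<eta> ==> \<bar>u (x, y)\<bar> \<le> C * (N - x)"
  and v: "C2_partials (dom \<eta>) v vx vy vxx vyy"
   "\<And>p. p \<in> dom \<eta> ==> \<bar>v p\<bar> \<le> C" "\<And>p. p \<in> dom \<eta> ==> \<bar>vxx p + vyy p\<bar> \<le> C"
   "\<And>x y. (x, y) \<in> dom \<eta> ==> \<bar>v (x, y)\<bar> \<le> C * (x + \<eta> * \<phi> y)"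
   "\<And>x y. (x, y) \<in> dom \<eta> ==> \<bar>v (x, y)\<bar> \<le> C * (y * (1 - y))"
   "\<And>x y. (x, y) \<in> dom \<eta> ==> \<bar>v (x, y)\<bar> \<le> C * (N - x)"
 shows "(\<integral>p. indicator (dom \<eta>) p * (u p * (vxx p + vyy p) - v p * (uxx p + uyy p)) \<partial>lborel) = 0"
proof (cases "dom \<eta> = {}")
 case False
 then have C0: "C \<ge> 0" using u(2) by force
 define s where "s p = fst p + \<eta> * \<phi> (snd p)" for p :: "real \<times> real"
 define b where "b p = snd p * (1 - snd p)" for p :: "real \<times> real"
 define r where "r p = N - fst p" for p :: "real \<times> real"
 define \<rho> where "\<rho> p = s p * r p * b p" for p
 define \<rho>x where "\<rho>x p = r p * b p - s p * b p" for p
 define \<rho>y where "\<rho>y p = \<eta> * \<phi>1 (snd p) * r p * b p + s p * r p * (1 - 2 * snd p)" for p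
 note cs = continuous_on_snd_compose[OF continuous_\<phi>(1)] continuous_on_snd_compose[OF continuous_\<phi>(2)]
 have sub: "snd ` dom \<eta> \<subseteq> {0..1}" "snd ` Om \<eta> \<subseteq> {0..1}" by (auto simp: dom_def Omega_def)
 have pos: "s p > 0" "r p > 0" "b p > 0" if "p \<in> dom \<eta>" for p
  using that by (auto simp: dom_def s_def r_def b_def)
 have bounds: "\<bar>f p * \<rho>x p\<bar> \<le> 2 * C * \<rho> p" "\<bar>f p * \<rho>y p\<bar> \<le> 2 * C * \<rho> p"
  if f: "\<And>x y. (x, y) \<in> dom \<eta> ==> \<bar>f (x, y)\<bar> \<le> C * (x + \<eta> * \<phi> y)"
   "\<And>x y. (x, y) \<in> dom \<eta> ==> \<bar>f (x, y)\<bar> \<le> C * (y * (1 - y))"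
   "\<And>x y. (x, y) \<in> dom \<eta> ==> \<bar>f (x, y)\<bar> \<le> C * (N - x)" and p: "p \<in> dom \<eta>" for f p
 proof -
  have f': "\<bar>f p\<bar> \<le> C * s p" "\<bar>f p\<bar> \<le> C * b p" "\<bar>f p\<bar> \<le> C * r p"
   using f[of "fst p" "snd p"] p by (auto simp: s_def r_def b_def)
  have y: "snd p \<in> {0..1}" using sub p by auto
  note ps = pos[OF p]
  have 1: "\<bar>f p\<bar> * (r p * b p) \<le> C * s p * (r p * b p)" using f' ps by (intro mult_right_mono) auto
  have 2: "\<bar>f p\<bar> * (s p * b p) \<le> C * r p * (s p * b p)" using f' ps by (intro mult_right_mono) auto
  have 3: "\<bar>f p\<bar> * (s p * r p) \<le> C * b p * (s p * r p)" using f' ps by (intro mult_right_mono) auto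
  have e: "C * s p * (r p * b p) = C * \<rho> p" "C * r p * (s p * b p) = C * \<rho> p" "C * b p * (s p * r p) = C * \<rho> p"
   by (auto simp: \<rho>_def)
  have "\<bar>f p * \<rho>x p\<bar> \<le> \<bar>f p * (r p * b p)\<bar> + \<bar>f p * (s p * b p)\<bar>"
   unfolding \<rho>x_def right_diff_distrib by (rule abs_triangle_ineq4)
  also have "... = \<bar>f p\<bar> * (r p * b p) + \<bar>f p\<bar> * (s p * b p)" using ps by (simp add: abs_mult)
  finally show "\<bar>f p * \<rho>x p\<bar> \<le> 2 * C * \<rho> p" using 1 2 unfolding e by linarith
  have k: "\<bar>\<eta> * \<phi>1 (snd p)\<bar> \<le> 1"
   using \<phi>_bounds(3)[OF y] \<eta> by (simp add: abs_mult mult_le_one)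
  have k2: "\<bar>1 - 2 * snd p\<bar> \<le> 1" using y by auto
  have "\<bar>f p * \<rho>y p\<bar> \<le> \<bar>\<eta> * \<phi>1 (snd p) * (f p * (r p * b p))\<bar> + \<bar>(1 - 2 * snd p) * (f p * (s p * r p))\<bar>"
   using abs_triangle_ineq[of "\<eta> * \<phi>1 (snd p) * (f p * (r p * b p))" "(1 - 2 * snd p) * (f p * (s p * r p))"]
   by (simp add: \<rho>y_def algebra_simps)
  also have "... \<le> 1 * \<bar>f p * (r p * b p)\<bar> + 1 * \<bar>f p * (s p * r p)\<bar>"
   unfolding abs_mult[of "\<eta> * \<phi>1 (snd p)"] abs_mult[of "1 - 2 * snd p"]
   using k k2 by (intro add_mono mult_right_mono) auto
  also have "... = \<bar>f p\<bar> * (r p * b p) + \<bar>f p\<bar> * (s p * r p)" using ps by (simp add: abs_mult)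
  finally show "\<bar>f p * \<rho>y p\<bar> \<le> 2 * C * \<rho> p" using 1 3 unfolding e by linarith
 qed
 have u2: "\<bar>u p\<bar> \<le> 2 * C" "\<bar>uxx p + uyy p\<bar> \<le> 2 * C" if "p \<in> dom \<eta>" for p
  using u(2)[OF that] u(3)[OF that] C0 by linarith+
 have v2: "\<bar>v p\<bar> \<le> 2 * C" "\<bar>vxx p + vyy p\<bar> \<le> 2 * C" if "p \<in> dom \<eta>" for p
  using v(2)[OF that] v(3)[OF that] C0 by linarith+
 show ?thesis
 proof (rule green_zero[where \<rho> = \<rho> and \<rho>x = \<rho>x and \<rho>y = \<rho>y and C = "2 * C",
    OF open_dom bounded_dom[OF \<eta>(1)] _ _ _ _ _ _ _ u(1) u2 bounds(1)[OF u(4-6)] bounds(2)[OF u(4-6)]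
     v(1) v2 bounds(1)[OF v(4-6)] bounds(2)[OF v(4-6)]])
  show "continuous_on (dom \<eta>) \<rho>" "continuous_on (dom \<eta>) \<rho>x" "continuous_on (dom \<eta>) \<rho>y"
   unfolding \<rho>_def \<rho>x_def \<rho>y_def s_def r_def b_def by (intro continuous_intros cs sub)+
  fix x y assume "(x, y) \<in> dom \<eta>"
  then have y: "0 < y" "y < 1" by (auto simp: dom_def)
  show "((\<lambda>x. \<rho> (x, y)) has_real_derivative \<rho>x (x, y)) (at x)"
   unfolding \<rho>_def \<rho>x_def s_def r_def b_def
   by (auto intro!: derivative_eq_intros simp: algebra_simps)
  show "((\<lambda>y. \<rho> (x, y)) has_real_derivative \<rho>y (x, y)) (at y)"
   unfolding \<rho>_def \<rho>y_def s_def r_def b_def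
   by (auto intro!: derivative_eq_intros DERIV_\<phi>[OF y] simp: algebra_simps)
 next
  show "0 < \<rho> p" if "p \<in> dom \<eta>" for p using pos[OF that] by (simp add: \<rho>_def)
  show "compact {p \<in> dom \<eta>. e \<le> \<rho> p}" if "e > 0" for e
  proof -
   \<comment> \<open>On each side one factor of \<rho> vanishes, so a superlevel set of \<rho> in
     the closed domain already lies in \<open>dom \<eta>\<close>.\<close>
   have "p \<in> dom \<eta>" if p: "p \<in> Om \<eta>" "e \<le> \<rho> p" for p
   proof -
    have "\<rho> p \<noteq> 0" using p \<open>e > 0\<close> by auto
    then have "s p \<noteq> 0" "r p \<noteq> 0" "b p \<noteq> 0" by (auto simp: \<rho>_def)
    then show ?thesis using p(1) by (auto simp: dom_def Omega_def s_def r_def b_def less_le algebra_simps)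
   qed
   then have "{p \<in> dom \<eta>. e \<le> \<rho> p} = {p \<in> Om \<eta>. e \<le> \<rho> p}" using dom_subset by auto
   moreover have "closed {p \<in> Om \<eta>. e \<le> \<rho> p}"
    unfolding \<rho>_def s_def r_def b_def
    by (intro continuous_on_closed_Collect_le continuous_intros cs sub compact_imp_closed compact_Om \<eta>)
   moreover have "bounded {p \<in> Om \<eta>. e \<le> \<rho> p}"
    by (rule bounded_subset[OF compact_imp_bounded[OF compact_Om[OF \<eta>(1)]]]) auto
   ultimately show ?thesis by (simp add: compact_eq_bounded_closed)
  qed
 qed
qed simp

text \<open>Applied to the two branches at the same \<eta>. In the limit it makes \<open>v0\<close>
  and \<open>w0\<close> orthogonal, and with them their coefficient vectors.\<close>

lemma eigenfunctions_orthogonal: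
 assumes \<eta>: "0 \<le> \<eta>" "\<eta> * (N + 1) \<le> 1"
  and u: "dirichlet_eigenfunction (Om \<eta>) lam u" and v: "dirichlet_eigenfunction (Om \<eta>) mu v"
  and ne: "lam \<noteq> mu"
 shows "(\<integral>p. indicator (dom \<eta>) p * (u p * v p) \<partial>lborel) = 0"
proof -
 have \<eta>1: "\<eta> \<le> 1" using \<eta> N mult_left_mono[of 1 "N + 1" \<eta>] by simp
 have ex: "\<exists>S. \<forall>p\<in>Om \<eta>. \<bar>f p\<bar> \<le> S" if "dirichlet_eigenfunction (Om \<eta>) l f" for f l
  using compact_imp_bounded[OF compact_continuous_image[OF eigenfunction_facts(1)[OF \<eta>(1) that] compact_Om[OF \<eta>(1)]]]
  by (auto simp: bounded_iff)
 obtain S1 S2 where S1: "\<And>p. p \<in> Om \<eta> ==> \<bar>u p\<bar> \<le> S1" and S2: "\<And>p. p \<in> Om \<eta> ==> \<bar>v p\<bar> \<le> S2"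
  using ex[OF u] ex[OF v] by blast
 define S where "S = max S1 S2"
 have Su: "\<bar>u p\<bar> \<le> S" and Sv: "\<bar>v p\<bar> \<le> S" if "p \<in> Om \<eta>" for p
  using S1[OF that] S2[OF that] by (auto simp: S_def)
 have S0: "S \<ge> 0" using Su[of "(0, 0)"] N \<phi>_ends by (auto simp: Omega_def)
 define L where "L = \<bar>lam\<bar> + \<bar>mu\<bar> + 1"
 define C where "C = L * S * (2 * N + 2)"
 have L: "\<bar>lam\<bar> \<le> L" "\<bar>mu\<bar> \<le> L" "1 \<le> L" by (auto simp: L_def)
 have C: "l * S * (N + 1) \<le> C" "l * S \<le> C" "l * S * (2 * N + 1) \<le> C" "S \<le> C" if "0 \<le> l" "l \<le> L" for l
 proof -
  have *: "l * S * c \<le> C" if "0 \<le> c" "c \<le> 2 * N + 2" for c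
   unfolding C_def using that \<open>0 \<le> l\<close> \<open>l \<le> L\<close> S0 by (intro mult_mono) auto
  show "l * S * (N + 1) \<le> C" "l * S \<le> C" "l * S * (2 * N + 1) \<le> C"
   using *[of "N + 1"] *[of 1] *[of "2 * N + 1"] N by auto
  have "1 * S * 1 \<le> C" unfolding C_def using L S0 N by (intro mult_mono) auto
  then show "S \<le> C" by simp
 qed
 have bd: "\<And>p. p \<in> dom \<eta> ==> \<bar>f p\<bar> \<le> C"
   "\<And>p. p \<in> dom \<eta> ==> \<bar>partial_x (partial_x f) p + partial_y (partial_y f) p\<bar> \<le> C"
   "\<And>x y. (x, y) \<in> dom \<eta> ==> \<bar>f (x, y)\<bar> \<le> C * (x + \<eta> * \<phi> y)"
   "\<And>x y. (x, y) \<in> dom \<eta> ==> \<bar>f (x, y)\<bar> \<le> C * (y * (1 - y))"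
   "\<And>x y. (x, y) \<in> dom \<eta> ==> \<bar>f (x, y)\<bar> \<le> C * (N - x)"
  if f: "dirichlet_eigenfunction (Om \<eta>) l f" "\<And>p. p \<in> Om \<eta> ==> \<bar>f p\<bar> \<le> S" and l: "\<bar>l\<bar> \<le> L" for f l
 proof -
  note Cl = C[OF abs_ge_zero l]
  fix x y assume p: "(x, y) \<in> dom \<eta>"
  then have pO: "(x, y) \<in> Om \<eta>" using dom_subset by auto
  have nn: "0 \<le> x + \<eta> * \<phi> y" "0 \<le> y * (1 - y)" "0 \<le> N - x" using p by (auto simp: dom_def)
  note D = eigenfunction_boundary_decay[OF \<eta> f pO]
  show "\<bar>f (x, y)\<bar> \<le> C * (x + \<eta> * \<phi> y)" using D(1) mult_right_mono[OF Cl(1) nn(1)] by linarith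
  show "\<bar>f (x, y)\<bar> \<le> C * (y * (1 - y))" using D(2) mult_right_mono[OF Cl(2) nn(2)] by linarith
  show "\<bar>f (x, y)\<bar> \<le> C * (N - x)" using D(3) mult_right_mono[OF Cl(3) nn(3)] by linarith
 next
  note Cl = C[OF abs_ge_zero l]
  fix p assume p: "p \<in> dom \<eta>"
  then have pO: "p \<in> Om \<eta>" using dom_subset by auto
  show "\<bar>f p\<bar> \<le> C" using f(2)[OF pO] Cl(4) by linarith
  have "\<bar>l\<bar> * \<bar>f p\<bar> \<le> \<bar>l\<bar> * S" using f(2)[OF pO] by (intro mult_left_mono) auto
  then show "\<bar>partial_x (partial_x f) p + partial_y (partial_y f) p\<bar> \<le> C"
   using eigenfunction_facts(3)[OF \<eta>(1) f(1) p] Cl(2) by (simp add: abs_mult)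
 qed
 note bu = bd[OF u Su L(1)] and bv = bd[OF v Sv L(2)]
 have "0 = (\<integral>p. indicator (dom \<eta>) p * (u p * (partial_x (partial_x v) p + partial_y (partial_y v) p)
   - v p * (partial_x (partial_x u) p + partial_y (partial_y u) p)) \<partial>lborel)"
  using green_dom[OF \<eta>(1) \<eta>1 eigenfunction_facts(2)[OF \<eta>(1) u] bu
    eigenfunction_facts(2)[OF \<eta>(1) v] bv] by simp
 also have "... = (\<integral>p. (lam - mu) * (indicator (dom \<eta>) p * (u p * v p)) \<partial>lborel)"
 proof (rule Bochner_Integration.integral_cong[OF refl])
  fix p
  show "indicator (dom \<eta>) p * (u p * (partial_x (partial_x v) p + partial_y (partial_y v) p)
   - v p * (partial_x (partial_x u) p + partial_y (partial_y u) p)) = (lam - mu) * (indicator (dom \<eta>) p * (u p * v p))"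
  proof (cases "p \<in> dom \<eta>")
   case True
   show ?thesis unfolding eigenfunction_facts(3)[OF \<eta>(1) u True] eigenfunction_facts(3)[OF \<eta>(1) v True]
    by (simp add: algebra_simps)
  qed simp
 qed
 finally show ?thesis using ne by simp
qed

end

subsection \<open>Trial functions\<close>

lemma integrable_bounded_on:
 fixes f :: "real \<times> real => real"
 assumes "open W" "bounded W" "continuous_on W f" "\<And>p. p \<in> W ==> \<bar>f p\<bar> \<le> B"
 shows "integrable lborel (\<lambda>p. indicator W p * f p)"
proof -
 have "integrable lborel (\<lambda>p. indicator W p *\<^sub>R f p)"
  by (rule integrableI_bounded_set[where A = W and B = B])
    (use assms emeasure_bounded_finite[OF assms(2)] in
     \<open>auto intro!: borel_measurable_continuous_on_indicator simp del: real_scaleR_def\<close>)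
 then show ?thesis by simp
qed

lemma abs_sin_le_abs: "\<bar>sin x\<bar> \<le> \<bar>x\<bar>" for x :: real
 using abs_sin_x_le_abs_x by blast

lemma abs_sin_nat_pi_diff: "\<bar>sin (real m * pi - z)\<bar> = \<bar>sin z\<bar>"
proof -
 have "sin (real m * pi) = 0" "\<bar>cos (real m * pi)\<bar> = 1" by (simp_all add: sin_npi cos_npi)
 then show ?thesis by (simp add: sin_diff abs_mult)
qed

text \<open>The factor 2 pays for replacing y by y (1 - y): for y \<le> 1/2 one has 2 (1 - y) \<ge>
  1, and the other half follows by reflection.\<close>

lemma abs_sin_nat_pi_le:
 assumes "0 \<le> y" "y \<le> 1"
 shows "\<bar>sin (real n * pi * y)\<bar> \<le> 2 * real n * pi * (y * (1 - y))"
proof (cases "y \<le> 1/2")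
 case True
 have "\<bar>sin (real n * pi * y)\<bar> \<le> real n * pi * y" using abs_sin_le_abs[of "real n * pi * y"] assms by simp
 also have "... \<le> real n * pi * (y * (2 * (1 - y)))"
  using True assms by (intro mult_left_mono) (auto simp: mult_le_cancel_left1)
 finally show ?thesis by (simp add: algebra_simps)
next
 case False
 have "\<bar>sin (real n * pi * y)\<bar> = \<bar>sin (real n * pi * (1 - y))\<bar>"
  using abs_sin_nat_pi_diff[of n "real n * pi * (1 - y)"] by (simp add: algebra_simps)
 also have "... \<le> real n * pi * (1 - y)" using abs_sin_le_abs[of "real n * pi * (1 - y)"] assms by simp
 also have "... \<le> real n * pi * ((1 - y) * (2 * y))"
  using False assms by (intro mult_left_mono) (auto simp: mult_le_cancel_left1)
 finally show ?thesis by (simp add: algebra_simps)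
qed

context profile begin

definition len :: "real => real => real" where "len \<eta> y = N + \<eta> * \<phi> y"

text \<open>Measured from the right side, which does not move; the moving side is where the angle
  equals m pi.\<close>

definition ang :: "real => nat => real \<times> real => real" where
 "ang \<eta> m p = real m * pi * (N - fst p) / len \<eta> (snd p)"

definition trial :: "real => nat => nat => real \<times> real => real" where
 "trial \<eta> m n p = sin (ang \<eta> m p) * sin (real n * pi * snd p)"

text \<open>The trial functions vanish on the boundary of the perturbed domain; \<open>defect\<close> is the
 amount by which they fail to be eigenfunctions, divided by \<open>\<eta>\<close>.\<close>

definition defect :: "real => nat => nat => real \<times> real => real" where
 "defect \<eta> m n p = (let y = snd p; L = len \<eta> y; t = ang \<eta> m p in
   (real m * pi)\<^sup>2 * \<phi> y * (2 * N + \<eta> * \<phi> y) / (N^2 * L^2) * sin t * sin (real n * pi * y)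
   + (- sin t * t^2 * \<eta> * (\<phi>1 y)^2 / L^2 + cos t * (2 * t * \<eta> * (\<phi>1 y)^2 / L^2 - t * \<phi>2 y / L)) * sin (real n * pi * y)
   - 2 * real n * pi * t * \<phi>1 y / L * cos t * cos (real n * pi * y))"

definition angy :: "real => nat => real \<times> real => real" where
 "angy \<eta> m p = - ang \<eta> m p * \<eta> * \<phi>1 (snd p) / len \<eta> (snd p)"

definition angyy :: "real => nat => real \<times> real => real" where
 "angyy \<eta> m p = 2 * ang \<eta> m p * \<eta>^2 * (\<phi>1 (snd p))^2 / (len \<eta> (snd p))^2 - ang \<eta> m p * \<eta> * \<phi>2 (snd p) / len \<eta> (snd p)"

definition trialx :: "real => nat => nat => real \<times> real => real" where
 "trialx \<eta> m n p = - (real m * pi / len \<eta> (snd p)) * cos (ang \<eta> m p) * sin (real n * pi * snd p)"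

definition trialxx :: "real => nat => nat => real \<times> real => real" where
 "trialxx \<eta> m n p = - (real m * pi / len \<eta> (snd p))\<^sup>2 * sin (ang \<eta> m p) * sin (real n * pi * snd p)"

definition trialy :: "real => nat => nat => real \<times> real => real" where
 "trialy \<eta> m n p = cos (ang \<eta> m p) * angy \<eta> m p * sin (real n * pi * snd p)
   + sin (ang \<eta> m p) * (real n * pi) * cos (real n * pi * snd p)"

definition trialyy :: "real => nat => nat => real \<times> real => real" where
 "trialyy \<eta> m n p = (- sin (ang \<eta> m p) * (angy \<eta> m p)^2 + cos (ang \<eta> m p) * angyy \<eta> m p) * sin (real n * pi * snd p)
   + 2 * cos (ang \<eta> m p) * angy \<eta> m p * (real n * pi) * cos (real n * pi * snd p)
   - sin (ang \<eta> m p) * (real n * pi)^2 * sin (real n * pi * snd p)"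

lemma len_ge: "0 \<le> \<eta> ==> y \<in> {0..1} ==> N \<le> len \<eta> y"
 using \<phi>_bounds(1) by (simp add: len_def)

lemma len_nz: "0 \<le> \<eta> ==> y \<in> {0..1} ==> len \<eta> y \<noteq> 0"
 using len_ge[of \<eta> y] N by simp

lemma dom_snd: "p \<in> dom \<eta> ==> snd p \<in> {0..1}" by (auto simp: dom_def)

text \<open>Every source of error carries a factor \<eta>: the square of the width differs from N^2
  by \<eta> \<phi> (2 N + \<eta> \<phi>), and the y-derivatives of the angle contain \<eta>.\<close>

lemma trial_laplacian:
 assumes "0 \<le> \<eta>" "p \<in> dom \<eta>"
 shows "trialxx \<eta> m n p + trialyy \<eta> m n p = \<eta> * defect \<eta> m n p - rect_eigenvalue N m n * trial \<eta> m n p"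
proof -
 define L where "L = len \<eta> (snd p)"
 define f where "f = \<phi> (snd p)"
 define a where "a = real m * pi"
 have L: "L \<noteq> 0" using len_nz[OF assms(1) dom_snd[OF assms(2)]] by (simp add: L_def)
 have Lf: "L = N + \<eta> * f" by (simp add: L_def f_def len_def)
 have "(a / N)^2 - (a / L)^2 = a^2 * (L^2 - N^2) / (N^2 * L^2)"
  using L N by (simp add: field_simps power_divide)
 also have "L^2 - N^2 = \<eta> * (f * (2 * N + \<eta> * f))" by (simp add: Lf power2_eq_square algebra_simps)
 finally have k: "(a / L)^2 = (a / N)^2 - \<eta> * (a^2 * f * (2 * N + \<eta> * f) / (N^2 * L^2))"
  by (simp add: algebra_simps)
 have r: "rect_eigenvalue N m n = (a / N)^2 + (real n * pi)^2"
  by (simp add: rect_eigenvalue_def a_def power_divide power_mult_distrib algebra_simps)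
 show ?thesis
  unfolding trialxx_def trialyy_def defect_def trial_def angy_def angyy_def Let_def r
   L_def[symmetric] f_def[symmetric] a_def[symmetric] k
  by (simp add: algebra_simps power2_eq_square)
qed

lemma C2_trial:
 assumes \<eta>: "0 \<le> \<eta>"
 shows "C2_partials (dom \<eta>) (trial \<eta> m n) (trialx \<eta> m n) (trialy \<eta> m n) (trialxx \<eta> m n) (trialyy \<eta> m n)"
proof -
 note cs = continuous_on_snd_compose[OF continuous_\<phi>(1)] continuous_on_snd_compose[OF continuous_\<phi>(2)]
  continuous_on_snd_compose[OF \<phi>2]
 have sub: "snd ` dom \<eta> \<subseteq> {0..1}" by (auto simp: dom_def)
 have Lnz: "len \<eta> (snd p) \<noteq> 0" if "p \<in> dom \<eta>" for p using len_nz[OF \<eta> dom_snd[OF that]] .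
 have cL: "continuous_on (dom \<eta>) (\<lambda>p. len \<eta> (snd p))"
  unfolding len_def by (intro continuous_intros cs sub)
 have cA: "continuous_on (dom \<eta>) (ang \<eta> m)"
  unfolding ang_def by (intro continuous_intros cL) (use Lnz in auto)
 have cAy: "continuous_on (dom \<eta>) (angy \<eta> m)"
  unfolding angy_def by (intro continuous_intros cL cA cs sub) (use Lnz in auto)
 have cAyy: "continuous_on (dom \<eta>) (angyy \<eta> m)"
  unfolding angyy_def by (intro continuous_intros cL cA cs sub) (use Lnz in auto)
 show ?thesis unfolding C2_partials_def
 proof (intro conjI allI impI)
  show "continuous_on (dom \<eta>) (trial \<eta> m n)" unfolding trial_def by (intro continuous_intros cA)
  show "continuous_on (dom \<eta>) (trialx \<eta> m n)"
   unfolding trialx_def by (intro continuous_intros cA cL) (use Lnz in auto)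
  show "continuous_on (dom \<eta>) (trialy \<eta> m n)" unfolding trialy_def by (intro continuous_intros cA cAy)
  show "continuous_on (dom \<eta>) (trialxx \<eta> m n)"
   unfolding trialxx_def by (intro continuous_intros cA cL) (use Lnz in auto)
  show "continuous_on (dom \<eta>) (trialyy \<eta> m n)" unfolding trialyy_def by (intro continuous_intros cA cAy cAyy)
  fix x y assume p: "(x, y) \<in> dom \<eta>"
  then have y: "0 < y" "y < 1" by (auto simp: dom_def)
  have L0: "len \<eta> y \<noteq> 0" using Lnz[OF p] by simp
  note d = DERIV_\<phi>[OF y]
  have dL: "((\<lambda>y. len \<eta> y) has_real_derivative \<eta> * \<phi>1 y) (at y)"
   unfolding len_def by (auto intro!: derivative_eq_intros d)
  have ax: "((\<lambda>x. ang \<eta> m (x, y)) has_real_derivative - (real m * pi / len \<eta> y)) (at x)"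
   unfolding ang_def by (auto intro!: derivative_eq_intros simp: L0)
  have ay: "((\<lambda>y. ang \<eta> m (x, y)) has_real_derivative angy \<eta> m (x, y)) (at y)"
   unfolding ang_def angy_def
   by (auto intro!: derivative_eq_intros dL L0 simp: L0 power2_eq_square)
  have ayy: "((\<lambda>y. angy \<eta> m (x, y)) has_real_derivative angyy \<eta> m (x, y)) (at y)"
   unfolding angy_def angyy_def snd_conv
   by (rule derivative_eq_intros ay dL d L0 refl)+ (simp add: angy_def L0 power2_eq_square field_simps)
  show "((\<lambda>x. trial \<eta> m n (x, y)) has_real_derivative trialx \<eta> m n (x, y)) (at x)"
   unfolding trial_def trialx_def snd_conv by (rule derivative_eq_intros ax refl)+ simp
  show "((\<lambda>x. trialx \<eta> m n (x, y)) has_real_derivative trialxx \<eta> m n (x, y)) (at x)"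
   unfolding trialx_def trialxx_def snd_conv
   by (rule derivative_eq_intros ax refl)+ (simp add: power2_eq_square)
  show "((\<lambda>y. trial \<eta> m n (x, y)) has_real_derivative trialy \<eta> m n (x, y)) (at y)"
   unfolding trial_def trialy_def snd_conv by (rule derivative_eq_intros ay refl)+ simp
  show "((\<lambda>y. trialy \<eta> m n (x, y)) has_real_derivative trialyy \<eta> m n (x, y)) (at y)"
   unfolding trialy_def trialyy_def snd_conv
   by (rule derivative_eq_intros ay ayy refl)+ (simp add: power2_eq_square algebra_simps)
 qed
qed

text \<open>Joint continuity in \<eta> and p on a compact set gives one bound for all \<eta>. The
  box contains every \<open>dom \<eta>\<close> with \<eta> \<le> 1, so the bound can serve in
  dominated convergence.\<close>

lemma defect_bounded:
 obtains G where "\<And>\<eta> p. \<eta> \<in> {0..1} ==> p \<in> {-1..N} \<times> {0..1} ==> \<bar>defect \<eta> m n p\<bar> \<le> G"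
proof -
 let ?S = "{0..1::real} \<times> ({-1..N} \<times> {0..1::real})"
 have c: "continuous_on ?S (\<lambda>q. g (snd (snd q)))" if "continuous_on {0..1} g" for g :: "real => real"
  by (rule continuous_on_compose2[OF that]) (auto intro!: continuous_intros)
 note cs = c[OF continuous_\<phi>(1)] c[OF continuous_\<phi>(2)] c[OF \<phi>2]
 have Lnz: "len (fst q) (snd (snd q)) \<noteq> 0" if "q \<in> ?S" for q using that by (intro len_nz) auto
 have cL: "continuous_on ?S (\<lambda>q. len (fst q) (snd (snd q)))"
  unfolding len_def by (intro continuous_intros cs)
 have cA: "continuous_on ?S (\<lambda>q. ang (fst q) m (snd q))"
  unfolding ang_def by (intro continuous_intros cL) (use Lnz in auto)
 have "continuous_on ?S (\<lambda>q. defect (fst q) m n (snd q))"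
  unfolding defect_def Let_def by (intro continuous_intros cL cA cs) (use Lnz N in auto)
 moreover have "compact ?S" by (intro compact_Times) auto
 ultimately have "bounded ((\<lambda>q. defect (fst q) m n (snd q)) ` ?S)"
  by (intro compact_imp_bounded compact_continuous_image)
 then obtain G where "\<forall>z \<in> (\<lambda>q. defect (fst q) m n (snd q)) ` ?S. norm z \<le> G"
  unfolding bounded_iff by blast
 then have G: "\<bar>defect (fst q) m n (snd q)\<bar> \<le> G" if "q \<in> ?S" for q using that by fastforce
 show ?thesis
 proof (rule that[of G])
  fix \<eta> :: real and p :: "real \<times> real" assume "\<eta> \<in> {0..1}" "p \<in> {-1..N} \<times> {0..1}"
  then show "\<bar>defect \<eta> m n p\<bar> \<le> G" using G[of "(\<eta>, p)"] by simp
 qed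
qed

lemma defect_continuous: "0 \<le> \<eta> ==> continuous_on (dom \<eta>) (defect \<eta> m n)"
proof -
 assume \<eta>: "0 \<le> \<eta>"
 note cs = continuous_on_snd_compose[OF continuous_\<phi>(1)] continuous_on_snd_compose[OF continuous_\<phi>(2)]
  continuous_on_snd_compose[OF \<phi>2]
 have sub: "snd ` dom \<eta> \<subseteq> {0..1}" by (auto simp: dom_def)
 have Lnz: "len \<eta> (snd p) \<noteq> 0" if "p \<in> dom \<eta>" for p using len_nz[OF \<eta> dom_snd[OF that]] .
 have cL: "continuous_on (dom \<eta>) (\<lambda>p. len \<eta> (snd p))"
  unfolding len_def by (intro continuous_intros cs sub)
 have cA: "continuous_on (dom \<eta>) (ang \<eta> m)"
  unfolding ang_def by (intro continuous_intros cL) (use Lnz in auto)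
 show ?thesis unfolding defect_def Let_def
  by (intro continuous_intros cL cA cs sub) (use Lnz N in auto)
qed

lemma dom_subset_box: assumes "0 \<le> \<eta>" "\<eta> \<le> 1" shows "dom \<eta> \<subseteq> {-1..N} \<times> {0..1}"
proof
 fix p assume p: "p \<in> dom \<eta>"
 then have "(fst p, snd p) \<in> Om \<eta>" using dom_subset by auto
 from Om_bounds[OF assms(1) this] assms(2) show "p \<in> {-1..N} \<times> {0..1}" by (cases p) auto
qed

text \<open>At the moving side the angle is m pi minus a multiple of x + \<eta> \<phi> y, and |sin|
  does not see the shift by m pi. So the decay there is the same as at the fixed side.\<close>

lemma trial_boundary_decay:
 assumes \<eta>: "0 \<le> \<eta>" "\<eta> \<le> 1" and p: "(x, y) \<in> dom \<eta>"
 shows "\<bar>trial \<eta> m n (x, y)\<bar> \<le> 1" "\<bar>trial \<eta> m n (x, y)\<bar> \<le> real m * pi / N * (x + \<eta> * \<phi> y)"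
  "\<bar>trial \<eta> m n (x, y)\<bar> \<le> real m * pi / N * (N - x)" "\<bar>trial \<eta> m n (x, y)\<bar> \<le> 2 * real n * pi * (y * (1 - y))"
proof -
 have y: "y \<in> {0..1}" and nn: "0 < x + \<eta> * \<phi> y" "0 < N - x" using p by (auto simp: dom_def)
 have L: "N \<le> len \<eta> y" using len_ge[OF \<eta>(1) y] .
 then have L0: "len \<eta> y > 0" using N by simp
 have b: "\<bar>sin (ang \<eta> m (x, y))\<bar> \<le> 1" "\<bar>sin (real n * pi * y)\<bar> \<le> 1" by auto
 have q: "real m * pi * c / len \<eta> y \<le> real m * pi / N * c" if "c > 0" for c
 proof -
  have "real m * pi * c / len \<eta> y \<le> real m * pi * c / N"
   using L N that by (intro divide_left_mono) auto
  then show ?thesis by simp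
 qed
 have le1: "\<bar>trial \<eta> m n (x, y)\<bar> \<le> \<bar>sin (ang \<eta> m (x, y))\<bar>" "\<bar>trial \<eta> m n (x, y)\<bar> \<le> \<bar>sin (real n * pi * y)\<bar>"
  using b by (auto simp: trial_def abs_mult mult_left_le mult_left_le_one_le)
 show "\<bar>trial \<eta> m n (x, y)\<bar> \<le> 1" using le1 b by linarith
 have "\<bar>sin (ang \<eta> m (x, y))\<bar> \<le> \<bar>ang \<eta> m (x, y)\<bar>" by (rule abs_sin_le_abs)
 also have "... = real m * pi * (N - x) / len \<eta> y" using nn L0 by (simp add: ang_def abs_mult)
 finally show "\<bar>trial \<eta> m n (x, y)\<bar> \<le> real m * pi / N * (N - x)" using q[OF nn(2)] le1 by linarith
 have "ang \<eta> m (x, y) = real m * pi - real m * pi * (x + \<eta> * \<phi> y) / len \<eta> y"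
  using L0 by (simp add: ang_def field_simps) (simp add: len_def algebra_simps)
 then have "\<bar>sin (ang \<eta> m (x, y))\<bar> = \<bar>sin (real m * pi * (x + \<eta> * \<phi> y) / len \<eta> y)\<bar>"
  by (simp add: abs_sin_nat_pi_diff)
 also have "... \<le> \<bar>real m * pi * (x + \<eta> * \<phi> y) / len \<eta> y\<bar>" by (rule abs_sin_le_abs)
 also have "... = real m * pi * (x + \<eta> * \<phi> y) / len \<eta> y" using nn L0 by (simp add: abs_mult)
 finally show "\<bar>trial \<eta> m n (x, y)\<bar> \<le> real m * pi / N * (x + \<eta> * \<phi> y)" using q[OF nn(1)] le1 by linarith
 show "\<bar>trial \<eta> m n (x, y)\<bar> \<le> 2 * real n * pi * (y * (1 - y))"
  using abs_sin_nat_pi_le[of y n] y le1 by auto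
qed

text \<open>Both functions decay linearly at all sides, so \<open>green_dom\<close> applies. The
  factor \<eta> on the right is the point: dividing by it yields first-order information on
  \<open>lam\<close> without differentiating u in \<eta>.\<close>

lemma trial_identity:
 assumes \<eta>: "0 \<le> \<eta>" "\<eta> * (N + 1) \<le> 1" and u: "dirichlet_eigenfunction (Om \<eta>) lam u"
  and S: "\<And>p. p \<in> Om \<eta> ==> \<bar>u p\<bar> \<le> S"
 shows "(lam - rect_eigenvalue N m n) * (\<integral>p. indicator (dom \<eta>) p * (u p * trial \<eta> m n p) \<partial>lborel) =
   - \<eta> * (\<integral>p. indicator (dom \<eta>) p * (u p * defect \<eta> m n p) \<partial>lborel)"
proof -
 have \<eta>1: "\<eta> \<le> 1" using \<eta> N mult_left_mono[of 1 "N + 1" \<eta>] by simp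
 obtain G where G: "\<And>\<eta> p. \<eta> \<in> {0..1} ==> p \<in> {-1..N} \<times> {0..1} ==> \<bar>defect \<eta> m n p\<bar> \<le> G"
  using defect_bounded[of m n] by blast
 have Gd: "\<bar>defect \<eta> m n p\<bar> \<le> G" if "p \<in> dom \<eta>" for p
  using G[of \<eta> p] \<eta>(1) \<eta>1 dom_subset_box[OF \<eta>(1) \<eta>1] that by auto
 have S0: "S \<ge> 0" using S[of "(0, 0)"] N \<phi>_ends by (auto simp: Omega_def)
 have Su: "\<bar>u p\<bar> \<le> S" if "p \<in> dom \<eta>" for p using S dom_subset that by blast
 define R where "R = rect_eigenvalue N m n"
 define l where "l = \<bar>lam\<bar>"
 have nn: "0 \<le> l * S" "0 \<le> l * S * (N + 1)" "0 \<le> l * S * (2 * N + 1)" "0 \<le> real m * pi / N" "0 \<le> real n * pi"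
  using S0 N by (auto simp: l_def)
 \<comment> \<open>The sum of all the bounds that \<open>green_dom\<close> asks for, so that a
   single constant serves for both functions.\<close>
 define C where "C = S + \<bar>G\<bar> + \<bar>R\<bar> + 1 + l * S + l * S * (N + 1) + l * S * (2 * N + 1) + real m * pi / N + 2 * (real n * pi)"
 have C: "S \<le> C" "\<bar>G\<bar> + \<bar>R\<bar> \<le> C" "1 \<le> C" "l * S \<le> C" "l * S * (N + 1) \<le> C" "l * S * (2 * N + 1) \<le> C"
  "real m * pi / N \<le> C" "2 * real n * pi \<le> C" using nn S0 by (auto simp: C_def)
 note uf = eigenfunction_facts[OF \<eta>(1) u] and tl = trial_laplacian[OF \<eta>(1), of _ m n, folded R_def]
 have up: "a \<le> C * r" if "a \<le> b * r" "b \<le> C" "0 \<le> r" for a b r :: real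
  using mult_right_mono[OF that(2,3)] that(1) by linarith
 have pos: "0 \<le> x + \<eta> * \<phi> y" "0 \<le> y * (1 - y)" "0 \<le> N - x" if "(x, y) \<in> dom \<eta>" for x y
  using that by (auto simp: dom_def)
 have "(\<integral>p. indicator (dom \<eta>) p * (u p * (trialxx \<eta> m n p + trialyy \<eta> m n p)
   - trial \<eta> m n p * (partial_x (partial_x u) p + partial_y (partial_y u) p)) \<partial>lborel) = 0"
 proof (rule green_dom[OF \<eta>(1) \<eta>1 uf(2) _ _ _ _ _ C2_trial[OF \<eta>(1)], where C = C])
  fix p assume p: "p \<in> dom \<eta>"
  show "\<bar>u p\<bar> \<le> C" using Su[OF p] C by linarith
  have "\<bar>lam\<bar> * \<bar>u p\<bar> \<le> l * S" using Su[OF p] by (auto simp: l_def intro!: mult_left_mono)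
  then show "\<bar>partial_x (partial_x u) p + partial_y (partial_y u) p\<bar> \<le> C"
   using uf(3)[OF p] C by (simp add: abs_mult)
  have t1: "\<bar>trial \<eta> m n p\<bar> \<le> 1" using trial_boundary_decay(1)[OF \<eta>(1) \<eta>1, of "fst p" "snd p"] p by simp
  then show "\<bar>trial \<eta> m n p\<bar> \<le> C" using C by linarith
  have "\<bar>\<eta> * defect \<eta> m n p\<bar> \<le> 1 * \<bar>G\<bar>"
   unfolding abs_mult using Gd[OF p] \<eta>(1) \<eta>1 by (intro mult_mono) auto
  moreover have "\<bar>R * trial \<eta> m n p\<bar> \<le> \<bar>R\<bar> * 1" unfolding abs_mult using t1 by (intro mult_left_mono) auto
  ultimately show "\<bar>trialxx \<eta> m n p + trialyy \<eta> m n p\<bar> \<le> C" unfolding tl[OF p] using C by linarith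
 next
  fix x y assume p: "(x, y) \<in> dom \<eta>"
  then have pO: "(x, y) \<in> Om \<eta>" using dom_subset by auto
  note D = eigenfunction_boundary_decay[OF \<eta> u S pO, folded l_def] and T = trial_boundary_decay[OF \<eta>(1) \<eta>1 p]
  show "\<bar>u (x, y)\<bar> \<le> C * (x + \<eta> * \<phi> y)" using up[OF D(1) C(5) pos(1)[OF p]] .
  show "\<bar>u (x, y)\<bar> \<le> C * (y * (1 - y))" using up[OF D(2) C(4) pos(2)[OF p]] .
  show "\<bar>u (x, y)\<bar> \<le> C * (N - x)" using up[OF D(3) C(6) pos(3)[OF p]] .
  show "\<bar>trial \<eta> m n (x, y)\<bar> \<le> C * (x + \<eta> * \<phi> y)" using up[OF T(2) C(7) pos(1)[OF p]] .
  show "\<bar>trial \<eta> m n (x, y)\<bar> \<le> C * (y * (1 - y))" using up[OF T(4) C(8) pos(2)[OF p]] .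
  show "\<bar>trial \<eta> m n (x, y)\<bar> \<le> C * (N - x)" using up[OF T(3) C(7) pos(3)[OF p]] .
 qed
 also have "(\<integral>p. indicator (dom \<eta>) p * (u p * (trialxx \<eta> m n p + trialyy \<eta> m n p)
   - trial \<eta> m n p * (partial_x (partial_x u) p + partial_y (partial_y u) p)) \<partial>lborel) =
  (\<integral>p. \<eta> * (indicator (dom \<eta>) p * (u p * defect \<eta> m n p)) +
    (lam - R) * (indicator (dom \<eta>) p * (u p * trial \<eta> m n p)) \<partial>lborel)"
 proof (rule Bochner_Integration.integral_cong[OF refl])
  fix p
  show "indicator (dom \<eta>) p * (u p * (trialxx \<eta> m n p + trialyy \<eta> m n p)
   - trial \<eta> m n p * (partial_x (partial_x u) p + partial_y (partial_y u) p)) =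
   \<eta> * (indicator (dom \<eta>) p * (u p * defect \<eta> m n p)) + (lam - R) * (indicator (dom \<eta>) p * (u p * trial \<eta> m n p))"
  proof (cases "p \<in> dom \<eta>")
   case True
   show ?thesis unfolding tl[OF True] uf(3)[OF True] by (simp add: algebra_simps)
  qed simp
 qed
 also have "... = \<eta> * (\<integral>p. indicator (dom \<eta>) p * (u p * defect \<eta> m n p) \<partial>lborel) +
    (lam - R) * (\<integral>p. indicator (dom \<eta>) p * (u p * trial \<eta> m n p) \<partial>lborel)"
 proof -
  have cu: "continuous_on (dom \<eta>) u" and ct: "continuous_on (dom \<eta>) (trial \<eta> m n)"
   using uf(2) C2_trial[OF \<eta>(1), of m n] by (auto simp: C2_partials_def)
  have "integrable lborel (\<lambda>p. indicator (dom \<eta>) p * (u p * defect \<eta> m n p))"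
  proof (rule integrable_bounded_on[OF open_dom bounded_dom[OF \<eta>(1)]])
   show "continuous_on (dom \<eta>) (\<lambda>p. u p * defect \<eta> m n p)" by (intro continuous_intros cu defect_continuous \<eta>)
   show "\<bar>u p * defect \<eta> m n p\<bar> \<le> S * G" if "p \<in> dom \<eta>" for p
    unfolding abs_mult using Su[OF that] Gd[OF that] by (intro mult_mono) auto
  qed
  moreover have "integrable lborel (\<lambda>p. indicator (dom \<eta>) p * (u p * trial \<eta> m n p))"
  proof (rule integrable_bounded_on[OF open_dom bounded_dom[OF \<eta>(1)]])
   show "continuous_on (dom \<eta>) (\<lambda>p. u p * trial \<eta> m n p)" by (intro continuous_intros cu ct)
   show "\<bar>u p * trial \<eta> m n p\<bar> \<le> S * 1" if "p \<in> dom \<eta>" for p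
    unfolding abs_mult using Su[OF that] trial_boundary_decay(1)[OF \<eta>(1) \<eta>1, of "fst p" "snd p"] that
    by (intro mult_mono) auto
  qed
  ultimately show ?thesis by simp
 qed
 finally show ?thesis by (simp add: R_def)
qed

end

subsection \<open>Limits of eigenfunctions\<close>

text \<open>A sequence of parameters takes the place of \<eta> \<rightarrow> 0, so that dominated
  convergence applies. The uniform bounds \<open>M\<close> and \<open>L\<close> and the smallness of
  \<open>h\<close> are reached by dropping initial terms, see \<open>make_eigen_seq\<close>.\<close>

locale eigen_seq = profile +
 fixes h :: "nat => real" and u :: "nat => real \<times> real => real" and lam :: "nat => real"
  and u0 :: "real \<times> real => real" and lam0 M L :: real
 assumes h: "\<And>k. h k > 0" "\<And>k. h k * (N + 1) \<le> 1" "h \<longlonglongrightarrow> 0"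
  and u: "\<And>k. dirichlet_eigenfunction (Om (h k)) (lam k) (u k)"
  and M: "\<And>k p. p \<in> Om (h k) ==> \<bar>u k p\<bar> \<le> M"
  and lam: "lam \<longlonglongrightarrow> lam0" "\<And>k. \<bar>lam k\<bar> \<le> L"
  and u0: "uniform_limit (rect N) u u0 sequentially"
  and norm1: "\<And>k. integral (Om (h k)) (\<lambda>p. (u k p)^2) = 1"
begin

lemma h0: "0 \<le> h k" using h(1)[of k] by simp

lemma h1: "h k \<le> 1"
 using h(2)[of k] h0[of k] N mult_left_mono[of 1 "N + 1" "h k"] by simp

lemma rect_subset_Om: "0 \<le> \<eta> ==> rect N \<subseteq> Om \<eta>"
proof
 fix p assume \<eta>: "0 \<le> \<eta>" and p: "p \<in> rect N"
 obtain x y where xy: "p = (x, y)" by (cases p)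
 have y: "y \<in> {0..1}" and x: "0 \<le> x" "x \<le> N" using p xy by (auto simp: rect_def)
 have "0 \<le> \<eta> * \<phi> y" using \<eta> \<phi>_bounds(1)[OF y] by simp
 then show "p \<in> Om \<eta>" using x y xy by (auto simp: Omega_def)
qed

lemma dom0_subset: "dom 0 \<subseteq> rect N" by (auto simp: dom_def rect_def)

lemma dom0_subset_dom: assumes "0 \<le> \<eta>" shows "dom 0 \<subseteq> dom \<eta>"
proof
 fix p assume p: "p \<in> dom 0"
 obtain x y where xy: "p = (x, y)" by (cases p)
 have "0 \<le> \<eta> * \<phi> y" using assms \<phi>_bounds(1)[of y] p xy by (auto simp: dom_def)
 then show "p \<in> dom \<eta>" using p xy by (auto simp: dom_def)
qed

lemma continuous_u0: "continuous_on (rect N) u0"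
proof (rule uniform_limit_theorem[OF _ u0])
 have "continuous_on (rect N) (u k)" for k
  using eigenfunction_facts(1)[OF h0 u] rect_subset_Om[OF h0] continuous_on_subset by blast
 then show "\<forall>\<^sub>F k in sequentially. continuous_on (rect N) (u k)" by simp
qed simp

lemma u_tendsto: "p \<in> rect N ==> (\<lambda>k. u k p) \<longlonglongrightarrow> u0 p"
 using tendsto_uniform_limitI[OF u0] .

lemma continuous_u: "continuous_on (dom (h k)) (u k)"
 using eigenfunction_facts(1)[OF h0 u] dom_subset continuous_on_subset by blast

lemma M0: "M \<ge> 0"
 using M[of "(0, 0)" 0] N \<phi>_ends by (auto simp: Omega_def)

text \<open>Stated for a general second factor because it is used with trial functions, with
  defects, with u itself and with the other branch. The domain of integration varies too; points
  outside \<open>dom 0\<close> drop out by the boundary decay.\<close>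

lemma limit_integral:
 assumes f: "\<And>k. continuous_on (dom (h k)) (f k)" "\<And>k p. p \<in> dom (h k) ==> \<bar>f k p\<bar> \<le> G"
  and f0: "continuous_on (dom 0) f0" "\<And>p. p \<in> dom 0 ==> (\<lambda>k. f k p) \<longlonglongrightarrow> f0 p"
 shows "(\<lambda>k. \<integral>p. indicator (dom (h k)) p * (u k p * f k p) \<partial>lborel) \<longlonglongrightarrow>
  (\<integral>p. indicator (dom 0) p * (u0 p * f0 p) \<partial>lborel)"
proof (rule integral_dominated_convergence[where w = "\<lambda>p. indicator ({-1..N} \<times> {0..1}) p * (M * \<bar>G\<bar>)"])
 have "(\<lambda>p. indicator (dom 0) p *\<^sub>R (u0 p * f0 p)) \<in> borel_measurable borel"
  by (rule borel_measurable_continuous_on_indicator)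
    (auto intro!: continuous_intros f0 continuous_on_subset[OF continuous_u0 dom0_subset] open_dom borel_open)
 then show "(\<lambda>p. indicator (dom 0) p * (u0 p * f0 p)) \<in> borel_measurable lborel" by simp
 have "(\<lambda>p. indicator (dom (h k)) p *\<^sub>R (u k p * f k p)) \<in> borel_measurable borel" for k
  by (rule borel_measurable_continuous_on_indicator)
    (auto intro!: continuous_intros f continuous_u open_dom borel_open)
 then show "(\<lambda>p. indicator (dom (h k)) p * (u k p * f k p)) \<in> borel_measurable lborel" for k by simp
 have "compact ({-1..N} \<times> {0..1::real})" by (intro compact_Times) auto
 then have "integrable lborel (\<lambda>p. indicator ({-1..N} \<times> {0..1::real}) p *\<^sub>R (M * \<bar>G\<bar>))"
  by (rule borel_integrable_compact) (rule continuous_on_const)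
 then show "integrable lborel (\<lambda>p. indicator ({-1..N} \<times> {0..1::real}) p * (M * \<bar>G\<bar>))" by simp
 show "AE p in lborel. norm (indicator (dom (h k)) p * (u k p * f k p)) \<le>
   indicator ({-1..N} \<times> {0..1}) p * (M * \<bar>G\<bar>)" for k
 proof (rule AE_I2)
  fix p
  show "norm (indicator (dom (h k)) p * (u k p * f k p)) \<le> indicator ({-1..N} \<times> {0..1}) p * (M * \<bar>G\<bar>)"
  proof (cases "p \<in> dom (h k)")
   case True
   have "\<bar>u k p\<bar> \<le> M" using M dom_subset True by blast
   moreover have "\<bar>f k p\<bar> \<le> \<bar>G\<bar>" using f(2)[OF True] by linarith
   ultimately have "\<bar>u k p\<bar> * \<bar>f k p\<bar> \<le> M * \<bar>G\<bar>" using M0 by (intro mult_mono) auto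
   moreover have "p \<in> {-1..N} \<times> {0..1}" using dom_subset_box[OF h0 h1] True by blast
   ultimately show ?thesis using True by (simp add: abs_mult)
  qed (use M0 in simp)
 qed
 show "AE p in lborel. (\<lambda>k. indicator (dom (h k)) p * (u k p * f k p)) \<longlonglongrightarrow> indicator (dom 0) p * (u0 p * f0 p)"
 proof (rule AE_I2)
  fix p
  show "(\<lambda>k. indicator (dom (h k)) p * (u k p * f k p)) \<longlonglongrightarrow> indicator (dom 0) p * (u0 p * f0 p)"
  proof (cases "p \<in> dom 0")
   case True
   then have *: "p \<in> dom (h k)" for k using dom0_subset_dom[OF h0] by blast
   have "(\<lambda>k. u k p * f k p) \<longlonglongrightarrow> u0 p * f0 p"
    using True dom0_subset by (intro tendsto_intros u_tendsto f0(2)) auto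
   then show ?thesis using True * by simp
  next
   \<comment> \<open>Such a point may belong to every \<open>dom (h k)\<close>, as it does for x = 0
     where \<phi> y > 0. The decay at the moving side bounds the integrand by a multiple of
     \<open>h k\<close> in all cases.\<close>
   case False
   obtain x y where xy: "p = (x, y)" by (cases p)
   define K where "K = L * M * (N + 1) * \<bar>G\<bar>"
   have L0: "0 \<le> L" using lam(2)[of 0] by linarith
   have le: "norm (indicator (dom (h k)) p * (u k p * f k p)) \<le> K * h k" for k
   proof (cases "p \<in> dom (h k)")
    case True
    have x: "x \<le> 0" using True False xy by (auto simp: dom_def)
    have y: "y \<in> {0..1}" using True xy by (auto simp: dom_def)
    have s: "0 \<le> x + h k * \<phi> y" "x + h k * \<phi> y \<le> h k"
     using True xy x mult_left_mono[OF \<phi>_bounds(2)[OF y] h0[of k]] by (auto simp: dom_def)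
    have pO: "(x, y) \<in> Om (h k)" using True dom_subset xy by blast
    have "\<bar>u k p\<bar> \<le> \<bar>lam k\<bar> * M * (N + 1) * (x + h k * \<phi> y)"
     using eigenfunction_boundary_decay(1)[OF h0 h(2) u M pO] xy by simp
    also have "... \<le> L * M * (N + 1) * h k"
     using lam(2)[of k] M0 N s L0 by (intro mult_mono) auto
    finally have "\<bar>u k p\<bar> \<le> L * M * (N + 1) * h k" .
    moreover have "\<bar>f k p\<bar> \<le> \<bar>G\<bar>" using f(2)[OF True] by linarith
    ultimately have "\<bar>u k p\<bar> * \<bar>f k p\<bar> \<le> (L * M * (N + 1) * h k) * \<bar>G\<bar>"
     by (rule mult_mono) (use L0 M0 N h0[of k] in auto)
    then show ?thesis using True by (simp add: abs_mult K_def algebra_simps)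
   next
    case False
    have "0 \<le> K * h k" unfolding K_def using L0 M0 N h0[of k] by simp
    then show ?thesis using False by simp
   qed
   have "(\<lambda>k. K * h k) \<longlonglongrightarrow> 0" using tendsto_mult[OF tendsto_const[of K] h(3)] by simp
   then have "(\<lambda>k. indicator (dom (h k)) p * (u k p * f k p)) \<longlonglongrightarrow> 0"
    by (rule Lim_null_comparison[rotated]) (intro always_eventually allI le)
   then show ?thesis using False by simp
  qed
 qed
qed

lemma u0_norm: "(\<integral>p. indicator (dom 0) p * (u0 p * u0 p) \<partial>lborel) = 1"
proof -
 have "(\<lambda>k. \<integral>p. indicator (dom (h k)) p * (u k p * u k p) \<partial>lborel) \<longlonglongrightarrow>
  (\<integral>p. indicator (dom 0) p * (u0 p * u0 p) \<partial>lborel)"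
 proof (rule limit_integral[where G = M])
  show "\<bar>u k p\<bar> \<le> M" if "p \<in> dom (h k)" for k p using M dom_subset that by blast
  show "continuous_on (dom 0) u0" using continuous_on_subset[OF continuous_u0 dom0_subset] .
  show "(\<lambda>k. u k p) \<longlonglongrightarrow> u0 p" if "p \<in> dom 0" for p using that dom0_subset by (intro u_tendsto) auto
 qed (rule continuous_u)
 moreover have "(\<integral>p. indicator (dom (h k)) p * (u k p * u k p) \<partial>lborel) = 1" for k
 proof -
  have c: "continuous_on (Om (h k)) (\<lambda>p. (u k p)^2)"
   by (intro continuous_intros eigenfunction_facts(1)[OF h0 u])
  have "set_integrable lborel (Om (h k)) (\<lambda>p. (u k p)^2)"
   unfolding set_integrable_def by (rule borel_integrable_compact[OF compact_Om[OF h0] c])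
  then have "(LINT p : Om (h k) | lborel. (u k p)^2) = 1"
   using norm1[of k] by (simp add: set_borel_integral_eq_integral(2))
  moreover have "(LINT p : Om (h k) | lborel. (u k p)^2) = (\<integral>p. indicator (dom (h k)) p * (u k p * u k p) \<partial>lborel)"
   unfolding set_lebesgue_integral_def
  proof (rule Bochner_Integration.integral_cong[OF refl])
   fix p
   show "indicator (Om (h k)) p *\<^sub>R (u k p)\<^sup>2 = indicator (dom (h k)) p * (u k p * u k p)"
    using eigenfunction_facts(4)[OF h0 u, of p k] dom_subset[of "h k"]
    by (cases "p \<in> dom (h k)"; cases "p \<in> Om (h k)") (auto simp: power2_eq_square)
  qed
  ultimately show ?thesis by simp
 qed
 ultimately show ?thesis using LIMSEQ_unique[OF _ tendsto_const] by simp
qed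

lemma continuous_trial: "0 \<le> \<eta> ==> continuous_on (dom \<eta>) (trial \<eta> m n)"
 using C2_trial[of \<eta> m n] by (simp add: C2_partials_def)

lemma len_tendsto: "(\<lambda>k. len (h k) y) \<longlonglongrightarrow> len 0 y"
 unfolding len_def by (intro tendsto_intros h(3))

lemma ang_tendsto: "(\<lambda>k. ang (h k) m p) \<longlonglongrightarrow> ang 0 m p"
 unfolding ang_def by (intro tendsto_intros len_tendsto) (use N in \<open>auto simp: len_def\<close>)

lemma trial_moments:
 "(\<lambda>k. \<integral>p. indicator (dom (h k)) p * (u k p * trial (h k) m n p) \<partial>lborel) \<longlonglongrightarrow>
  (\<integral>p. indicator (dom 0) p * (u0 p * trial 0 m n p) \<partial>lborel)"
proof (rule limit_integral[where G = 1])
 show "continuous_on (dom (h k)) (trial (h k) m n)" for k by (rule continuous_trial[OF h0])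
 show "continuous_on (dom 0) (trial 0 m n)" by (rule continuous_trial) simp
 show "\<bar>trial (h k) m n p\<bar> \<le> 1" if "p \<in> dom (h k)" for k p
  using trial_boundary_decay(1)[OF h0 h1, of "fst p" "snd p" k] that by simp
 show "(\<lambda>k. trial (h k) m n p) \<longlonglongrightarrow> trial 0 m n p" for p
  unfolding trial_def by (intro tendsto_intros ang_tendsto)
qed

lemma defect_moments:
 "(\<lambda>k. \<integral>p. indicator (dom (h k)) p * (u k p * defect (h k) m n p) \<partial>lborel) \<longlonglongrightarrow>
  (\<integral>p. indicator (dom 0) p * (u0 p * defect 0 m n p) \<partial>lborel)"
proof -
 obtain G where G: "\<And>\<eta> p. \<eta> \<in> {0..1} ==> p \<in> {-1..N} \<times> {0..1} ==> \<bar>defect \<eta> m n p\<bar> \<le> G"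
  using defect_bounded[of m n] by blast
 show ?thesis
 proof (rule limit_integral[where G = G])
  show "continuous_on (dom (h k)) (defect (h k) m n)" for k by (rule defect_continuous[OF h0])
  show "continuous_on (dom 0) (defect 0 m n)" by (rule defect_continuous) simp
  show "\<bar>defect (h k) m n p\<bar> \<le> G" if "p \<in> dom (h k)" for k p
   using that dom_subset_box[OF h0 h1, of k] h0[of k] h1[of k] by (intro G) auto
  show "(\<lambda>k. defect (h k) m n p) \<longlonglongrightarrow> defect 0 m n p" for p
   unfolding defect_def Let_def
   by (intro tendsto_intros ang_tendsto len_tendsto h(3)) (use N in \<open>auto simp: len_def\<close>)
 qed
qed

lemma identity_k:
 "(lam k - rect_eigenvalue N m n) * (\<integral>p. indicator (dom (h k)) p * (u k p * trial (h k) m n p) \<partial>lborel) =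
   - h k * (\<integral>p. indicator (dom (h k)) p * (u k p * defect (h k) m n p) \<partial>lborel)"
 using trial_identity[OF h0 h(2) u M] .

text \<open>Off resonance the factor \<open>lam k - rect_eigenvalue N m n\<close> has a nonzero
  limit, while the right side of the identity carries \<open>h k\<close>.\<close>

lemma moment_zero:
 assumes "rect_eigenvalue N m n \<noteq> lam0"
 shows "(\<integral>p. indicator (dom 0) p * (u0 p * trial 0 m n p) \<partial>lborel) = 0"
proof -
 have "(\<lambda>k. (lam k - rect_eigenvalue N m n) * (\<integral>p. indicator (dom (h k)) p * (u k p * trial (h k) m n p) \<partial>lborel))
  \<longlonglongrightarrow> (lam0 - rect_eigenvalue N m n) * (\<integral>p. indicator (dom 0) p * (u0 p * trial 0 m n p) \<partial>lborel)"
  by (intro tendsto_intros lam(1) trial_moments)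
 moreover have "(\<lambda>k. - h k * (\<integral>p. indicator (dom (h k)) p * (u k p * defect (h k) m n p) \<partial>lborel))
  \<longlonglongrightarrow> - 0 * (\<integral>p. indicator (dom 0) p * (u0 p * defect 0 m n p) \<partial>lborel)"
  by (intro tendsto_intros h(3) defect_moments)
 ultimately have "(lam0 - rect_eigenvalue N m n) * (\<integral>p. indicator (dom 0) p * (u0 p * trial 0 m n p) \<partial>lborel) =
   - 0 * (\<integral>p. indicator (dom 0) p * (u0 p * defect 0 m n p) \<partial>lborel)"
  unfolding identity_k by (rule LIMSEQ_unique)
 then show ?thesis using assms by simp
qed

lemma rate_moment:
 assumes "rect_eigenvalue N m n = lam0"
 shows "(\<lambda>k. (lam k - lam0) / h k * (\<integral>p. indicator (dom (h k)) p * (u k p * trial (h k) m n p) \<partial>lborel))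
  \<longlonglongrightarrow> - (\<integral>p. indicator (dom 0) p * (u0 p * defect 0 m n p) \<partial>lborel)"
proof -
 have "(lam k - lam0) / h k * (\<integral>p. indicator (dom (h k)) p * (u k p * trial (h k) m n p) \<partial>lborel) =
   - (\<integral>p. indicator (dom (h k)) p * (u k p * defect (h k) m n p) \<partial>lborel)" for k
  using identity_k[of k m n] h(1)[of k] assms by (simp add: field_simps)
 then show ?thesis using tendsto_minus[OF defect_moments[of m n]] by simp
qed

text \<open>Differentiability of the branch at 0 is derived here: where the limit moment is nonzero,
  the difference quotient is a convergent product divided by a factor with nonzero limit. The same
  rate \<nu> then serves for both modes, which is the eigenvector equation.\<close>

lemma rate_converges:
 assumes "rect_eigenvalue N m1 n1 = lam0" "rect_eigenvalue N m2 n2 = lam0"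
  and "(\<integral>p. indicator (dom 0) p * (u0 p * trial 0 m1 n1 p) \<partial>lborel) \<noteq> 0 \<or>
   (\<integral>p. indicator (dom 0) p * (u0 p * trial 0 m2 n2 p) \<partial>lborel) \<noteq> 0"
 obtains \<nu> where "(\<lambda>k. (lam k - lam0) / h k) \<longlonglongrightarrow> \<nu>"
  "\<nu> * (\<integral>p. indicator (dom 0) p * (u0 p * trial 0 m1 n1 p) \<partial>lborel) =
   - (\<integral>p. indicator (dom 0) p * (u0 p * defect 0 m1 n1 p) \<partial>lborel)"
  "\<nu> * (\<integral>p. indicator (dom 0) p * (u0 p * trial 0 m2 n2 p) \<partial>lborel) =
   - (\<integral>p. indicator (dom 0) p * (u0 p * defect 0 m2 n2 p) \<partial>lborel)"
proof -
 have conv: "convergent (\<lambda>k. (lam k - lam0) / h k)"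
  if "rect_eigenvalue N m n = lam0" "(\<integral>p. indicator (dom 0) p * (u0 p * trial 0 m n p) \<partial>lborel) \<noteq> 0" for m n
 proof -
  let ?J = "\<lambda>k. \<integral>p. indicator (dom (h k)) p * (u k p * trial (h k) m n p) \<partial>lborel"
  have lim: "(\<lambda>k. (lam k - lam0) / h k * ?J k / ?J k) \<longlonglongrightarrow>
   - (\<integral>p. indicator (dom 0) p * (u0 p * defect 0 m n p) \<partial>lborel) / (\<integral>p. indicator (dom 0) p * (u0 p * trial 0 m n p) \<partial>lborel)"
   by (intro tendsto_divide rate_moment trial_moments that)
  have "\<forall>\<^sub>F k in sequentially. ?J k \<noteq> 0"
   using tendsto_imp_eventually_ne[OF trial_moments that(2)] .
  then have "\<forall>\<^sub>F k in sequentially. (lam k - lam0) / h k * ?J k / ?J k = (lam k - lam0) / h k"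
   by (rule eventually_mono) simp
  from Lim_transform_eventually[OF lim this] show ?thesis unfolding convergent_def by (rule exI)
 qed
 have "convergent (\<lambda>k. (lam k - lam0) / h k)"
  using conv[OF assms(1)] conv[OF assms(2)] assms(3) by blast
 then obtain \<nu> where \<nu>: "(\<lambda>k. (lam k - lam0) / h k) \<longlonglongrightarrow> \<nu>"
  unfolding convergent_def ..
 have "\<nu> * (\<integral>p. indicator (dom 0) p * (u0 p * trial 0 m n p) \<partial>lborel) =
   - (\<integral>p. indicator (dom 0) p * (u0 p * defect 0 m n p) \<partial>lborel)"
  if "rect_eigenvalue N m n = lam0" for m n
  using LIMSEQ_unique[OF tendsto_mult[OF \<nu> trial_moments[of m n]] rate_moment[OF that]] .
 from that[OF \<nu> this[OF assms(1)] this[OF assms(2)]] show ?thesis .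
qed

end

subsection \<open>Completeness of products of sines\<close>

text \<open>The span is closed under multiplication by cosines, hence contains
 \<open>sin a * sin b * P (cos a, cos b)\<close> for all polynomials \<open>P\<close>, and Stone-Weierstrass applies.\<close>

inductive sine_span :: "real => (real \<times> real => real) => bool" for N where
 base: "sine_span N (\<lambda>p. sin (real m * (pi * (N - fst p) / N)) * sin (real n * (pi * snd p)))"
| add: "sine_span N f ==> sine_span N g ==> sine_span N (\<lambda>p. f p + g p)"
| scale: "sine_span N f ==> sine_span N (\<lambda>p. c * f p)"

lemma sin_Suc_mult_cos: "cos a * sin (real (Suc m) * a) = 1/2 * sin (real (Suc (Suc m)) * a) + 1/2 * sin (real m * a)"
 for a :: real
 using sin_add[of "real (Suc m) * a" a] sin_diff[of "real (Suc m) * a" a] by (simp add: algebra_simps)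

lemma sine_span_mult_cos:
 assumes "sine_span N f"
 shows "sine_span N (\<lambda>p. cos (pi * (N - fst p) / N) * f p) \<and> sine_span N (\<lambda>p. cos (pi * snd p) * f p)"
 using assms
proof induction
 case (base m n)
 let ?e = "\<lambda>m n p. sin (real m * (pi * (N - fst p) / N)) * sin (real n * (pi * snd p))"
 have half_left: "a * z = 1/2 * (a * x) + 1/2 * (a * y)"
  and half_right: "z * a = 1/2 * (x * a) + 1/2 * (y * a)" if "z = 1/2 * x + 1/2 * y" for a x y z :: real
  using that by (simp_all add: algebra_simps)
 have zero: "sine_span N (\<lambda>p. 0)" using sine_span.scale[OF sine_span.base[of N m n], of 0] by simp
 have 1: "sine_span N (\<lambda>p. cos (pi * (N - fst p) / N) * ?e m n p)"
 proof (cases m)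
  case (Suc m')
  have "sine_span N (\<lambda>p. 1/2 * ?e (Suc (Suc m')) n p + 1/2 * ?e m' n p)"
   by (intro sine_span.intros)
  moreover have "cos (pi * (N - fst p) / N) * ?e m n p = 1/2 * ?e (Suc (Suc m')) n p + 1/2 * ?e m' n p" for p
  proof -
   have "cos (pi * (N - fst p) / N) * ?e m n p =
     (cos (pi * (N - fst p) / N) * sin (real (Suc m') * (pi * (N - fst p) / N))) * sin (real n * (pi * snd p))"
    unfolding Suc by (rule mult.assoc[symmetric])
   then show ?thesis using half_right[OF sin_Suc_mult_cos] by (rule trans)
  qed
  ultimately show ?thesis by simp
 qed (use zero in simp)
 have 2: "sine_span N (\<lambda>p. cos (pi * snd p) * ?e m n p)"
 proof (cases n)
  case (Suc n')
  have "sine_span N (\<lambda>p. 1/2 * ?e m (Suc (Suc n')) p + 1/2 * ?e m n' p)"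
   by (intro sine_span.intros)
  moreover have "cos (pi * snd p) * ?e m n p = 1/2 * ?e m (Suc (Suc n')) p + 1/2 * ?e m n' p" for p
  proof -
   have "cos (pi * snd p) * ?e m n p = sin (real m * (pi * (N - fst p) / N)) * (cos (pi * snd p) * sin (real (Suc n') * (pi * snd p)))"
    unfolding Suc by (rule mult.left_commute)
   then show ?thesis using half_left[OF sin_Suc_mult_cos] by (rule trans)
  qed
  ultimately show ?thesis by simp
 qed (use zero in simp)
 show ?case using 1 2 by simp
next
 case (add f g)
 then have "sine_span N (\<lambda>p. cos (pi * (N - fst p) / N) * f p + cos (pi * (N - fst p) / N) * g p)"
  "sine_span N (\<lambda>p. cos (pi * snd p) * f p + cos (pi * snd p) * g p)"
  by (auto intro: sine_span.add)
 then show ?case by (simp add: distrib_left)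
next
 case (scale f c)
 then have "sine_span N (\<lambda>p. c * (cos (pi * (N - fst p) / N) * f p))" "sine_span N (\<lambda>p. c * (cos (pi * snd p) * f p))"
  by (auto intro: sine_span.scale)
 then show ?case by (simp add: mult.left_commute)
qed

text \<open>The induction over P keeps f arbitrary, since in the product case one factor is applied
  to the result of the other.\<close>

lemma sine_span_mult_polynomial:
 fixes P :: "real \<times> real => real"
 assumes "real_polynomial_function P" "sine_span N f"
 shows "sine_span N (\<lambda>p. P (cos (pi * (N - fst p) / N), cos (pi * snd p)) * f p)"
 using assms
proof (induction arbitrary: f)
 case (linear P)
 have P: "P (a, b) = P (1, 0) * a + P (0, 1) * b" for a b
 proof -
  have "P (a, b) = P (a *\<^sub>R (1, 0) + b *\<^sub>R (0, 1))" by simp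
  also have "... = a *\<^sub>R P (1, 0) + b *\<^sub>R P (0, 1)"
   using linear(1) by (simp only: linear_add linear_scale bounded_linear.linear)
  finally show ?thesis by (simp add: mult.commute)
 qed
 have "sine_span N (\<lambda>p. P (1, 0) * (cos (pi * (N - fst p) / N) * f p) + P (0, 1) * (cos (pi * snd p) * f p))"
  using sine_span_mult_cos[OF linear(2)] by (intro sine_span.intros) auto
 then show ?case by (subst P) (simp add: algebra_simps)
next
 case (const c)
 then show ?case by (auto intro: sine_span.scale)
next
 case (add P Q)
 then have "sine_span N (\<lambda>p. P (cos (pi * (N - fst p) / N), cos (pi * snd p)) * f p +
   Q (cos (pi * (N - fst p) / N), cos (pi * snd p)) * f p)" by (auto intro: sine_span.add)
 then show ?case by (simp add: distrib_right)
next
 case (mult P Q)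
 from mult.IH(1)[OF mult.IH(2)[OF mult.prems]] show ?case by (simp add: mult.assoc)
qed

text \<open>Orthogonality to the span means that f is orthogonal to P (c p) s p for every polynomial
  P, where c collects the two cosines and s is the lowest mode. Approximating f uniformly by P (c p)
  shows that f^2 s has integral 0, and s is positive inside.\<close>

lemma sine_system_complete:
 fixes f :: "real \<times> real => real"
 assumes N: "N > 0" and f: "continuous_on (cbox (0, 0) (N, 1)) f"
  and orth: "\<And>m n. integral (cbox (0, 0) (N, 1))
   (\<lambda>p. f p * (sin (real m * (pi * (N - fst p) / N)) * sin (real n * (pi * snd p)))) = 0"
  and p: "p \<in> box (0, 0) (N, 1)"
 shows "f p = 0"
proof -
 let ?R = "cbox (0, 0) (N, 1) :: (real \<times> real) set"
 define c where "c p = (cos (pi * (N - fst p) / N), cos (pi * snd p))" for p :: "real \<times> real"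
 define s where "s p = sin (pi * (N - fst p) / N) * sin (pi * snd p)" for p :: "real \<times> real"
 have cs: "continuous_on ?R c" "continuous_on ?R s"
  unfolding c_def s_def by (intro continuous_intros; use N in simp)+
 have R: "0 \<le> fst p" "fst p \<le> N" "0 \<le> snd p" "snd p \<le> 1" if "p \<in> ?R" for p
  using that by (cases p; simp)+
 have ang: "0 \<le> pi * (N - fst p) / N" "pi * (N - fst p) / N \<le> pi" "0 \<le> pi * snd p" "pi * snd p \<le> pi" if "p \<in> ?R" for p
  using R[OF that] N by (auto simp: field_simps)
 have s0: "0 \<le> s p" "s p \<le> 1" if "p \<in> ?R" for p
 proof -
  have "0 \<le> sin (pi * (N - fst p) / N)" "0 \<le> sin (pi * snd p)" using ang[OF that] by (auto intro: sin_ge_zero)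
  then show "0 \<le> s p" "s p \<le> 1" unfolding s_def by (auto intro: mult_le_one)
 qed
 have span: "continuous_on ?R g \<and> integral ?R (\<lambda>p. f p * g p) = 0" if "sine_span N g" for g
  using that
 proof induction
  case (base m n)
  show ?case using orth N by (auto intro!: continuous_intros)
 next
  case (add g1 g2)
  then have "(\<lambda>p. f p * g1 p) integrable_on ?R" "(\<lambda>p. f p * g2 p) integrable_on ?R"
   by (auto intro!: integrable_continuous continuous_intros f)
  then have "integral ?R (\<lambda>p. f p * g1 p + f p * g2 p) = 0" using add by (simp add: Henstock_Kurzweil_Integration.integral_add)
  then show ?case using add by (auto intro!: continuous_intros simp: distrib_left)
 next
  case (scale g a)
  then have "integral ?R (\<lambda>p. a * (f p * g p)) = 0" by simp
  then show ?case using scale by (auto intro!: continuous_intros simp: mult.left_commute)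
 qed
 have ss: "sine_span N s" using sine_span.base[of N 1 1] by (simp add: s_def[abs_def])
 have poly: "integral ?R (\<lambda>p. f p * (P (c p) * s p)) = 0" "continuous_on ?R (\<lambda>p. P (c p) * s p)"
  if "real_polynomial_function P" for P
  using span[OF sine_span_mult_polynomial[OF that ss]] by (simp_all add: c_def)
 \<comment> \<open>This is f in the coordinates given by the two cosines. They map the closed
   rectangle injectively onto the square, where polynomials approximate uniformly.\<close>
 define F where "F q = f (N - N / pi * arccos (fst q), arccos (snd q) / pi)" for q :: "real \<times> real"
 let ?S = "{-1..1} \<times> {-1..1} :: (real \<times> real) set"
 have cF: "continuous_on ?S F"
  unfolding F_def
 proof (rule continuous_on_compose2[OF f])
  show "continuous_on ?S (\<lambda>q. (N - N / pi * arccos (fst q), arccos (snd q) / pi))"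
   by (intro continuous_intros) auto
  show "(\<lambda>q. (N - N / pi * arccos (fst q), arccos (snd q) / pi)) ` ?S \<subseteq> ?R"
  proof
   fix z assume "z \<in> (\<lambda>q. (N - N / pi * arccos (fst q), arccos (snd q) / pi)) ` ?S"
   then obtain q where q: "q \<in> ?S" "z = (N - N / pi * arccos (fst q), arccos (snd q) / pi)" by auto
   have b: "0 \<le> arccos (fst q)" "arccos (fst q) \<le> pi" "0 \<le> arccos (snd q)" "arccos (snd q) \<le> pi"
    using q(1) by (auto intro!: arccos_lbound arccos_ubound)
   then have "0 \<le> N / pi * arccos (fst q)" "N / pi * arccos (fst q) \<le> N" using N by (auto simp: field_simps)
   then show "z \<in> ?R" using q(2) b by (simp add: field_simps)
  qed
 qed
 have Fc: "F (c p) = f p" if "p \<in> ?R" for p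
  using ang[OF that] N by (simp add: F_def c_def arccos_cos)
 have cS: "c p \<in> ?S" for p by (simp add: c_def)
 define I where "I = integral ?R (\<lambda>p. f p * (f p * s p))"
 have intI: "(\<lambda>p. f p * (f p * s p)) integrable_on ?R"
  by (intro integrable_continuous continuous_intros f cs)
 obtain B where B: "\<And>p. p \<in> ?R ==> \<bar>f p\<bar> \<le> B"
  using compact_imp_bounded[OF compact_continuous_image[OF f compact_cbox]] unfolding bounded_iff by fastforce
 have B0: "B \<ge> 0" using B[of "(0, 0)"] N by force
 have "\<bar>I\<bar> \<le> 0"
 proof (rule field_le_epsilon)
  fix e :: real assume e: "e > 0"
  \<comment> \<open>B N is the bound of |f| times the area of the rectangle; the summand 1 avoids a
    division by 0 when B = 0.\<close>
  define d where "d = e / (B * N + 1)"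
  have BN: "B * N + 1 > 0" using B0 N by (simp add: add_nonneg_pos)
  have d: "d > 0" using e BN by (simp add: d_def)
  obtain P where P: "real_polynomial_function P" "\<And>q. q \<in> ?S ==> \<bar>F q - P q\<bar> < d"
   using Stone_Weierstrass_real_polynomial_function[of ?S F d] cF d compact_Times by blast
  note pP = poly[OF P(1)]
  have i2: "(\<lambda>p. f p * (P (c p) * s p)) integrable_on ?R"
   by (intro integrable_continuous continuous_intros f pP)
  have "I = integral ?R (\<lambda>p. f p * (f p * s p) - f p * (P (c p) * s p))"
   using pP intI i2 by (simp add: I_def Henstock_Kurzweil_Integration.integral_diff)
  also have "norm ... \<le> (B * d) * measure lborel ?R"
  proof (rule integrable_bound[OF _ integrable_diff[OF intI i2]])
   show "0 \<le> B * d" using B0 d by simp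
   fix p assume p: "p \<in> ?R"
   have "\<bar>f p - P (c p)\<bar> \<le> d" using P(2)[OF cS, of p] Fc[OF p] by simp
   then have "\<bar>f p\<bar> * (\<bar>f p - P (c p)\<bar> * \<bar>s p\<bar>) \<le> B * (d * 1)"
    using B[OF p] s0[OF p] B0 d by (intro mult_mono) auto
   moreover have "f p * (f p * s p) - f p * (P (c p) * s p) = f p * ((f p - P (c p)) * s p)" by (simp add: algebra_simps)
   ultimately show "norm (f p * (f p * s p) - f p * (P (c p) * s p)) \<le> B * d" by (simp add: abs_mult)
  qed
  finally have "\<bar>I\<bar> \<le> B * d * N" using N by (simp add: content_Pair)
  also have "... = d * (B * N)" by simp
  also have "... \<le> d * (B * N + 1)" using d by simp
  also have "... = e" using BN by (simp add: d_def)
  finally show "\<bar>I\<bar> \<le> 0 + e" by simp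
 qed
 then have I0: "((\<lambda>p. f p * (f p * s p)) has_integral 0) ?R"
  using integrable_integral[OF intI] by (simp add: I_def)
 have pR: "p \<in> ?R" using p box_subset_cbox by blast
 have "f p * (f p * s p) = 0"
 proof (rule has_integral_0_cbox_imp_0[OF _ _ I0, where x = p])
  show "continuous_on ?R (\<lambda>p. f p * (f p * s p))" by (intro continuous_intros f cs)
  show "0 \<le> f q * (f q * s q)" if "q \<in> box (0, 0) (N, 1)" for q
   using s0(1)[OF subsetD[OF box_subset_cbox that]] by (simp add: mult.assoc[symmetric])
  show "box (0, 0) (N, 1) \<noteq> ({} :: (real \<times> real) set)" using p by auto
 qed (rule pR)
 moreover have "s p > 0"
 proof -
  obtain x y where xy: "p = (x, y)" by (cases p)
  have "0 < x" "x < N" "0 < y" "y < 1" using p xy by (auto simp: mem_box Basis_prod_def)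
  then have "0 < pi * (N - x) / N" "pi * (N - x) / N < pi" "0 < pi * y" "pi * y < pi" using N by (auto simp: field_simps)
  then show ?thesis unfolding s_def xy by (auto intro!: mult_pos_pos sin_gt_zero)
 qed
 ultimately show ?thesis by simp
qed

subsection \<open>The resonant modes\<close>

lemma has_integral_FTC:
 fixes F f :: "real => real"
 assumes "\<And>s. (F has_real_derivative f s) (at s)" and "a \<le> b" "F b - F a = I"
 shows "(f has_integral I) {a..b}"
 using fundamental_theorem_of_calculus[of a b F f] assms
 by (auto simp: has_real_derivative_iff_has_vector_derivative[symmetric] intro: has_field_derivative_at_within)

lemma has_integral_sin_sin:
 assumes "m \<ge> 1" "n \<ge> 1"
 shows "((\<lambda>s. sin (real m * (pi * s)) * sin (real n * (pi * s))) has_integral (if m = n then 1/2 else 0)) {0..1}"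
proof (cases "m = n")
 case True
 have "((\<lambda>s. sin (real m * (pi * s)) * sin (real m * (pi * s))) has_integral 1/2) {0..1}"
 proof (rule has_integral_FTC[where F = "\<lambda>s. s / 2 - sin (real m * (pi * s)) * cos (real m * (pi * s)) / (2 * real m * pi)"])
  fix s
  have "((\<lambda>s. s / 2 - sin (real m * (pi * s)) * cos (real m * (pi * s)) / (2 * real m * pi)) has_real_derivative
    1 / 2 - (cos (real m * (pi * s)) * cos (real m * (pi * s)) - sin (real m * (pi * s)) * sin (real m * (pi * s))) / 2) (at s)"
   using assms(1) by (auto intro!: derivative_eq_intros simp: field_simps)
  moreover have "1 / 2 - (cos (real m * (pi * s)) * cos (real m * (pi * s)) - sin (real m * (pi * s)) * sin (real m * (pi * s))) / 2 =
   sin (real m * (pi * s)) * sin (real m * (pi * s))"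
  proof -
   have half: "1 / 2 - (q - r) / 2 = r" if "r + q = 1" for q r :: real using that by (simp add: field_simps)
   show ?thesis by (rule half) (use sin_cos_squared_add[of "real m * (pi * s)"] in \<open>simp add: power2_eq_square\<close>)
  qed
  ultimately show "((\<lambda>s. s / 2 - sin (real m * (pi * s)) * cos (real m * (pi * s)) / (2 * real m * pi)) has_real_derivative
   sin (real m * (pi * s)) * sin (real m * (pi * s))) (at s)" by simp
 qed (simp_all add: sin_npi)
 then show ?thesis using True by simp
next
 case False
 define a b where "a = (real m - real n) * pi" and "b = (real m + real n) * pi"
 have ab: "a \<noteq> 0" "b \<noteq> 0" using False assms by (auto simp: a_def b_def)
 have "((\<lambda>s. sin (real m * (pi * s)) * sin (real n * (pi * s))) has_integral 0) {0..1}"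
 proof (rule has_integral_FTC[where F = "\<lambda>s. sin (a * s) / (2 * a) - sin (b * s) / (2 * b)"])
  fix s
  have "((\<lambda>s. sin (a * s) / (2 * a) - sin (b * s) / (2 * b)) has_real_derivative (cos (a * s) - cos (b * s)) / 2) (at s)"
   using ab by (auto intro!: derivative_eq_intros simp: field_simps)
  moreover have "(cos (a * s) - cos (b * s)) / 2 = sin (real m * (pi * s)) * sin (real n * (pi * s))"
   using cos_add[of "real m * (pi * s)" "real n * (pi * s)"] cos_diff[of "real m * (pi * s)" "real n * (pi * s)"]
   by (simp add: a_def b_def algebra_simps)
  ultimately show "((\<lambda>s. sin (a * s) / (2 * a) - sin (b * s) / (2 * b)) has_real_derivative
   sin (real m * (pi * s)) * sin (real n * (pi * s))) (at s)" by simp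
 next
  have "sin a = 0" "sin b = 0" by (auto simp: a_def b_def sin_diff sin_add sin_npi left_diff_distrib distrib_right)
  then show "sin (a * 1) / (2 * a) - sin (b * 1) / (2 * b) - (sin (a * 0) / (2 * a) - sin (b * 0) / (2 * b)) = 0" by simp
 qed simp
 then show ?thesis using False by simp
qed

text \<open>The x-integral that couples two different modes: the amplitude m pi s comes from
  differentiating the stretched angle in y. Product formulas reduce it to s sin (r s) with r = (n +
  m) pi and r = (n - m) pi, and both frequencies have cosine (-1)^(m + n) at s = 1.\<close>

lemma has_integral_arg_cos_sin:
 assumes "m \<ge> 1" "n \<ge> 1" "m \<noteq> n"
 shows "((\<lambda>s. (real m * (pi * s)) * cos (real m * (pi * s)) * sin (real n * (pi * s))) has_integral
  - (real m * real n * (-1) ^ (m + n) / ((real n)^2 - (real m)^2))) {0..1}"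
proof -
 define a b where "a = (real n + real m) * pi" and "b = (real n - real m) * pi"
 have ab: "a \<noteq> 0" "b \<noteq> 0" using assms by (auto simp: a_def b_def)
 define F where "F s = real m * pi / 2 * ((sin (a * s) / a^2 - s * cos (a * s) / a) + (sin (b * s) / b^2 - s * cos (b * s) / b))" for s
 have s: "sin a = 0" "sin b = 0" by (auto simp: a_def b_def sin_diff sin_add sin_npi left_diff_distrib distrib_right)
 have c: "cos a = (-1) ^ (m + n)" "cos b = (-1) ^ (m + n)"
  by (auto simp: a_def b_def cos_diff cos_add sin_npi cos_npi left_diff_distrib distrib_right power_add)
 show ?thesis
 proof (rule has_integral_FTC[where F = F])
  fix s
  have d: "((\<lambda>s. sin (r * s) / r^2 - s * cos (r * s) / r) has_real_derivative s * sin (r * s)) (at s)" if "r \<noteq> 0" for r :: real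
   using that by (auto intro!: derivative_eq_intros simp: field_simps power2_eq_square)
  have dF: "(F has_real_derivative real m * pi / 2 * (s * sin (a * s) + s * sin (b * s))) (at s)"
   unfolding F_def by (intro DERIV_cmult DERIV_add d ab)
  have "sin (a * s) + sin (b * s) = 2 * cos (real m * (pi * s)) * sin (real n * (pi * s))"
   using sin_add[of "real n * (pi * s)" "real m * (pi * s)"] sin_diff[of "real n * (pi * s)" "real m * (pi * s)"]
   by (simp add: a_def b_def algebra_simps)
  then have "real m * pi / 2 * (s * sin (a * s) + s * sin (b * s)) =
    (real m * (pi * s)) * cos (real m * (pi * s)) * sin (real n * (pi * s))"
   by (simp add: distrib_left[symmetric])
  with dF show "(F has_real_derivative (real m * (pi * s)) * cos (real m * (pi * s)) * sin (real n * (pi * s))) (at s)"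
   by (simp only:)
 next
  have ne: "real n + real m \<noteq> 0" "real n - real m \<noteq> 0" using assms by auto
  have sq: "(real n)^2 - (real m)^2 = (real n + real m) * (real n - real m)" by (simp add: power2_eq_square algebra_simps)
  have "F 1 - F 0 = - (real m * pi / 2 * (-1) ^ (m + n) * (1 / a + 1 / b))"
   by (simp add: F_def s c algebra_simps)
  also have "1 / a + 1 / b = 2 * real n / (pi * ((real n)^2 - (real m)^2))"
  proof -
   have "1 / (u * pi) + 1 / (w * pi) = (u + w) / (pi * (u * w))" if "u \<noteq> 0" "w \<noteq> 0" for u w :: real
    using that by (simp add: field_simps)
   from this[OF ne] show ?thesis unfolding sq a_def b_def by simp
  qed
  finally show "F 1 - F 0 = - (real m * real n * (-1) ^ (m + n) / ((real n)^2 - (real m)^2))"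
   by simp
 qed simp
qed

text \<open>The modes measure x from the right side, hence the substitution s = (N - x) / N.\<close>

lemma has_integral_reflect_scale:
 fixes F :: "real => real"
 assumes N: "N > 0" and F: "(F has_integral I) {0..1}"
 shows "((\<lambda>x. F ((N - x) / N)) has_integral N * I) {0..N}"
proof -
 have "((\<lambda>x. F ((-1/N) *\<^sub>R x + 1)) has_integral (1 / \<bar>-1/N\<bar> ^ DIM(real)) *\<^sub>R I)
   ((\<lambda>x. (1 / (-1/N)) *\<^sub>R x + -((1 / (-1/N)) *\<^sub>R 1)) ` cbox 0 1)"
  by (rule has_integral_affinity) (use F N in auto)
 moreover have "(\<lambda>x. (1 / (-1/N)) *\<^sub>R x + -((1 / (-1/N)) *\<^sub>R 1)) ` cbox 0 1 = {0..N}"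
 proof -
  have "(\<lambda>x. (1 / (-1/N)) *\<^sub>R x + -((1 / (-1/N)) *\<^sub>R 1)) = (\<lambda>x. (-N) * x + N)" by (simp add: fun_eq_iff)
  moreover have "y \<in> (\<lambda>x. (-N) * x + N) ` {0..1}" if "y \<in> {0..N}" for y
   by (rule image_eqI[where x = "(N - y) / N"]) (use that N in \<open>auto simp: field_simps\<close>)
  moreover have "(-N) * x + N \<in> {0..N}" if "x \<in> {0..1}" for x
   using that N by (simp add: mult_left_le)
  ultimately show ?thesis by auto
 qed
 moreover have "(-1/N) *\<^sub>R x + 1 = (N - x) / N" for x using N by (simp add: field_simps)
 ultimately show ?thesis using N by simp
qed

context profile begin

text \<open>Matrix entries of the multiplication by \<phi> between vertical modes.
  \<open>Phi 2 1\<close> is \<open>Lam \<phi>\<close>, the entry that couples the two resonant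
  modes.\<close>

definition Phi :: "nat => nat => real" where
 "Phi n n' = integral {0..1} (\<lambda>y. \<phi> y * sin (real n * (pi * y)) * sin (real n' * (pi * y)))"

lemma has_integral_Phi: "((\<lambda>y. \<phi> y * sin (real n * (pi * y)) * sin (real n' * (pi * y))) has_integral Phi n n') {0..1}"
 unfolding Phi_def
 by (intro integrable_integral integrable_continuous_real continuous_intros continuous_\<phi>)

lemma Phi_commute: "Phi n n' = Phi n' n"
 unfolding Phi_def by (simp add: mult.assoc mult.commute[of "sin (real n * (pi * _))"])

text \<open>Integration by parts: the bracket \<open>((\<phi> s\<^sub>n)' s\<^sub>n\<^sub>' - \<phi> s\<^sub>n s\<^sub>n\<^sub>')\<close>
 has zero boundary values.\<close>

lemma has_integral_second_order:
 "((\<lambda>y. (\<phi>2 y * sin (real n * (pi * y)) + 2 * real n * pi * \<phi>1 y * cos (real n * (pi * y))) * sin (real n' * (pi * y)))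
  has_integral ((real n)^2 - (real n')^2) * pi^2 * Phi n n') {0..1}"
proof -
 let ?s = "\<lambda>n y. sin (real n * (pi * y))" and ?c = "\<lambda>n y. cos (real n * (pi * y))"
 let ?F = "\<lambda>y. (\<phi>1 y * ?s n y + \<phi> y * (real n * pi * ?c n y)) * ?s n' y - \<phi> y * ?s n y * (real n' * pi * ?c n' y)"
 let ?f = "\<lambda>y. (\<phi>2 y * ?s n y + 2 * real n * pi * \<phi>1 y * ?c n y) * ?s n' y"
 let ?g = "\<lambda>y. \<phi> y * ?s n y * ?s n' y"
 have ds: "((\<lambda>y. ?s m y) has_real_derivative real m * pi * ?c m y) (at y within S)"
  "((\<lambda>y. ?c m y) has_real_derivative - (real m * pi * ?s m y)) (at y within S)" for m y S
  by (auto intro!: derivative_eq_intros)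
 have "((\<lambda>y. ?f y - ((real n)^2 - (real n')^2) * pi^2 * ?g y) has_integral ?F 1 - ?F 0) {0..1}"
 proof (rule fundamental_theorem_of_calculus)
  fix y :: real assume y: "y \<in> {0..1}"
  have "(?F has_real_derivative ?f y - ((real n)^2 - (real n')^2) * pi^2 * ?g y) (at y within {0..1})"
   by (rule derivative_eq_intros \<phi>[OF y] \<phi>1[OF y] ds refl)+ (simp add: algebra_simps power2_eq_square)
  then show "(?F has_vector_derivative ?f y - ((real n)^2 - (real n')^2) * pi^2 * ?g y) (at y within {0..1})"
   by (simp add: has_real_derivative_iff_has_vector_derivative)
 qed simp
 moreover have "?F 1 - ?F 0 = 0" by (simp add: \<phi>_ends sin_npi)
 ultimately have "((\<lambda>y. ?f y - ((real n)^2 - (real n')^2) * pi^2 * ?g y) has_integral 0) {0..1}" by simp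
 from has_integral_add[OF this has_integral_mult_right[OF has_integral_Phi[of n n'], of "((real n)^2 - (real n')^2) * pi^2"]]
 show ?thesis by simp
qed

lemma mode_eq: "trial 0 m n p = sin (real m * (pi * ((N - fst p) / N))) * sin (real n * (pi * snd p))"
 by (simp add: trial_def ang_def len_def mult.assoc)

lemma dom0_eq: "dom 0 = box (0, 0) (N, 1)"
 by (auto simp: dom_def mem_box Basis_prod_def)

lemma rect_eq: "rect N = cbox (0, 0) (N, 1)"
 unfolding rect_def by (auto simp: mem_box Basis_prod_def)

lemma mode_boundary: "p \<in> rect N - dom 0 ==> trial 0 m n p = 0"
proof -
 assume p: "p \<in> rect N - dom 0"
 then have "fst p = 0 \<or> fst p = N \<or> snd p = 0 \<or> snd p = 1" by (auto simp: rect_def dom_def)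
 then show ?thesis using N by (auto simp: mode_eq sin_npi)
qed

lemma dom0_integral:
 fixes g :: "real \<times> real => real"
 assumes g: "continuous_on (rect N) g" "\<And>p. p \<in> rect N - dom 0 ==> g p = 0"
 shows "(\<integral>p. indicator (dom 0) p * g p \<partial>lborel) = integral {0..N} (\<lambda>x. integral {0..1} (\<lambda>y. g (x, y)))"
  and "(\<integral>p. indicator (dom 0) p * g p \<partial>lborel) = integral (cbox (0, 0) (N, 1)) g"
proof -
 define G where "G p = indicator (cbox (0, 0) (N, 1)) p * g p" for p
 have sub: "dom 0 \<subseteq> rect N" by (auto simp: dom_def rect_def)
 have G: "indicator (dom 0) p * g p = G p" for p
  using g(2)[of p] sub by (auto simp: G_def rect_eq indicator_def)
 have cG: "continuous_on (cbox (0, 0) (N, 1)) G"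
  by (rule continuous_on_eq[OF g(1)[unfolded rect_eq]]) (simp add: G_def)
 have G0: "p \<notin> cbox (0, 0) (N, 1) ==> G p = 0" for p by (simp add: G_def)
 have "(\<integral>p. indicator (dom 0) p * g p \<partial>lborel) = integral {0..N} (\<lambda>x. integral {0..1} (\<lambda>y. G (x, y)))"
  unfolding G using integral_eq_iterated(2)[OF cG G0] by simp
 also have "... = integral {0..N} (\<lambda>x. integral {0..1} (\<lambda>y. g (x, y)))"
  by (intro Henstock_Kurzweil_Integration.integral_cong) (auto simp: G_def)
 finally show 1: "(\<integral>p. indicator (dom 0) p * g p \<partial>lborel) = integral {0..N} (\<lambda>x. integral {0..1} (\<lambda>y. g (x, y)))" .
 then show "(\<integral>p. indicator (dom 0) p * g p \<partial>lborel) = integral (cbox (0, 0) (N, 1)) g"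
  using integral_prod_continuous[OF g(1)[unfolded rect_eq]] by simp
qed

lemma continuous_mode: "continuous_on S (trial 0 m n)"
 unfolding mode_eq[abs_def] using N by (intro continuous_intros) auto

lemma integral_mode_mode:
 assumes "m \<ge> 1" "n \<ge> 1" "m' \<ge> 1" "n' \<ge> 1"
 shows "(\<integral>p. indicator (dom 0) p * (trial 0 m' n' p * trial 0 m n p) \<partial>lborel) =
  (if m = m' \<and> n = n' then N / 4 else 0)"
proof -
 have i1: "((\<lambda>x. sin (real m' * (pi * ((N - x) / N))) * sin (real m * (pi * ((N - x) / N)))) has_integral
   N * (if m' = m then 1/2 else 0)) {0..N}"
  using has_integral_reflect_scale[OF N has_integral_sin_sin[OF assms(3,1)]] .
 note i2 = has_integral_sin_sin[OF assms(4,2)]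
 have "(\<integral>p. indicator (dom 0) p * (trial 0 m' n' p * trial 0 m n p) \<partial>lborel) =
  integral {0..N} (\<lambda>x. integral {0..1} (\<lambda>y. trial 0 m' n' (x, y) * trial 0 m n (x, y)))"
  by (intro dom0_integral continuous_intros continuous_mode) (simp add: mode_boundary)
 also have "... = integral {0..N} (\<lambda>x. (sin (real m' * (pi * ((N - x) / N))) * sin (real m * (pi * ((N - x) / N)))) * (if n' = n then 1/2 else 0))"
 proof (rule Henstock_Kurzweil_Integration.integral_cong)
  fix x
  have "((\<lambda>y. (sin (real m' * (pi * ((N - x) / N))) * sin (real m * (pi * ((N - x) / N)))) *
    (sin (real n' * (pi * y)) * sin (real n * (pi * y)))) has_integral
    (sin (real m' * (pi * ((N - x) / N))) * sin (real m * (pi * ((N - x) / N)))) * (if n' = n then 1/2 else 0)) {0..1}"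
   by (rule has_integral_mult_right[OF i2])
  then show "integral {0..1} (\<lambda>y. trial 0 m' n' (x, y) * trial 0 m n (x, y)) =
   (sin (real m' * (pi * ((N - x) / N))) * sin (real m * (pi * ((N - x) / N)))) * (if n' = n then 1/2 else 0)"
   by (intro integral_unique) (simp add: mode_eq algebra_simps)
 qed
 also have "... = (N * (if m' = m then 1/2 else 0)) * (if n' = n then 1/2 else 0)"
  by (rule integral_unique[OF has_integral_mult_left[OF i1]])
 finally show ?thesis by auto
qed

text \<open>At \<eta> = 0 the defect is a sum of two products of a function of x with a function of
  y, so its moments reduce to one-dimensional integrals.\<close>

lemma defect0_eq:
 "defect 0 m n (x, y) = 2 * (real m * pi)^2 / N ^ 3 * sin (real m * (pi * ((N - x) / N))) * (\<phi> y * sin (real n * (pi * y)))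
  - 1 / N * ((real m * (pi * ((N - x) / N))) * cos (real m * (pi * ((N - x) / N)))) *
   (\<phi>2 y * sin (real n * (pi * y)) + 2 * real n * pi * \<phi>1 y * cos (real n * (pi * y)))"
proof -
 have a: "ang 0 m (x, y) = real m * (pi * ((N - x) / N))" by (simp add: ang_def len_def)
 show ?thesis unfolding defect_def Let_def snd_conv a
  using N by (simp add: len_def field_simps power2_eq_square power3_eq_cube)
qed

lemma continuous_defect0: "continuous_on (rect N) (defect 0 m n)"
proof -
 have sub: "snd ` rect N \<subseteq> {0..1}" by (auto simp: rect_def)
 note cs = continuous_on_snd_compose[OF continuous_\<phi>(1) sub] continuous_on_snd_compose[OF continuous_\<phi>(2) sub]
  continuous_on_snd_compose[OF \<phi>2 sub]
 have "defect 0 m n = (\<lambda>p. 2 * (real m * pi)^2 / N ^ 3 * sin (real m * (pi * ((N - fst p) / N))) * (\<phi> (snd p) * sin (real n * (pi * snd p)))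
  - 1 / N * ((real m * (pi * ((N - fst p) / N))) * cos (real m * (pi * ((N - fst p) / N)))) *
   (\<phi>2 (snd p) * sin (real n * (pi * snd p)) + 2 * real n * pi * \<phi>1 (snd p) * cos (real n * (pi * snd p))))"
 proof
  fix p :: "real \<times> real"
  show "defect 0 m n p = 2 * (real m * pi)^2 / N ^ 3 * sin (real m * (pi * ((N - fst p) / N))) * (\<phi> (snd p) * sin (real n * (pi * snd p)))
  - 1 / N * ((real m * (pi * ((N - fst p) / N))) * cos (real m * (pi * ((N - fst p) / N)))) *
   (\<phi>2 (snd p) * sin (real n * (pi * snd p)) + 2 * real n * pi * \<phi>1 (snd p) * cos (real n * (pi * snd p)))"
   using defect0_eq[of m n "fst p" "snd p"] by simp
 qed
 then show ?thesis using N by (simp only:) (intro continuous_intros cs; simp)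
qed

text \<open>\<open>Y\<close> stays a parameter because of its two uses: on the diagonal n = n', so
  its coefficient is 0 and any value will do; off the diagonal the first term is 0 and
  \<open>has_integral_arg_cos_sin\<close> supplies the value.\<close>

lemma integral_mode_defect:
 assumes "m \<ge> 1" "n \<ge> 1" "m' \<ge> 1" "n' \<ge> 1"
  and Y: "((\<lambda>s. (real m * (pi * s)) * cos (real m * (pi * s)) * sin (real m' * (pi * s))) has_integral Y) {0..1}"
 shows "(\<integral>p. indicator (dom 0) p * (trial 0 m' n' p * defect 0 m n p) \<partial>lborel) =
  2 * (real m * pi)^2 / N ^ 3 * (N * (if m = m' then 1/2 else 0)) * Phi n n'
  - Y * (((real n)^2 - (real n')^2) * pi^2 * Phi n n')"
proof -
 let ?X1 = "\<lambda>x. sin (real m * (pi * ((N - x) / N))) * sin (real m' * (pi * ((N - x) / N)))"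
 let ?X2 = "\<lambda>x. (real m * (pi * ((N - x) / N))) * cos (real m * (pi * ((N - x) / N))) * sin (real m' * (pi * ((N - x) / N)))"
 define P where "P = Phi n n'"
 define Q where "Q = ((real n)^2 - (real n')^2) * pi^2 * Phi n n'"
 define K where "K = 2 * (real m * pi)^2 / N ^ 3"
 have i1: "(?X1 has_integral N * (if m = m' then 1/2 else 0)) {0..N}"
  using has_integral_reflect_scale[OF N has_integral_sin_sin[OF assms(1,3)]] .
 have i2: "(?X2 has_integral N * Y) {0..N}"
  using has_integral_reflect_scale[OF N Y] .
 note j1 = has_integral_Phi[of n n', folded P_def] and j2 = has_integral_second_order[of n n', folded Q_def]
 have "(\<integral>p. indicator (dom 0) p * (trial 0 m' n' p * defect 0 m n p) \<partial>lborel) =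
  integral {0..N} (\<lambda>x. integral {0..1} (\<lambda>y. trial 0 m' n' (x, y) * defect 0 m n (x, y)))"
  by (intro dom0_integral continuous_intros continuous_mode continuous_defect0) (simp add: mode_boundary)
 also have "... = integral {0..N} (\<lambda>x. (K * P) * ?X1 x - (1 / N * Q) * ?X2 x)"
 proof (rule Henstock_Kurzweil_Integration.integral_cong)
  fix x
  from has_integral_diff[OF has_integral_mult_right[OF j1, of "K * ?X1 x"] has_integral_mult_right[OF j2, of "1 / N * ?X2 x"]]
  have "((\<lambda>y. trial 0 m' n' (x, y) * defect 0 m n (x, y)) has_integral (K * ?X1 x) * P - (1 / N * ?X2 x) * Q) {0..1}"
   unfolding mode_eq defect0_eq K_def[symmetric] fst_conv snd_conv by (simp only: algebra_simps)
  then show "integral {0..1} (\<lambda>y. trial 0 m' n' (x, y) * defect 0 m n (x, y)) = (K * P) * ?X1 x - (1 / N * Q) * ?X2 x"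
   by (intro integral_unique) (simp only: algebra_simps)
 qed
 also have "... = (K * P) * (N * (if m = m' then 1/2 else 0)) - (1 / N * Q) * (N * Y)"
  by (rule integral_unique[OF has_integral_diff[OF has_integral_mult_right[OF i1] has_integral_mult_right[OF i2]]])
 finally show ?thesis using N by (simp add: K_def P_def Q_def)
qed

end

section \<open>Coefficients of the limits in the resonant pair\<close>

text \<open>Equality of the eigenvalues reads m^2 = 4 + (4 - n^2) N^2. As k \<ge> 3 forces N^2 \<ge>
  5/3, the right side is negative from n = 3 on.\<close>

lemma resonant_pair_unique:
 assumes N: "N > 0" and k: "k \<ge> 3" "(real k)^2 = 3 * N^2 + 4"
  and mn: "m \<ge> 1" "n \<ge> 1" "rect_eigenvalue N m n = rect_eigenvalue N 2 2"
 shows "(m = 2 \<and> n = 2) \<or> (m = k \<and> n = 1)"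
proof -
 have "(real m)^2 / N^2 + (real n)^2 = 4 / N^2 + 4"
  using mn(3) by (simp add: rect_eigenvalue_def)
 then have e: "(real m)^2 = 4 + (4 - (real n)^2) * N^2" using N by (simp add: field_simps)
 have "(3::real)^2 \<le> (real k)^2" using k(1) by (intro power_mono) auto
 then have N2: "N^2 \<ge> 5/3" using k(2) by simp
 consider "n = 1" | "n = 2" | "n \<ge> 3" using mn(2) by linarith
 then show ?thesis
 proof cases
  case 1
  then have "(real m)^2 = (real k)^2" using e k(2) by simp
  then have "real m = real k" by (rule power2_eq_imp_eq) simp_all
  then show ?thesis using 1 by simp
 next
  case 2
  then have "(real m)^2 = 2^2" using e by simp
  then have "real m = 2" by (rule power2_eq_imp_eq) simp_all
  then show ?thesis using 2 by simp
 next
  case 3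
  then have "(3::real)^2 \<le> (real n)^2" by (intro power_mono) auto
  then have "(4 - (real n)^2) * N^2 \<le> (- 5) * N^2" by (intro mult_right_mono) auto
  then have "(real m)^2 < 0" using e N2 by linarith
  then show ?thesis by (simp add: not_less[symmetric])
 qed
qed

lemma rect_eigenvalue_resonance:
 assumes "N > 0" "(real k)^2 = 3 * N^2 + 4"
 shows "rect_eigenvalue N k 1 = rect_eigenvalue N 2 2"
 using assms by (simp add: rect_eigenvalue_def field_simps)

text \<open>Subtracting the projection to the two resonant modes leaves a function orthogonal to all
  products of sines, so completeness applies. N / 4 is the squared norm of a mode. The last two
  equations make (a, b) an eigenvector of a symmetric matrix.\<close>

lemma (in eigen_seq) limit_in_span:
 assumes k: "k \<ge> 3" "(real k)^2 = 3 * N^2 + 4" and l0: "lam0 = rect_eigenvalue N 2 2"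
 obtains a b \<nu> where "\<And>p. p \<in> dom 0 ==> u0 p = a * trial 0 2 2 p + b * trial 0 k 1 p"
  "N / 4 * (a^2 + b^2) = 1" "(\<lambda>j. (lam j - lam0) / h j) \<longlonglongrightarrow> \<nu>"
  "\<nu> * (N / 4 * a) = - (pi^2 / N^2 * (4 * Phi 2 2 * a + 2 * real k * (-1) ^ k * Phi 2 1 * b))"
  "\<nu> * (N / 4 * b) = - (pi^2 / N^2 * (2 * real k * (-1) ^ k * Phi 2 1 * a + (real k)^2 * Phi 1 1 * b))"
proof -
 define J where "J f g = (\<integral>p. indicator (dom 0) p * (f p * g p) \<partial>lborel)" for f g :: "real \<times> real => real"
 have sub: "dom 0 \<subseteq> rect N" by (auto simp: dom_def rect_def)
 have int: "integrable lborel (\<lambda>p. indicator (dom 0) p * (f p * g p))"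
  if "continuous_on (rect N) f" "continuous_on (rect N) g" for f g :: "real \<times> real => real"
 proof -
  have c: "continuous_on (rect N) (\<lambda>p. f p * g p)" by (intro continuous_intros that)
  have "compact (rect N)" unfolding rect_eq by simp
  then obtain B where "\<And>p. p \<in> rect N ==> \<bar>f p * g p\<bar> \<le> B"
   using compact_imp_bounded[OF compact_continuous_image[OF c]] unfolding bounded_iff by fastforce
  then show ?thesis using sub
   by (intro integrable_bounded_on[OF open_dom bounded_dom continuous_on_subset[OF c sub]]) auto
 qed
 have Jadd: "J (\<lambda>p. a * f p + b * f' p) g = a * J f g + b * J f' g"
  if "continuous_on (rect N) f" "continuous_on (rect N) f'" "continuous_on (rect N) g" for f f' g a b
 proof -
  have "J (\<lambda>p. a * f p + b * f' p) g =
   (\<integral>p. a * (indicator (dom 0) p * (f p * g p)) + b * (indicator (dom 0) p * (f' p * g p)) \<partial>lborel)"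
   unfolding J_def by (rule Bochner_Integration.integral_cong) (auto simp: algebra_simps)
  then show ?thesis unfolding J_def using int[OF that(1,3)] int[OF that(2,3)] by simp
 qed
 have Jcong: "J f g = J f' g" if "\<And>p. p \<in> dom 0 ==> f p = f' p" for f f' g
  unfolding J_def by (rule Bochner_Integration.integral_cong) (use that in \<open>auto simp: indicator_def\<close>)
 have k2: "k \<noteq> 2" "k \<ge> 1" using k(1) by auto
 note cm = continuous_mode[of "rect N"]
 have Jm: "J (trial 0 m' n') (trial 0 m n) = (if m = m' \<and> n = n' then N / 4 else 0)"
  if "m \<ge> 1" "n \<ge> 1" "m' \<ge> 1" "n' \<ge> 1" for m n m' n'
  unfolding J_def by (rule integral_mode_mode[OF that])
 define a where "a = 4 / N * J u0 (trial 0 2 2)"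
 define b where "b = 4 / N * J u0 (trial 0 k 1)"
 have Ja: "J u0 (trial 0 2 2) = N / 4 * a" and Jb: "J u0 (trial 0 k 1) = N / 4 * b"
  using N by (simp_all add: a_def b_def)
 define f where "f p = 1 * u0 p + (-1) * (a * trial 0 2 2 p + b * trial 0 k 1 p)" for p
 have cab: "continuous_on (rect N) (\<lambda>p. a * trial 0 2 2 p + b * trial 0 k 1 p)"
  by (intro continuous_intros cm)
 have cf: "continuous_on (rect N) f" unfolding f_def by (intro continuous_intros cm continuous_u0)
 have Jf: "J f (trial 0 m n) = 0" for m n
 proof (cases "m \<ge> 1 \<and> n \<ge> 1")
  case True
  have "J f (trial 0 m n) = 1 * J u0 (trial 0 m n) +
    (-1) * (a * J (trial 0 2 2) (trial 0 m n) + b * J (trial 0 k 1) (trial 0 m n))"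
   unfolding f_def Jadd[OF continuous_u0 cab cm] Jadd[OF cm cm cm] ..
  moreover have "J u0 (trial 0 m n) = 0" if "\<not> (m = 2 \<and> n = 2)" "\<not> (m = k \<and> n = 1)"
   using moment_zero[of m n] resonant_pair_unique[OF N k, of m n] that True l0 unfolding J_def by blast
  ultimately show ?thesis using True k2 by (auto simp: Jm Ja Jb simp del: One_nat_def)
 next
  case False
  then have "trial 0 m n = (\<lambda>p. 0)" by (auto simp: mode_eq fun_eq_iff not_le)
  then show ?thesis by (simp add: J_def)
 qed
 have f0: "f p = 0" if "p \<in> dom 0" for p
 proof (rule sine_system_complete[OF N cf[unfolded rect_eq]])
  show "p \<in> box (0, 0) (N, 1)" using that dom0_eq by simp
  fix m n
  have "integral (cbox (0, 0) (N, 1)) (\<lambda>p. f p * trial 0 m n p) = J f (trial 0 m n)"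
   unfolding J_def
   by (rule dom0_integral(2)[symmetric]) (auto intro!: continuous_intros cf cm simp: mode_boundary)
  then show "integral (cbox (0, 0) (N, 1)) (\<lambda>p. f p * (sin (real m * (pi * (N - fst p) / N)) * sin (real n * (pi * snd p)))) = 0"
   using Jf by (simp add: mode_eq)
 qed
 have span: "u0 p = a * trial 0 2 2 p + b * trial 0 k 1 p" if "p \<in> dom 0" for p
  using f0[OF that] by (simp add: f_def)
 have Jspan: "J u0 g = a * J (trial 0 2 2) g + b * J (trial 0 k 1) g" if "continuous_on (rect N) g" for g
  using Jcong[OF span] Jadd[OF cm cm that] by simp
 have comm: "J f g = J g f" for f g unfolding J_def by (simp add: mult.commute)
 have "1 = J u0 u0" using u0_norm by (simp add: J_def)
 also have "... = a * (N / 4 * a) + b * (N / 4 * b)"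
  unfolding Jspan[OF continuous_u0] comm[of "trial 0 2 2" u0] comm[of "trial 0 k 1" u0] Ja Jb ..
 finally have norm: "N / 4 * (a^2 + b^2) = 1" by (simp add: power2_eq_square algebra_simps)
 then have "a \<noteq> 0 \<or> b \<noteq> 0" by auto
 then have "J u0 (trial 0 2 2) \<noteq> 0 \<or> J u0 (trial 0 k 1) \<noteq> 0" using Ja Jb N by auto
 moreover have "rect_eigenvalue N 2 2 = lam0" "rect_eigenvalue N k 1 = lam0"
  using l0 rect_eigenvalue_resonance[OF N k(2)] by auto
 ultimately obtain \<nu> where \<nu>: "(\<lambda>j. (lam j - lam0) / h j) \<longlonglongrightarrow> \<nu>"
  "\<nu> * J u0 (trial 0 2 2) = - J u0 (defect 0 2 2)" "\<nu> * J u0 (trial 0 k 1) = - J u0 (defect 0 k 1)"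
  using rate_converges[of 2 2 k 1] unfolding J_def by blast
 \<comment> \<open>The resonance replaces k^2 - 4 by 3 N^2, whose 3 cancels against 2^2 - 1^2 from
   the vertical integral. This makes the two off-diagonal entries equal.\<close>
 have kN: "(real k)^2 - 4 = 3 * N^2" "(real k)^2 - 2^2 = 3 * N^2" "(2::real)^2 - (real k)^2 = - (3 * N^2)"
  using k(2) by auto
 have cd: "continuous_on (rect N) (defect 0 m n)" for m n by (rule continuous_defect0)
 have same: "J (trial 0 m n) (defect 0 m n) = pi^2 / N^2 * ((real m)^2 * Phi n n)" if "m \<ge> 1" "n \<ge> 1" for m n
 proof -
  have "(\<lambda>s. (real m * (pi * s)) * cos (real m * (pi * s)) * sin (real m * (pi * s))) integrable_on {0..1}"
   by (intro integrable_continuous_real continuous_intros)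
  from integral_mode_defect[OF that that integrable_integral[OF this]]
  show ?thesis using N by (simp add: J_def power2_eq_square power3_eq_cube field_simps)
 qed
 have d1: "J (trial 0 k 1) (defect 0 2 2) = pi^2 / N^2 * (2 * real k * (-1) ^ k * Phi 2 1)"
  using integral_mode_defect[OF _ _ _ _ has_integral_arg_cos_sin[of 2 k], of 2 1] k2 N kN
  by (simp add: J_def field_simps)
 have d2: "J (trial 0 2 2) (defect 0 k 1) = pi^2 / N^2 * (2 * real k * (-1) ^ k * Phi 2 1)"
  using integral_mode_defect[OF _ _ _ _ has_integral_arg_cos_sin[of k 2], of 1 2] k2 N kN
  unfolding Phi_commute[of 1 2] by (simp add: J_def field_simps)
 show ?thesis
 proof (rule that[OF span norm \<nu>(1)])
  show "\<nu> * (N / 4 * a) = - (pi^2 / N^2 * (4 * Phi 2 2 * a + 2 * real k * (-1) ^ k * Phi 2 1 * b))"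
   using \<nu>(2) unfolding Ja Jspan[OF cd] using same[of 2 2] d1 by (simp add: algebra_simps)
  show "\<nu> * (N / 4 * b) = - (pi^2 / N^2 * (2 * real k * (-1) ^ k * Phi 2 1 * a + (real k)^2 * Phi 1 1 * b))"
   using \<nu>(3) unfolding Jb Jspan[OF cd] using same[of k 1] d2 k2 by (simp add: algebra_simps)
 qed
qed

text \<open>The equation for \<tau> is quadratic and its roots have product -1. Here \<sigma> = P -
  R \<tau> and \<sigma>' = Q + R \<tau>, so \<sigma> \<le> \<sigma>' bounds R \<tau> from below by
  -(Q - P) / 2, which excludes the root of modulus at least 1. In other words, the eigenvector of
  the smaller eigenvalue leans towards the smaller diagonal entry.\<close>

lemma symmetric_2x2_eigenvectors:
 fixes P Q R a b a' b' \<sigma> \<sigma>' :: real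
 assumes eq: "P * a + R * b = \<sigma> * a" "R * a + Q * b = \<sigma> * b"
  and eq': "P * a' + R * b' = \<sigma>' * a'" "R * a' + Q * b' = \<sigma>' * b'"
  and orth: "a * a' + b * b' = 0" and nz: "a \<noteq> 0 \<or> b \<noteq> 0" "a' \<noteq> 0 \<or> b' \<noteq> 0"
  and le: "\<sigma> \<le> \<sigma>'" and PQ: "P < Q" and R: "R \<noteq> 0"
 obtains \<tau> where "\<bar>\<tau>\<bar> < 1" "R * (1 - \<tau>^2) = (Q - P) * \<tau>" "a \<noteq> 0" "b = - \<tau> * a" "b' \<noteq> 0" "a' = \<tau> * b'"
proof -
 have a: "a \<noteq> 0" using eq(1) nz R by auto
 have b': "b' \<noteq> 0" using eq'(2) nz R by auto
 define \<tau> where "\<tau> = - b / a"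
 have b: "b = - \<tau> * a" using a by (simp add: \<tau>_def)
 have "a * a' = a * (\<tau> * b')" using orth b by (simp add: algebra_simps)
 then have a': "a' = \<tau> * b'" using a by simp
 have "(P - R * \<tau>) * a = \<sigma> * a" using eq(1) b by (simp add: algebra_simps)
 then have \<sigma>: "P - R * \<tau> = \<sigma>" using a by simp
 have "(R - Q * \<tau>) * a = (- \<tau> * \<sigma>) * a" using eq(2) b by (simp add: algebra_simps)
 then have "R - Q * \<tau> = - \<tau> * \<sigma>" by (rule mult_right_cancel[OF a, THEN iffD1])
 then have t: "R * (1 - \<tau>^2) = (Q - P) * \<tau>" using \<sigma>[symmetric] by (simp add: algebra_simps power2_eq_square)
 have "(R * \<tau> + Q) * b' = \<sigma>' * b'" using eq'(2) a' by (simp add: algebra_simps)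
 then have \<sigma>': "R * \<tau> + Q = \<sigma>'" using b' by simp
 have D: "0 \<le> (Q - P) + 2 * (R * \<tau>)" using \<sigma> \<sigma>' le by linarith
 have "\<bar>\<tau>\<bar> < 1"
 proof (rule ccontr)
  assume "\<not> \<bar>\<tau>\<bar> < 1"
  then have t1: "1 \<le> \<tau>^2" using abs_le_square_iff[of 1 \<tau>] by simp
  have t0: "\<tau> \<noteq> 0" using t1 by auto
  have t2: "R * \<tau> * (1 - \<tau>^2) = (Q - P) * \<tau>^2" 
 proof -
   have "R * \<tau> * (1 - \<tau>^2) = \<tau> * (R * (1 - \<tau>^2))" by simp
   then show ?thesis unfolding t by (simp add: power2_eq_square)
  qed
  have "0 < (Q - P) * \<tau>^2" using PQ t0 by simp
  moreover have "- (1/2) * (Q - P) * (1 - \<tau>^2) \<ge> R * \<tau> * (1 - \<tau>^2)"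
  proof (rule mult_right_mono_neg)
   show "R * \<tau> \<ge> - (1/2) * (Q - P)" using D by (simp add: field_simps)
  qed (use t1 in simp)
  ultimately have "(Q - P) * \<tau>^2 \<le> - (1/2) * (Q - P) * (1 - \<tau>^2)" using t2 by simp
  also have "... = 1/2 * ((Q - P) * \<tau>^2) - 1/2 * (Q - P)" by (simp add: field_simps)
  finally have "(Q - P) * \<tau>^2 \<le> 1/2 * ((Q - P) * \<tau>^2) - 1/2 * (Q - P)" .
  moreover have "0 < (Q - P) * \<tau>^2" using PQ t0 by simp
  moreover have "False" if "X \<le> 1/2 * X - 1/2 * d" "0 < X" "0 < d" for X d :: real using that by linarith
  ultimately show False using PQ by fastforce
 qed
 from that[OF this t a b b' a'] show ?thesis .
qed

context profile begin

text \<open>The conclusion covers every n \<ge> n0 so that the sequences of both branches can be cut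
  at the same place. Uniform convergence puts all later functions within 2 of one fixed function on
  the rectangle, which gives \<open>M\<close>, and \<open>eigenfunction_sup_bound\<close> extends
  the bound to the strip.\<close>

lemma make_eigen_seq:
 assumes h: "\<And>j. h j > 0" "h \<longlonglongrightarrow> 0" and u: "\<And>j. dirichlet_eigenfunction (Om (h j)) (lam j) (u j)"
  and lam: "lam \<longlonglongrightarrow> lam0" and u0: "uniform_limit (rect N) u u0 sequentially"
  and norm1: "\<And>j. integral (Om (h j)) (\<lambda>p. (u j p)^2) = 1"
 obtains n0 M L where "\<And>n. n \<ge> n0 ==>
  eigen_seq \<phi> \<phi>1 \<phi>2 N (\<lambda>j. h (j + n)) (\<lambda>j. u (j + n)) (\<lambda>j. lam (j + n)) u0 lam0 M L"
proof -
 have h0: "0 \<le> h j" for j using h(1)[of j] by simp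
 have sub: "rect N \<subseteq> Om \<eta>" if "0 \<le> \<eta>" for \<eta>
 proof
  fix p assume p: "p \<in> rect N"
  obtain x y where xy: "p = (x, y)" by (cases p)
  have y: "y \<in> {0..1}" and x: "0 \<le> x" "x \<le> N" using p xy by (auto simp: rect_def)
  have "0 \<le> \<eta> * \<phi> y" using that \<phi>_bounds(1)[OF y] by simp
  then show "p \<in> Om \<eta>" using x y xy by (auto simp: Omega_def)
 qed
 have "Bseq lam" using lam convergent_imp_Bseq convergentI by blast
 then obtain L where "0 < L" and "\<forall>j. norm (lam j) \<le> L" by (rule BseqE)
 then have L: "\<bar>lam j\<bar> \<le> L" for j by simp
 have "\<forall>\<^sub>F j in sequentially. \<forall>p\<in>rect N. dist (u j p) (u0 p) < 1"
  by (rule uniform_limitD[OF u0 zero_less_one])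
 then obtain n1 where n1: "\<And>j p. j \<ge> n1 ==> p \<in> rect N ==> dist (u j p) (u0 p) < 1"
  unfolding eventually_sequentially by blast
 have "continuous_on (rect N) (u n1)"
  using eigenfunction_facts(1)[OF h0 u] sub[OF h0] continuous_on_subset by blast
 moreover have "compact (rect N)" unfolding rect_eq by simp
 ultimately have "bounded (u n1 ` rect N)" by (intro compact_imp_bounded compact_continuous_image)
 then obtain M' where M': "\<And>p. p \<in> rect N ==> \<bar>u n1 p\<bar> \<le> M'" unfolding bounded_iff by fastforce
 define M where "M = M' + 2"
 have M: "\<bar>u j p\<bar> \<le> M" if "j \<ge> n1" "p \<in> rect N" for j p
 proof -
  have "\<bar>u j p - u0 p\<bar> < 1" "\<bar>u n1 p - u0 p\<bar> < 1"
   using n1[OF that] n1[OF order_refl that(2)] unfolding dist_real_def by auto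
  then show ?thesis using M'[OF that(2)] unfolding M_def by linarith
 qed
 have "(\<lambda>j. h j * (N + 1)) \<longlonglongrightarrow> 0 * (N + 1)" by (intro tendsto_intros h)
 then have "\<forall>\<^sub>F j in sequentially. h j * (N + 1) < 1" by (rule order_tendstoD) simp
 moreover have "(\<lambda>j. L * (N + 1) * h j) \<longlonglongrightarrow> L * (N + 1) * 0" by (intro tendsto_intros h)
 then have "\<forall>\<^sub>F j in sequentially. L * (N + 1) * h j < 1" by (rule order_tendstoD) simp
 ultimately have "\<forall>\<^sub>F j in sequentially. h j * (N + 1) < 1 \<and> L * (N + 1) * h j < 1" by (rule eventually_conj)
 then obtain n2 where n2: "\<And>j. j \<ge> n2 ==> h j * (N + 1) < 1" "\<And>j. j \<ge> n2 ==> L * (N + 1) * h j < 1"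
  unfolding eventually_sequentially by blast
 show ?thesis
 proof (rule that[of "max n1 n2" M L])
  fix n assume n: "max n1 n2 \<le> n"
  show "eigen_seq \<phi> \<phi>1 \<phi>2 N (\<lambda>j. h (j + n)) (\<lambda>j. u (j + n)) (\<lambda>j. lam (j + n)) u0 lam0 M L"
  proof unfold_locales
   show "(\<lambda>j. h (j + n)) \<longlonglongrightarrow> 0" using h(2) by (rule LIMSEQ_ignore_initial_segment)
   show "(\<lambda>j. lam (j + n)) \<longlonglongrightarrow> lam0" using lam by (rule LIMSEQ_ignore_initial_segment)
   show "uniform_limit (rect N) (\<lambda>j. u (j + n)) u0 sequentially"
    using filterlim_compose[OF u0 filterlim_add_const_nat_at_top] .
   fix j
   show "0 < h (j + n)" "\<bar>lam (j + n)\<bar> \<le> L" by (fact h L)+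
   have g: "j + n \<ge> n1" "j + n \<ge> n2" using n by auto
   show h1: "h (j + n) * (N + 1) \<le> 1" using n2(1)[OF g(2)] by simp
   show "dirichlet_eigenfunction (Om (h (j + n))) (lam (j + n)) (u (j + n))" by (rule u)
   show "integral (Om (h (j + n))) (\<lambda>p. (u (j + n) p)^2) = 1" by (rule norm1)
   have "\<bar>lam (j + n)\<bar> * (N + 1) * h (j + n) \<le> L * (N + 1) * h (j + n)"
    using L h0 N by (intro mult_right_mono) auto
   then have l1: "\<bar>lam (j + n)\<bar> * (N + 1) * h (j + n) < 1" using n2(2)[OF g(2)] by linarith
   show "\<bar>u (j + n) p\<bar> \<le> M" if "p \<in> Om (h (j + n))" for p
    by (rule eigenfunction_sup_bound[OF h0 h1 l1 u _ that]) (rule M[OF g(1)])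
  qed
 qed
qed

lemma limit_pair_in_span:
 assumes v: "eigen_seq \<phi> \<phi>1 \<phi>2 N h v mu v0 lam0 M L" and w: "eigen_seq \<phi> \<phi>1 \<phi>2 N h w ga w0 lam0 M' L'"
  and less: "\<And>j. ga j < mu j" and l0: "lam0 = rect_eigenvalue N 2 2"
  and k: "k \<ge> 3" "(real k)^2 = 3 * N^2 + 4" and PQ: "4 * Phi 2 2 < (real k)^2 * Phi 1 1" and L0: "Phi 2 1 \<noteq> 0"
 obtains \<tau> c c' where "\<bar>\<tau>\<bar> < 1" "2 * real k * Phi 2 1 * (1 - \<tau>^2) = ((real k)^2 * Phi 1 1 - 4 * Phi 2 2) * \<tau>"
  "c \<noteq> 0" "c' \<noteq> 0"
  "\<And>x y. (x, y) \<in> dom 0 ==> v0 (x, y) = c * (sin (2 * (pi * x / N)) * sin (2 * (pi * y)) - \<tau> * sin (real k * (pi * x / N)) * sin (pi * y))"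
  "\<And>x y. (x, y) \<in> dom 0 ==> w0 (x, y) = c' * (sin (real k * (pi * x / N)) * sin (pi * y) + \<tau> * sin (2 * (pi * x / N)) * sin (2 * (pi * y)))"
proof -
 interpret V: eigen_seq \<phi> \<phi>1 \<phi>2 N h v mu v0 lam0 M L by (rule v)
 interpret W: eigen_seq \<phi> \<phi>1 \<phi>2 N h w ga w0 lam0 M' L' by (rule w)
 obtain a b \<nu> where A: "\<And>p. p \<in> dom 0 ==> v0 p = a * trial 0 2 2 p + b * trial 0 k 1 p"
  "N / 4 * (a^2 + b^2) = 1" "(\<lambda>j. (mu j - lam0) / h j) \<longlonglongrightarrow> \<nu>"
  "\<nu> * (N / 4 * a) = - (pi^2 / N^2 * (4 * Phi 2 2 * a + 2 * real k * (-1) ^ k * Phi 2 1 * b))"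
  "\<nu> * (N / 4 * b) = - (pi^2 / N^2 * (2 * real k * (-1) ^ k * Phi 2 1 * a + (real k)^2 * Phi 1 1 * b))"
  using V.limit_in_span[OF k l0] by blast
 obtain a' b' \<nu>' where A': "\<And>p. p \<in> dom 0 ==> w0 p = a' * trial 0 2 2 p + b' * trial 0 k 1 p"
  "N / 4 * (a'^2 + b'^2) = 1" "(\<lambda>j. (ga j - lam0) / h j) \<longlonglongrightarrow> \<nu>'"
  "\<nu>' * (N / 4 * a') = - (pi^2 / N^2 * (4 * Phi 2 2 * a' + 2 * real k * (-1) ^ k * Phi 2 1 * b'))"
  "\<nu>' * (N / 4 * b') = - (pi^2 / N^2 * (2 * real k * (-1) ^ k * Phi 2 1 * a' + (real k)^2 * Phi 1 1 * b'))"
  using W.limit_in_span[OF k l0] by blast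
 have "(\<lambda>j. \<integral>p. indicator (dom (h j)) p * (v j p * w j p) \<partial>lborel) \<longlonglongrightarrow> (\<integral>p. indicator (dom 0) p * (v0 p * w0 p) \<partial>lborel)"
 proof (rule V.limit_integral[where G = M'])
  show "continuous_on (dom (h j)) (w j)" for j by (rule W.continuous_u)
  show "\<bar>w j p\<bar> \<le> M'" if "p \<in> dom (h j)" for j p using W.M dom_subset that by blast
  show "continuous_on (dom 0) w0" using continuous_on_subset[OF W.continuous_u0 W.dom0_subset] .
  show "(\<lambda>j. w j p) \<longlonglongrightarrow> w0 p" if "p \<in> dom 0" for p using that W.dom0_subset by (intro W.u_tendsto) auto
 qed
 moreover have "(\<integral>p. indicator (dom (h j)) p * (v j p * w j p) \<partial>lborel) = 0" for j
  by (rule eigenfunctions_orthogonal[OF V.h0 V.h(2) V.u W.u]) (use less[of j] in simp)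
 ultimately have o: "(\<integral>p. indicator (dom 0) p * (v0 p * w0 p) \<partial>lborel) = 0" using LIMSEQ_unique[OF _ tendsto_const] by simp
 have k2: "k \<noteq> 2" "k \<ge> 1" using k(1) by auto
 have int: "integrable lborel (\<lambda>p. indicator (dom 0) p * (trial 0 m n p * trial 0 m' n' p))" for m n m' n'
 proof (rule integrable_bounded_on[OF open_dom bounded_dom, where B = "1 * 1"])
  show "continuous_on (dom 0) (\<lambda>p. trial 0 m n p * trial 0 m' n' p)" by (intro continuous_intros continuous_mode)
  show "\<bar>trial 0 m n p * trial 0 m' n' p\<bar> \<le> 1 * 1" if "p \<in> dom 0" for p
   unfolding abs_mult using trial_boundary_decay(1)[of 0 "fst p" "snd p"] that by (intro mult_mono) auto
 qed simp
 have "(\<integral>p. indicator (dom 0) p * (v0 p * w0 p) \<partial>lborel) =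
   (\<integral>p. a * a' * (indicator (dom 0) p * (trial 0 2 2 p * trial 0 2 2 p)) + a * b' * (indicator (dom 0) p * (trial 0 2 2 p * trial 0 k 1 p))
    + (b * a' * (indicator (dom 0) p * (trial 0 k 1 p * trial 0 2 2 p)) + b * b' * (indicator (dom 0) p * (trial 0 k 1 p * trial 0 k 1 p))) \<partial>lborel)"
 proof (rule Bochner_Integration.integral_cong[OF refl])
  fix p
  show "indicator (dom 0) p * (v0 p * w0 p) = a * a' * (indicator (dom 0) p * (trial 0 2 2 p * trial 0 2 2 p)) + a * b' * (indicator (dom 0) p * (trial 0 2 2 p * trial 0 k 1 p))
    + (b * a' * (indicator (dom 0) p * (trial 0 k 1 p * trial 0 2 2 p)) + b * b' * (indicator (dom 0) p * (trial 0 k 1 p * trial 0 k 1 p)))"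
   using A(1)[of p] A'(1)[of p] by (cases "p \<in> dom 0") (simp_all add: algebra_simps)
 qed
 also have "... = N / 4 * (a * a' + b * b')"
  using int k2 by (simp add: integral_mode_mode algebra_simps del: One_nat_def)
 finally have orth: "a * a' + b * b' = 0" using o N by simp
 have "(ga j - lam0) / h j \<le> (mu j - lam0) / h j" for j
  using less[of j] V.h0[of j] by (intro divide_right_mono) auto
 then have \<nu>: "\<nu>' \<le> \<nu>" by (intro LIMSEQ_le[OF A'(3) A(3)]) blast
 \<comment> \<open>The factor that converts a rate \<nu> into an eigenvalue of the matrix. It is
   negative, so the upper branch belongs to the smaller matrix eigenvalue.\<close>
 define s where "s = - (N ^ 3 / (4 * pi^2))"
 have s: "s * \<nu> \<le> s * \<nu>'" using \<nu> N by (intro mult_left_mono_neg) (auto simp: s_def)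
 have resc: "X = s * c * z" if "c * (N / 4 * z) = - (pi^2 / N^2 * X)" for X c z
 proof -
  have "X = - (N^2 / pi^2) * (- (pi^2 / N^2 * X))" using N by simp
  also have "... = - (N^2 / pi^2) * (c * (N / 4 * z))" using that by simp
  also have "... = s * c * z" by (simp add: s_def power2_eq_square power3_eq_cube field_simps)
  finally show ?thesis .
 qed
 note eqs = resc[OF A(4)] resc[OF A(5)] resc[OF A'(4)] resc[OF A'(5)]
 have R: "2 * real k * (-1) ^ k * Phi 2 1 \<noteq> 0" using L0 k(1) by simp
 have nz: "a \<noteq> 0 \<or> b \<noteq> 0" "a' \<noteq> 0 \<or> b' \<noteq> 0" using A(2) A'(2) by auto
 obtain t where t: "\<bar>t\<bar> < 1" "2 * real k * (-1) ^ k * Phi 2 1 * (1 - t^2) = ((real k)^2 * Phi 1 1 - 4 * Phi 2 2) * t"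
  "a \<noteq> 0" "b = - t * a" "b' \<noteq> 0" "a' = t * b'"
  using symmetric_2x2_eigenvectors[OF eqs orth nz s PQ R] by blast
 \<comment> \<open>The modes are sines of the distance to the right side. Rewriting the second one
   in x costs a sign (-1)^k, which is absorbed here.\<close>
 define \<tau> where "\<tau> = (-1) ^ k * t"
 have sq: "(-1) ^ k * (-1) ^ k = (1::real)" by (simp add: power_mult_distrib[symmetric])
 have t\<tau>: "t = (-1) ^ k * \<tau>" using sq by (simp add: \<tau>_def mult.assoc[symmetric])
 have \<tau>sq: "\<tau>^2 = t^2" by (simp add: \<tau>_def power_mult_distrib power_even_eq[symmetric] power_mult[symmetric])
 have m22: "trial 0 2 2 (x, y) = - (sin (2 * (pi * x / N)) * sin (2 * (pi * y)))" for x y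
 proof -
  have "real 2 * (pi * ((N - x) / N)) = 2 * pi - 2 * (pi * x / N)" using N by (simp add: field_simps)
  then show ?thesis by (simp only: mode_eq fst_conv snd_conv) (simp add: sin_diff)
 qed
 have mk1: "trial 0 k 1 (x, y) = - ((-1) ^ k * sin (real k * (pi * x / N)) * sin (pi * y))" for x y
 proof -
  have "real k * (pi * ((N - x) / N)) = real k * pi - real k * (pi * x / N)" using N by (simp add: field_simps)
  then show ?thesis by (simp only: mode_eq fst_conv snd_conv) (simp add: sin_diff sin_npi cos_npi)
 qed
 show ?thesis
 proof (rule that[of \<tau> "- a" "- ((-1) ^ k * b')"])
  show "\<bar>\<tau>\<bar> < 1" using t(1) by (simp add: \<tau>_def abs_mult power_abs)
  have "2 * real k * Phi 2 1 * (1 - \<tau>^2) = (-1) ^ k * (2 * real k * (-1) ^ k * Phi 2 1 * (1 - t^2))"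
   using sq by (simp add: \<tau>sq algebra_simps)
  also have "... = ((real k)^2 * Phi 1 1 - 4 * Phi 2 2) * \<tau>" unfolding t(2) by (simp add: \<tau>_def algebra_simps)
  finally show "2 * real k * Phi 2 1 * (1 - \<tau>^2) = ((real k)^2 * Phi 1 1 - 4 * Phi 2 2) * \<tau>" .
  show "- a \<noteq> 0" "- ((-1) ^ k * b') \<noteq> 0" using t by auto
  fix x y assume p: "(x, y) \<in> dom 0"
  show "v0 (x, y) = - a * (sin (2 * (pi * x / N)) * sin (2 * (pi * y)) - \<tau> * sin (real k * (pi * x / N)) * sin (pi * y))"
   using A(1)[OF p] unfolding m22 mk1 t(4) \<tau>_def by (simp add: algebra_simps)
  let ?S = "sin (real k * (pi * x / N)) * sin (pi * y)" and ?T = "sin (2 * (pi * x / N)) * sin (2 * (pi * y))"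
  have "w0 (x, y) = - (b' * ((-1) ^ k * \<tau>) * ?T) - b' * ((-1) ^ k * ?S)"
   using A'(1)[OF p] unfolding m22 mk1 t(6) t\<tau>[symmetric] by (simp add: algebra_simps)
  also have "... = - ((-1) ^ k * b') * (?S + \<tau> * sin (2 * (pi * x / N)) * sin (2 * (pi * y)))"
   by (simp add: algebra_simps)
  finally show "w0 (x, y) = - ((-1) ^ k * b') * (?S + \<tau> * sin (2 * (pi * x / N)) * sin (2 * (pi * y)))" .
 qed
qed

end

lemma admissible_imp_profile:
 assumes "admissible \<phi>" "N > 0"
 obtains \<phi>1 \<phi>2 where "profile \<phi> \<phi>1 \<phi>2 N"
proof -
 obtain d :: "nat => real => real" where d: "d 0 = \<phi>"
   "\<And>l y. l < 5 ==> y \<in> {0..1} ==> (d l has_real_derivative d (Suc l) y) (at y within {0..1})"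
   "\<And>l y. l \<in> {1..5} ==> y \<in> {0..1} ==> \<bar>d l y\<bar> \<le> 1"
  and im: "\<phi> ` {0..1} \<subseteq> {0..1}" and ends: "\<phi> 0 = 0" "\<phi> 1 = 0"
  using assms(1) unfolding admissible_def by blast
 have "profile \<phi> (d 1) (d 2) N"
 proof unfold_locales
  show "N > 0" by (rule assms(2))
  show "continuous_on {0..1} (d 2)" by (rule DERIV_continuous_on[of _ _ "d 3"]) (use d(2)[of 2] in simp)
  show "\<phi> 0 = 0" "\<phi> 1 = 0" by (fact ends)+
  fix y :: real assume y: "y \<in> {0..1}"
  show "(\<phi> has_real_derivative d 1 y) (at y within {0..1})" using d(2)[of 0 y] y d(1) by simp
  show "(d 1 has_real_derivative d 2 y) (at y within {0..1})" using d(2)[of 1 y] y by (simp add: numeral_2_eq_2)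
  show "0 \<le> \<phi> y" "\<phi> y \<le> 1" using im y by (auto simp: image_subset_iff)
  show "\<bar>d 1 y\<bar> \<le> 1" "\<bar>d 2 y\<bar> \<le> 1" using d(3) y by auto
 qed
 then show ?thesis by (rule that)
qed

lemma limiting_eigenfunctions_form:
 fixes \<phi> :: "real => real"
 defines "A \<equiv> integral {0..1} (\<lambda>y. \<phi> y * (sin (2 * (pi * y)))^2)"
  and "B \<equiv> integral {0..1} (\<lambda>y. \<phi> y * (sin (pi * y))^2)"
 assumes adm: "admissible \<phi>" and N: "N > 0" and k: "k \<ge> 3" "(real k)^2 = 3 * N^2 + 4"
  and lim: "limiting_eigenfunctions \<phi> N v0 w0" and AB: "4 * A < (real k)^2 * B"
 obtains \<tau> c c' where "\<bar>\<tau>\<bar> < 1" "2 * real k * Lam \<phi> * (1 - \<tau>^2) = ((real k)^2 * B - 4 * A) * \<tau>"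
  "c \<noteq> 0" "c' \<noteq> 0"
  "\<And>x y. 0 < x ==> x < N ==> 0 < y ==> y < 1 ==>
    v0 (x, y) = c * (sin (2 * (pi * x / N)) * sin (2 * (pi * y)) - \<tau> * sin (real k * (pi * x / N)) * sin (pi * y))"
  "\<And>x y. 0 < x ==> x < N ==> 0 < y ==> y < 1 ==>
    w0 (x, y) = c' * (sin (real k * (pi * x / N)) * sin (pi * y) + \<tau> * sin (2 * (pi * x / N)) * sin (2 * (pi * y)))"
proof -
 obtain \<phi>1 \<phi>2 where "profile \<phi> \<phi>1 \<phi>2 N" using admissible_imp_profile[OF adm N] .
 then interpret profile \<phi> \<phi>1 \<phi>2 N .
 obtain e \<mu> \<gamma> v w where e: "e > 0" and c\<mu>: "continuous_on {0..<e} \<mu>" and c\<gamma>: "continuous_on {0..<e} \<gamma>"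
  and z: "\<mu> 0 = rect_eigenvalue N 2 2" "\<gamma> 0 = rect_eigenvalue N 2 2"
  and ev: "\<And>\<eta>. \<eta> \<in> {0<..<e} ==> \<gamma> \<eta> < \<mu> \<eta>"
   "\<And>\<eta>. \<eta> \<in> {0<..<e} ==> normalized_eigenfunction (Om \<eta>) (\<mu> \<eta>) (v \<eta>)"
   "\<And>\<eta>. \<eta> \<in> {0<..<e} ==> normalized_eigenfunction (Om \<eta>) (\<gamma> \<eta>) (w \<eta>)"
  and ul: "uniform_limit (rect N) v v0 (at_right 0)" "uniform_limit (rect N) w w0 (at_right 0)"
  using lim unfolding limiting_eigenfunctions_def by blast
 \<comment> \<open>The shift by 2 keeps every term strictly below e, also the one for j = 0.\<close>
 define h where "h j = e / real (j + 2)" for j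
 have h: "h j \<in> {0<..<e}" for j using e by (simp add: h_def divide_less_eq add_pos_nonneg)
 have h0: "h \<longlonglongrightarrow> 0"
  unfolding h_def using LIMSEQ_ignore_initial_segment[OF lim_const_over_n[of e], of 2] by simp
 have hne: "h j \<noteq> 0 \<and> h j \<in> {0<..}" for j using h[of j] by auto
 have hr: "filterlim h (at_right 0) sequentially"
  unfolding filterlim_at by (intro conjI always_eventually allI h0) (use hne in auto)
 have tl: "(\<lambda>j. f (h j)) \<longlonglongrightarrow> f 0" if "continuous_on {0..<e} f" for f :: "real => real"
  by (rule continuous_on_tendsto_compose[OF that h0]) (use e h in \<open>auto simp: less_imp_le intro!: always_eventually\<close>)
 have nv: "dirichlet_eigenfunction (Om (h j)) (\<mu> (h j)) (v (h j))" "integral (Om (h j)) (\<lambda>p. (v (h j) p)^2) = 1"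
  "dirichlet_eigenfunction (Om (h j)) (\<gamma> (h j)) (w (h j))" "integral (Om (h j)) (\<lambda>p. (w (h j) p)^2) = 1" for j
  using ev(2,3)[OF h[of j]] by (auto simp: normalized_eigenfunction_def)
 have hp: "h j > 0" for j using h[of j] by simp
 obtain n1 M L where V: "\<And>n. n \<ge> n1 ==> eigen_seq \<phi> \<phi>1 \<phi>2 N (\<lambda>j. h (j + n)) (\<lambda>j. v (h (j + n))) (\<lambda>j. \<mu> (h (j + n))) v0 (rect_eigenvalue N 2 2) M L"
  using make_eigen_seq[OF hp h0 nv(1) tl[OF c\<mu>, unfolded z] filterlim_compose[OF ul(1) hr] nv(2)] by blast
 obtain n2 M' L' where W: "\<And>n. n \<ge> n2 ==> eigen_seq \<phi> \<phi>1 \<phi>2 N (\<lambda>j. h (j + n)) (\<lambda>j. w (h (j + n))) (\<lambda>j. \<gamma> (h (j + n))) w0 (rect_eigenvalue N 2 2) M' L'"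
  using make_eigen_seq[OF hp h0 nv(3) tl[OF c\<gamma>, unfolded z] filterlim_compose[OF ul(2) hr] nv(4)] by blast
 have Phi: "Phi 2 2 = A" "Phi 1 1 = B" "Phi 2 1 = Lam \<phi>"
  unfolding Phi_def A_def B_def Lam_def by (simp_all add: power2_eq_square mult.assoc)
 have L0: "Phi 2 1 \<noteq> 0" unfolding Phi using adm by (simp add: admissible_def)
 have AB': "4 * Phi 2 2 < (real k)^2 * Phi 1 1" using AB Phi by simp
 show ?thesis
 proof (rule limit_pair_in_span[OF V[of "max n1 n2"] W[of "max n1 n2"] _ refl k AB' L0])
  fix \<tau> c c'
  assume "\<bar>\<tau>\<bar> < 1" "2 * real k * Phi 2 1 * (1 - \<tau>^2) = ((real k)^2 * Phi 1 1 - 4 * Phi 2 2) * \<tau>" "c \<noteq> 0" "c' \<noteq> 0"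
   "\<And>x y. (x, y) \<in> dom 0 ==> v0 (x, y) = c * (sin (2 * (pi * x / N)) * sin (2 * (pi * y)) - \<tau> * sin (real k * (pi * x / N)) * sin (pi * y))"
   "\<And>x y. (x, y) \<in> dom 0 ==> w0 (x, y) = c' * (sin (real k * (pi * x / N)) * sin (pi * y) + \<tau> * sin (2 * (pi * x / N)) * sin (2 * (pi * y)))"
  then show ?thesis using that[of \<tau> c c'] unfolding Phi by (simp add: dom_def)
 qed (use ev(1)[OF h] in auto)
qed

subsection \<open>The size of the mixing parameter\<close>

text \<open>Everything is expressed through B and J, the \<phi>-moments of sin^2 and sin^4, since A
  = 4 B - 4 J. For k \<ge> 4 the first claim is then positivity of (k^2 - 16) B + 16 J. The bounds
  on \<tau> rest on two inequalities, B^2 \<le> J and |Lam \<phi>| \<le> 2 B - J.\<close>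

lemma angle_constants:
 fixes \<phi> :: "real => real"
 defines "A \<equiv> integral {0..1} (\<lambda>y. \<phi> y * (sin (2 * (pi * y)))^2)"
  and "B \<equiv> integral {0..1} (\<lambda>y. \<phi> y * (sin (pi * y))^2)"
 assumes c: "continuous_on {0..1} \<phi>" and b: "\<And>y. y \<in> {0..1} ==> 0 \<le> \<phi> y" "\<And>y. y \<in> {0..1} ==> \<phi> y \<le> 1"
  and L0: "Lam \<phi> \<noteq> 0" and k: "k \<ge> 4"
 shows "4 * A < (real k)^2 * B"
  and "\<bar>\<tau>\<bar> < 1 ==> 2 * real k * Lam \<phi> * (1 - \<tau>^2) = ((real k)^2 * B - 4 * A) * \<tau> ==>
   real k * \<bar>\<tau>\<bar> \<le> 4 * (1 - (Lam \<phi>)^2 / 24) \<and> \<bar>Lam \<phi>\<bar> \<le> real k * \<bar>\<tau>\<bar>"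
proof -
 let ?s = "\<lambda>y. sin (pi * y)" and ?c = "\<lambda>y. cos (pi * y)"
 define J where "J = integral {0..1} (\<lambda>y. \<phi> y * ?s y ^ 4)"
 define P where "P = integral {0..1} \<phi>"
 define L where "L = \<bar>Lam \<phi>\<bar>"
 have int: "(\<lambda>y. \<phi> y * g y) integrable_on {0..1}" if "continuous_on {0..1} g" for g :: "real => real"
  by (intro integrable_continuous_real continuous_intros c that)
 have iB: "((\<lambda>y. \<phi> y * (?s y)^2) has_integral B) {0..1}"
  unfolding B_def by (intro integrable_integral int continuous_intros)
 have iA: "((\<lambda>y. \<phi> y * (sin (2 * (pi * y)))^2) has_integral A) {0..1}"
  unfolding A_def by (intro integrable_integral int continuous_intros)
 have iJ: "((\<lambda>y. \<phi> y * ?s y ^ 4) has_integral J) {0..1}"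
  unfolding J_def by (intro integrable_integral int continuous_intros)
 have iP: "(\<phi> has_integral P) {0..1}"
  unfolding P_def by (intro integrable_integral integrable_continuous_real c)
 have iL: "((\<lambda>y. \<phi> y * sin (2 * pi * y) * ?s y) has_integral Lam \<phi>) {0..1}"
  unfolding Lam_def by (intro integrable_integral integrable_continuous_real continuous_intros c)
 have dbl: "sin (2 * pi * y) = 2 * ?s y * ?c y" for y
  using sin_double[of "pi * y"] by (simp add: mult.assoc)
 have cs: "(?c y)^2 = 1 - (?s y)^2" for y by (rule cos_squared_eq)
 have "((\<lambda>y. 4 * (\<phi> y * (?s y)^2) - 4 * (\<phi> y * ?s y ^ 4)) has_integral 4 * B - 4 * J) {0..1}"
  by (intro has_integral_diff has_integral_mult_right iB iJ)
 moreover have "4 * (\<phi> y * (?s y)^2) - 4 * (\<phi> y * ?s y ^ 4) = \<phi> y * (sin (2 * (pi * y)))^2" for y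
  unfolding sin_double power_mult_distrib cs by (simp add: power2_eq_square power4_eq_xxxx algebra_simps)
 ultimately have A: "A = 4 * B - 4 * J" using iA by (simp add: has_integral_unique)
 \<comment> \<open>Cauchy-Schwarz for the weight \<phi>, whose mass is at most 1, in the form that
   the integral of \<phi> (sin^2 - B)^2 is nonnegative.\<close>
 have "((\<lambda>y. \<phi> y * ?s y ^ 4 - 2 * B * (\<phi> y * (?s y)^2) + B^2 * \<phi> y) has_integral J - 2 * B * B + B^2 * P) {0..1}"
  by (intro has_integral_diff has_integral_add has_integral_mult_right iB iJ iP)
 moreover have "0 \<le> \<phi> y * ?s y ^ 4 - 2 * B * (\<phi> y * (?s y)^2) + B^2 * \<phi> y" if "y \<in> {0..1}" for y
 proof -
  have "0 \<le> \<phi> y * ((?s y)^2 - B)^2" using b(1)[OF that] by simp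
  then show ?thesis by (simp add: power2_eq_square power4_eq_xxxx algebra_simps)
 qed
 ultimately have "0 \<le> J - 2 * B * B + B^2 * P" by (rule has_integral_nonneg)
 moreover have P1: "P \<le> 1"
 proof -
  have "((\<lambda>y::real. 1) has_integral (1::real)) {0..1}" using has_integral_const_real[of "1::real" 0 1] by simp
  from has_integral_le[OF iP this] show ?thesis using b(2) by simp
 qed
 moreover have "B^2 * P \<le> B^2 * 1" using P1 by (intro mult_left_mono) auto
 ultimately have JB: "B^2 \<le> J" by (simp add: power2_eq_square)
 have B1: "B \<le> 1"
 proof -
  have "\<phi> y * (?s y)^2 \<le> \<phi> y" if "y \<in> {0..1}" for y
   using b(1)[OF that] by (intro mult_left_le) (auto simp: abs_square_le_1)
  from has_integral_le[OF iB iP this] P1 show ?thesis by simp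
 qed
 \<comment> \<open>Pointwise 2 |cos| \<le> 1 + cos^2 = 2 - sin^2.\<close>
 have LB: "L \<le> 2 * B - J"
 proof -
  have i: "((\<lambda>y. 2 * (\<phi> y * (?s y)^2) - \<phi> y * ?s y ^ 4) has_integral 2 * B - J) {0..1}"
   by (intro has_integral_diff has_integral_mult_right iB iJ)
  have pw: "\<bar>\<phi> y * sin (2 * pi * y) * ?s y\<bar> \<le> 2 * (\<phi> y * (?s y)^2) - \<phi> y * ?s y ^ 4" if "y \<in> {0..1}" for y
  proof -
   have e: "\<bar>\<phi> y * sin (2 * pi * y) * ?s y\<bar> = \<phi> y * (?s y)^2 * (2 * \<bar>?c y\<bar>)"
    unfolding dbl using b(1)[OF that] by (simp add: abs_mult power2_eq_square)
   have "0 \<le> (1 - \<bar>?c y\<bar>) * (1 - \<bar>?c y\<bar>)" by simp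
   then have "2 * \<bar>?c y\<bar> \<le> 1 + (?c y)^2" by (simp add: algebra_simps power2_eq_square abs_mult_self_eq)
   then have "2 * \<bar>?c y\<bar> \<le> 2 - (?s y)^2" unfolding cs by simp
   then have "\<phi> y * (?s y)^2 * (2 * \<bar>?c y\<bar>) \<le> \<phi> y * (?s y)^2 * (2 - (?s y)^2)"
    using b(1)[OF that] by (intro mult_left_mono) auto
   then show ?thesis unfolding e by (simp add: algebra_simps power2_eq_square power4_eq_xxxx)
  qed
  have "Lam \<phi> \<le> 2 * B - J" by (rule has_integral_le[OF iL i]) (use pw in \<open>force simp: abs_le_iff\<close>)
  moreover have "- Lam \<phi> \<le> 2 * B - J"
   by (rule has_integral_le[OF has_integral_neg[OF iL] i]) (use pw in \<open>force simp: abs_le_iff\<close>)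
  ultimately show ?thesis by (simp add: L_def)
 qed
 have Lp: "L > 0" using L0 by (simp add: L_def)
 have J0: "J \<ge> 0" using JB by (meson order_trans zero_le_power2)
 have BL: "L / 2 \<le> B" using LB J0 by simp
 then have "(L / 2)^2 \<le> B^2" using Lp by (intro power_mono) auto
 then have JL: "L^2 / 4 \<le> J" using JB by (simp add: power_divide)
 then have Jp: "J > 0" using Lp by (smt (verit) divide_pos_pos zero_less_power)
 have k16: "(real k)^2 \<ge> 16" using k power_mono[of 4 "real k" 2] by simp
 have Bp: "B > 0" using BL Lp by simp
 define D where "D = (real k)^2 * B - 4 * A"
 have Deq: "D = ((real k)^2 - 16) * B + 16 * J" by (simp add: D_def A algebra_simps)
 have Dp: "D > 0" using k16 Bp Jp by (simp add: Deq add_nonneg_pos)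
 then show "4 * A < (real k)^2 * B" by (simp add: D_def)
 assume t1: "\<bar>\<tau>\<bar> < 1" and e: "2 * real k * Lam \<phi> * (1 - \<tau>^2) = ((real k)^2 * B - 4 * A) * \<tau>"
 define t where "t = \<bar>\<tau>\<bar>"
 have t: "0 \<le> t" "t < 1" "\<tau>^2 = t^2" using t1 by (auto simp: t_def)
 have tsq: "t^2 \<le> 1" using t by (simp add: abs_square_le_1)
 have "\<bar>2 * real k * Lam \<phi> * (1 - \<tau>^2)\<bar> = \<bar>D * \<tau>\<bar>" using e by (simp add: D_def)
 then have e': "2 * real k * L * (1 - t^2) = D * t"
  using Dp tsq by (simp add: abs_mult L_def t_def[symmetric] t(3))
 \<comment> \<open>Normalized so that k |\<tau>| < 4 becomes q < 1. The equation for \<tau> is a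
   quadratic in q, and the amount by which q = 1 fails to solve it equals 1 - q times a positive
   factor.\<close>
 define q where "q = real k * t / 4"
 have kq: "real k * t = 4 * q" by (simp add: q_def)
 have "16 * L * q^2 + 2 * D * q = (real k)^2 * L"
 proof -
  have "2 * D * q = real k / 2 * (D * t)" by (simp add: q_def)
  also have "... = real k / 2 * (2 * real k * L * (1 - t^2))" unfolding e' ..
  also have "... = (real k)^2 * L - 16 * L * q^2" by (simp add: q_def power2_eq_square algebra_simps)
  finally show ?thesis by simp
 qed
 then have "(1 - q) * (16 * L * (1 + q) + 2 * D) = 16 * L + 2 * D - (real k)^2 * L"
  by (simp add: power2_eq_square algebra_simps)
 also have "... = ((real k)^2 - 16) * (2 * B - L) + 32 * J" by (simp add: Deq algebra_simps)
 also have "... \<ge> ((real k)^2 - 16) * J + 32 * J"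
  using LB k16 by (intro add_right_mono mult_left_mono) auto
 finally have E: "(real k)^2 * J \<le> (1 - q) * (16 * L * (1 + q) + 2 * D)" using J0 by (simp add: algebra_simps)
 have q0: "0 \<le> q" using t by (simp add: q_def)
 have den: "0 < 16 * L * (1 + q) + 2 * D" using Lp q0 Dp by (simp add: add_pos_pos)
 have kJ: "(real k)^2 * J > 0" using k16 Jp by (intro mult_pos_pos) linarith+
 have q1: "q < 1"
 proof (rule ccontr)
  assume "\<not> q < 1"
  then have "(1 - q) * (16 * L * (1 + q) + 2 * D) \<le> 0" using den by (intro mult_nonpos_nonneg) auto
  then show False using E kJ by linarith
 qed
 have L2: "L \<le> 2" using LB B1 J0 by linarith
 have "D \<le> (real k)^2 * 1"
 proof -
  have "0 \<le> A" using iA b(1) by (intro has_integral_nonneg[OF iA]) auto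
  then have "D \<le> (real k)^2 * B" by (simp add: D_def)
  also have "... \<le> (real k)^2 * 1" using B1 by (intro mult_left_mono) auto
  finally show ?thesis .
 qed
 note Dk = this
 \<comment> \<open>L \<le> 2 and q < 1 bound this by 64, hence by 4 k^2; with 2 D \<le> 2 k^2 the
   factor 6 results. Together with L^2 / 4 \<le> J it yields the 24 of the claim.\<close>
 have "16 * L * (1 + q) \<le> 16 * 2 * 2" using L2 Lp q1 q0 by (intro mult_mono) auto
 then have "16 * L * (1 + q) + 2 * D \<le> 6 * (real k)^2" using Dk k16 by linarith
 then have "(1 - q) * (16 * L * (1 + q) + 2 * D) \<le> (1 - q) * (6 * (real k)^2)" using q1 by (intro mult_left_mono) auto
 with E have "(real k)^2 * J \<le> (real k)^2 * (6 * (1 - q))" by (simp add: algebra_simps)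
 then have "J \<le> 6 * (1 - q)" by (rule mult_left_le_imp_le) (use k16 in linarith)
 with JL have "L^2 / 4 \<le> 6 * (1 - q)" by (rule order_trans)
 then have "L^2 / 24 \<le> 1 - q" by simp
 moreover have "L^2 = (Lam \<phi>)^2" by (simp add: L_def)
 ultimately have "real k * t \<le> 4 * (1 - (Lam \<phi>)^2 / 24)" using kq by simp
 \<comment> \<open>For t \<ge> 1/2 already k t \<ge> 2 \<ge> L. Otherwise 1 - t^2 \<ge> 3/4 in the
   equation, whose right side is at most k^2 t.\<close>
 moreover have "L \<le> real k * t"
 proof (cases "t \<ge> 1/2")
  case True
  then have "4 * (1/2) \<le> real k * t" using k by (intro mult_mono) auto
  then show ?thesis using L2 by simp
 next
  case False
  then have "t^2 \<le> (1/2)^2" using t by (intro power_mono) auto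
  then have "3/4 \<le> 1 - t^2" by (simp add: power2_eq_square)
  then have "2 * real k * L * (3/4) \<le> 2 * real k * L * (1 - t^2)" using Lp by (intro mult_left_mono) auto
  also have "... \<le> (real k)^2 * 1 * t" unfolding e' using Dk t by (intro mult_right_mono) auto
  finally have "real k * (3/2 * L) \<le> real k * (real k * t)" by (simp add: power2_eq_square algebra_simps)
  then have "3/2 * L \<le> real k * t" by (rule mult_left_le_imp_le) (use k in simp)
  then show ?thesis using Lp by simp
 qed
 ultimately show "real k * \<bar>\<tau>\<bar> \<le> 4 * (1 - (Lam \<phi>)^2 / 24) \<and> \<bar>Lam \<phi>\<bar> \<le> real k * \<bar>\<tau>\<bar>"
  by (simp add: t_def L_def)
qed

section \<open>The quotient of sin (k X) by sin X as a cosine sum\<close>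

text \<open>This is sin (k X) / sin X with the removable singularities filled, a form that can be
  differentiated and evaluated at 0 and pi without case distinctions. For k \<ge> 1 it is the
  Chebyshev polynomial of the second kind of degree k - 1 in cos X.\<close>

definition Dir :: "nat => real => real" where
 "Dir k X = (\<Sum>j<k. cos ((real k - 1 - 2 * real j) * X))"

definition Dir' :: "nat => real => real" where
 "Dir' k X = (\<Sum>j<k. - ((real k - 1 - 2 * real j) * sin ((real k - 1 - 2 * real j) * X)))"

definition Dir'' :: "nat => real => real" where
 "Dir'' k X = (\<Sum>j<k. - ((real k - 1 - 2 * real j)^2 * cos ((real k - 1 - 2 * real j) * X)))"

lemma sin_mult_Dir: "sin X * Dir k X = sin (real k * X)"
proof -
 have "2 * (sin X * Dir k X) = (\<Sum>j<k. sin ((real k - 2 * real j) * X) - sin ((real k - 2 * real (Suc j)) * X))"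
  unfolding Dir_def sum_distrib_left
 proof (rule sum.cong[OF refl])
  fix j
  have "2 * (sin X * cos ((real k - 1 - 2 * real j) * X)) =
    sin ((real k - 1 - 2 * real j) * X + X) - sin ((real k - 1 - 2 * real j) * X - X)"
   by (simp add: sin_add sin_diff)
  moreover have "(real k - 1 - 2 * real j) * X + X = (real k - 2 * real j) * X"
   "(real k - 1 - 2 * real j) * X - X = (real k - 2 * real (Suc j)) * X" by (simp_all add: algebra_simps)
  ultimately show "2 * (sin X * cos ((real k - 1 - 2 * real j) * X)) =
    sin ((real k - 2 * real j) * X) - sin ((real k - 2 * real (Suc j)) * X)" by simp
 qed
 also have "... = sin (real k * X) - sin ((real k - 2 * real k) * X)"
  using sum_lessThan_telescope'[of "\<lambda>j. sin ((real k - 2 * real j) * X)" k] by simp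
 also have "... = 2 * sin (real k * X)" by (simp add: algebra_simps)
 finally show ?thesis by simp
qed

lemma DERIV_Dir: "(Dir k has_real_derivative Dir' k X) (at X within S)"
 unfolding Dir_def[abs_def] Dir'_def by (auto intro!: derivative_eq_intros sum.cong)

lemma DERIV_Dir': "(Dir' k has_real_derivative Dir'' k X) (at X within S)"
 unfolding Dir'_def[abs_def] Dir''_def
 by (auto intro!: derivative_eq_intros sum.cong simp: power2_eq_square)

lemma continuous_Dir: "continuous_on S (Dir k)" "continuous_on S (Dir' k)" "continuous_on S (Dir'' k)"
 unfolding Dir_def[abs_def] Dir'_def[abs_def] Dir''_def[abs_def] by (intro continuous_intros)+

lemma abs_Dir_le: "\<bar>Dir k X\<bar> \<le> real k"
proof -
 have "\<bar>Dir k X\<bar> \<le> (\<Sum>j<k. \<bar>cos ((real k - 1 - 2 * real j) * X)\<bar>)" unfolding Dir_def by (rule sum_abs)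
 also have "... \<le> (\<Sum>j<k. 1)" by (intro sum_mono) simp
 finally show ?thesis by simp
qed

lemma Dir_0: "Dir k 0 = real k" by (simp add: Dir_def)

lemma Dir'_0: "Dir' k 0 = 0" by (simp add: Dir'_def)

lemma int_multiple_pi:
 assumes "j < k"
 obtains i :: int where "(real k - 1 - 2 * real j) * pi = of_int i * pi" "even i \<longleftrightarrow> odd k"
proof
 show "(real k - 1 - 2 * real j) * pi = of_int (int k - 1 - 2 * int j) * pi" by simp
 show "even (int k - 1 - 2 * int j) \<longleftrightarrow> odd k" by simp
qed

lemma Dir_reflect: "Dir k (pi - X) = (- 1) ^ (k + 1) * Dir k X"
 unfolding Dir_def sum_distrib_left
proof (rule sum.cong[OF refl])
 fix j assume "j \<in> {..<k}"
 then obtain i :: int where i: "(real k - 1 - 2 * real j) * pi = of_int i * pi" "even i \<longleftrightarrow> odd k"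
  using int_multiple_pi[of j k] by auto
 have "sin (of_int i * pi) = 0" by (simp add: sin_zero_iff_int2)
 moreover have "cos (of_int i * pi) = (- 1) ^ (k + 1)"
 proof (cases "odd k")
  case True
  then obtain m where m: "i = 2 * m" using i(2) by (auto elim: evenE)
  have "cos (of_int i * pi) = cos (2 * pi * of_int m)" by (simp add: m algebra_simps)
  then show ?thesis using True by simp
 next
  case False
  then obtain m where m: "i = 2 * m + 1" using i(2) by (auto elim: oddE)
  have "cos (of_int i * pi) = cos (2 * pi * of_int m + pi)" by (simp add: m algebra_simps)
  also have "... = - 1" using cos_periodic_pi[of "2 * pi * of_int m"] by simp
  finally show ?thesis using False by simp
 qed
 ultimately show "cos ((real k - 1 - 2 * real j) * (pi - X)) = (- 1) ^ (k + 1) * cos ((real k - 1 - 2 * real j) * X)"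
  using i(1) by (simp add: right_diff_distrib cos_diff)
qed

lemma Dir'_pi: "Dir' k pi = 0"
 unfolding Dir'_def
proof (rule sum.neutral, rule ballI)
 fix j assume "j \<in> {..<k}"
 then obtain i :: int where i: "(real k - 1 - 2 * real j) * pi = of_int i * pi"
  using int_multiple_pi[of j k] by auto
 have "sin (of_int i * pi) = 0" by (simp add: sin_zero_iff_int2)
 then show "- ((real k - 1 - 2 * real j) * sin ((real k - 1 - 2 * real j) * pi)) = 0" using i by simp
qed

text \<open>Both sides agree after multiplication by sin X, the zeros of sine are isolated, and
  continuity does the rest. The factor cos X for even k is what puts the line x = N / 2 into the
  nodal set of \<open>v0\<close>.\<close>

lemma Dir_double: "Dir (2 * m) X = 2 * cos X * Dir m (2 * X)"
proof -
 have "sin z * Dir (2 * m) z = sin z * (2 * cos z * Dir m (2 * z))" for z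
  using sin_mult_Dir[of z "2 * m"] sin_mult_Dir[of "2 * z" m] sin_double[of z] by (simp add: algebra_simps)
 then have ne: "Dir (2 * m) z = 2 * cos z * Dir m (2 * z)" if "sin z \<noteq> 0" for z using that by (metis mult_left_cancel)
 define f where "f z = Dir (2 * m) z - 2 * cos z * Dir m (2 * z)" for z
 have cf: "isCont f z" for z
 proof -
  have "continuous_on UNIV f" unfolding f_def
   by (intro continuous_intros continuous_Dir continuous_on_compose2[OF continuous_Dir(1)[of UNIV]]) auto
  then show ?thesis by (simp add: continuous_on_eq_continuous_at)
 qed
 have "f X = 0"
 proof (cases "sin X = 0")
  case True
  have "((\<lambda>z. sin z - sin X) has_real_derivative cos X) (at X)" by (auto intro!: derivative_eq_intros)
  then have "\<forall>\<^sub>F z in at X. f z = 0"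
  proof -
   have "\<bar>cos X\<bar> = 1" using True sin_zero_abs_cos_one by blast
   then have "((\<lambda>z. (sin z - sin X) / (z - X)) \<longlongrightarrow> cos X) (at X)" "cos X \<noteq> 0"
    using DERIV_sin[of X] by (auto simp: has_field_derivative_iff)
   then have "\<forall>\<^sub>F z in at X. (sin z - sin X) / (z - X) \<noteq> 0" using tendsto_imp_eventually_ne by blast
   then show ?thesis by (rule eventually_mono) (use True ne in \<open>auto simp: f_def\<close>)
  qed
  then have "(f \<longlongrightarrow> 0) (at X)" by (rule tendsto_eventually)
  then show ?thesis using cf[of X] unfolding isCont_def using tendsto_unique[of "at X"] by force
 qed (simp add: f_def ne)
 then show ?thesis by (simp add: f_def)
qed

text \<open>Obtained by differentiating \<open>sin_mult_Dir\<close>. Where r Dir + 4 a cos X and its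
  derivative vanish together, only the cosines of frequencies k and 2 remain, and they have to
  cancel.\<close>

lemma sin_mult_Dir':
 "sin X * (r * Dir' k X - 4 * a * sin X) =
  r * real k * cos (real k * X) + 4 * a * cos (2 * X) - cos X * (r * Dir k X + 4 * a * cos X)"
proof -
 have "((\<lambda>X. sin X * Dir k X) has_real_derivative cos X * Dir k X + Dir' k X * sin X) (at X)"
  by (rule DERIV_mult[OF DERIV_sin DERIV_Dir])
 moreover have "((\<lambda>X. sin X * Dir k X) has_real_derivative real k * cos (real k * X)) (at X)"
  unfolding sin_mult_Dir by (auto intro!: derivative_eq_intros)
 ultimately have e: "cos X * Dir k X + Dir' k X * sin X = real k * cos (real k * X)" by (rule DERIV_unique)
 have "sin X * (r * Dir' k X - 4 * a * sin X) = r * (cos X * Dir k X + Dir' k X * sin X) - r * (cos X * Dir k X) - 4 * a * (sin X)^2"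
  by (simp add: algebra_simps power2_eq_square)
 also have "... = r * real k * cos (real k * X) + 4 * a * ((cos X)^2 - (sin X)^2) - cos X * (r * Dir k X + 4 * a * cos X)"
  unfolding e by (simp add: algebra_simps power2_eq_square)
 finally show ?thesis by (simp add: cos_double)
qed

subsection \<open>Components of sign regions\<close>

text \<open>The projection of an open set to the first coordinate is an open map, and an open map
  with connected fibres has connected preimages of connected sets.\<close>

lemma connected_if_connected_fibres:
 fixes D :: "(real \<times> real) set"
 assumes D: "open D" and I: "connected (fst ` D)" and f: "\<And>x. connected {y. (x, y) \<in> D}"
 shows "connected D"
proof -
 have "connected (D \<inter> fst -` (fst ` D))"
 proof (rule connected_open_monotone_preimage[OF _ refl _ _ I order_refl])
  show "continuous_on D fst" by (intro continuous_intros)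
  fix C assume "openin (top_of_set D) C"
  then have "open C" using D by (simp add: openin_open_eq)
  then have "open (fst ` C)" by (rule open_image_fst)
  moreover have "fst ` C \<subseteq> fst ` D"
   using \<open>openin (top_of_set D) C\<close> openin_imp_subset by (intro image_mono) blast
  ultimately show "openin (top_of_set (fst ` D)) (fst ` C)" by (simp add: open_subset)
 next
  fix x assume "x \<in> fst ` D"
  have "D \<inter> fst -` {x} = {x} \<times> {y. (x, y) \<in> D}" by auto
  then show "connected (D \<inter> fst -` {x})" using f[of x] by (simp add: connected_Times)
 qed
 moreover have "D \<inter> fst -` (fst ` D) = D" by auto
 ultimately show ?thesis by simp
qed

lemma card_components_family:
 fixes D :: "'k => (real \<times> real) set"
 assumes U: "(\<Union>i\<in>K. D i) = S" and dj: "\<And>i j. i \<in> K ==> j \<in> K ==> i \<noteq> j ==> D i \<inter> D j = {}"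
  and D: "\<And>i. i \<in> K ==> open (D i)" "\<And>i. i \<in> K ==> connected (D i)" "\<And>i. i \<in> K ==> D i \<noteq> {}"
 shows "card (components S) = card K"
proof -
 have "D ` K = components S"
 proof (rule components_open_unique[symmetric])
  show "pairwise disjnt (D ` K)" using dj by (auto simp: pairwise_def disjnt_def)
  show "\<Union> (D ` K) = S" using U by simp
  show "open X \<and> connected X \<and> X \<noteq> {}" if "X \<in> D ` K" for X using that D by auto
 qed
 moreover have "inj_on D K" using dj D(3) by (intro inj_onI) (metis Int_absorb)
 ultimately show ?thesis by (metis card_image)
qed

lemma unit_interval_cos:
 assumes "\<bar>c\<bar> < 1"
 obtains y where "0 < y" "y < 1" "cos (pi * y) = c"
proof
 have "0 < arccos c" "arccos c < pi" using assms arccos_lt_bounded[of c] by auto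
 then show "0 < arccos c / pi" "arccos c / pi < 1" by (auto simp: divide_less_eq)
 show "cos (pi * (arccos c / pi)) = c" using assms by (simp add: cos_arccos_abs)
qed

text \<open>Each vertical fibre of a sign region of \<open>A x + B x cos (\<pi> y)\<close> is an interval, which is nonempty
 iff \<open>A x + \<bar>B x\<bar>\<close> is positive.\<close>

lemma sign_region:
 fixes A B :: "real => real"
 assumes I: "open I" "connected I" "I \<noteq> {}" and c: "continuous_on UNIV A" "continuous_on UNIV B"
  and E: "\<And>x. x \<in> I ==> 0 < A x + \<bar>B x\<bar>"
 defines "D \<equiv> {(x, y). x \<in> I \<and> 0 < y \<and> y < 1 \<and> 0 < A x + B x * cos (pi * y)}"
 shows "open D" "connected D" "D \<noteq> {}"
proof -
 have eq: "D = (I \<times> {0<..<1}) \<inter> (\<lambda>p. A (fst p) + B (fst p) * cos (pi * snd p)) -` {0<..}"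
  by (auto simp: D_def)
 have cc: "continuous_on S (\<lambda>p :: real \<times> real. f (fst p))" if "continuous_on UNIV f" for f :: "real => real" and S
  by (rule continuous_on_compose2[OF that]) (auto intro!: continuous_intros)
 show op: "open D" unfolding eq
  by (intro continuous_open_preimage open_Times I continuous_intros cc c)
 have proj: "fst ` D = I"
 proof
  show "fst ` D \<subseteq> I" by (auto simp: D_def)
  show "I \<subseteq> fst ` D"
  proof
   fix x assume x: "x \<in> I"
   have "\<exists>c. \<bar>c\<bar> < 1 \<and> 0 < A x + B x * c"
   proof (cases "0 < A x")
    case True
    then show ?thesis by (intro exI[of _ 0]) simp
   next
    case False
    define b where "b = \<bar>B x\<bar>"
    have Ab: "0 < A x + b" using E[OF x] by (simp add: b_def)
    then have b0: "b > 0" using False by linarith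
    define r where "r = (- A x) / b"
    have r: "0 \<le> r" unfolding r_def using False b0 by (intro divide_nonneg_pos) auto
    have Ar: "- A x = b * r" using b0 by (simp add: r_def)
    have "b * r < b * 1" using Ab Ar by simp
    then have r1: "r < 1" using b0 by (simp only: mult_less_cancel_left_pos)
    \<comment> \<open>A cosine strictly between the ratio r that is required and 1, so that an
      interior y attains it with either sign.\<close>
    define m where "m = (1 + r) / 2"
    have m: "0 \<le> m" "m < 1" "r < m" using r r1 by (auto simp: m_def)
    have "- A x < b * m" unfolding Ar using m(3) b0 by simp
    moreover have "B x * (sgn (B x) * m) = b * m" by (simp add: b_def abs_sgn mult.assoc[symmetric])
    moreover have "\<bar>sgn (B x) * m\<bar> < 1" using m by (simp add: abs_mult sgn_if)
    ultimately show ?thesis by (intro exI[of _ "sgn (B x) * m"] conjI) linarith+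
   qed
   then obtain c where c: "\<bar>c\<bar> < 1" "0 < A x + B x * c" by blast
   obtain y where "0 < y" "y < 1" "cos (pi * y) = c" using unit_interval_cos[OF c(1)] .
   then have "(x, y) \<in> D" using x c by (simp add: D_def)
   then show "x \<in> fst ` D" by force
  qed
 qed
 show "D \<noteq> {}" using proj I(3) by auto
 show "connected D"
 proof (rule connected_if_connected_fibres[OF op])
  show "connected (fst ` D)" using proj I(2) by simp
  fix x
  show "connected {y. (x, y) \<in> D}"
   unfolding is_interval_connected_1[symmetric] is_interval_1
  proof (intro ballI allI impI)
   fix y1 y2 y assume y1: "y1 \<in> {y. (x, y) \<in> D}" and y2: "y2 \<in> {y. (x, y) \<in> D}" and y: "y1 \<le> y \<and> y \<le> y2"
   have b: "0 < y1" "y1 < 1" "0 < y2" "y2 < 1" and x: "x \<in> I"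
    and P: "0 < A x + B x * cos (pi * y1)" "0 < A x + B x * cos (pi * y2)" using y1 y2 by (auto simp: D_def)
   have "cos (pi * y) \<le> cos (pi * y1)" "cos (pi * y2) \<le> cos (pi * y)"
    using b y by (auto intro!: cos_monotone_0_pi_le)
   then have "0 < A x + B x * cos (pi * y)"
   proof (cases "B x \<ge> 0")
    case True
    then have "B x * cos (pi * y2) \<le> B x * cos (pi * y)" using \<open>cos (pi * y2) \<le> cos (pi * y)\<close> by (rule mult_left_mono[rotated])
    then show ?thesis using P by linarith
   next
    case False
    then have "B x * cos (pi * y1) \<le> B x * cos (pi * y)" using \<open>cos (pi * y) \<le> cos (pi * y1)\<close> by (intro mult_left_mono_neg) auto
    then show ?thesis using P by linarith
   qed
   then show "y \<in> {y. (x, y) \<in> D}" using b y x by (simp add: D_def)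
  qed
 qed
qed

text \<open>Reduces a count in the plane to one on the line: by \<open>sign_region\<close> each
  interval of \<open>K1\<close> carries one component of the positive region and each interval of
  \<open>K2\<close> one of the negative region.\<close>

lemma card_components_sign_regions:
 fixes A B :: "real => real" and K1 :: "'i set" and K2 :: "'j set"
 assumes N: "N > 0" and K: "finite K1" "finite K2"
  and c: "continuous_on UNIV A" "continuous_on UNIV B"
  and E1: "\<And>i. i \<in> K1 ==> open (E1 i) \<and> connected (E1 i) \<and> E1 i \<noteq> {}"
   "\<And>i j. i \<in> K1 ==> j \<in> K1 ==> i \<noteq> j ==> E1 i \<inter> E1 j = {}"
   "(\<Union>i\<in>K1. E1 i) = {X. 0 < X \<and> X < pi \<and> 0 < A X + \<bar>B X\<bar>}"
  and E2: "\<And>i. i \<in> K2 ==> open (E2 i) \<and> connected (E2 i) \<and> E2 i \<noteq> {}"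
   "\<And>i j. i \<in> K2 ==> j \<in> K2 ==> i \<noteq> j ==> E2 i \<inter> E2 j = {}"
   "(\<Union>i\<in>K2. E2 i) = {X. 0 < X \<and> X < pi \<and> 0 < - A X + \<bar>B X\<bar>}"
 shows "card (components {(x, y). 0 < x \<and> x < N \<and> 0 < y \<and> y < 1 \<and>
  A (pi * x / N) + B (pi * x / N) * cos (pi * y) \<noteq> 0}) = card K1 + card K2"
proof -
 define V where "V E = (\<lambda>x. pi * x / N) -` E" for E :: "real set"
 have V: "open (V E) \<and> connected (V E) \<and> V E \<noteq> {}" if "open E \<and> connected E \<and> E \<noteq> {}" for E
 proof -
  have "open (V E)" unfolding V_def using that by (intro open_vimage continuous_intros) (use N in auto)
  moreover have eq: "V E = (\<lambda>X. N * X / pi) ` E"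
  proof -
   have "x \<in> (\<lambda>X. N * X / pi) ` E" if "x \<in> V E" for x
    by (rule image_eqI[of _ _ "pi * x / N"]) (use that N in \<open>auto simp: V_def\<close>)
   then show ?thesis using N by (auto simp: V_def)
  qed
  have "connected ((\<lambda>X. N * X / pi) ` E)" by (rule connected_continuous_image) (use that in \<open>auto intro!: continuous_intros\<close>)
  ultimately show ?thesis using that eq by simp
 qed
 define R where "R s E = {(x, y). x \<in> V E \<and> 0 < y \<and> y < 1 \<and> 0 < s * A (pi * x / N) + (s * B (pi * x / N)) * cos (pi * y)}"
  for s :: real and E
 have cc: "continuous_on UNIV (\<lambda>x. s * f (pi * x / N))" if "continuous_on UNIV f" for f :: "real => real" and s :: real
  by (intro continuous_intros continuous_on_compose2[OF that]) (use N in auto)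
 have R: "open (R s E) \<and> connected (R s E) \<and> R s E \<noteq> {}"
  if "open E \<and> connected E \<and> E \<noteq> {}" "\<And>X. X \<in> E ==> 0 < s * A X + \<bar>s * B X\<bar>" for s E
  unfolding R_def using V[OF that(1)] that(2)
  by (intro conjI sign_region cc c) (auto simp: V_def)
 define D where "D = case_sum (\<lambda>i. R 1 (E1 i)) (\<lambda>j. R (-1) (E2 j))"
 let ?S = "{(x, y). 0 < x \<and> x < N \<and> 0 < y \<and> y < 1 \<and> A (pi * x / N) + B (pi * x / N) * cos (pi * y) \<noteq> 0}"
 have X: "0 < x \<and> x < N \<longleftrightarrow> 0 < pi * x / N \<and> pi * x / N < pi" for x
  using N by (auto simp: zero_less_divide_iff zero_less_mult_iff divide_less_eq)
 have ab: "B x * cos z \<le> \<bar>B x\<bar>" "- (B x * cos z) \<le> \<bar>B x\<bar>" for x z :: real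
 proof -
  have "\<bar>B x * cos z\<bar> \<le> \<bar>B x\<bar> * 1" unfolding abs_mult by (intro mult_left_mono) auto
  then show "B x * cos z \<le> \<bar>B x\<bar>" "- (B x * cos z) \<le> \<bar>B x\<bar>" by linarith+
 qed
 have "card (components ?S) = card (K1 <+> K2)"
 proof (rule card_components_family[where D = D])
  show "open (D i)" "connected (D i)" "D i \<noteq> {}" if "i \<in> K1 <+> K2" for i
  proof -
   have "open (D i) \<and> connected (D i) \<and> D i \<noteq> {}"
    using that
   proof (rule PlusE)
    fix a assume a: "a \<in> K1" "i = Inl a"
    have "0 < 1 * A X + \<bar>1 * B X\<bar>" if "X \<in> E1 a" for X using E1(3) a that by auto
    from R[OF E1(1)[OF a(1)] this] show ?thesis using a by (simp add: D_def)
   next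
    fix a assume a: "a \<in> K2" "i = Inr a"
    have "0 < (-1) * A X + \<bar>(-1) * B X\<bar>" if "X \<in> E2 a" for X using E2(3) a that by auto
    from R[OF E2(1)[OF a(1)] this] show ?thesis using a by (simp add: D_def)
   qed
   then show "open (D i)" "connected (D i)" "D i \<noteq> {}" by auto
  qed
  show "D i \<inter> D j = {}" if "i \<in> K1 <+> K2" "j \<in> K1 <+> K2" "i \<noteq> j" for i j
  proof -
   have "R 1 E \<inter> R (-1) E' = {}" for E E' by (auto simp: R_def)
   moreover have same: "R s E \<inter> R s E' = {}" if "E \<inter> E' = {}" for s E E' using that by (auto simp: R_def V_def)
   moreover note same[OF E1(2)] same[OF E2(2)]
   ultimately show ?thesis using that
    by (elim PlusE) (simp_all add: D_def Int_commute)
  qed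
  show "(\<Union>i\<in>K1 <+> K2. D i) = ?S"
  proof -
   have "(\<Union>i\<in>K1 <+> K2. D i) = (\<Union>i\<in>K1. R 1 (E1 i)) \<union> (\<Union>i\<in>K2. R (-1) (E2 i))"
    by (auto simp: D_def Plus_def)
   also have "... = R 1 (\<Union>i\<in>K1. E1 i) \<union> R (-1) (\<Union>i\<in>K2. E2 i)" by (auto simp: R_def V_def)
   also have "... = ?S"
   proof (intro set_eqI iffI)
    fix p assume p: "p \<in> R 1 (\<Union>i\<in>K1. E1 i) \<union> R (-1) (\<Union>i\<in>K2. E2 i)"
    then show "p \<in> ?S" unfolding E1(3) E2(3) using X[of "fst p"] by (cases p) (auto simp: R_def V_def)
   next
    fix p assume p: "p \<in> ?S"
    obtain x y where xy: "p = (x, y)" by (cases p)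
    define Xx where "Xx = pi * x / N"
    have pS: "0 < x \<and> x < N" "0 < y" "y < 1" "A Xx + B Xx * cos (pi * y) \<noteq> 0" using p by (simp_all add: xy Xx_def)
    have b: "0 < Xx \<and> Xx < pi" using X pS(1) unfolding Xx_def by blast
    note ab' = ab[of Xx "pi * y"]
    show "p \<in> R 1 (\<Union>i\<in>K1. E1 i) \<union> R (-1) (\<Union>i\<in>K2. E2 i)"
    proof (cases "0 < A Xx + B Xx * cos (pi * y)")
     case True
     then have "Xx \<in> (\<Union>i\<in>K1. E1 i)" unfolding E1(3) using b ab' by simp
     then have "p \<in> R 1 (\<Union>i\<in>K1. E1 i)" unfolding R_def V_def xy using True pS(2,3) by (simp add: Xx_def)
     then show ?thesis ..
    next
     case False
     then have "A Xx + B Xx * cos (pi * y) < 0" using pS(4) by linarith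
     moreover from this have "Xx \<in> (\<Union>i\<in>K2. E2 i)" unfolding E2(3) using b ab' by simp
     ultimately have "p \<in> R (-1) (\<Union>i\<in>K2. E2 i)" unfolding R_def V_def xy using pS(2,3) by (simp add: Xx_def)
     then show ?thesis ..
    qed
   qed
   finally show ?thesis .
  qed
 qed
 then show ?thesis using K by (simp add: card_Plus)
qed

section \<open>Sign changes of functions of one variable\<close>

text \<open>f decreases through each of its zeros, so it can cross 0 only downwards. At a first
  return to 0 it would have to decrease although it was negative just before.\<close>

lemma negative_persists:
 fixes f f' :: "real => real"
 assumes d: "\<And>x. x \<in> {a..b} ==> (f has_real_derivative f' x) (at x)"
  and z: "\<And>x. x \<in> {a..b} ==> f x = 0 ==> f' x < 0"
  and x: "a \<le> x" "x < y" "y \<le> b" and fx: "f x \<le> 0"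
 shows "f y < 0"
proof (rule ccontr)
 assume fy: "\<not> f y < 0"
 have c: "continuous_on {a..b} f" by (intro continuous_at_imp_continuous_on ballI DERIV_isCont[OF d])
 obtain x1 where x1: "x \<le> x1" "x1 < y" "f x1 < 0"
 proof (cases "f x = 0")
  case True
  have xab: "x \<in> {a..b}" using x by simp
  obtain e where e: "e > 0" "\<And>h. h > 0 ==> h < e ==> f (x + h) < f x"
   using DERIV_neg_dec_right[OF d[OF xab] z[OF xab True]] by blast
  define h where "h = min e (y - x) / 2"
  have h: "0 < h" "h < e" "x + h < y" using e(1) x by (auto simp: h_def min_def field_simps)
  show ?thesis by (rule that[of "x + h"]) (use h e(2)[OF h(1,2)] True in linarith)+
 next
  case False
  show ?thesis by (rule that[of x]) (use fx x False in linarith)+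
 qed
 let ?S = "{x1..y} \<inter> f -` {0..}"
 have cl: "closed ?S"
 proof (rule continuous_closed_preimage)
  show "continuous_on {x1..y} f" by (rule continuous_on_subset[OF c]) (use x1 x in auto)
 qed auto
 have ne: "?S \<noteq> {}" using fy x1 by (intro ex_in_conv[THEN iffD1] exI[of _ y]) auto
 have bd: "bdd_below ?S" by (intro bdd_belowI[of _ x1]) auto
 define w where "w = Inf ?S"
 have wS: "w \<in> ?S" unfolding w_def by (rule closed_contains_Inf[OF ne bd cl])
 have below: "f s < 0" if "x1 \<le> s" "s < w" for s
 proof (rule ccontr)
  assume "\<not> f s < 0"
  then have "s \<in> ?S" using that wS by auto
  then have "w \<le> s" unfolding w_def by (rule cInf_lower[OF _ bd])
  then show False using that by simp
 qed
 have x1w: "x1 < w" using wS x1 by (cases "x1 = w") auto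
 have fw: "f w = 0"
 proof (rule ccontr)
  assume "f w \<noteq> 0"
  then have "f w > 0" using wS by auto
  moreover have "continuous_on {x1..w} f" by (rule continuous_on_subset[OF c]) (use wS x1 x in auto)
  ultimately obtain s where "x1 \<le> s" "s \<le> w" "f s = 0" using IVT'[of f x1 0 w] x1(3) x1w by force
  then show False using below[of s] \<open>f w \<noteq> 0\<close> by (cases "s = w") auto
 qed
 have wab: "w \<in> {a..b}" using wS x1 x by auto
 obtain e where e: "e > 0" "\<And>h. h > 0 ==> h < e ==> f w < f (w - h)"
  using DERIV_neg_dec_left[OF d[OF wab] z[OF wab fw]] by blast
 define h where "h = min e (w - x1) / 2"
 have "0 < h" "h < e" "x1 \<le> w - h" using e(1) x1w by (auto simp: h_def min_def field_simps)
 then show False using e(2)[of h] below[of "w - h"] fw by linarith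
qed

text \<open>The signs at two abscissae on either side of \<xi> y persist for nearby parameters and
  trap the crossing. This gives continuity of an implicitly defined curve from signs alone, without
  a bound on a derivative.\<close>

lemma continuous_on_unique_crossing:
 fixes F :: "real => real => real" and a b :: real
 assumes c: "\<And>x. x \<in> {a..b} ==> continuous_on S (F x)"
  and \<xi>: "\<And>y. y \<in> S ==> a < \<xi> y \<and> \<xi> y < b"
  and neg: "\<And>x y. y \<in> S ==> a \<le> x ==> x < \<xi> y ==> F x y < 0"
  and pos: "\<And>x y. y \<in> S ==> \<xi> y < x ==> x \<le> b ==> 0 < F x y"
 shows "continuous_on S (\<xi> :: real => real)"
 unfolding continuous_on_def
proof (intro ballI)
 fix y assume y: "y \<in> S"
 show "(\<xi> \<longlongrightarrow> \<xi> y) (at y within S)"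
 proof (rule order_tendstoI)
  fix l assume l: "l < \<xi> y"
  define x where "x = (max a l + \<xi> y) / 2"
  have x: "a \<le> x" "x < \<xi> y" "l < x" "x \<le> b" using l \<xi>[OF y] by (auto simp: x_def max_def)
  have "(F x \<longlongrightarrow> F x y) (at y within S)" using c[of x] x y by (simp add: continuous_on_def)
  then have "\<forall>\<^sub>F z in at y within S. F x z < 0" using neg[OF y x(1,2)] by (rule order_tendstoD)
  moreover have "\<forall>\<^sub>F z in at y within S. z \<in> S" by (simp add: eventually_at_filter)
  ultimately show "\<forall>\<^sub>F z in at y within S. l < \<xi> z"
  proof eventually_elim
   case (elim z)
   have "\<not> \<xi> z < x"
   proof
    assume "\<xi> z < x"
    from pos[OF elim(2) this x(4)] elim(1) show False by simp
   qed
   then show ?case using x(3) by simp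
  qed
 next
  fix r assume r: "\<xi> y < r"
  define x where "x = (min b r + \<xi> y) / 2"
  have x: "x \<le> b" "\<xi> y < x" "x < r" "a \<le> x" using r \<xi>[OF y] by (auto simp: x_def min_def)
  have "(F x \<longlongrightarrow> F x y) (at y within S)" using c[of x] x y by (simp add: continuous_on_def)
  then have "\<forall>\<^sub>F z in at y within S. 0 < F x z" using pos[OF y x(2,1)] by (rule order_tendstoD)
  moreover have "\<forall>\<^sub>F z in at y within S. z \<in> S" by (simp add: eventually_at_filter)
  ultimately show "\<forall>\<^sub>F z in at y within S. \<xi> z < r"
  proof eventually_elim
   case (elim z)
   have "\<not> x < \<xi> z"
   proof
    assume "x < \<xi> z"
    from neg[OF elim(2) x(4) this] elim(1) show False by simp
   qed
   then show ?case using x(3) by simp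
  qed
 qed
qed

subsection \<open>Local structure of the nodal set\<close>

lemma mean_value_between:
 fixes f :: "real => real"
 assumes "\<And>x. (f has_real_derivative f' x) (at x)"
 shows "\<exists>\<xi>. \<bar>\<xi> - a\<bar> \<le> \<bar>b - a\<bar> \<and> f b - f a = f' \<xi> * (b - a)"
proof -
 consider "a = b" | "a < b" | "b < a" by linarith
 then show ?thesis
 proof cases
  case 1
  then show ?thesis by (intro exI[of _ a]) simp
 next
  case 2
  then obtain z where "a < z" "z < b" "f b - f a = (b - a) * f' z" using MVT2[of a b f f'] assms by blast
  then show ?thesis by (intro exI[of _ z]) auto
 next
  case 3
  then obtain z where "b < z" "z < a" "f a - f b = (a - b) * f' z" using MVT2[of b a f f'] assms by blast
  then show ?thesis by (intro exI[of _ z]) (auto simp: algebra_simps)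
 qed
qed

text \<open>Implicit function theorem in the form the local pictures ask for: inside a whole box the
  zero set is a graph over y, with derivatives up to the ends of the interval. Monotonicity of H in
  x gives existence and uniqueness, \<open>continuous_on_unique_crossing\<close> the continuity, and
  mean values the derivative.\<close>

lemma implicit_graph_pos:
 fixes H Hx Hy :: "real => real => real"
 assumes dx: "\<And>x y. ((\<lambda>x. H x y) has_real_derivative Hx x y) (at x)"
  and dy: "\<And>x y. ((\<lambda>y. H x y) has_real_derivative Hy x y) (at y)"
  and cx: "continuous_on UNIV (\<lambda>p. Hx (fst p) (snd p))" and cy: "continuous_on UNIV (\<lambda>p. Hy (fst p) (snd p))"
  and H0: "H x0 y0 = 0" and Hx0: "Hx x0 y0 > 0" and e: "e > 0"
 shows "\<exists>r \<delta> X. 0 < r \<and> r < e \<and> 0 < \<delta> \<and> \<delta> < e \<and> X y0 = x0 \<and>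
  (\<forall>y. \<bar>y - y0\<bar> \<le> r \<longrightarrow> \<bar>X y - x0\<bar> < \<delta>) \<and>
  (\<forall>x y. \<bar>y - y0\<bar> \<le> r \<longrightarrow> \<bar>x - x0\<bar> \<le> \<delta> \<longrightarrow> (H x y = 0 \<longleftrightarrow> x = X y)) \<and>
  (\<forall>y. \<bar>y - y0\<bar> \<le> r \<longrightarrow> Hx (X y) y \<noteq> 0 \<and>
    (X has_real_derivative - (Hy (X y) y / Hx (X y) y)) (at y within {y0-r..y0+r}))"
proof -
 have "open ((\<lambda>p. Hx (fst p) (snd p)) -` {0<..})" by (intro open_vimage cx) simp
 moreover have "(x0, y0) \<in> (\<lambda>p. Hx (fst p) (snd p)) -` {0<..}" using Hx0 by simp
 ultimately obtain A B where "open A" "open B" "(x0, y0) \<in> A \<times> B"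
  and AB: "A \<times> B \<subseteq> (\<lambda>p. Hx (fst p) (snd p)) -` {0<..}"
  by (rule open_prod_elim)
 then have A: "open A" "x0 \<in> A" and B: "open B" "y0 \<in> B" by auto
 have pos: "Hx x y > 0" if "x \<in> A" "y \<in> B" for x y using AB that by (auto simp: subset_iff)
 obtain a where a: "a > 0" "\<And>x. \<bar>x - x0\<bar> < a ==> x \<in> A"
  using A by (auto simp: open_dist dist_real_def)
 obtain b where b: "b > 0" "\<And>y. \<bar>y - y0\<bar> < b ==> y \<in> B"
  using B by (auto simp: open_dist dist_real_def)
 define \<delta> where "\<delta> = min a e / 2"
 have \<delta>: "0 < \<delta>" "\<delta> < a" "\<delta> < e" using a(1) e by (auto simp: \<delta>_def)
 have inc: "H x y < H x' y" if "x < x'" "\<bar>x - x0\<bar> \<le> \<delta>" "\<bar>x' - x0\<bar> \<le> \<delta>" "y \<in> B" for x x' y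
 proof (rule DERIV_pos_imp_increasing[OF that(1), where f = "\<lambda>x. H x y"])
  fix z assume z: "x \<le> z" "z \<le> x'"
  have "z \<in> A" by (rule a(2)) (use z that \<delta> in linarith)
  then show "\<exists>D. ((\<lambda>x. H x y) has_real_derivative D) (at z) \<and> 0 < D" using dx pos that(4) by blast
 qed
 have cyH: "continuous (at y) (\<lambda>y. H x y)" for x y using DERIV_isCont[OF dy] .
 have "((\<lambda>y. H (x0 + \<delta>) y) \<longlongrightarrow> H (x0 + \<delta>) y0) (at y0)" "((\<lambda>y. H (x0 - \<delta>) y) \<longlongrightarrow> H (x0 - \<delta>) y0) (at y0)"
  using cyH by (auto simp: isCont_def)
 moreover have H1: "0 < H (x0 + \<delta>) y0" "H (x0 - \<delta>) y0 < 0"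
  using inc[of x0 "x0 + \<delta>" y0] inc[of "x0 - \<delta>" x0 y0] \<delta> B H0 by auto
 ultimately have "\<forall>\<^sub>F y in at y0. 0 < H (x0 + \<delta>) y" "\<forall>\<^sub>F y in at y0. H (x0 - \<delta>) y < 0"
  by (auto intro: order_tendstoD)
 then have "\<forall>\<^sub>F y in at y0. 0 < H (x0 + \<delta>) y \<and> H (x0 - \<delta>) y < 0" by (rule eventually_conj)
 then obtain d where d: "d > 0" "\<And>y. y \<noteq> y0 ==> \<bar>y - y0\<bar> < d ==> 0 < H (x0 + \<delta>) y \<and> H (x0 - \<delta>) y < 0"
  unfolding eventually_at dist_real_def by blast
 define r where "r = min (min b d) e / 2"
 have r: "0 < r" "r < b" "r < d" "r < e" using b(1) d(1) e by (auto simp: r_def)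
 let ?S = "{y0-r..y0+r}"
 have yS: "y \<in> ?S \<longleftrightarrow> \<bar>y - y0\<bar> \<le> r" for y by auto
 have yB: "y \<in> B" if "\<bar>y - y0\<bar> \<le> r" for y by (rule b(2)) (use that r in linarith)
 have ends: "0 < H (x0 + \<delta>) y" "H (x0 - \<delta>) y < 0" if "\<bar>y - y0\<bar> \<le> r" for y
  using d(2)[of y] H1 that r by (cases "y = y0"; force)+
 have "\<exists>x. \<bar>x - x0\<bar> < \<delta> \<and> H x y = 0" if y: "\<bar>y - y0\<bar> \<le> r" for y
 proof -
  have "continuous_on {x0 - \<delta>..x0 + \<delta>} (\<lambda>x. H x y)"
   by (intro continuous_at_imp_continuous_on ballI DERIV_isCont[OF dx])
  then obtain x where x: "x0 - \<delta> \<le> x" "x \<le> x0 + \<delta>" "H x y = 0"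
   using IVT'[of "\<lambda>x. H x y" "x0 - \<delta>" 0 "x0 + \<delta>"] ends[OF y] \<delta> by auto
  moreover have "x \<noteq> x0 - \<delta>" "x \<noteq> x0 + \<delta>" using x(3) ends[OF y] by auto
  ultimately show ?thesis by (intro exI[of _ x]) auto
 qed
 then obtain X where X: "\<And>y. \<bar>y - y0\<bar> \<le> r ==> \<bar>X y - x0\<bar> < \<delta>" "\<And>y. \<bar>y - y0\<bar> \<le> r ==> H (X y) y = 0"
  by metis
 have neg: "H x y < 0" if "\<bar>y - y0\<bar> \<le> r" "x0 - \<delta> \<le> x" "x < X y" for x y
  using inc[of x "X y" y] X[OF that(1)] yB[OF that(1)] that by auto
 have posi: "0 < H x y" if "\<bar>y - y0\<bar> \<le> r" "X y < x" "x \<le> x0 + \<delta>" for x y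
  using inc[of "X y" x y] X[OF that(1)] yB[OF that(1)] that by auto
 have uniq: "H x y = 0 \<longleftrightarrow> x = X y" if "\<bar>y - y0\<bar> \<le> r" "\<bar>x - x0\<bar> \<le> \<delta>" for x y
  using neg[OF that(1), of x] posi[OF that(1), of x] X(2)[OF that(1)] that(2)
  by (cases x "X y" rule: linorder_cases) (auto simp: abs_le_iff)
 have X0: "X y0 = x0" using uniq[of y0 x0] r \<delta> H0 by auto
 have cX: "continuous_on ?S X"
 proof (rule continuous_on_unique_crossing[where F = H and a = "x0 - \<delta>" and b = "x0 + \<delta>"])
  show "continuous_on ?S (H x)" for x
   by (intro continuous_at_imp_continuous_on ballI cyH)
  show "x0 - \<delta> < X y \<and> X y < x0 + \<delta>" if "y \<in> ?S" for y using X(1)[OF iffD1[OF yS that]] by linarith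
 qed (use neg posi yS in auto)
 have nz: "Hx (X y) y \<noteq> 0" if "\<bar>y - y0\<bar> \<le> r" for y
 proof -
  have "X y \<in> A" by (rule a(2)) (use X(1)[OF that] \<delta> in linarith)
  then show ?thesis using pos yB[OF that] by fastforce
 qed
 have der: "(X has_real_derivative - (Hy (X y1) y1 / Hx (X y1) y1)) (at y1 within ?S)" if y1: "\<bar>y1 - y0\<bar> \<le> r" for y1
 proof -
  let ?F = "at y1 within ?S"
  \<comment> \<open>The zero increment of H between two points of the curve is split along the axes.
    Both intermediate points converge, and solving for the quotient gives the derivative.\<close>
  have "\<forall>y. \<exists>\<xi>. \<bar>\<xi> - X y1\<bar> \<le> \<bar>X y - X y1\<bar> \<and> H (X y) y - H (X y1) y = Hx \<xi> y * (X y - X y1)"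
   using mean_value_between[OF dx] by blast
  then obtain \<xi> where \<xi>: "\<And>y. \<bar>\<xi> y - X y1\<bar> \<le> \<bar>X y - X y1\<bar>"
   "\<And>y. H (X y) y - H (X y1) y = Hx (\<xi> y) y * (X y - X y1)" by metis
  have "\<forall>y. \<exists>\<eta>. \<bar>\<eta> - y1\<bar> \<le> \<bar>y - y1\<bar> \<and> H (X y1) y - H (X y1) y1 = Hy (X y1) \<eta> * (y - y1)"
   using mean_value_between[OF dy] by blast
  then obtain \<eta> where \<eta>: "\<And>y. \<bar>\<eta> y - y1\<bar> \<le> \<bar>y - y1\<bar>"
   "\<And>y. H (X y1) y - H (X y1) y1 = Hy (X y1) (\<eta> y) * (y - y1)" by metis
  have tX: "(X \<longlongrightarrow> X y1) ?F" using cX y1 yS by (simp add: continuous_on_def)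
  have t\<xi>: "(\<xi> \<longlongrightarrow> X y1) ?F"
  proof (rule Lim_transform[OF tX])
   have "((\<lambda>y. \<bar>X y - X y1\<bar>) \<longlongrightarrow> \<bar>X y1 - X y1\<bar>) ?F" by (intro tendsto_intros tX)
   then have z: "((\<lambda>y. 2 * \<bar>X y - X y1\<bar>) \<longlongrightarrow> 0) ?F" by (auto intro: tendsto_mult_right_zero)
   show "((\<lambda>y. \<xi> y - X y) \<longlongrightarrow> 0) ?F"
   proof (rule Lim_null_comparison[OF _ z], rule always_eventually, rule allI)
    fix y show "norm (\<xi> y - X y) \<le> 2 * \<bar>X y - X y1\<bar>" using \<xi>(1)[of y] abs_triangle_ineq4[of "\<xi> y - X y1" "X y - X y1"] by simp
   qed
  qed
  have ty: "((\<lambda>y. y) \<longlongrightarrow> y1) ?F" by (rule tendsto_ident_at)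
  have t\<eta>: "(\<eta> \<longlongrightarrow> y1) ?F"
  proof (rule Lim_transform[OF ty])
   have "((\<lambda>y. \<bar>y - y1\<bar>) \<longlongrightarrow> \<bar>y1 - y1\<bar>) ?F" by (intro tendsto_intros)
   then have z: "((\<lambda>y. 2 * \<bar>y - y1\<bar>) \<longlongrightarrow> 0) ?F" by (auto intro: tendsto_mult_right_zero)
   show "((\<lambda>y. \<eta> y - y) \<longlongrightarrow> 0) ?F"
   proof (rule Lim_null_comparison[OF _ z], rule always_eventually, rule allI)
    fix y show "norm (\<eta> y - y) \<le> 2 * \<bar>y - y1\<bar>" using \<eta>(1)[of y] abs_triangle_ineq4[of "\<eta> y - y1" "y - y1"] by simp
   qed
  qed
  have comp: "((\<lambda>y. G (f y) (g y)) \<longlongrightarrow> G p q) ?F"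
   if "continuous_on UNIV (\<lambda>p. G (fst p) (snd p))" "(f \<longlongrightarrow> p) ?F" "(g \<longlongrightarrow> q) ?F" for G :: "real => real => real" and f g p q
  proof -
   have "isCont (\<lambda>p. G (fst p) (snd p)) (p, q)" using that(1) by (simp add: continuous_on_eq_continuous_at)
   from isCont_tendsto_compose[OF this tendsto_Pair[OF that(2,3)]] show ?thesis by simp
  qed
  have l1: "((\<lambda>y. Hx (\<xi> y) y) \<longlongrightarrow> Hx (X y1) y1) ?F" by (rule comp[OF cx t\<xi> ty])
  have l2: "((\<lambda>y. Hy (X y1) (\<eta> y)) \<longlongrightarrow> Hy (X y1) y1) ?F" by (rule comp[OF cy tendsto_const t\<eta>])
  have lim: "((\<lambda>y. - (Hy (X y1) (\<eta> y) / Hx (\<xi> y) y)) \<longlongrightarrow> - (Hy (X y1) y1 / Hx (X y1) y1)) ?F"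
   by (intro tendsto_intros l1 l2 nz[OF y1])
  have "\<forall>\<^sub>F y in ?F. Hx (\<xi> y) y \<noteq> 0" using tendsto_imp_eventually_ne[OF l1 nz[OF y1]] .
  moreover have "\<forall>\<^sub>F y in ?F. y \<in> ?S \<and> y \<noteq> y1" by (simp add: eventually_at_filter)
  ultimately have "\<forall>\<^sub>F y in ?F. - (Hy (X y1) (\<eta> y) / Hx (\<xi> y) y) = (X y - X y1) / (y - y1)"
  proof eventually_elim
   case (elim y)
   have yr: "\<bar>y - y0\<bar> \<le> r" using elim(2) yS by blast
   have "Hx (\<xi> y) y * (X y - X y1) + Hy (X y1) (\<eta> y) * (y - y1) = 0"
    using \<xi>(2)[of y] \<eta>(2)[of y] X(2)[OF yr] X(2)[OF y1] by simp
   then show ?case using elim by (simp add: field_simps)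
  qed
  from Lim_transform_eventually[OF lim this] show ?thesis by (simp add: has_field_derivative_iff)
 qed
 show ?thesis
  by (intro exI[of _ r] exI[of _ \<delta>] exI[of _ X] conjI allI impI r \<delta> X0 X(1) uniq nz der)
qed

lemma implicit_graph:
 fixes H Hx Hy :: "real => real => real"
 assumes dx: "\<And>x y. ((\<lambda>x. H x y) has_real_derivative Hx x y) (at x)"
  and dy: "\<And>x y. ((\<lambda>y. H x y) has_real_derivative Hy x y) (at y)"
  and cx: "continuous_on UNIV (\<lambda>p. Hx (fst p) (snd p))" and cy: "continuous_on UNIV (\<lambda>p. Hy (fst p) (snd p))"
  and H0: "H x0 y0 = 0" and Hx0: "Hx x0 y0 \<noteq> 0" and e: "e > 0"
 obtains r \<delta> X X' where "0 < r" "r < e" "0 < \<delta>" "\<delta> < e" "X y0 = x0" "X' y0 = - (Hy x0 y0 / Hx x0 y0)"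
  "\<And>y. \<bar>y - y0\<bar> \<le> r ==> \<bar>X y - x0\<bar> < \<delta>"
  "\<And>x y. \<bar>y - y0\<bar> \<le> r ==> \<bar>x - x0\<bar> \<le> \<delta> ==> H x y = 0 \<longleftrightarrow> x = X y"
  "\<And>y. \<bar>y - y0\<bar> \<le> r ==> (X has_real_derivative X' y) (at y within {y0-r..y0+r})"
  "continuous_on {y0-r..y0+r} X'"
proof -
 have "\<exists>r \<delta> X. 0 < r \<and> r < e \<and> 0 < \<delta> \<and> \<delta> < e \<and> X y0 = x0 \<and>
  (\<forall>y. \<bar>y - y0\<bar> \<le> r \<longrightarrow> \<bar>X y - x0\<bar> < \<delta>) \<and>
  (\<forall>x y. \<bar>y - y0\<bar> \<le> r \<longrightarrow> \<bar>x - x0\<bar> \<le> \<delta> \<longrightarrow> (H x y = 0 \<longleftrightarrow> x = X y)) \<and>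
  (\<forall>y. \<bar>y - y0\<bar> \<le> r \<longrightarrow> Hx (X y) y \<noteq> 0 \<and>
    (X has_real_derivative - (Hy (X y) y / Hx (X y) y)) (at y within {y0-r..y0+r}))"
 proof (cases "Hx x0 y0 > 0")
  case True
  then show ?thesis by (rule implicit_graph_pos[OF dx dy cx cy H0 _ e])
 next
  case False
  then have "- Hx x0 y0 > 0" using Hx0 by simp
  from implicit_graph_pos[of "\<lambda>x y. - H x y" "\<lambda>x y. - Hx x y" "\<lambda>x y. - Hy x y", OF DERIV_minus[OF dx] DERIV_minus[OF dy] _ _ _ this e]
  show ?thesis using cx cy H0 by (simp add: continuous_on_minus)
 qed
 then obtain r \<delta> X where R: "0 < r" "r < e" "0 < \<delta>" "\<delta> < e" "X y0 = x0"
  "\<And>y. \<bar>y - y0\<bar> \<le> r ==> \<bar>X y - x0\<bar> < \<delta>"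
  "\<And>x y. \<bar>y - y0\<bar> \<le> r ==> \<bar>x - x0\<bar> \<le> \<delta> ==> H x y = 0 \<longleftrightarrow> x = X y"
  "\<And>y. \<bar>y - y0\<bar> \<le> r ==> Hx (X y) y \<noteq> 0"
  "\<And>y. \<bar>y - y0\<bar> \<le> r ==> (X has_real_derivative - (Hy (X y) y / Hx (X y) y)) (at y within {y0-r..y0+r})"
  by blast
 have cX: "continuous_on {y0-r..y0+r} X"
  by (rule DERIV_continuous_on[OF R(9)]) auto
 have comp: "continuous_on {y0-r..y0+r} (\<lambda>y. G (X y) y)" if "continuous_on UNIV (\<lambda>p. G (fst p) (snd p))" for G :: "real => real => real"
 proof -
  have "continuous_on {y0-r..y0+r} (\<lambda>y. (X y, y))" by (intro continuous_intros cX)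
  from continuous_on_compose2[OF that this] show ?thesis by simp
 qed
 have cX': "continuous_on {y0-r..y0+r} (\<lambda>y. - (Hy (X y) y / Hx (X y) y))"
  by (intro continuous_intros comp cx cy) (use R(8) in \<open>auto simp: abs_le_iff\<close>)
 show ?thesis
  by (rule that[OF R(1-5) _ R(6,7,9) cX']) (simp_all add: R(5))
qed

lemma C1_arc_graph:
 fixes f f' :: "real => real"
 assumes d: "\<And>t. t \<in> {0..1} ==> (f has_real_derivative f' t) (at t within {0..1})"
  and c: "continuous_on {0..1} f'" and b: "b \<noteq> 0"
 shows "C1_arc (\<lambda>t. (f t, a + b * t)) (\<lambda>t. (f' t, b))" "C1_arc (\<lambda>t. (a + b * t, f t)) (\<lambda>t. (b, f' t))"
proof -
 have cf: "continuous_on {0..1} f" by (rule DERIV_continuous_on[OF d])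
 have lin: "((\<lambda>t. a + b * t) has_derivative (\<lambda>h. h * b)) (at t within {0..1})" for t
  by (auto intro!: derivative_eq_intros)
 have df: "(f has_derivative (\<lambda>h. h * f' t)) (at t within {0..1})" if "t \<in> {0..1}" for t
 proof -
  have "(*) (f' t) = (\<lambda>h. h * f' t)" by (simp add: fun_eq_iff)
  then show ?thesis using d[OF that] by (simp add: has_field_derivative_def)
 qed
 show "C1_arc (\<lambda>t. (f t, a + b * t)) (\<lambda>t. (f' t, b))"
  unfolding C1_arc_def arc_def path_def has_vector_derivative_def
  using has_derivative_Pair[OF df lin] b
  by (auto intro!: continuous_intros cf c inj_onI simp: zero_prod_def)
 show "C1_arc (\<lambda>t. (a + b * t, f t)) (\<lambda>t. (b, f' t))"
  unfolding C1_arc_def arc_def path_def has_vector_derivative_def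
  using has_derivative_Pair[OF lin df] b
  by (auto intro!: continuous_intros cf c inj_onI simp: zero_prod_def)
qed

lemma DERIV_affine_segment:
 fixes X X' :: "real => real"
 assumes X: "\<And>y. y \<in> S ==> (X has_real_derivative X' y) (at y within S)" and S: "\<And>t. t \<in> {0..1} ==> a + b * t \<in> S"
  and c: "continuous_on S X'"
 shows "\<And>t. t \<in> {0..1} ==> ((\<lambda>t. X (a + b * t)) has_real_derivative X' (a + b * t) * b) (at t within {0..1})"
  and "continuous_on {0..1} (\<lambda>t. X' (a + b * t) * b)"
proof -
 fix t :: real assume t: "t \<in> {0..1}"
 have "(X has_real_derivative X' (a + b * t)) (at (a + b * t) within (\<lambda>t. a + b * t) ` {0..1})"
  by (rule DERIV_subset[OF X[OF S[OF t]]]) (use S in auto)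
 moreover have "((\<lambda>t. a + b * t) has_real_derivative b) (at t within {0..1})" by (auto intro!: derivative_eq_intros)
 ultimately show "((\<lambda>t. X (a + b * t)) has_real_derivative X' (a + b * t) * b) (at t within {0..1})"
  using DERIV_image_chain[of X _ "\<lambda>t. a + b * t" t "{0..1}" b] by (simp add: o_def)
next
 show "continuous_on {0..1} (\<lambda>t. X' (a + b * t) * b)"
  by (intro continuous_intros continuous_on_compose2[OF c]) (use S in auto)
qed

section \<open>The common form of both limits and their regular boundary points\<close>

text \<open>\<open>v0\<close> has r = -\<tau>, s = 1 and \<open>w0\<close> has r = 1, s = \<tau>.
  Values are prescribed in the open rectangle only, and only these enter \<open>nodal_set\<close>
  and \<open>nodal_domains\<close>.\<close>

locale nodal =
 fixes N r s C :: real and k :: nat and u :: "real \<times> real => real"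
 assumes N: "N > 0" and k: "k \<ge> 4" and C: "C \<noteq> 0"
  and u: "\<And>x y. 0 < x ==> x < N ==> 0 < y ==> y < 1 ==>
   u (x, y) = C * sin (pi * x / N) * sin (pi * y) * (r * Dir k (pi * x / N) + 4 * s * cos (pi * x / N) * cos (pi * y))"
begin

definition H :: "real => real => real" where
 "H x y = r * Dir k (pi * x / N) + 4 * s * cos (pi * x / N) * cos (pi * y)"

definition Hx :: "real => real => real" where
 "Hx x y = pi / N * (r * Dir' k (pi * x / N) - 4 * s * sin (pi * x / N) * cos (pi * y))"

definition Hy :: "real => real => real" where
 "Hy x y = - 4 * s * cos (pi * x / N) * (pi * sin (pi * y))"

abbreviation Z :: "(real \<times> real) set" where "Z \<equiv> nodal_set (rect N) u"

lemma DERIV_H: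
 "((\<lambda>x. H x y) has_real_derivative Hx x y) (at x)" "((\<lambda>y. H x y) has_real_derivative Hy x y) (at y)"
proof -
 have dX: "((\<lambda>x. pi * x / N) has_real_derivative pi / N) (at x)"
  using N by (auto intro!: derivative_eq_intros)
 have 1: "((\<lambda>x. r * Dir k (pi * x / N)) has_real_derivative r * (Dir' k (pi * x / N) * (pi / N))) (at x)"
  by (rule DERIV_cmult[OF DERIV_chain2[OF DERIV_Dir dX]])
 have 2: "((\<lambda>x. 4 * s * cos (pi * x / N) * cos (pi * y)) has_real_derivative
   4 * s * (- sin (pi * x / N) * (pi / N)) * cos (pi * y)) (at x)"
  by (rule DERIV_cmult_right[OF DERIV_cmult[OF DERIV_chain2[OF DERIV_cos dX]]])
 show "((\<lambda>x. H x y) has_real_derivative Hx x y) (at x)"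
  unfolding H_def by (rule DERIV_cong[OF DERIV_add[OF 1 2]]) (simp add: Hx_def algebra_simps)
 show "((\<lambda>y. H x y) has_real_derivative Hy x y) (at y)"
  unfolding H_def Hy_def by (auto intro!: derivative_eq_intros)
qed

lemma continuous_H: "continuous_on S (\<lambda>p. H (fst p) (snd p))" "continuous_on S (\<lambda>p. Hx (fst p) (snd p))"
 "continuous_on S (\<lambda>p. Hy (fst p) (snd p))"
proof -
 have cD: "continuous_on S (\<lambda>p. f (pi * fst p / N))" if "continuous_on UNIV f" for f :: "real => real"
  by (rule continuous_on_compose2[OF that]) (use N in \<open>auto intro!: continuous_intros\<close>)
 show "continuous_on S (\<lambda>p. H (fst p) (snd p))" "continuous_on S (\<lambda>p. Hx (fst p) (snd p))"
  "continuous_on S (\<lambda>p. Hy (fst p) (snd p))"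
  unfolding H_def Hx_def Hy_def by (intro continuous_intros cD continuous_Dir; use N in simp)+
qed

lemma interior_rect: "interior (rect N) = {0<..<N} \<times> {0<..<1}"
 by (simp add: rect_def interior_Times)

lemma closed_rect: "closed (rect N)" by (auto simp: rect_def intro: closed_Times)

lemma frontier_rect: "frontier (rect N) = rect N - {0<..<N} \<times> {0<..<1}"
 using closed_rect by (simp add: frontier_def interior_rect)

lemma X_range: "0 < x ==> x < N ==> 0 < pi * x / N" "0 < x ==> x < N ==> pi * x / N < pi"
 using N by (auto simp: divide_less_eq)

lemma u_zero_iff: "0 < x ==> x < N ==> 0 < y ==> y < 1 ==> u (x, y) = 0 \<longleftrightarrow> H x y = 0"
proof -
 assume b: "0 < x" "x < N" "0 < y" "y < 1"
 have "sin (pi * x / N) > 0" using X_range b by (intro sin_gt_zero) auto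
 moreover have "sin (pi * y) > 0" using b by (intro sin_gt_zero) auto
 ultimately show ?thesis unfolding u[OF b] H_def[symmetric] using C by simp
qed

lemma Z_eq: "Z = closure {(x, y). 0 < x \<and> x < N \<and> 0 < y \<and> y < 1 \<and> H x y = 0}"
proof -
 have "{p \<in> {0<..<N} \<times> {0<..<1}. u p = 0} = {(x, y). 0 < x \<and> x < N \<and> 0 < y \<and> y < 1 \<and> H x y = 0}"
 proof (rule set_eqI)
  fix p :: "real \<times> real"
  obtain x y where xy: "p = (x, y)" by (cases p)
  show "p \<in> {p \<in> {0<..<N} \<times> {0<..<1}. u p = 0} \<longleftrightarrow> p \<in> {(x, y). 0 < x \<and> x < N \<and> 0 < y \<and> y < 1 \<and> H x y = 0}"
   using u_zero_iff[of x y] unfolding xy by auto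
 qed
 then show ?thesis unfolding nodal_set_def interior_rect by simp
qed

lemma closed_Z: "closed Z" by (simp add: nodal_set_def)

lemma Z_I: "0 < x ==> x < N ==> 0 < y ==> y < 1 ==> H x y = 0 ==> (x, y) \<in> Z"
 unfolding Z_eq by (rule subsetD[OF closure_subset]) simp

text \<open>H is continuous on the whole plane, so its zero set is closed. It tells which boundary
  points belong to the nodal set, whereas the removed factor sin X sin (pi y) vanishes on the entire
  boundary.\<close>

lemma Z_D: assumes "(x, y) \<in> Z" shows "0 \<le> x" "x \<le> N" "0 \<le> y" "y \<le> 1" "H x y = 0"
proof -
 have "closed {p. H (fst p) (snd p) = 0}"
  by (rule closed_Collect_eq[OF continuous_H(1) continuous_on_const])
 then have "closed (rect N \<inter> {p. H (fst p) (snd p) = 0})"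
  by (rule closed_Int[OF closed_rect])
 moreover have "{(x, y). 0 < x \<and> x < N \<and> 0 < y \<and> y < 1 \<and> H x y = 0} \<subseteq> rect N \<inter> {p. H (fst p) (snd p) = 0}"
  by (auto simp: rect_def)
 ultimately have "Z \<subseteq> rect N \<inter> {p. H (fst p) (snd p) = 0}"
  unfolding Z_eq by (intro closure_minimal)
 from subsetD[OF this assms] show "0 \<le> x" "x \<le> N" "0 \<le> y" "y \<le> 1" "H x y = 0"
  by (simp_all add: rect_def)
qed

lemma nodal_domains_eq:
 "nodal_domains (rect N) u = components {(x, y). 0 < x \<and> x < N \<and> 0 < y \<and> y < 1 \<and> H x y \<noteq> 0}"
proof -
 have "interior (rect N) - Z = {(x, y). 0 < x \<and> x < N \<and> 0 < y \<and> y < 1 \<and> H x y \<noteq> 0}"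
 proof (rule set_eqI)
  fix p :: "real \<times> real"
  obtain x y where xy: "p = (x, y)" by (cases p)
  show "p \<in> interior (rect N) - Z \<longleftrightarrow> p \<in> {(x, y). 0 < x \<and> x < N \<and> 0 < y \<and> y < 1 \<and> H x y \<noteq> 0}"
   using Z_I[of x y] Z_D(5)[of x y] by (auto simp: interior_rect xy)
 qed
 then show ?thesis by (simp add: nodal_domains_def)
qed

lemma frontier_cases:
 assumes "p \<in> Z \<inter> frontier (rect N)"
 obtains x y where "p = (x, y)" "H x y = 0" "0 < x" "x < N" "y = 0 \<or> y = 1"
 | x y where "p = (x, y)" "H x y = 0" "x = 0 \<or> x = N" "0 \<le> y" "y \<le> 1"
proof -
 obtain x y where xy: "p = (x, y)" by (cases p)
 note D = Z_D[of x y]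
 have Z: "(x, y) \<in> Z" using assms xy by simp
 have nQ: "\<not> (0 < x \<and> x < N \<and> 0 < y \<and> y < 1)" using assms xy by (auto simp: frontier_rect)
 show ?thesis
 proof (cases "x = 0 \<or> x = N")
  case True
  then show ?thesis using that(2)[OF xy] D[OF Z] by blast
 next
  case False
  then have x: "0 < x" "x < N" using D[OF Z] by auto
  then have "y = 0 \<or> y = 1" using nQ D[OF Z] by auto
  then show ?thesis using that(1)[OF xy] x D[OF Z] by blast
 qed
qed

lemma Z_closure_path:
 assumes c: "continuous_on {0..1} g" and g: "\<And>t. 0 < t ==> t < 1 ==> g t \<in> Z"
 shows "g ` {0..1::real} \<subseteq> Z"
proof -
 have "g ` closure {0<..<1} \<subseteq> Z"
  by (rule image_closure_subset) (use c g closed_Z in auto)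
 then show ?thesis by simp
qed

text \<open>\<open>Hy\<close> contains sin (pi y) and vanishes on the horizontal sides. The curve
  obtained by solving H = 0 for x therefore starts with derivative 0.\<close>

lemma meets_orthogonally_horizontal:
 assumes x0: "0 < x0" "x0 < N" and y0: "y0 = 0 \<or> y0 = 1" and H0: "H x0 y0 = 0" and Hx0: "Hx x0 y0 \<noteq> 0"
 shows "meets_orthogonally N Z (x0, y0)"
proof -
 define e where "e = min (1/2) (min x0 (N - x0))"
 have e: "e > 0" "e < 1" "e \<le> x0" "e \<le> N - x0" using x0 by (auto simp: e_def)
 obtain \<rho> \<delta> X X' where R: "0 < \<rho>" "\<rho> < e" "0 < \<delta>" "\<delta> < e" "X y0 = x0" "X' y0 = - (Hy x0 y0 / Hx x0 y0)"
  "\<And>y. \<bar>y - y0\<bar> \<le> \<rho> ==> \<bar>X y - x0\<bar> < \<delta>"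
  "\<And>x y. \<bar>y - y0\<bar> \<le> \<rho> ==> \<bar>x - x0\<bar> \<le> \<delta> ==> H x y = 0 \<longleftrightarrow> x = X y"
  "\<And>y. \<bar>y - y0\<bar> \<le> \<rho> ==> (X has_real_derivative X' y) (at y within {y0-\<rho>..y0+\<rho>})"
  "continuous_on {y0-\<rho>..y0+\<rho>} X'"
  using implicit_graph[OF DERIV_H continuous_H(2,3) H0 Hx0 e(1)] by blast
 \<comment> \<open>The direction in y that points into the rectangle.\<close>
 define \<sigma> where "\<sigma> = (if y0 = 0 then 1 else (-1) :: real)"
 have \<sigma>: "\<bar>\<sigma>\<bar> = 1" by (simp add: \<sigma>_def)
 define b where "b = \<sigma> * \<rho>"
 have b: "b \<noteq> 0" "\<bar>b\<bar> = \<rho>" using \<sigma> R(1) by (auto simp: b_def abs_mult)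
 define g where "g t = (X (y0 + b * t), y0 + b * t)" for t
 define g' where "g' t = (X' (y0 + b * t) * b, b)" for t
 have seg: "\<bar>y0 + b * t - y0\<bar> \<le> \<rho>" if "t \<in> {0..1}" for t using that b R(1) by (simp add: abs_mult mult_left_le)
 have arc: "C1_arc g g'"
  unfolding g_def g'_def
 proof -
  have "(X has_real_derivative X' y) (at y within {y0-\<rho>..y0+\<rho>})" if "y \<in> {y0-\<rho>..y0+\<rho>}" for y
   using that by (intro R(9)) auto
  moreover have "y0 + b * t \<in> {y0-\<rho>..y0+\<rho>}" if "t \<in> {0..1}" for t using seg[OF that] by (auto simp: abs_le_iff)
  ultimately have DA: "t \<in> {0..1} ==> ((\<lambda>t. X (y0 + b * t)) has_real_derivative X' (y0 + b * t) * b) (at t within {0..1})"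
   "continuous_on {0..1} (\<lambda>t. X' (y0 + b * t) * b)" for t
   using DERIV_affine_segment[where X = X and X' = X' and S = "{y0-\<rho>..y0+\<rho>}" and a = y0 and b = b] R(10) by blast+
  show "C1_arc (\<lambda>t. (X (y0 + b * t), y0 + b * t)) (\<lambda>t. (X' (y0 + b * t) * b, b))" by (rule C1_arc_graph(1)[OF DA b(1)])
 qed
 have cg: "continuous_on {0..1} g" using arc by (auto simp: C1_arc_def arc_def path_def)
 have inQ: "0 < y0 + b * t \<and> y0 + b * t < 1" if "0 < t" "t \<le> 1" for t
 proof -
  have "0 < \<rho> * t" using that R(1) by simp
  moreover have "\<rho> * t \<le> \<rho>" using that R(1) by (simp add: mult_left_le)
  ultimately show ?thesis using y0 R(2) e by (auto simp: b_def \<sigma>_def)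
 qed
 have gZ: "g t \<in> Z" if t: "0 < t" "t < 1" for t
 proof -
  have t': "t \<in> {0..1}" using t by simp
  have "\<bar>X (y0 + b * t) - x0\<bar> < \<delta>" by (rule R(7)[OF seg[OF t']])
  moreover from this have "H (X (y0 + b * t)) (y0 + b * t) = 0" using R(8)[OF seg[OF t']] by simp
  ultimately show ?thesis unfolding g_def using inQ[of t] t e R(4) by (intro Z_I) auto
 qed
 have img: "path_image g \<subseteq> Z" unfolding path_image_def by (rule Z_closure_path[OF cg gZ])
 define U where "U = {x0-\<delta><..<x0+\<delta>} \<times> {y0-\<rho><..<y0+\<rho>}"
 have "Z \<inter> U \<subseteq> path_image g"
 proof
  fix p assume p: "p \<in> Z \<inter> U"
  obtain x y where xy: "p = (x, y)" by (cases p)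
  have pU: "\<bar>x - x0\<bar> < \<delta>" "\<bar>y - y0\<bar> < \<rho>" using p xy by (auto simp: U_def abs_less_iff)
  have D: "0 \<le> y" "y \<le> 1" "H x y = 0" using Z_D[of x y] p xy by auto
  have x: "x = X y" using R(8)[of y x] pU D(3) by simp
  define t where "t = \<bar>y - y0\<bar> / \<rho>"
  have t: "t \<in> {0..1}" using pU R(1) by (auto simp: t_def divide_le_eq)
  have "b * t = \<sigma> * \<bar>y - y0\<bar>" using R(1) by (simp add: b_def t_def)
  also have "... = y - y0" using y0 D by (auto simp: \<sigma>_def)
  finally have "g t = p" using x xy by (simp add: g_def)
  then show "p \<in> path_image g" using t unfolding path_image_def by blast
 qed
 then have ZU: "Z \<inter> U = path_image g \<inter> U" using img by blast
 have "Hy x0 y0 = 0" using y0 by (auto simp: Hy_def)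
 then have "fst (g' 0) = 0" using R(6) by (simp add: g'_def)
 moreover have "pathstart g = (x0, y0)" using R(5) by (simp add: g_def pathstart_def)
 moreover have "open U" "(x0, y0) \<in> U" using R(1,3) by (auto simp: U_def intro: open_Times)
 ultimately show ?thesis unfolding meets_orthogonally_def
  using arc ZU x0 by (intro exI[of _ g] exI[of _ g'] exI[of _ U]) auto
qed

text \<open>The same argument with the coordinates exchanged; \<open>Hx\<close> vanishes on the
  vertical sides because sine and \<open>Dir' k\<close> do at 0 and pi.\<close>

lemma meets_orthogonally_vertical:
 assumes x0: "x0 = 0 \<or> x0 = N" and y0: "0 < y0" "y0 < 1" and H0: "H x0 y0 = 0" and Hy0: "Hy x0 y0 \<noteq> 0"
 shows "meets_orthogonally N Z (x0, y0)"
proof -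
 define e where "e = min (N/2) (min y0 (1 - y0))"
 have e: "e > 0" "e < N" "e \<le> y0" "e \<le> 1 - y0" using y0 N by (auto simp: e_def)
 have cont: "continuous_on UNIV (\<lambda>p. G (snd p) (fst p))" if "continuous_on UNIV (\<lambda>p. G (fst p) (snd p))" for G :: "real => real => real"
 proof -
  have "continuous_on UNIV (\<lambda>p :: real \<times> real. (snd p, fst p))" by (intro continuous_intros)
  from continuous_on_compose2[OF that this] show ?thesis by simp
 qed
 obtain \<rho> \<delta> Y Y' where R: "0 < \<rho>" "\<rho> < e" "0 < \<delta>" "\<delta> < e" "Y x0 = y0" "Y' x0 = - (Hx x0 y0 / Hy x0 y0)"
  "\<And>x. \<bar>x - x0\<bar> \<le> \<rho> ==> \<bar>Y x - y0\<bar> < \<delta>"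
  "\<And>y x. \<bar>x - x0\<bar> \<le> \<rho> ==> \<bar>y - y0\<bar> \<le> \<delta> ==> H x y = 0 \<longleftrightarrow> y = Y x"
  "\<And>x. \<bar>x - x0\<bar> \<le> \<rho> ==> (Y has_real_derivative Y' x) (at x within {x0-\<rho>..x0+\<rho>})"
  "continuous_on {x0-\<rho>..x0+\<rho>} Y'"
  using implicit_graph[of "\<lambda>y x. H x y" "\<lambda>y x. Hy x y" "\<lambda>y x. Hx x y", OF DERIV_H(2,1) cont[OF continuous_H(3)] cont[OF continuous_H(2)] H0 Hy0 e(1)]
  by blast
 define \<sigma> where "\<sigma> = (if x0 = 0 then 1 else (-1) :: real)"
 have \<sigma>: "\<bar>\<sigma>\<bar> = 1" by (simp add: \<sigma>_def)
 define b where "b = \<sigma> * \<rho>"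
 have b: "b \<noteq> 0" "\<bar>b\<bar> = \<rho>" using \<sigma> R(1) by (auto simp: b_def abs_mult)
 define g where "g t = (x0 + b * t, Y (x0 + b * t))" for t
 define g' where "g' t = (b, Y' (x0 + b * t) * b)" for t
 have seg: "\<bar>x0 + b * t - x0\<bar> \<le> \<rho>" if "t \<in> {0..1}" for t using that b R(1) by (simp add: abs_mult mult_left_le)
 have arc: "C1_arc g g'"
  unfolding g_def g'_def
 proof -
  have "(Y has_real_derivative Y' x) (at x within {x0-\<rho>..x0+\<rho>})" if "x \<in> {x0-\<rho>..x0+\<rho>}" for x
   using that by (intro R(9)) auto
  moreover have "x0 + b * t \<in> {x0-\<rho>..x0+\<rho>}" if "t \<in> {0..1}" for t using seg[OF that] by (auto simp: abs_le_iff)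
  ultimately have DA: "t \<in> {0..1} ==> ((\<lambda>t. Y (x0 + b * t)) has_real_derivative Y' (x0 + b * t) * b) (at t within {0..1})"
   "continuous_on {0..1} (\<lambda>t. Y' (x0 + b * t) * b)" for t
   using DERIV_affine_segment[where X = Y and X' = Y' and S = "{x0-\<rho>..x0+\<rho>}" and a = x0 and b = b] R(10) by blast+
  show "C1_arc (\<lambda>t. (x0 + b * t, Y (x0 + b * t))) (\<lambda>t. (b, Y' (x0 + b * t) * b))" by (rule C1_arc_graph(2)[OF DA b(1)])
 qed
 have cg: "continuous_on {0..1} g" using arc by (auto simp: C1_arc_def arc_def path_def)
 have inQ: "0 < x0 + b * t \<and> x0 + b * t < N" if "0 < t" "t \<le> 1" for t
 proof -
  have "0 < \<rho> * t" using that R(1) by simp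
  moreover have "\<rho> * t \<le> \<rho>" using that R(1) by (simp add: mult_left_le)
  ultimately show ?thesis using x0 R(2) e N by (auto simp: b_def \<sigma>_def)
 qed
 have gZ: "g t \<in> Z" if t: "0 < t" "t < 1" for t
 proof -
  have t': "t \<in> {0..1}" using t by simp
  have "\<bar>Y (x0 + b * t) - y0\<bar> < \<delta>" by (rule R(7)[OF seg[OF t']])
  moreover from this have "H (x0 + b * t) (Y (x0 + b * t)) = 0" using R(8)[OF seg[OF t']] by simp
  ultimately show ?thesis unfolding g_def using inQ[of t] t e R(4) by (intro Z_I) auto
 qed
 have img: "path_image g \<subseteq> Z" unfolding path_image_def by (rule Z_closure_path[OF cg gZ])
 define U where "U = {x0-\<rho><..<x0+\<rho>} \<times> {y0-\<delta><..<y0+\<delta>}"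
 have "Z \<inter> U \<subseteq> path_image g"
 proof
  fix p assume p: "p \<in> Z \<inter> U"
  obtain x y where xy: "p = (x, y)" by (cases p)
  have pU: "\<bar>x - x0\<bar> < \<rho>" "\<bar>y - y0\<bar> < \<delta>" using p xy by (auto simp: U_def abs_less_iff)
  have D: "0 \<le> x" "x \<le> N" "H x y = 0" using Z_D[of x y] p xy by auto
  have y: "y = Y x" using R(8)[of x y] pU D(3) by simp
  define t where "t = \<bar>x - x0\<bar> / \<rho>"
  have t: "t \<in> {0..1}" using pU R(1) by (auto simp: t_def divide_le_eq)
  have "b * t = \<sigma> * \<bar>x - x0\<bar>" using R(1) by (simp add: b_def t_def)
  also have "... = x - x0" using x0 D N by (auto simp: \<sigma>_def)
  finally have "g t = p" using y xy by (simp add: g_def)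
  then show "p \<in> path_image g" using t unfolding path_image_def by blast
 qed
 then have ZU: "Z \<inter> U = path_image g \<inter> U" using img by blast
 have "Hx x0 y0 = 0" using x0 N by (auto simp: Hx_def Dir'_0 Dir'_pi)
 then have "snd (g' 0) = 0" using R(6) by (simp add: g'_def)
 moreover have "pathstart g = (x0, y0)" using R(5) by (simp add: g_def pathstart_def)
 moreover have "open U" "(x0, y0) \<in> U" using R(1,3) by (auto simp: U_def intro: open_Times)
 ultimately show ?thesis unfolding meets_orthogonally_def
  using arc ZU y0 by (intro exI[of _ g] exI[of _ g'] exI[of _ U]) auto
qed

text \<open>H = 0 determines r sin (k X) and Hx = 0 determines r k cos (k X), both in terms of the
  frequency 2. Squaring and adding leaves one equation, against which the size of \<tau> can be
  held.\<close>

lemma degenerate_horizontal: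
 assumes x0: "0 < x0" "x0 < N" and y0: "y0 = 0 \<or> y0 = 1" and H0: "H x0 y0 = 0" and Hx0: "Hx x0 y0 = 0"
 shows "(real k)^2 * r^2 = 4 * (real k)^2 * s^2 * (sin (2 * (pi * x0 / N)))^2 + 16 * s^2 * (cos (2 * (pi * x0 / N)))^2"
proof -
 define X where "X = pi * x0 / N"
 define c where "c = cos (pi * y0)"
 have c: "c^2 = 1" using y0 by (auto simp: c_def)
 have h: "r * Dir k X + 4 * (s * c) * cos X = 0" using H0 by (simp add: H_def X_def c_def algebra_simps)
 have "r * Dir' k X - 4 * s * sin X * c = 0" using Hx0 N by (simp add: Hx_def X_def c_def)
 then have h': "r * Dir' k X - 4 * (s * c) * sin X = 0" by (simp add: algebra_simps)
 have "r * real k * cos (real k * X) + 4 * (s * c) * cos (2 * X) = 0"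
  using sin_mult_Dir'[of X r k "s * c"] h h' by simp
 then have e1: "r * real k * cos (real k * X) = - (4 * (s * c) * cos (2 * X))" by linarith
 have "r * (sin X * Dir k X) + 2 * (s * c) * (2 * sin X * cos X) = sin X * (r * Dir k X + 4 * (s * c) * cos X)"
  by (simp add: algebra_simps)
 then have "r * sin (real k * X) + 2 * (s * c) * sin (2 * X) = 0" unfolding h sin_mult_Dir sin_double by simp
 then have e2: "r * sin (real k * X) = - (2 * (s * c) * sin (2 * X))" by linarith
 have "(real k)^2 * r^2 = (r * real k * cos (real k * X))^2 + (real k)^2 * (r * sin (real k * X))^2"
  using sin_cos_squared_add[of "real k * X"] by (simp add: power_mult_distrib algebra_simps flip: distrib_left)
 also have "... = 4 * (real k)^2 * (s^2 * c^2) * (sin (2 * X))^2 + 16 * (s^2 * c^2) * (cos (2 * X))^2"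
  unfolding e1 e2 by (simp add: power_mult_distrib algebra_simps)
 finally show ?thesis unfolding c X_def by simp
qed

end

section \<open>Degenerate boundary points\<close>

text \<open>Near a nondegenerate double zero Q behaves like (\<kappa> / 2) (x - x0)^2, by
  l'Hopital's rule. Changing the sign of the root at x0 removes its corner and leaves a continuously
  differentiable R of slope sqrt (\<kappa> / 2).\<close>

lemma signed_sqrt_C1:
 fixes Q Q1 :: "real => real"
 assumes \<rho>: "\<rho> > 0" and dQ: "\<And>x. \<bar>x - x0\<bar> < \<rho> ==> (Q has_real_derivative Q1 x) (at x)"
  and dQ1: "(Q1 has_real_derivative \<kappa>) (at x0)" and z: "Q x0 = 0" "Q1 x0 = 0" and \<kappa>: "\<kappa> > 0"
  and c: "\<And>x. \<bar>x - x0\<bar> < \<rho> ==> isCont Q1 x"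
 obtains d R' R where "0 < d" "d < \<rho>" "R' x0 = sqrt (\<kappa> / 2)" "R x0 = 0"
  "\<And>x. \<bar>x - x0\<bar> \<le> d ==> (R has_real_derivative R' x) (at x)" "continuous_on {x0-d..x0+d} R'"
  "\<And>x. \<bar>x - x0\<bar> \<le> d ==> (R x)^2 = Q x" "\<And>x. \<bar>x - x0\<bar> \<le> d ==> x0 < x ==> 0 < R x"
  "\<And>x. \<bar>x - x0\<bar> \<le> d ==> x < x0 ==> R x < 0"
proof -
 have ev\<rho>: "\<forall>\<^sub>F x in at x0. \<bar>x - x0\<bar> < \<rho>"
  using \<rho> unfolding eventually_at dist_real_def by auto
 have ne: "\<forall>\<^sub>F x in at x0. x \<noteq> x0" by (simp add: eventually_at_filter)
 have l1: "((\<lambda>x. Q1 x / (x - x0)) \<longlongrightarrow> \<kappa>) (at x0)"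
  using dQ1 z(2) by (simp add: has_field_derivative_iff)
 have l2: "((\<lambda>x. Q x / (x - x0)^2) \<longlongrightarrow> \<kappa> / 2) (at x0)"
 proof (rule lhopital[where f' = Q1 and g' = "\<lambda>x. 2 * (x - x0)"])
  have "isCont Q x0" using dQ[of x0] \<rho> by (intro DERIV_isCont) auto
  then show "(Q \<longlongrightarrow> 0) (at x0)" using z(1) by (simp add: isCont_def)
  have "((\<lambda>x. (x - x0)^2) \<longlongrightarrow> (x0 - x0)\<^sup>2) (at x0)" by (intro tendsto_intros)
  then show "((\<lambda>x. (x - x0)^2) \<longlongrightarrow> 0) (at x0)" by simp
  show "\<forall>\<^sub>F x in at x0. (x - x0)^2 \<noteq> 0" using ne by eventually_elim simp
  show "\<forall>\<^sub>F x in at x0. 2 * (x - x0) \<noteq> 0" using ne by eventually_elim simp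
  show "\<forall>\<^sub>F x in at x0. (Q has_real_derivative Q1 x) (at x)" using ev\<rho> by eventually_elim (rule dQ)
  show "\<forall>\<^sub>F x in at x0. ((\<lambda>x. (x - x0)^2) has_real_derivative 2 * (x - x0)) (at x)"
   by (intro always_eventually allI) (auto intro!: derivative_eq_intros)
  have "((\<lambda>x. 1/2 * (Q1 x / (x - x0))) \<longlongrightarrow> 1/2 * \<kappa>) (at x0)" by (intro tendsto_intros l1)
  then show "((\<lambda>x. Q1 x / (2 * (x - x0))) \<longlongrightarrow> \<kappa> / 2) (at x0)" by simp
 qed
 have "\<forall>\<^sub>F x in at x0. 0 < Q x / (x - x0)^2" using order_tendstoD(1)[OF l2, of 0] \<kappa> by simp
 then obtain e where e: "e > 0" "\<And>x. x \<noteq> x0 ==> \<bar>x - x0\<bar> < e ==> 0 < Q x / (x - x0)^2"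
  unfolding eventually_at dist_real_def by blast
 define d where "d = min \<rho> e / 2"
 have d: "0 < d" "d < \<rho>" "d < e" using \<rho> e(1) by (auto simp: d_def)
 have Qpos: "0 < Q x" if "x \<noteq> x0" "\<bar>x - x0\<bar> \<le> d" for x
 proof -
  have "0 < Q x / (x - x0)^2" using e(2)[OF that(1)] that(2) d(3) by simp
  then show ?thesis using that(1) by (simp add: zero_less_divide_iff)
 qed
 define R where "R x = sgn (x - x0) * sqrt (Q x)" for x
 define R' where "R' x = (if x = x0 then sqrt (\<kappa> / 2) else sgn (x - x0) * (Q1 x / (2 * sqrt (Q x))))" for x
 have Rq: "R x / (x - x0) = sqrt (Q x / (x - x0)^2)" if "x \<noteq> x0" for x
  using that by (simp add: R_def real_sqrt_divide sgn_if field_simps)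
 have ln: "((\<lambda>x. sqrt (Q x / (x - x0)^2)) \<longlongrightarrow> sqrt (\<kappa> / 2)) (at x0)" by (intro tendsto_intros l2)
 have dR: "(R has_real_derivative R' x) (at x)" if x: "\<bar>x - x0\<bar> \<le> d" for x
 proof (cases "x = x0")
  case True
  have "((\<lambda>x. (R x - R x0) / (x - x0)) \<longlongrightarrow> sqrt (\<kappa> / 2)) (at x0)"
   by (rule Lim_transform_eventually[OF ln]) (use ne Rq in \<open>auto simp: R_def elim!: eventually_mono\<close>)
  then show ?thesis using True by (simp add: has_field_derivative_iff R'_def)
 next
  case False
  have Qp: "0 < Q x" by (rule Qpos[OF False x])
  have dq: "(Q has_real_derivative Q1 x) (at x)" by (rule dQ) (use x d in linarith)
  have "((\<lambda>z. sgn (x - x0) * sqrt (Q z)) has_real_derivative sgn (x - x0) * (Q1 x / (2 * sqrt (Q x)))) (at x)"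
   using Qp by (auto intro!: derivative_eq_intros dq simp: field_simps)
  then have "(R has_real_derivative sgn (x - x0) * (Q1 x / (2 * sqrt (Q x)))) (at x)"
  proof (rule has_field_derivative_transform_within_open[where S = "if x0 < x then {x0<..} else {..<x0}"])
   show "x \<in> (if x0 < x then {x0<..} else {..<x0})" using False by auto
   show "sgn (x - x0) * sqrt (Q z) = R z" if "z \<in> (if x0 < x then {x0<..} else {..<x0})" for z
    using that False by (auto simp: R_def sgn_if split: if_splits)
  qed auto
  then show ?thesis using False by (simp add: R'_def)
 qed
 have cR': "continuous_on {x0-d..x0+d} R'"
 proof (intro continuous_at_imp_continuous_on ballI)
  fix x assume "x \<in> {x0-d..x0+d}"
  then have x: "\<bar>x - x0\<bar> \<le> d" by auto
  show "isCont R' x"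
  proof (cases "x = x0")
   case True
   have "((\<lambda>x. (Q1 x / (x - x0)) / (2 * sqrt (Q x / (x - x0)^2))) \<longlongrightarrow> \<kappa> / (2 * sqrt (\<kappa> / 2))) (at x0)"
    by (intro tendsto_intros l1 ln) (use \<kappa> in simp)
   moreover have "\<kappa> / (2 * sqrt (\<kappa> / 2)) = sqrt (\<kappa> / 2)"
   proof -
    have "sqrt (\<kappa> / 2) * sqrt (\<kappa> / 2) = \<kappa> / 2" using \<kappa> by simp
    then have "\<kappa> = sqrt (\<kappa> / 2) * (2 * sqrt (\<kappa> / 2))" by linarith
    moreover have "2 * sqrt (\<kappa> / 2) \<noteq> 0" using \<kappa> by simp
    ultimately show ?thesis by (metis nonzero_mult_div_cancel_right)
   qed
   ultimately have "((\<lambda>x. (Q1 x / (x - x0)) / (2 * sqrt (Q x / (x - x0)^2))) \<longlongrightarrow> R' x0) (at x0)" by (simp add: R'_def)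
   moreover have "\<forall>\<^sub>F x in at x0. (Q1 x / (x - x0)) / (2 * sqrt (Q x / (x - x0)^2)) = R' x"
    using ne
   proof eventually_elim
    case (elim x)
    have gen: "(p / c) / (2 * (q / c)) = p / (2 * q)" if "c \<noteq> 0" for p q c :: real
     using that by (cases "q = 0") auto
    have "(Q1 x / (x - x0)) / (2 * sqrt (Q x / (x - x0)^2)) = Q1 x / (2 * R x)"
     unfolding Rq[OF elim, symmetric] by (rule gen) (use elim in simp)
    also have "... = R' x" using elim by (cases "x0 < x") (simp_all add: R'_def R_def)
    finally show ?case .
   qed
   ultimately have "(R' \<longlongrightarrow> R' x0) (at x0)" by (rule Lim_transform_eventually)
   then show ?thesis using True by (simp add: isCont_def)
  next
   case False
   have x\<rho>: "\<bar>x - x0\<bar> < \<rho>" using x d by linarith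
   have "isCont Q x" by (rule DERIV_isCont[OF dQ[OF x\<rho>]])
   then have cz: "isCont (\<lambda>z. sgn (x - x0) * (Q1 z / (2 * sqrt (Q z)))) x"
    by (intro continuous_intros c[OF x\<rho>]) (use Qpos[OF False x] in simp_all)
   have ez: "\<forall>\<^sub>F z in nhds x. sgn (x - x0) * (Q1 z / (2 * sqrt (Q z))) = R' z"
   proof -
    have "\<forall>\<^sub>F z in nhds x. z \<in> (if x0 < x then {x0<..} else {..<x0})"
     by (rule eventually_nhds_in_open) (use False in auto)
    then show ?thesis by eventually_elim (use False in \<open>auto simp: R'_def sgn_if split: if_splits\<close>)
   qed
   show ?thesis using cz unfolding isCont_cong[OF ez] .
  qed
 qed
 show ?thesis
 proof (rule that[OF d(1,2) _ _ dR cR'])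
  show "R' x0 = sqrt (\<kappa> / 2)" "R x0 = 0" by (simp_all add: R'_def R_def)
  fix x assume x: "\<bar>x - x0\<bar> \<le> d"
  show "(R x)^2 = Q x" using Qpos[OF _ x] z(1) by (cases "x = x0") (auto simp: R_def power_mult_distrib sgn_if)
  show "x0 < x ==> 0 < R x" "x < x0 ==> R x < 0" using Qpos[OF _ x] by (auto simp: R_def)
 qed
qed

text \<open>Obtained by differentiating \<open>sin_mult_Dir'\<close>. At a degenerate boundary point
  the last two terms vanish, which gives the second derivative of H along the side in closed
  form.\<close>

lemma sin_mult_Dir'':
 "sin X * (r * Dir'' k X - 4 * a * cos X) =
  - (r * (real k)^2 * sin (real k * X)) - 8 * a * sin (2 * X) + sin X * (r * Dir k X + 4 * a * cos X)
  - 2 * cos X * (r * Dir' k X - 4 * a * sin X)"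
proof -
 have "((\<lambda>X. sin X * (r * Dir' k X - 4 * a * sin X)) has_real_derivative
   cos X * (r * Dir' k X - 4 * a * sin X) + sin X * (r * Dir'' k X - 4 * a * cos X)) (at X)"
  by (auto intro!: derivative_eq_intros DERIV_Dir')
 moreover have "((\<lambda>X. sin X * (r * Dir' k X - 4 * a * sin X)) has_real_derivative
   - (r * (real k)^2 * sin (real k * X)) - 8 * a * sin (2 * X)
   - (cos X * (r * Dir' k X - 4 * a * sin X) - sin X * (r * Dir k X + 4 * a * cos X))) (at X)"
  unfolding sin_mult_Dir'
  by (auto intro!: derivative_eq_intros DERIV_Dir simp: power2_eq_square algebra_simps)
 ultimately have "cos X * (r * Dir' k X - 4 * a * sin X) + sin X * (r * Dir'' k X - 4 * a * cos X) =
   - (r * (real k)^2 * sin (real k * X)) - 8 * a * sin (2 * X)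
   - (cos X * (r * Dir' k X - 4 * a * sin X) - sin X * (r * Dir k X + 4 * a * cos X))"
  by (rule DERIV_unique)
 then show ?thesis by (simp add: algebra_simps)
qed

context nodal begin

text \<open>Where the nodal set is degenerate at the top or bottom side, \<open>H\<close> vanishes to second order with an
 indefinite Hessian because of the Helmholtz equation.\<close>

lemma boundary_branch_point_horizontal:
 assumes x0: "0 < x0" "x0 < N" and y0: "y0 = 0 \<or> y0 = 1" and H0: "H x0 y0 = 0" and Hx0: "Hx x0 y0 = 0"
  and s0: "s \<noteq> 0" and c0: "cos (pi * x0 / N) \<noteq> 0"
 shows "boundary_branch_point Z (x0, y0)"
proof -
 define c where "c = cos (pi * y0)"
 define a where "a = s * c"
 have c: "c = 1 \<or> c = -1" using y0 by (auto simp: c_def)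
 have a0: "a \<noteq> 0" using s0 c by (auto simp: a_def)
 define X where "X x = pi * x / N" for x
 have dX: "(X has_real_derivative pi / N) (at x)" for x
  unfolding X_def[abs_def] using N by (auto intro!: derivative_eq_intros)
 define hh where "hh x = r * Dir k (X x) + 4 * a * cos (X x)" for x
 define h1 where "h1 x = pi / N * (r * Dir' k (X x) - 4 * a * sin (X x))" for x
 define h2 where "h2 x = (pi / N)^2 * (r * Dir'' k (X x) - 4 * a * cos (X x))" for x
 have dDir: "((\<lambda>x. Dir k (X x)) has_real_derivative Dir' k (X x) * (pi / N)) (at x)"
  "((\<lambda>x. Dir' k (X x)) has_real_derivative Dir'' k (X x) * (pi / N)) (at x)"
  "((\<lambda>x. cos (X x)) has_real_derivative - sin (X x) * (pi / N)) (at x)"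
  "((\<lambda>x. sin (X x)) has_real_derivative cos (X x) * (pi / N)) (at x)" for x
  by (rule DERIV_chain2[OF DERIV_Dir dX] DERIV_chain2[OF DERIV_Dir' dX] DERIV_chain2[OF DERIV_cos dX] DERIV_chain2[OF DERIV_sin dX])+
 have dh: "(hh has_real_derivative h1 x) (at x)" for x
  unfolding hh_def[abs_def]
  by (rule DERIV_cong[OF DERIV_add[OF DERIV_cmult[OF dDir(1)] DERIV_cmult[OF dDir(3)]]]) (simp add: h1_def algebra_simps)
 have dh1: "(h1 has_real_derivative h2 x) (at x)" for x
  unfolding h1_def[abs_def]
  by (rule DERIV_cong[OF DERIV_cmult[OF DERIV_diff[OF DERIV_cmult[OF dDir(2)] DERIV_cmult[OF dDir(4)]]]])
    (simp add: h2_def algebra_simps power2_eq_square)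
 have h0: "hh x0 = 0" using H0 by (simp add: hh_def H_def a_def c_def X_def algebra_simps)
 have h10: "h1 x0 = 0" using Hx0 by (simp add: h1_def Hx_def a_def c_def X_def algebra_simps)
 then have h10': "r * Dir' k (X x0) - 4 * a * sin (X x0) = 0" using N by (simp add: h1_def)
 have X0: "0 < X x0" "X x0 < pi" using X_range x0 by (auto simp: X_def)
 have sX: "sin (X x0) > 0" using X0 by (rule sin_gt_zero)
 have cX0: "cos (X x0) \<noteq> 0" using c0 by (simp add: X_def)
 have "sin (X x0) * (r * Dir k (X x0) + 4 * a * cos (X x0)) = 0" using h0 by (simp add: hh_def)
 then have "r * (sin (X x0) * Dir k (X x0)) + 2 * a * (2 * sin (X x0) * cos (X x0)) = 0" by (simp add: algebra_simps)
 then have rs: "r * sin (real k * X x0) = - (2 * a * sin (2 * X x0))" unfolding sin_mult_Dir sin_double by linarith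
 have "sin (X x0) * (r * Dir'' k (X x0) - 4 * a * cos (X x0)) = - ((real k)^2 * (r * sin (real k * X x0))) - 8 * a * sin (2 * X x0)"
  unfolding sin_mult_Dir'' h10' using h0 by (simp add: hh_def algebra_simps)
 also have "... = sin (X x0) * (4 * ((real k)^2 - 4) * a * cos (X x0))"
  unfolding rs sin_double by (simp add: algebra_simps)
 finally have "r * Dir'' k (X x0) - 4 * a * cos (X x0) = 4 * ((real k)^2 - 4) * a * cos (X x0)"
  using sX by simp
 then have h20: "h2 x0 = (pi / N)^2 * (4 * ((real k)^2 - 4) * a * cos (X x0))" by (simp add: h2_def)
 \<comment> \<open>With q the distance to the side, cos (pi q) = 1 - 2 sin^2 (pi q / 2), hence H =
   hh - m sin^2 (pi q / 2). The zero set is thus given by sin^2 (pi q / 2) = hh / m, which is the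
   function Q below.\<close>
 define m where "m x = 8 * a * cos (X x)" for x
 define m1 where "m1 x = - (8 * a * sin (X x) * (pi / N))" for x
 have dm: "(m has_real_derivative m1 x) (at x)" for x
  unfolding m_def[abs_def] by (rule DERIV_cong[OF DERIV_cmult[OF dDir(3)]]) (simp add: m1_def)
 have dm1: "(m1 has_real_derivative - (8 * a * (cos (X x) * (pi / N)) * (pi / N))) (at x)" for x
  unfolding m1_def[abs_def]
  by (rule DERIV_cong[OF DERIV_minus[OF DERIV_cmult_right[OF DERIV_cmult[OF dDir(4)]]]]) simp
 have mx0: "m x0 \<noteq> 0" using a0 cX0 by (simp add: m_def)
 have "continuous_on UNIV m" by (intro continuous_at_imp_continuous_on ballI DERIV_isCont[OF dm])
 then have "open (m -` (- {0}))" by (intro open_vimage) auto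
 moreover have "x0 \<in> m -` (- {0})" using mx0 by simp
 ultimately obtain e1 where e1: "e1 > 0" "\<And>x. \<bar>x - x0\<bar> < e1 ==> m x \<noteq> 0"
  unfolding open_dist dist_real_def by auto
 define \<rho> where "\<rho> = min e1 (min x0 (N - x0))"
 have \<rho>: "\<rho> > 0" "\<rho> \<le> e1" "\<rho> \<le> x0" "\<rho> \<le> N - x0" using e1 x0 by (auto simp: \<rho>_def)
 have mnz: "m x \<noteq> 0" if "\<bar>x - x0\<bar> < \<rho>" for x using e1(2)[of x] that \<rho> by simp
 define Q where "Q x = hh x / m x" for x
 define Q1 where "Q1 x = (h1 x * m x - hh x * m1 x) / (m x * m x)" for x
 \<comment> \<open>The ratio of \<open>h2\<close> to \<open>m\<close> at x0. The slope
   \<open>w\<close> below works out to sqrt (k^2 - 4) / N, which is sqrt 3 under the resonance and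
   accounts for angles of pi / 3.\<close>
 define \<kappa> where "\<kappa> = (pi / N)^2 * ((real k)^2 - 4) / 2"
 have k2: "(real k)^2 > 4" using power_strict_mono[of 2 "real k" 2] k by simp
 have \<kappa>: "\<kappa> > 0" unfolding \<kappa>_def using k2 N by simp
 have dQ: "(Q has_real_derivative Q1 x) (at x)" if "\<bar>x - x0\<bar> < \<rho>" for x
  unfolding Q_def[abs_def] Q1_def by (rule DERIV_divide[OF dh dm mnz[OF that]])
 have dQ1: "(Q1 has_real_derivative \<kappa>) (at x0)"
 proof -
  have num: "((\<lambda>x. h1 x * m x - hh x * m1 x) has_real_derivative h2 x0 * m x0) (at x0)"
   by (rule DERIV_cong[OF DERIV_diff[OF DERIV_mult[OF dh1 dm] DERIV_mult[OF dh dm1]]]) (simp add: h0 h10)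
  have "(Q1 has_real_derivative ((h2 x0 * m x0) * (m x0 * m x0) - (h1 x0 * m x0 - hh x0 * m1 x0) * (m1 x0 * m x0 + m1 x0 * m x0)) / ((m x0 * m x0) * (m x0 * m x0))) (at x0)"
   unfolding Q1_def[abs_def] by (rule DERIV_divide[OF num DERIV_mult[OF dm dm]]) (use mx0 in simp)
  moreover have "((h2 x0 * m x0) * (m x0 * m x0) - (h1 x0 * m x0 - hh x0 * m1 x0) * (m1 x0 * m x0 + m1 x0 * m x0)) / ((m x0 * m x0) * (m x0 * m x0)) = h2 x0 / m x0"
   using mx0 by (simp add: h0 h10)
  moreover have "h2 x0 = \<kappa> * m x0" unfolding h20 m_def \<kappa>_def by simp
  then have "h2 x0 / m x0 = \<kappa>" using mx0 by simp
  ultimately show ?thesis using \<open>h2 x0 / m x0 = \<kappa>\<close> by simp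
 qed
 have cQ1: "isCont Q1 x" if "\<bar>x - x0\<bar> < \<rho>" for x
  unfolding Q1_def[abs_def]
  using DERIV_isCont[OF dh] DERIV_isCont[OF dh1] DERIV_isCont[OF dm] DERIV_isCont[OF dm1] mnz[OF that]
  by (intro continuous_intros) auto
 have Q0: "Q x0 = 0" "Q1 x0 = 0" by (simp_all add: Q_def Q1_def h0 h10)
 obtain d R' R where R: "0 < d" "d < \<rho>" "R' x0 = sqrt (\<kappa> / 2)" "R x0 = 0"
  "\<And>x. \<bar>x - x0\<bar> \<le> d ==> (R has_real_derivative R' x) (at x)" "continuous_on {x0-d..x0+d} R'"
  "\<And>x. \<bar>x - x0\<bar> \<le> d ==> (R x)^2 = Q x" "\<And>x. \<bar>x - x0\<bar> \<le> d ==> x0 < x ==> 0 < R x"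
  "\<And>x. \<bar>x - x0\<bar> \<le> d ==> x < x0 ==> R x < 0"
  by (rule signed_sqrt_C1[OF \<rho>(1) dQ dQ1 Q0 \<kappa> cQ1]; (assumption | (rule that; assumption)))
 have "isCont R x0" by (rule DERIV_isCont[OF R(5)]) (use R(1) in simp)
 then have "(R \<longlongrightarrow> 0) (at x0)" using R(4) by (simp add: isCont_def)
 then have "\<forall>\<^sub>F x in at x0. \<bar>R x\<bar> < 1" using order_tendstoD(2)[OF tendsto_rabs_zero, of R _ 1] by simp
 then obtain e2 where e2: "e2 > 0" "\<And>x. x \<noteq> x0 ==> \<bar>x - x0\<bar> < e2 ==> \<bar>R x\<bar> < 1"
  unfolding eventually_at dist_real_def by blast
 define b where "b = min d e2 / 2"
 have b: "0 < b" "b < d" "b < e2" "b < \<rho>" using R(1,2) e2(1) by (auto simp: b_def)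
 have R1: "\<bar>R x\<bar> < 1" if "\<bar>x - x0\<bar> \<le> b" for x using e2(2)[of x] that b R(4) by (cases "x = x0") auto
 \<comment> \<open>A signed distance from the side: the two nodal branches are the parts x > x0 and
   x < x0 of the graph of |D|.\<close>
 define D where "D x = 2 / pi * arcsin (R x)" for x
 define D' where "D' x = 2 / pi * (R' x / sqrt (1 - (R x)^2))" for x
 have dD: "(D has_real_derivative D' x) (at x)" if x: "\<bar>x - x0\<bar> \<le> b" for x
 proof -
  have bd: "-1 < R x" "R x < 1" using R1[OF x] by (auto simp: abs_less_iff)
  have "((\<lambda>x. arcsin (R x)) has_real_derivative inverse (sqrt (1 - (R x)^2)) * R' x) (at x)"
   by (rule DERIV_chain2[where f = arcsin and g = R, OF DERIV_arcsin[OF bd]]) (use R(5) x b in simp)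
  from DERIV_cmult[OF this, of "2 / pi"] show ?thesis unfolding D_def[abs_def] D'_def by (simp add: divide_inverse mult.commute)
 qed
 have cD': "continuous_on {x0-b..x0+b} D'"
 proof -
  have cR: "continuous_on {x0-b..x0+b} R"
  proof (intro continuous_at_imp_continuous_on ballI)
   fix x assume "x \<in> {x0-b..x0+b}"
   then have "\<bar>x - x0\<bar> \<le> d" using b by auto
   then show "isCont R x" by (rule DERIV_isCont[OF R(5)])
  qed
  have "continuous_on {x0-b..x0+b} R'" by (rule continuous_on_subset[OF R(6)]) (use b in auto)
  moreover have "sqrt (1 - (R x)^2) \<noteq> 0" if "x \<in> {x0-b..x0+b}" for x
  proof -
   have "\<bar>R x\<bar> < 1" using R1[of x] that by (auto simp: abs_le_iff)
   then have "(R x)^2 < 1" by (simp add: abs_square_less_1)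
   then show ?thesis by simp
  qed
  ultimately show ?thesis unfolding D'_def by (intro continuous_intros cR) auto
 qed
 have D0: "D x0 = 0" "D' x0 = 2 / pi * sqrt (\<kappa> / 2)" by (simp_all add: D_def D'_def R(3,4))
 have D1: "\<bar>D x\<bar> < 1" if "\<bar>x - x0\<bar> \<le> b" for x
 proof -
  have "-1 < R x" "R x < 1" using R1[OF that] by (auto simp: abs_less_iff)
  from arcsin_lt_bounded[OF this] have "\<bar>arcsin (R x)\<bar> < pi / 2" by linarith
  then have "2 / pi * \<bar>arcsin (R x)\<bar> < 2 / pi * (pi / 2)" by (intro mult_strict_left_mono) auto
  then show ?thesis by (simp add: D_def abs_mult)
 qed
 have Dpos: "0 < D x" if "\<bar>x - x0\<bar> \<le> b" "x0 < x" for x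
 proof -
  have "arcsin 0 < arcsin (R x)" using R(8)[of x] R1[of x] that b by (subst arcsin_less_mono) auto
  then show ?thesis by (simp add: D_def)
 qed
 have Dneg: "D x < 0" if "\<bar>x - x0\<bar> \<le> b" "x < x0" for x
 proof -
  have "arcsin (R x) < arcsin 0" using R(9)[of x] R1[of x] that b by (subst arcsin_less_mono) auto
  then show ?thesis by (simp add: D_def divide_less_0_iff)
 qed
 define \<sigma> where "\<sigma> = (if y0 = 0 then 1 else (-1) :: real)"
 have \<sigma>: "\<sigma> = 1 \<or> \<sigma> = -1" by (simp add: \<sigma>_def)
 have H_iff: "H x y = 0 \<longleftrightarrow> y = y0 + \<sigma> * \<bar>D x\<bar>" if x: "\<bar>x - x0\<bar> \<le> b" and y: "0 \<le> y" "y \<le> 1" "\<bar>y - y0\<bar> < 1" for x y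
 proof -
  define q where "q = \<bar>y - y0\<bar>"
  have q: "0 \<le> q" "q < 1" "y = y0 + \<sigma> * q" using y y0 by (auto simp: q_def \<sigma>_def)
  have "cos (pi * y) = c * cos (pi * q)"
   using y0 by (auto simp: q(3) c_def \<sigma>_def right_diff_distrib distrib_left cos_diff)
  also have "cos (pi * q) = 1 - 2 * (sin (pi * q / 2))^2" using cos_double_sin[of "pi * q / 2"] by simp
  finally have cy: "cos (pi * y) = c * (1 - 2 * (sin (pi * q / 2))^2)" .
  have "H x y = hh x - m x * (sin (pi * q / 2))^2"
   unfolding H_def cy hh_def m_def a_def X_def by (simp add: algebra_simps)
  moreover have mz: "m x \<noteq> 0" using mnz x b by simp
  ultimately have "H x y = 0 \<longleftrightarrow> (sin (pi * q / 2))^2 = Q x" unfolding Q_def by (auto simp: field_simps)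
  also have "... \<longleftrightarrow> (sin (pi * q / 2))^2 = \<bar>R x\<bar>\<^sup>2" using R(7)[of x] x b by simp
  also have "... \<longleftrightarrow> sin (pi * q / 2) = \<bar>R x\<bar>"
  proof -
   have "0 \<le> sin (pi * q / 2)" using q by (intro sin_ge_zero) (auto simp: mult_left_le field_simps)
   then show ?thesis by (rule power2_eq_iff_nonneg[OF _ abs_ge_zero])
  qed
  also have "... \<longleftrightarrow> q = \<bar>D x\<bar>"
  proof -
   have "0 \<le> pi * q" "pi * q \<le> pi" using q by simp_all
   then have rng: "- (pi / 2) \<le> pi * q / 2" "pi * q / 2 \<le> pi / 2" using pi_gt_zero by linarith+
   have "sin (pi * q / 2) = \<bar>R x\<bar> \<longleftrightarrow> pi * q / 2 = arcsin \<bar>R x\<bar>"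
    using arcsin_sin[OF rng] sin_arcsin[of "\<bar>R x\<bar>"] R1[OF x] by auto
   moreover have "arcsin \<bar>R x\<bar> = \<bar>arcsin (R x)\<bar>"
    using R1[OF x] arcsin_minus[of "R x"] arcsin_le_mono[of 0 "R x"] arcsin_le_mono[of "R x" 0] by (auto simp: abs_if)
   moreover have "pi * q / 2 = \<bar>arcsin (R x)\<bar> \<longleftrightarrow> q = \<bar>D x\<bar>" by (auto simp: D_def abs_mult field_simps)
   ultimately show ?thesis by simp
  qed
  also have "... \<longleftrightarrow> y = y0 + \<sigma> * \<bar>D x\<bar>" using q(3) \<sigma> by auto
  finally show ?thesis .
 qed
 define w where "w = 2 / pi * sqrt (\<kappa> / 2)"
 have w: "w > 0" using \<kappa> by (simp add: w_def)
 have arcs: "\<exists>g g'. C1_arc g g' \<and> pathstart g = (x0, y0) \<and> g' 0 = (p * b, \<sigma> * w * b) \<and> path_image g \<subseteq> Z \<and>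
   path_image g = {(x0 + p * b * t, y0 + \<sigma> * \<bar>D (x0 + p * b * t)\<bar>) | t. t \<in> {0..1}}"
  if p: "p = 1 \<or> p = -1" for p :: real
 proof -
  define f where "f t = y0 + \<sigma> * (p * D (x0 + (p * b) * t))" for t
  define f' where "f' t = \<sigma> * (p * (D' (x0 + (p * b) * t) * (p * b)))" for t
  have seg: "\<bar>x0 + p * b * t - x0\<bar> \<le> b" if "t \<in> {0..1}" for t
   using that p b by (auto simp: abs_mult mult_left_le)
  have segS: "x0 + p * b * t \<in> {x0-b..x0+b}" if "t \<in> {0..1}" for t using seg[OF that] by (auto simp: abs_le_iff)
  have dDS: "(D has_real_derivative D' x) (at x within {x0-b..x0+b})" if "x \<in> {x0-b..x0+b}" for x
   by (rule has_field_derivative_at_within, rule dD) (use that in auto)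
  have DA1: "((\<lambda>t. D (x0 + (p * b) * t)) has_real_derivative D' (x0 + (p * b) * t) * (p * b)) (at t within {0..1})"
   if t: "t \<in> {0..1}" for t
   by (rule DERIV_affine_segment(1)[where S = "{x0-b..x0+b}", OF _ _ cD' t]) (use dDS segS in simp_all)
  have DA2: "continuous_on {0..1} (\<lambda>t. D' (x0 + (p * b) * t) * (p * b))"
   by (rule DERIV_affine_segment(2)[where S = "{x0-b..x0+b}", OF _ _ cD']) (use dDS segS in simp_all)
  have df: "(f has_real_derivative f' t) (at t within {0..1})" if "t \<in> {0..1}" for t
   unfolding f_def[abs_def] f'_def
   using DERIV_add[OF DERIV_const DERIV_cmult[OF DERIV_cmult[OF DA1[OF that], of p], of \<sigma>], of y0] by simp
  have cf': "continuous_on {0..1} f'" unfolding f'_def[abs_def] by (intro continuous_intros DA2)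
  have pb: "p * b \<noteq> 0" using p b by auto
  have arc: "C1_arc (\<lambda>t. (x0 + p * b * t, f t)) (\<lambda>t. (p * b, f' t))"
   by (rule C1_arc_graph(2)[OF df cf' pb])
  have fD: "f t = y0 + \<sigma> * \<bar>D (x0 + p * b * t)\<bar>" if t: "t \<in> {0..1}" for t
  proof (cases "t = 0")
   case True
   then show ?thesis by (simp add: f_def D0)
  next
   case False
   then have t0: "0 < t" using t by simp
   have "0 < b * t" using t0 b by simp
   then have "p * D (x0 + p * b * t) = \<bar>D (x0 + p * b * t)\<bar>"
    using p Dpos[OF seg[OF t]] Dneg[OF seg[OF t]] by auto
   then show ?thesis by (simp add: f_def)
  qed
  have gZ: "(x0 + p * b * t, f t) \<in> Z" if t: "0 < t" "t < 1" for t
  proof -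
   have t': "t \<in> {0..1}" using t by simp
   have bt: "0 < b * t" "b * t \<le> b" using t b by (auto simp: mult_left_le)
   have xN: "0 < x0 + p * b * t" "x0 + p * b * t < N" using seg[OF t'] b \<rho> by linarith+
   have "x0 + p * b * t \<noteq> x0" using p bt by auto
   then have Dnz: "D (x0 + p * b * t) \<noteq> 0" using Dpos[OF seg[OF t']] Dneg[OF seg[OF t']] by (metis linorder_neqE less_irrefl)
   have yb: "0 < f t" "f t < 1" unfolding fD[OF t'] using y0 Dnz D1[OF seg[OF t']] by (auto simp: \<sigma>_def)
   have "\<bar>f t - y0\<bar> < 1" unfolding fD[OF t'] using \<sigma> D1[OF seg[OF t']] by auto
   then have "H (x0 + p * b * t) (f t) = 0" using H_iff[OF seg[OF t'], of "f t"] yb fD[OF t'] by simp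
   then show ?thesis using xN yb by (intro Z_I)
  qed
  have "continuous_on {0..1} (\<lambda>t. (x0 + p * b * t, f t))" using arc by (simp add: C1_arc_def arc_def path_def)
  then have "path_image (\<lambda>t. (x0 + p * b * t, f t)) \<subseteq> Z"
   unfolding path_image_def by (rule Z_closure_path[OF _ gZ])
  moreover have "path_image (\<lambda>t. (x0 + p * b * t, f t)) = {(x0 + p * b * t, y0 + \<sigma> * \<bar>D (x0 + p * b * t)\<bar>) | t. t \<in> {0..1}}"
   unfolding path_image_def using fD by auto
  moreover have "f' 0 = \<sigma> * w * b" using p by (auto simp: f'_def D0 w_def)
  moreover have "f 0 = y0" by (simp add: f_def D0)
  ultimately show ?thesis using arc
   by (intro exI[of _ "\<lambda>t. (x0 + p * b * t, f t)"] exI[of _ "\<lambda>t. (p * b, f' t)"]) (simp add: pathstart_def)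
 qed
 obtain g g' where g: "C1_arc g g'" "pathstart g = (x0, y0)" "g' 0 = (1 * b, \<sigma> * w * b)" "path_image g \<subseteq> Z"
  "path_image g = {(x0 + 1 * b * t, y0 + \<sigma> * \<bar>D (x0 + 1 * b * t)\<bar>) | t. t \<in> {0..1}}" using arcs[of 1] by blast
 obtain h h' where h: "C1_arc h h'" "pathstart h = (x0, y0)" "h' 0 = ((-1) * b, \<sigma> * w * b)" "path_image h \<subseteq> Z"
  "path_image h = {(x0 + (-1) * b * t, y0 + \<sigma> * \<bar>D (x0 + (-1) * b * t)\<bar>) | t. t \<in> {0..1}}" using arcs[of "-1"] by blast
 define U where "U = {x0-b<..<x0+b} \<times> {y0-1<..<y0+1}"
 have int: "path_image g \<inter> path_image h = {(x0, y0)}"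
 proof
  show "path_image g \<inter> path_image h \<subseteq> {(x0, y0)}"
  proof
   fix q assume "q \<in> path_image g \<inter> path_image h"
   then obtain t t' where t: "t \<in> {0..1}" "t' \<in> {0..1}" "q = (x0 + 1 * b * t, y0 + \<sigma> * \<bar>D (x0 + 1 * b * t)\<bar>)"
    "x0 + 1 * b * t = x0 + (-1) * b * t'" unfolding g(5) h(5) by auto
   then have "b * (t + t') = 0" by (simp add: algebra_simps)
   then have "t = 0" using b t(1,2) by auto
   then show "q \<in> {(x0, y0)}" using t(3) D0 by simp
  qed
  have "(x0, y0) \<in> path_image g" "(x0, y0) \<in> path_image h"
   using pathstart_in_path_image[of g] pathstart_in_path_image[of h] g(2) h(2) by auto
  then show "{(x0, y0)} \<subseteq> path_image g \<inter> path_image h" by simp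
 qed
 have col: "\<not> collinear {0, g' 0, h' 0}"
  unfolding g(3) h(3) collinear_lemma
 proof (intro notI, elim disjE exE)
  fix t assume "((-1) * b, \<sigma> * w * b) = t *\<^sub>R (1 * b, \<sigma> * w * b)"
  then have "- b = t * b" "\<sigma> * w * b = t * (\<sigma> * w * b)" by auto
  then have "(t + 1) * b = 0" "(t - 1) * (\<sigma> * w * b) = 0" by (simp_all add: algebra_simps)
  then have "t = -1" "t = 1" using b w \<sigma> by auto
  then show False by simp
 qed (use b in \<open>auto simp: zero_prod_def\<close>)
 have "Z \<inter> U \<subseteq> path_image g \<union> path_image h"
 proof
  fix q assume q: "q \<in> Z \<inter> U"
  obtain x y where xy: "q = (x, y)" by (cases q)
  have qU: "\<bar>x - x0\<bar> < b" "\<bar>y - y0\<bar> < 1" using q xy by (auto simp: U_def abs_less_iff)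
  have Dq: "0 \<le> y" "y \<le> 1" "H x y = 0" using Z_D[of x y] q xy by auto
  have y: "y = y0 + \<sigma> * \<bar>D x\<bar>" using H_iff[of x y] qU Dq by simp
  define t where "t = \<bar>x - x0\<bar> / b"
  have t: "t \<in> {0..1}" using qU b by (auto simp: t_def divide_le_eq)
  have bt: "b * t = \<bar>x - x0\<bar>" using b by (simp add: t_def)
  show "q \<in> path_image g \<union> path_image h"
  proof (cases "x0 \<le> x")
   case True
   then have "x0 + 1 * b * t = x" using bt by simp
   then have "q \<in> path_image g" unfolding g(5) using t xy y by force
   then show ?thesis by simp
  next
   case False
   then have "x0 + (-1) * b * t = x" using bt by simp
   then have "q \<in> path_image h" unfolding h(5) using t xy y by force
   then show ?thesis by simp
  qed
 qed
 then have ZU: "Z \<inter> U = (path_image g \<union> path_image h) \<inter> U" using g(4) h(4) by blast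
 have "open U" "(x0, y0) \<in> U" using b by (auto simp: U_def intro: open_Times)
 then show ?thesis unfolding boundary_branch_point_def
  using g(1,2) h(1,2) int col ZU
  by (intro exI[of _ g] exI[of _ g'] exI[of _ h] exI[of _ h'] exI[of _ U] conjI)
qed

end

subsection \<open>The upper branch\<close>

text \<open>Says that S has n components, but as a relation with witnesses, so that disjoint unions,
  reflections and monotone substitutions can be carried out on the witnesses.\<close>

definition pieces :: "nat => real set => bool" where
 "pieces n S \<longleftrightarrow> (\<exists>E. (\<forall>i<n. open (E i) \<and> connected (E i) \<and> E i \<noteq> {}) \<and>
   (\<forall>i<n. \<forall>j<n. i \<noteq> j \<longrightarrow> E i \<inter> E j = {}) \<and> (\<Union>i<n. E i) = S)"

lemma piecesE:
 assumes "pieces n S"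
 obtains E where "\<And>i. i < n ==> open (E i) \<and> connected (E i) \<and> E i \<noteq> {}"
  "\<And>i j. i < n ==> j < n ==> i \<noteq> j ==> E i \<inter> E j = {}" "(\<Union>i<n. E i) = S"
 using assms unfolding pieces_def by blast

lemma abs_less_square_iff: "\<bar>x\<bar> < \<bar>y\<bar> \<longleftrightarrow> x^2 < (y :: real)^2"
 using abs_le_square_iff[of y x] by linarith

lemma connected_real_iff:
 "connected (S :: real set) \<longleftrightarrow> (\<forall>a\<in>S. \<forall>b\<in>S. \<forall>x. a \<le> x \<and> x \<le> b \<longrightarrow> x \<in> S)"
 by (simp only: is_interval_connected_1[symmetric] is_interval_1)

lemma connected_realI:
 assumes "\<And>a x b :: real. a \<in> S ==> b \<in> S ==> a < x ==> x < b ==> x \<in> S"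
 shows "connected S"
 unfolding connected_real_iff
proof (intro ballI allI impI)
 fix a b x assume "a \<in> S" "b \<in> S" "a \<le> x \<and> x \<le> b"
 then show "x \<in> S" using assms[of a b x] by (cases "x = a \<or> x = b") auto
qed

lemma pieces_family:
 assumes K: "finite K" and E: "\<And>i. i \<in> K ==> open (E i)" "\<And>i. i \<in> K ==> connected (E i)" "\<And>i. i \<in> K ==> E i \<noteq> {}"
  and dj: "\<And>i j. i \<in> K ==> j \<in> K ==> i \<noteq> j ==> E i \<inter> E j = {}" and U: "(\<Union>i\<in>K. E i) = S"
 shows "pieces (card K) S"
proof -
 obtain h where h: "bij_betw h {0..<card K} K" using ex_bij_betw_nat_finite[OF K] by blast
 have hK: "h i \<in> K" if "i < card K" for i using h that by (auto simp: bij_betw_def)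
 have hi: "h i \<noteq> h j" if "i < card K" "j < card K" "i \<noteq> j" for i j
  using h that unfolding bij_betw_def inj_on_def by auto
 have im: "h ` {..<card K} = K" using h by (simp add: bij_betw_def atLeast0LessThan)
 have "(\<Union>i<card K. E (h i)) = (\<Union>i\<in>h ` {..<card K}. E i)" by simp
 also have "... = S" unfolding im U ..
 finally have "(\<Union>i<card K. E (h i)) = S" .
 then show ?thesis unfolding pieces_def
  by (intro exI[of _ "\<lambda>i. E (h i)"] conjI allI impI E dj hK hi)
qed

lemma pieces_1:
 assumes "open S" "z \<in> S" "\<And>a x b. a \<in> S ==> b \<in> S ==> a < x ==> x < b ==> x \<in> S"
 shows "pieces 1 S"
proof -
 have "connected S" by (rule connected_realI) (rule assms(3))
 then show ?thesis using assms(1,2) unfolding pieces_def by (intro exI[of _ "\<lambda>_. S"]) auto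
qed

lemma pieces_Un:
 assumes "pieces m S" "pieces n T" and ST: "S \<inter> T = {}"
 shows "pieces (m + n) (S \<union> T)"
proof -
 obtain E where E: "\<And>i. i < m ==> open (E i) \<and> connected (E i) \<and> E i \<noteq> {}"
  "\<And>i j. i < m ==> j < m ==> i \<noteq> j ==> E i \<inter> E j = {}" "(\<Union>i<m. E i) = S"
  by (rule piecesE[OF assms(1)]) (rule that; assumption)
 obtain F where F: "\<And>i. i < n ==> open (F i) \<and> connected (F i) \<and> F i \<noteq> {}"
  "\<And>i j. i < n ==> j < n ==> i \<noteq> j ==> F i \<inter> F j = {}" "(\<Union>i<n. F i) = T"
  by (rule piecesE[OF assms(2)]) (rule that; assumption)
 define G where "G i = (if i < m then E i else F (i - m))" for i
 have G1: "open (G i) \<and> connected (G i) \<and> G i \<noteq> {}" if "i < m + n" for i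
  unfolding G_def using E(1)[of i] F(1)[of "i - m"] that by (cases "i < m") simp_all
 have ES: "E i \<subseteq> S" if "i < m" for i using E(3) that by blast
 have FT: "F i \<subseteq> T" if "i < n" for i using F(3) that by blast
 have G2: "G i \<inter> G j = {}" if i: "i < m + n" "j < m + n" "i \<noteq> j" for i j
 proof -
  consider "i < m" "j < m" | "i < m" "\<not> j < m" | "\<not> i < m" "j < m" | "\<not> i < m" "\<not> j < m" by blast
  then show ?thesis
  proof cases
   case 1 then show ?thesis using E(2)[of i j] i by (simp add: G_def)
  next
   case 2
   have "j - m < n" using i 2 by simp
   then show ?thesis using ES[of i] FT[of "j - m"] ST 2 unfolding G_def by auto
  next
   case 3
   have "i - m < n" using i 3 by simp
   then show ?thesis using ES[of j] FT[of "i - m"] ST 3 unfolding G_def by auto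
  next
   case 4 then show ?thesis using F(2)[of "i - m" "j - m"] i by (simp add: G_def)
  qed
 qed
 have "{..<m+n} = {..<m} \<union> (\<lambda>i. m + i) ` {..<n}"
 proof (rule set_eqI)
  fix i show "i \<in> {..<m+n} \<longleftrightarrow> i \<in> {..<m} \<union> (\<lambda>i. m + i) ` {..<n}"
   using le_add_diff_inverse[of m i] by (cases "i < m") (auto simp: image_iff intro!: bexI[of _ "i - m"])
 qed
 then have "(\<Union>i<m+n. G i) = (\<Union>i<m. G i) \<union> (\<Union>i<n. G (m + i))" by (simp add: UN_Un)
 also have "(\<Union>i<m. G i) = S" unfolding E(3)[symmetric] by (simp add: G_def)
 also have "(\<Union>i<n. G (m + i)) = T" unfolding F(3)[symmetric] by (simp add: G_def)
 finally have G3: "(\<Union>i<m+n. G i) = S \<union> T" .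
 show ?thesis unfolding pieces_def using G1 G2 G3 by (intro exI[of _ G]) simp
qed

lemma pieces_reflect:
 assumes "pieces n S" shows "pieces n {x. b - x \<in> S}"
proof -
 obtain E where E: "\<And>i. i < n ==> open (E i) \<and> connected (E i) \<and> E i \<noteq> {}"
  "\<And>i j. i < n ==> j < n ==> i \<noteq> j ==> E i \<inter> E j = {}" "(\<Union>i<n. E i) = S"
  by (rule piecesE[OF assms]) (rule that; assumption)
 have "pieces (card {..<n}) {x. b - x \<in> S}"
 proof (rule pieces_family[where E = "\<lambda>i. {x. b - x \<in> E i}"])
  fix i assume i: "i \<in> {..<n}"
  have "open ((\<lambda>x. b - x) -` E i)" using E(1)[of i] i by (intro open_vimage continuous_intros) auto
  then show "open {x. b - x \<in> E i}" by (simp add: vimage_def)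
  have "connected (E i)" using E(1)[of i] i by simp
  then have Ec: "\<And>p q x. p \<in> E i ==> q \<in> E i ==> p \<le> x \<and> x \<le> q ==> x \<in> E i" unfolding connected_real_iff by blast
  show "connected {x. b - x \<in> E i}"
  proof (rule connected_realI, unfold mem_Collect_eq)
   fix p x q assume "b - p \<in> E i" "b - q \<in> E i" "p < x" "x < q"
   then show "b - x \<in> E i" using Ec[of "b - q" "b - p" "b - x"] by simp
  qed
  obtain z where "z \<in> E i" using E(1)[of i] i by auto
  then have "b - z \<in> {x. b - x \<in> E i}" by simp
  then show "{x. b - x \<in> E i} \<noteq> {}" by blast
 next
  fix i j assume "i \<in> {..<n}" "j \<in> {..<n}" "i \<noteq> j"
  then show "{x. b - x \<in> E i} \<inter> {x. b - x \<in> E j} = {}" using E(2)[of i j] by blast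
 next
  show "(\<Union>i\<in>{..<n}. {x. b - x \<in> E i}) = {x. b - x \<in> S}" unfolding E(3)[symmetric] by blast
 qed simp
 then show ?thesis by simp
qed

lemma pieces_symmetric:
 assumes sym: "\<And>x. x \<in> S ==> b - x \<in> S" and mid: "b / 2 \<notin> S"
  and p: "pieces n {x\<in>S. x < b / 2} \<or> pieces n {x\<in>S. b / 2 < x}"
 shows "pieces (2 * n) S"
proof -
 have sym': "b - x \<in> S \<longleftrightarrow> x \<in> S" for x using sym[of x] sym[of "b - x"] by auto
 have lr: "{x\<in>S. x < b / 2} = {x. b - x \<in> {x\<in>S. b / 2 < x}}" "{x\<in>S. b / 2 < x} = {x. b - x \<in> {x\<in>S. x < b / 2}}"
  by (auto simp: sym')
 have L: "pieces n {x\<in>S. x < b / 2}" and R: "pieces n {x\<in>S. b / 2 < x}"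
  using p pieces_reflect[of n "{x\<in>S. x < b / 2}" b] pieces_reflect[of n "{x\<in>S. b / 2 < x}" b]
  unfolding lr[symmetric] by blast+
 have "pieces (n + n) ({x\<in>S. x < b / 2} \<union> {x\<in>S. b / 2 < x})" by (rule pieces_Un[OF L R]) auto
 moreover have "{x\<in>S. x < b / 2} \<union> {x\<in>S. b / 2 < x} = S"
 proof (rule set_eqI)
  fix x show "x \<in> {x\<in>S. x < b / 2} \<union> {x\<in>S. b / 2 < x} \<longleftrightarrow> x \<in> S"
   using mid linorder_neqE[of x "b / 2"] by blast
 qed
 ultimately show ?thesis by (simp add: mult_2)
qed

text \<open>Cosine decreases from (0, pi) onto (-1, 1), so components correspond. This turns the
  counts for five to seven modes into counts for polynomials.\<close>

lemma pieces_cos: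
 assumes p: "pieces n S" and S: "S \<subseteq> {-1<..<1}"
 shows "pieces n {X. 0 < X \<and> X < pi \<and> cos X \<in> S}"
proof -
 obtain E where E: "\<And>i. i < n ==> open (E i) \<and> connected (E i) \<and> E i \<noteq> {}"
  "\<And>i j. i < n ==> j < n ==> i \<noteq> j ==> E i \<inter> E j = {}" "(\<Union>i<n. E i) = S"
  by (rule piecesE[OF p]) (rule that; assumption)
 have "pieces (card {..<n}) {X. 0 < X \<and> X < pi \<and> cos X \<in> S}"
 proof (rule pieces_family[where E = "\<lambda>i. {X. 0 < X \<and> X < pi \<and> cos X \<in> E i}"])
  fix i assume i: "i \<in> {..<n}"
  have "open ({0<..<pi} \<inter> cos -` E i)" using E(1)[of i] i by (intro open_Int open_vimage continuous_intros) auto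
  moreover have "{0<..<pi} \<inter> cos -` E i = {X. 0 < X \<and> X < pi \<and> cos X \<in> E i}" by auto
  ultimately show "open {X. 0 < X \<and> X < pi \<and> cos X \<in> E i}" by simp
  have "connected (E i)" using E(1)[of i] i by simp
  then have Ec: "\<And>p q x. p \<in> E i ==> q \<in> E i ==> p \<le> x \<and> x \<le> q ==> x \<in> E i" unfolding connected_real_iff by blast
  show "connected {X. 0 < X \<and> X < pi \<and> cos X \<in> E i}"
  proof (rule connected_realI, unfold mem_Collect_eq)
   fix p x q assume a: "0 < p \<and> p < pi \<and> cos p \<in> E i" "0 < q \<and> q < pi \<and> cos q \<in> E i" "p < x" "x < q"
   have "cos q \<le> cos x" "cos x \<le> cos p" using a by (intro cos_monotone_0_pi_le; simp)+
   then show "0 < x \<and> x < pi \<and> cos x \<in> E i" using Ec[of "cos q" "cos p" "cos x"] a by simp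
  qed
  obtain z where z: "z \<in> E i" using E(1)[of i] i by auto
  then have "z \<in> S" using i E(3) by blast
  then have z1: "-1 < z" "z < 1" using S by auto
  then have "arccos z \<in> {X. 0 < X \<and> X < pi \<and> cos X \<in> E i}" using arccos_lt_bounded[OF z1] z by simp
  then show "{X. 0 < X \<and> X < pi \<and> cos X \<in> E i} \<noteq> {}" by blast
 next
  fix i j assume "i \<in> {..<n}" "j \<in> {..<n}" "i \<noteq> j"
  then show "{X. 0 < X \<and> X < pi \<and> cos X \<in> E i} \<inter> {X. 0 < X \<and> X < pi \<and> cos X \<in> E j} = {}" using E(2)[of i j] by blast
 next
  show "(\<Union>i\<in>{..<n}. {X. 0 < X \<and> X < pi \<and> cos X \<in> E i}) = {X. 0 < X \<and> X < pi \<and> cos X \<in> S}" unfolding E(3)[symmetric] by blast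
 qed simp
 then show ?thesis by simp
qed

lemma Dir_pi: "Dir k pi = (- 1) ^ (k + 1) * real k"
 using Dir_reflect[of k 0] by (simp add: Dir_0)

lemma one_minus_cos_le: "1 - v^2 / 2 \<le> cos (v :: real)"
proof -
 have "(sin (v / 2))^2 \<le> (v / 2)^2" by (rule abs_le_square_iff[THEN iffD1, OF abs_sin_x_le_abs_x])
 then show ?thesis using cos_double_sin[of "v / 2"] by (simp add: power2_eq_square)
qed

context nodal
begin

lemma card_nodal_domains:
 assumes "pieces m {X. 0 < X \<and> X < pi \<and> 0 < r * Dir k X + \<bar>4 * s * cos X\<bar>}"
  and "pieces n {X. 0 < X \<and> X < pi \<and> 0 < - (r * Dir k X) + \<bar>4 * s * cos X\<bar>}"
 shows "card (nodal_domains (rect N) u) = m + n"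
proof -
 obtain E where E: "\<And>i. i < m ==> open (E i) \<and> connected (E i) \<and> E i \<noteq> {}"
  "\<And>i j. i < m ==> j < m ==> i \<noteq> j ==> E i \<inter> E j = {}"
  "(\<Union>i<m. E i) = {X. 0 < X \<and> X < pi \<and> 0 < r * Dir k X + \<bar>4 * s * cos X\<bar>}"
  by (rule piecesE[OF assms(1)]) (rule that; assumption)
 obtain F where F: "\<And>i. i < n ==> open (F i) \<and> connected (F i) \<and> F i \<noteq> {}"
  "\<And>i j. i < n ==> j < n ==> i \<noteq> j ==> F i \<inter> F j = {}"
  "(\<Union>i<n. F i) = {X. 0 < X \<and> X < pi \<and> 0 < - (r * Dir k X) + \<bar>4 * s * cos X\<bar>}"
  by (rule piecesE[OF assms(2)]) (rule that; assumption)
 have "card (components {(x, y). 0 < x \<and> x < N \<and> 0 < y \<and> y < 1 \<and>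
   r * Dir k (pi * x / N) + 4 * s * cos (pi * x / N) * cos (pi * y) \<noteq> 0}) = card {..<m} + card {..<n}"
  by (rule card_components_sign_regions[where A = "\<lambda>X. r * Dir k X" and B = "\<lambda>X. 4 * s * cos X" and ?E1.0 = E and ?E2.0 = F,
     OF N _ _ _ _ _ _ E(3) _ _ F(3)])
   (use E(1,2) F(1,2) in \<open>auto intro!: continuous_intros continuous_Dir\<close>)
 then show ?thesis unfolding nodal_domains_eq H_def by simp
qed

lemma H_sides:
 assumes "x = 0 \<or> x = N"
 obtains \<sigma> \<rho> where "\<sigma> = 1 \<or> \<sigma> = -1" "\<rho> = 1 \<or> \<rho> = -1" "Dir k (pi * x / N) = \<sigma> * real k" "cos (pi * x / N) = \<rho>"
 using assms
proof
 assume "x = 0"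
 then show thesis using that[of 1 1] by (simp add: Dir_0)
next
 assume "x = N"
 then have e: "pi * x / N = pi" using N by simp
 have "(- 1) ^ (k + 1) = (1::real) \<or> (- 1) ^ (k + 1) = (-1::real)" by (cases "even (k + 1)") auto
 then show thesis using that[of "(- 1) ^ (k + 1)" "-1"] unfolding e by (simp add: Dir_pi)
qed

end

section \<open>Geometry of the upper limit\<close>

text \<open>A degenerate point on a horizontal side would give k^2 \<tau>^2 = 4 k^2 sin^2 + 16 cos^2
  \<ge> 16 at the angle 2 X, against k |\<tau>| < 4. On a vertical side H = 0 reads 4 |cos (pi y)| =
  k |\<tau>| < 4, which excludes the corners and makes \<open>Hy\<close> nonzero.\<close>

lemma upper_meets_orthogonally:
 assumes nod: "nodal N (- \<tau>) 1 C k u" and t: "real k * \<bar>\<tau>\<bar> < 4"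
  and p: "p \<in> nodal_set (rect N) u \<inter> frontier (rect N)"
 shows "meets_orthogonally N (nodal_set (rect N) u) p"
proof -
 interpret nodal N "- \<tau>" 1 C k u by (rule nod)
 have "(real k * \<bar>\<tau>\<bar>)^2 < 4^2" using t by (intro power_strict_mono) auto
 then have t2: "(real k)^2 * \<tau>^2 < 16" by (simp add: power_mult_distrib)
 from p show ?thesis
 proof (cases rule: frontier_cases)
  case (1 x y)
  have "Hx x y \<noteq> 0"
  proof
   assume "Hx x y = 0"
   from degenerate_horizontal[OF 1(3,4,5,2) this]
   have "(real k)^2 * \<tau>^2 = 4 * (real k)^2 * (sin (2 * (pi * x / N)))^2 + 16 * (cos (2 * (pi * x / N)))^2" by simp
   moreover have "16 * (sin (2 * (pi * x / N)))^2 \<le> 4 * (real k)^2 * (sin (2 * (pi * x / N)))^2"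
   proof (rule mult_right_mono)
    have "(2::real)^2 \<le> (real k)^2" using k by (intro power_mono) auto
    then show "16 \<le> 4 * (real k)^2" by simp
   qed simp
   moreover have "(sin (2 * (pi * x / N)))^2 + (cos (2 * (pi * x / N)))^2 = 1" by simp
   ultimately show False using t2 by linarith
  qed
  then show ?thesis unfolding 1(1) by (rule meets_orthogonally_horizontal[OF 1(3,4,5,2)])
 next
  case (2 x y)
  obtain \<sigma> \<rho> where sr: "\<sigma> = 1 \<or> \<sigma> = -1" "\<rho> = 1 \<or> \<rho> = -1" "Dir k (pi * x / N) = \<sigma> * real k" "cos (pi * x / N) = \<rho>"
   by (rule H_sides[OF 2(3)])
  have "- \<tau> * (\<sigma> * real k) + 4 * \<rho> * cos (pi * y) = 0" using 2(2) unfolding H_def sr(3,4) by simp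
  then have "\<bar>4 * \<rho> * cos (pi * y)\<bar> = \<bar>\<tau> * (\<sigma> * real k)\<bar>" by simp
  moreover have "\<bar>4 * \<rho> * cos (pi * y)\<bar> = 4 * \<bar>cos (pi * y)\<bar>" using sr(2) by auto
  moreover have "\<bar>\<tau> * (\<sigma> * real k)\<bar> = real k * \<bar>\<tau>\<bar>" using sr(1) by (auto simp: abs_mult)
  ultimately have c: "\<bar>cos (pi * y)\<bar> < 1" using t by simp
  then have y: "0 < y" "y < 1" using 2(4,5) by (auto simp: less_le)
  have "sin (pi * y) > 0" using y by (intro sin_gt_zero) auto
  then have "Hy x y \<noteq> 0" unfolding Hy_def sr(4) using sr(2) by auto
  then show ?thesis unfolding 2(1) by (rule meets_orthogonally_vertical[OF 2(3) y 2(2)])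
 qed
qed

text \<open>For k = 2 m the factor cos X splits off from \<open>Dir k\<close>, and the remaining
  \<open>Dir m\<close> is at most m in absolute value. So 4 |cos X| dominates except at pi / 2, and
  each sign lives over the same two halves.\<close>

lemma upper_even_domains:
 assumes nod: "nodal N (- \<tau>) 1 C k u" and t: "real k * \<bar>\<tau>\<bar> < 4" and ev: "even k"
 shows "card (nodal_domains (rect N) u) = 4"
proof -
 interpret nodal N "- \<tau>" 1 C k u by (rule nod)
 obtain m where m: "k = 2 * m" using ev by (elim evenE)
 have D: "\<bar>\<tau> * Dir k X\<bar> < \<bar>4 * 1 * cos X\<bar>" if "cos X \<noteq> 0" for X
 proof -
  have "\<bar>\<tau> * Dir k X\<bar> = 2 * \<bar>cos X\<bar> * (\<bar>\<tau>\<bar> * \<bar>Dir m (2 * X)\<bar>)" unfolding m Dir_double by (simp add: abs_mult)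
  also have "... \<le> 2 * \<bar>cos X\<bar> * (\<bar>\<tau>\<bar> * real m)" by (intro mult_left_mono abs_Dir_le) auto
  also have "... < 2 * \<bar>cos X\<bar> * 2" using t that by (intro mult_strict_left_mono) (auto simp: m)
  finally show ?thesis by (simp add: abs_mult)
 qed
 have D0: "Dir k X = 0" if "cos X = 0" for X using that unfolding m Dir_double by simp
 have S: "{X. 0 < X \<and> X < pi \<and> 0 < \<epsilon> * (\<tau> * Dir k X) + \<bar>4 * 1 * cos X\<bar>} = {0<..<pi/2} \<union> {pi/2<..<pi}"
  if "\<epsilon> = 1 \<or> \<epsilon> = -1" for \<epsilon> :: real
 proof (rule set_eqI)
  fix X
  have "cos X = 0 \<longleftrightarrow> X = pi/2" if "0 < X" "X < pi"
  proof
   assume "cos X = 0"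
   then show "X = pi/2" using that cos_inj_pi[of X "pi/2"] by simp
  next
   assume "X = pi/2"
   then show "cos X = 0" by (simp only: cos_pi_half)
  qed
  moreover have "0 < \<epsilon> * (\<tau> * Dir k X) + \<bar>4 * 1 * cos X\<bar> \<longleftrightarrow> cos X \<noteq> 0"
  proof (cases "cos X = 0")
   case True then show ?thesis by (simp add: D0)
  next
   case False then show ?thesis using D[OF False] \<open>\<epsilon> = 1 \<or> \<epsilon> = -1\<close> by (auto simp: abs_less_iff)
  qed
  ultimately show "X \<in> {X. 0 < X \<and> X < pi \<and> 0 < \<epsilon> * (\<tau> * Dir k X) + \<bar>4 * 1 * cos X\<bar>} \<longleftrightarrow> X \<in> {0<..<pi/2} \<union> {pi/2<..<pi}"
   using pi_gt_zero by auto
 qed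
 have "pieces 1 {0<..<pi/2}" by (rule pieces_1[of _ "pi/4"]) auto
 moreover have "pieces 1 {pi/2<..<pi}" by (rule pieces_1[of _ "3*pi/4"]) auto
 ultimately have "pieces (1 + 1) ({0<..<pi/2} \<union> {pi/2<..<pi})" by (rule pieces_Un) auto
 then have "card (nodal_domains (rect N) u) = (1 + 1) + (1 + 1)"
  using S[of 1] S[of "-1"] by (intro card_nodal_domains) simp_all
 then show ?thesis by simp
qed

text \<open>H factors as 4 cos X (cos (pi y) - q x) with |q| < 1. Inside, the nodal set is the
  vertical line x = N / 2 together with the graph of arccos (q x) / pi, and the graph has a finite
  slope where they cross.\<close>

lemma upper_even_crossing:
 assumes nod: "nodal N (- \<tau>) 1 C k u" and t: "real k * \<bar>\<tau>\<bar> < 4" and ev: "even k"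
 obtains y0 where "0 < y0" "y0 < 1" "\<bar>cos (pi * y0)\<bar> \<le> real k * \<bar>\<tau>\<bar> / 4" "crossing_at (nodal_set (rect N) u) (N / 2, y0)"
proof -
 interpret nodal N "- \<tau>" 1 C k u by (rule nod)
 obtain m where m: "k = 2 * m" using ev by (elim evenE)
 define q where "q x = \<tau> / 2 * Dir m (2 * (pi * x / N))" for x
 define q' where "q' x = \<tau> / 2 * (Dir' m (2 * (pi * x / N)) * (2 * (pi / N)))" for x
 have dq: "(q has_real_derivative q' x) (at x)" for x
 proof -
  have "((\<lambda>x. 2 * (pi * x / N)) has_real_derivative 2 * (pi / N)) (at x)"
   using N by (auto intro!: derivative_eq_intros)
  then show ?thesis unfolding q_def[abs_def] q'_def by (rule DERIV_cmult[OF DERIV_chain2[OF DERIV_Dir]])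
 qed
 have qb: "\<bar>q x\<bar> \<le> real k * \<bar>\<tau>\<bar> / 4" for x
 proof -
  have "\<bar>q x\<bar> = \<bar>\<tau>\<bar> / 2 * \<bar>Dir m (2 * (pi * x / N))\<bar>" by (simp add: q_def abs_mult)
  also have "... \<le> \<bar>\<tau>\<bar> / 2 * real m" by (intro mult_left_mono abs_Dir_le) auto
  finally show ?thesis by (simp add: m)
 qed
 have q1: "-1 < q x" "q x < 1" for x using qb[of x] t by (auto simp: abs_le_iff)
 have cq': "continuous_on UNIV q'"
  unfolding q'_def[abs_def]
  by (intro continuous_intros continuous_on_compose2[OF continuous_Dir(2)[of UNIV]]) (use N in auto)
 have cq: "continuous_on UNIV q" by (rule DERIV_continuous_on[of _ q q']) (use dq in simp)
 have Dk: "Dir k X = 2 * cos X * Dir m (2 * X)" for X unfolding m by (rule Dir_double)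
 have H_eq: "H x y = 4 * cos (pi * x / N) * (cos (pi * y) - q x)" for x y
  unfolding H_def q_def Dk by (simp add: algebra_simps)
 define Y where "Y x = arccos (q x) / pi" for x
 have Y: "0 < Y x" "Y x < 1" "cos (pi * Y x) = q x" for x
  using arccos_lt_bounded[OF q1[of x]] q1[of x] by (simp_all add: Y_def)
 have Y_iff: "cos (pi * y) = q x \<longleftrightarrow> y = Y x" if "0 \<le> y" "y \<le> 1" for x y
 proof
  assume "cos (pi * y) = q x"
  then have "arccos (q x) = pi * y" using that arccos_cos[of "pi * y"] by simp
  then show "y = Y x" by (simp add: Y_def)
 qed (simp add: Y(3))
 define Y' where "Y' x = inverse (- sqrt (1 - (q x)^2)) * q' x / pi" for x
 have dY: "(Y has_real_derivative Y' x) (at x)" for x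
  unfolding Y_def[abs_def] Y'_def
  by (rule DERIV_cdivide, rule DERIV_chain2[where f = arccos and g = q, OF DERIV_arccos[OF q1] dq])
 have q2: "(q x)^2 < 1" for x using q1[of x] by (simp add: abs_square_less_1 abs_less_iff)
 have nz: "- sqrt (1 - (q x)^2) \<noteq> 0" for x using q2[of x] by simp
 have cY': "continuous_on UNIV Y'"
  unfolding Y'_def[abs_def] by (intro continuous_intros cq cq' ballI nz) simp
 define y0 where "y0 = Y (N / 2)"
 have y0: "0 < y0" "y0 < 1" by (simp_all add: y0_def Y)
 define b where "b = min y0 (1 - y0) / 2"
 have b: "0 < b" "b < y0" "b < 1 - y0" using y0 by (auto simp: b_def)
 \<comment> \<open>Both arcs are parametrized so that they reach the crossing at 1/2, as
   \<open>crossing_at\<close> requires.\<close>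
 define g where "g t = (N / 2, (y0 - b) + (2 * b) * t)" for t
 define h where "h t = (N / 4 + (N / 2) * t, Y (N / 4 + (N / 2) * t))" for t
 have g: "C1_arc g (\<lambda>t. (0, 2 * b))"
  unfolding g_def[abs_def] by (rule C1_arc_graph(1)) (use b in auto)
 have h: "C1_arc h (\<lambda>t. (N / 2, Y' (N / 4 + (N / 2) * t) * (N / 2)))"
  unfolding h_def[abs_def]
 proof (rule C1_arc_graph(2))
  fix t :: real
  have "((\<lambda>t. N / 4 + (N / 2) * t) has_real_derivative N / 2) (at t within {0..1})"
   by (auto intro!: derivative_eq_intros)
  from DERIV_chain2[OF dY this]
  show "((\<lambda>t. Y (N / 4 + (N / 2) * t)) has_real_derivative Y' (N / 4 + (N / 2) * t) * (N / 2)) (at t within {0..1})" .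
 next
  show "continuous_on {0..1} (\<lambda>t. Y' (N / 4 + (N / 2) * t) * (N / 2))"
   by (intro continuous_intros continuous_on_compose2[OF cY']) auto
 qed (use N in simp)
 have mid: "g (1/2) = (N / 2, y0)" "h (1/2) = (N / 2, y0)" by (simp_all add: g_def h_def y0_def)
 have gi: "path_image g = {N / 2} \<times> {y0-b..y0+b}"
 proof -
  have "path_image g \<subseteq> {N / 2} \<times> {y0-b..y0+b}"
   using b by (auto simp: path_image_def g_def mult_left_le)
  moreover have "{N / 2} \<times> {y0-b..y0+b} \<subseteq> path_image g"
  proof
   fix p assume "p \<in> {N / 2} \<times> {y0-b..y0+b}"
   then obtain y where y: "p = (N / 2, y)" "y0 - b \<le> y" "y \<le> y0 + b" by auto
   have "p = g ((y - (y0 - b)) / (2 * b))" using b y(1) by (simp add: g_def)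
   moreover have "(y - (y0 - b)) / (2 * b) \<in> {0..1}" using y b by (auto simp: divide_le_eq)
   ultimately show "p \<in> path_image g" unfolding path_image_def by (rule image_eqI)
  qed
  ultimately show ?thesis by blast
 qed
 have hi: "path_image h = {(x, Y x) | x. x \<in> {N/4..3*N/4}}"
 proof -
  have "path_image h \<subseteq> {(x, Y x) | x. x \<in> {N/4..3*N/4}}"
  proof
   fix p assume "p \<in> path_image h"
   then obtain t where tt: "t \<in> {0..1}" "p = h t" by (auto simp: path_image_def)
   have "0 \<le> N / 2 * t" "N / 2 * t \<le> N / 2" using tt(1) N by (auto simp: mult_left_le)
   then have "N / 4 + (N / 2) * t \<in> {N/4..3*N/4}" by simp
   then show "p \<in> {(x, Y x) | x. x \<in> {N/4..3*N/4}}" unfolding tt(2) h_def by blast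
  qed
  moreover have "{(x, Y x) | x. x \<in> {N/4..3*N/4}} \<subseteq> path_image h"
  proof
   fix p assume "p \<in> {(x, Y x) | x. x \<in> {N/4..3*N/4}}"
   then obtain x where x: "p = (x, Y x)" "N / 4 \<le> x" "x \<le> 3 * N / 4" by auto
   have "N / 4 + (N / 2) * ((x - N / 4) / (N / 2)) = x" using N by (simp add: field_simps)
   then have "p = h ((x - N / 4) / (N / 2))" unfolding h_def x(1) by simp
   moreover have "(x - N / 4) / (N / 2) \<in> {0..1}" using x N by (auto simp: divide_le_eq)
   ultimately show "p \<in> path_image h" unfolding path_image_def by (rule image_eqI)
  qed
  ultimately show ?thesis by blast
 qed
 have H_half: "H (N / 2) y = 0" for y
  using N by (simp add: H_eq)
 have gZ: "path_image g \<subseteq> Z"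
 proof
  fix p assume "p \<in> path_image g"
  then obtain y where y: "p = (N / 2, y)" "y0 - b \<le> y" "y \<le> y0 + b" unfolding gi by auto
  show "p \<in> Z" unfolding y(1) by (rule Z_I[OF _ _ _ _ H_half]) (use N y b in auto)
 qed
 have hZ: "path_image h \<subseteq> Z"
 proof
  fix p assume "p \<in> path_image h"
  then obtain x where x: "p = (x, Y x)" "x \<in> {N/4..3*N/4}" unfolding hi by blast
  show "p \<in> Z" unfolding x(1) by (rule Z_I) (use N x Y[of x] in \<open>auto simp: H_eq\<close>)
 qed
 define U where "U = {N/4<..<3*N/4} \<times> {y0-b<..<y0+b}"
 have "Z \<inter> U \<subseteq> path_image g \<union> path_image h"
 proof
  fix p assume p: "p \<in> Z \<inter> U"
  obtain x y where xy: "p = (x, y)" by (cases p)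
  have xU: "N / 4 < x" "x < 3 * N / 4" "y0 - b < y" "y < y0 + b" using p xy by (auto simp: U_def)
  have z: "0 \<le> y" "y \<le> 1" "H x y = 0" using Z_D[of x y] p xy by auto
  then consider "cos (pi * x / N) = 0" | "cos (pi * y) = q x" unfolding H_eq by auto
  then show "p \<in> path_image g \<union> path_image h"
  proof cases
   case 1
   have "0 < pi * x / N" "pi * x / N < pi" using xU N by (intro X_range; simp)+
   then have "pi * x / N = pi / 2" using 1 cos_inj_pi[of "pi * x / N" "pi / 2"] by auto
   then have "x = N / 2" using N by (simp add: field_simps)
   then show ?thesis unfolding gi xy using xU by auto
  next
   case 2
   then have "y = Y x" using Y_iff z by blast
   then show ?thesis unfolding hi xy using xU by auto
  qed
 qed
 then have ZU: "Z \<inter> U = (path_image g \<union> path_image h) \<inter> U" using gZ hZ by blast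
 have int: "path_image g \<inter> path_image h = {(N / 2, y0)}"
  unfolding gi hi using N b by (auto simp: y0_def)
 have col: "\<not> collinear {0, (0, 2 * b), (N / 2, Y' (N / 4 + (N / 2) * (1/2)) * (N / 2))}"
  unfolding collinear_lemma using N b by (auto simp: zero_prod_def)
 have "open U" "(N / 2, y0) \<in> U" using b N by (auto simp: U_def intro: open_Times)
 then have "crossing_at Z (N / 2, y0)"
  unfolding crossing_at_def using g h mid int col ZU by blast
 moreover have "\<bar>cos (pi * y0)\<bar> \<le> real k * \<bar>\<tau>\<bar> / 4" unfolding y0_def Y(3) by (rule qb)
 ultimately show thesis using that y0 by blast
qed

lemma cos_odd_half_pi: "odd k ==> cos (real k * (pi / 2)) = 0"
 using cos_zero_iff[of "real k * (pi / 2)"] by (auto simp: algebra_simps)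

lemma sin_odd_half_pi: "odd k ==> sin (real k * (pi / 2)) = 1 \<or> sin (real k * (pi / 2)) = -1"
proof -
 assume "odd k"
 then have "cos (real k * (pi / 2)) = 0" by (rule cos_odd_half_pi)
 then have "(sin (real k * (pi / 2)))^2 = 1" using sin_cos_squared_add[of "real k * (pi / 2)"] by simp
 then show ?thesis by (simp add: power2_eq_1_iff)
qed

text \<open>On (0, pi/2] the sign is that of F. At a zero of F, k |\<eta>| < 4 together with k \<ge>
  2 makes 4 cos (2 X) dominate the derivative of F. So F is positive up to pi/4 and afterwards can
  only turn negative. Its sign at pi/2 decides whether the region is one interval or, by the
  symmetry X to pi - X, two.\<close>

lemma pieces_odd_region:
 assumes k: "odd k" "k \<ge> 4" and t: "real k * \<bar>\<eta>\<bar> < 4"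
 defines "S \<equiv> {X. 0 < X \<and> X < pi \<and> 0 < - (\<eta> * Dir k X) + \<bar>4 * 1 * cos X\<bar>}"
 shows "\<eta> * sin (real k * (pi / 2)) < 0 ==> pieces 1 S"
  and "\<eta> * sin (real k * (pi / 2)) > 0 ==> pieces 2 S"
proof -
 define F where "F X = 2 * sin (2 * X) - \<eta> * sin (real k * X)" for X
 define F' where "F' X = 4 * cos (2 * X) - \<eta> * (real k * cos (real k * X))" for X
 have dF: "(F has_real_derivative F' X) (at X)" for X
  unfolding F_def[abs_def] F'_def by (auto intro!: derivative_eq_intros)
 have "(real k * \<bar>\<eta>\<bar>)^2 < 4^2" using t by (intro power_strict_mono) auto
 then have t2: "(real k * \<eta>)^2 < 16" by (simp add: power_mult_distrib)
 have zero: "\<bar>\<eta> * (real k * cos (real k * X))\<bar> < \<bar>4 * cos (2 * X)\<bar>" if "F X = 0" for X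
 proof -
  have "(2 * sin (2 * X))^2 = (\<eta> * sin (real k * X))^2" using that by (simp add: F_def)
  then have "(real k)^2 * (2 * sin (2 * X))^2 = (real k * \<eta>)^2 * (sin (real k * X))^2" by (simp add: power_mult_distrib)
  moreover have "2^2 * (2 * sin (2 * X))^2 \<le> (real k)^2 * (2 * sin (2 * X))^2"
   using k by (intro mult_right_mono power_mono) auto
  moreover have "(real k * \<eta>)^2 * (sin (real k * X))^2 + (real k * \<eta>)^2 * (cos (real k * X))^2 = (real k * \<eta>)^2"
   by (simp add: distrib_left[symmetric])
  moreover have "2^2 * (2 * a)^2 + (4 * b)^2 = 16 * (a^2 + b^2)" for a b :: real by (simp add: power_mult_distrib)
  then have "2^2 * (2 * sin (2 * X))^2 + (4 * cos (2 * X))^2 = 16" by (simp only: sin_cos_squared_add mult_1_right)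
  ultimately have "(real k * \<eta>)^2 * (cos (real k * X))^2 < (4 * cos (2 * X))^2" using t2 by linarith
  moreover have "(real k * \<eta>)^2 * (cos (real k * X))^2 = (\<eta> * (real k * cos (real k * X)))^2"
   by (simp add: power_mult_distrib)
  ultimately show ?thesis by (simp add: abs_less_square_iff)
 qed
 have F0: "0 < F X" if X: "0 < X" "X \<le> pi / 4" for X
 proof -
  have "- F X < 0"
  proof (rule negative_persists[where f = "\<lambda>x. - F x" and f' = "\<lambda>x. - F' x" and a = 0 and b = "pi / 4" and x = 0])
   fix x assume x: "x \<in> {0..pi / 4}"
   show "((\<lambda>x. - F x) has_real_derivative - F' x) (at x)" by (rule DERIV_minus[OF dF])
   assume "- F x = 0"
   then have z: "F x = 0" by simp
   have "0 \<le> cos (2 * x)" using x by (intro cos_ge_zero) auto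
   then show "- F' x < 0" using zero[OF z] unfolding F'_def by (simp add: abs_less_iff)
  qed (use X in \<open>auto simp: F_def\<close>)
  then show ?thesis by simp
 qed
 have Fneg: "F y < 0" if "pi / 4 \<le> x" "x < y" "y \<le> pi / 2" "F x \<le> 0" for x y
 proof (rule negative_persists[where f = F and f' = F' and a = "pi / 4" and b = "pi / 2" and x = x])
  fix x assume x: "x \<in> {pi / 4..pi / 2}"
  show "(F has_real_derivative F' x) (at x)" by (rule dF)
  assume z: "F x = 0"
  have "0 \<le> cos (pi - 2 * x)" using x by (intro cos_ge_zero) auto
  then have "cos (2 * x) \<le> 0" by (simp add: cos_diff)
  then show "F' x < 0" using zero[OF z] unfolding F'_def by (simp add: abs_less_iff)
 qed (use that in auto)
 have down: "0 < F x" if "0 < x" "x < y" "y \<le> pi / 2" "0 < F y" for x y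
 proof (cases "x \<le> pi / 4")
  case True
  then show ?thesis using F0[of x] that by simp
 next
  case False
  show ?thesis
  proof (rule ccontr)
   assume "\<not> 0 < F x"
   then have "F y < 0" using False that by (intro Fneg[of x y]) simp_all
   then show False using that by simp
  qed
 qed
 have S_iff: "X \<in> S \<longleftrightarrow> 0 < F X" if X: "0 < X" "X \<le> pi / 2" for X
 proof -
  have s: "sin X > 0" using X by (intro sin_gt_zero) auto
  have "cos X \<ge> 0" using X by (intro cos_ge_zero) auto
  then have "sin X * (- (\<eta> * Dir k X) + \<bar>4 * 1 * cos X\<bar>) = 4 * sin X * cos X - \<eta> * (sin X * Dir k X)"
   by (simp add: algebra_simps)
  also have "... = F X" unfolding sin_mult_Dir F_def sin_double by simp
  finally have "0 < F X \<longleftrightarrow> 0 < - (\<eta> * Dir k X) + \<bar>4 * 1 * cos X\<bar>" using s by (metis zero_less_mult_pos zero_less_mult_iff)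
  moreover have "X < pi" using X pi_gt_zero by linarith
  ultimately show ?thesis unfolding S_def using X by simp
 qed
 have sym: "pi - X \<in> S" if "X \<in> S" for X
 proof -
  have "Dir k (pi - X) = Dir k X" unfolding Dir_reflect using k(1) by simp
  moreover have "\<bar>4 * 1 * cos (pi - X)\<bar> = \<bar>4 * 1 * cos X\<bar>" by (simp add: cos_diff)
  ultimately show ?thesis using that unfolding S_def mem_Collect_eq by simp
 qed
 have Fh: "F (pi / 2) = - (\<eta> * sin (real k * (pi / 2)))" by (simp add: F_def)
 have oS: "open S"
  unfolding S_def by (intro open_Collect_conj open_Collect_less continuous_intros continuous_Dir)
 show "pieces 1 S" if "\<eta> * sin (real k * (pi / 2)) < 0"
 proof -
  have h: "0 < F (pi / 2)" using that Fh by simp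
  have L: "X \<in> S" if "0 < X" "X \<le> pi / 2" for X
  proof -
   have "0 < F X"
   proof (cases "X < pi / 2")
    case True
    then show ?thesis using down[of X "pi / 2"] h that by simp
   next
    case False
    then have "X = pi / 2" using that by linarith
    then show ?thesis by (simp only: h)
   qed
   then show ?thesis using S_iff[OF that] by simp
  qed
  have "X \<in> S" if "0 < X" "X < pi" for X
   using L[of X] sym[OF L[of "pi - X"]] that by (cases "X \<le> pi / 2") auto
  then have "S = {0<..<pi}" unfolding S_def by auto
  then show ?thesis using oS by (intro pieces_1[of _ "pi / 2"]) auto
 qed
 show "pieces 2 S" if "\<eta> * sin (real k * (pi / 2)) > 0"
 proof -
  have "pi / 2 \<notin> S" using S_iff[of "pi / 2"] that Fh by simp
  moreover have "pieces 1 {x\<in>S. x < pi / 2}"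
  proof (rule pieces_1)
   have "open (S \<inter> {..<pi / 2})" using oS by (rule open_Int) simp
   moreover have "S \<inter> {..<pi / 2} = {x\<in>S. x < pi / 2}" by auto
   ultimately show "open {x\<in>S. x < pi / 2}" by simp
   show "pi / 4 \<in> {x\<in>S. x < pi / 2}" using S_iff[of "pi / 4"] F0[of "pi / 4"] by simp
   fix a x b assume a: "a \<in> {x\<in>S. x < pi / 2}" "b \<in> {x\<in>S. x < pi / 2}" "a < x" "x < b"
   have "0 < a" using a(1) by (simp add: S_def)
   then show "x \<in> {x\<in>S. x < pi / 2}" using down[of x b] S_iff[of b] S_iff[of x] a by simp
  qed
  ultimately have "pieces (2 * 1) S" by (intro pieces_symmetric[where b = pi]) (use sym in auto)
  then show ?thesis by simp
 qed
qed

text \<open>Passing from \<tau> to -\<tau> reverses the sign at pi / 2, so one of the two regions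
  consists of one interval and the other of two.\<close>

lemma upper_odd_domains:
 assumes nod: "nodal N (- \<tau>) 1 C k u" and t: "real k * \<bar>\<tau>\<bar> < 4" and \<tau>: "\<tau> \<noteq> 0" and od: "odd k"
 shows "card (nodal_domains (rect N) u) = 3"
proof -
 interpret nodal N "- \<tau>" 1 C k u by (rule nod)
 have t': "real k * \<bar>- \<tau>\<bar> < 4" using t by simp
 note P = pieces_odd_region[OF od k t] and M = pieces_odd_region[OF od k t']
 have "\<tau> * sin (real k * (pi / 2)) \<noteq> 0" using sin_odd_half_pi[OF od] \<tau> by auto
 then consider "\<tau> * sin (real k * (pi / 2)) < 0" | "\<tau> * sin (real k * (pi / 2)) > 0" by linarith
 then show ?thesis
 proof cases
  case 1
  have "card (nodal_domains (rect N) u) = 1 + 2" using P(1)[OF 1] M(2) 1 by (intro card_nodal_domains) simp_all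
  then show ?thesis by simp
 next
  case 2
  have "card (nodal_domains (rect N) u) = 2 + 1" using P(2)[OF 2] M(1) 2 by (intro card_nodal_domains) simp_all
  then show ?thesis by simp
 qed
qed

text \<open>With d = X - pi / 2 and k odd, |sin (k X)| = |cos (k d)| is at least 1/2 in the strip,
  whereas |sin (2 X)| is at most 2 |d|. On the nodal set this forces |\<tau>| \<le> 8 |d|.\<close>

lemma upper_odd_strip:
 assumes nod: "nodal N (- \<tau>) 1 C k u" and od: "odd k" and z: "(x, y) \<in> nodal_set (rect N) u"
  and near: "real k * (pi * \<bar>x - N / 2\<bar> / N) < 1"
 shows "real k * \<bar>\<tau>\<bar> \<le> 8 * (real k * (pi * \<bar>x - N / 2\<bar> / N))"
proof -
 interpret nodal N "- \<tau>" 1 C k u by (rule nod)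
 define X where "X = pi * x / N"
 define d where "d = X - pi / 2"
 have ad: "pi * \<bar>x - N / 2\<bar> / N = \<bar>d\<bar>"
 proof -
  have "d = pi * (x - N / 2) / N" using N by (simp add: d_def X_def field_simps)
  then show ?thesis using N by (simp add: abs_mult)
 qed
 have "- \<tau> * Dir k X + 4 * 1 * cos X * cos (pi * y) = 0" using Z_D(5)[OF z] unfolding H_def X_def by simp
 then have "sin X * (\<tau> * Dir k X) = sin X * (4 * cos X * cos (pi * y))" by simp
 then have e: "\<tau> * sin (real k * X) = 2 * sin (2 * X) * cos (pi * y)"
  unfolding sin_mult_Dir[symmetric] sin_double by (simp add: algebra_simps)
 have "sin (2 * X) = - sin (2 * d)" using sin_minus_pi[of "2 * X"] by (simp add: d_def algebra_simps)
 then have "\<bar>sin (2 * X)\<bar> \<le> 2 * \<bar>d\<bar>" using abs_sin_x_le_abs_x[of "2 * d"] by simp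
 then have "2 * \<bar>sin (2 * X)\<bar> * \<bar>cos (pi * y)\<bar> \<le> 2 * (2 * \<bar>d\<bar>) * 1" by (intro mult_mono) auto
 moreover have "\<bar>\<tau>\<bar> * \<bar>sin (real k * X)\<bar> = 2 * \<bar>sin (2 * X)\<bar> * \<bar>cos (pi * y)\<bar>"
  using arg_cong[OF e, of abs] by (simp only: abs_mult) simp
 ultimately have up: "\<bar>\<tau>\<bar> * \<bar>sin (real k * X)\<bar> \<le> 4 * \<bar>d\<bar>" by linarith
 have "real k * X = real k * d + real k * (pi / 2)" by (simp add: d_def algebra_simps)
 moreover have "cos (real k * (pi / 2)) = 0" by (rule cos_odd_half_pi[OF od])
 ultimately have "sin (real k * X) = cos (real k * d) * sin (real k * (pi / 2))" by (simp add: sin_add)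
 then have "\<bar>sin (real k * X)\<bar> = \<bar>cos (real k * d)\<bar>" using sin_odd_half_pi[OF od] by (auto simp: abs_mult)
 moreover have "1 / 2 \<le> cos (real k * d)"
 proof -
  have "\<bar>real k * d\<bar> < 1" using near ad by (simp add: abs_mult)
  then have "(real k * d)^2 < 1" by (simp add: abs_square_less_1)
  then show ?thesis using one_minus_cos_le[of "real k * d"] by linarith
 qed
 ultimately have "\<bar>\<tau>\<bar> * (1 / 2) \<le> \<bar>\<tau>\<bar> * \<bar>sin (real k * X)\<bar>" by (intro mult_left_mono) auto
 then have "\<bar>\<tau>\<bar> \<le> 8 * \<bar>d\<bar>" using up by linarith
 then have "real k * \<bar>\<tau>\<bar> \<le> real k * (8 * \<bar>d\<bar>)" by (rule mult_left_mono) simp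
 then show ?thesis unfolding ad by simp
qed

subsection \<open>The lower branch for many modes\<close>

context
 fixes k :: nat and \<tau> :: real
 assumes k: "k \<ge> 4" and t: "2 * \<bar>\<tau>\<bar> < 1"
begin

text \<open>With c = cos (pi y) this is sin X times the bracket in the form of \<open>w0\<close>.
  The blocks used below are centred at the zeros j pi / k of sin (k X), and at their ends |sin (k
  X)| = 1 dominates the second term, whose coefficient is below 1.\<close>

definition G :: "real => real => real" where
 "G c X = sin (real k * X) + 2 * \<tau> * c * sin (2 * X)"

lemma abs_tau_mult: assumes "\<bar>c\<bar> \<le> 1" shows "\<bar>2 * \<tau> * c\<bar> < 1"
proof -
 have "2 * \<bar>\<tau>\<bar> * \<bar>c\<bar> \<le> 2 * \<bar>\<tau>\<bar> * 1" using assms by (intro mult_left_mono) auto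
 then show ?thesis using t by (simp add: abs_mult)
qed

lemma block_shift: "real k * ((2 * real j - 1) * pi / (2 * real k)) = real j * pi - pi / 2"
 "real k * ((2 * real j + 1) * pi / (2 * real k)) = real j * pi + pi / 2"
 using k by (simp_all add: field_simps)

lemma G_left: assumes "\<bar>c\<bar> \<le> 1" shows "(- 1) ^ j * G c ((2 * real j - 1) * pi / (2 * real k)) < 0"
proof -
 have sq: "(- 1) ^ j * (- 1) ^ j = (1 :: real)" by (simp add: power_mult_distrib[symmetric])
 have "sin (real j * pi - pi / 2) = - ((- 1) ^ j)" by (simp add: sin_diff)
 then have "(- 1) ^ j * G c ((2 * real j - 1) * pi / (2 * real k)) =
   - 1 + (- 1) ^ j * (2 * \<tau> * c * sin (2 * ((2 * real j - 1) * pi / (2 * real k))))"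
  unfolding G_def block_shift by (simp only: distrib_left mult_minus_right sq)
 moreover have "\<bar>(- 1) ^ j * (2 * \<tau> * c * sin (2 * ((2 * real j - 1) * pi / (2 * real k))))\<bar> \<le> \<bar>2 * \<tau> * c\<bar> * 1"
  unfolding abs_mult[of "(- 1) ^ j"] abs_mult[of "2 * \<tau> * c"] by (simp add: mult_left_le power_abs)
 ultimately show ?thesis using abs_tau_mult[OF assms] by linarith
qed

lemma G_right: assumes "\<bar>c\<bar> \<le> 1" shows "0 < (- 1) ^ j * G c ((2 * real j + 1) * pi / (2 * real k))"
proof -
 have "2 * real (Suc j) - 1 = 2 * real j + 1" by simp
 then show ?thesis using G_left[OF assms, of "Suc j"] by (simp add: add.commute)
qed

text \<open>At a zero, sin^2 (k X) = s^2 sin^2 (2 X) with s^2 < 1, so cos^2 (k X) exceeds s^2 cos^2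
  (2 X). Hence k cos (k X) dominates the derivative and gives it the sign (-1)^j: within a block all
  crossings have one direction.\<close>

lemma G_block:
 assumes c: "\<bar>c\<bar> \<le> 1" and x: "(2 * real j - 1) * pi / (2 * real k) \<le> x" "x < y" "y \<le> (2 * real j + 1) * pi / (2 * real k)"
  and nn: "0 \<le> (- 1) ^ j * G c x"
 shows "0 < (- 1) ^ j * G c y"
proof -
 define s where "s = 2 * \<tau> * c"
 have s1: "s^2 < 1" using abs_tau_mult[OF c] by (simp add: s_def abs_square_less_1)
 have "- ((- 1) ^ j * G c y) < 0"
 proof (rule negative_persists[where f = "\<lambda>X. - ((- 1) ^ j * G c X)"
    and f' = "\<lambda>X. - ((- 1) ^ j * (real k * cos (real k * X) + 2 * s * cos (2 * X)))"
    and a = "(2 * real j - 1) * pi / (2 * real k)" and b = "(2 * real j + 1) * pi / (2 * real k)" and x = x])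
  fix X assume X: "X \<in> {(2 * real j - 1) * pi / (2 * real k)..(2 * real j + 1) * pi / (2 * real k)}"
  show "((\<lambda>X. - ((- 1) ^ j * G c X)) has_real_derivative - ((- 1) ^ j * (real k * cos (real k * X) + 2 * s * cos (2 * X)))) (at X)"
   unfolding G_def s_def by (rule DERIV_minus, rule DERIV_cmult) (auto intro!: derivative_eq_intros)
  assume "- ((- 1) ^ j * G c X) = 0"
  then have "sin (real k * X) = - (s * sin (2 * X))" by (simp add: G_def s_def)
  then have sk: "(sin (real k * X))^2 = s^2 * (sin (2 * X))^2" by (simp add: power_mult_distrib)
  \<comment> \<open>The phase relative to the centre of the block. It lies in [-pi/2, pi/2], where
    cosine is nonnegative.\<close>
  define a where "a = real k * X - real j * pi"
  have kX: "real k * X = a + real j * pi" by (simp add: a_def)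
  have "real k * ((2 * real j - 1) * pi / (2 * real k)) \<le> real k * X" "real k * X \<le> real k * ((2 * real j + 1) * pi / (2 * real k))"
   using X by (intro mult_left_mono; simp)+
  then have "- (pi / 2) \<le> a" "a \<le> pi / 2" unfolding block_shift a_def by linarith+
  then have ca: "0 \<le> cos a" by (intro cos_ge_zero) auto
  have ck: "cos (real k * X) = (- 1) ^ j * cos a" unfolding kX cos_add by simp
  have "(cos (real k * X))^2 = (cos a)^2" unfolding ck by (simp add: power_mult_distrib power_mult[symmetric] mult.commute[of j])
  then have ca2: "(cos a)^2 = 1 - s^2 * (sin (2 * X))^2" using sk sin_cos_squared_add[of "real k * X"] by linarith
  have "s^2 * (sin (2 * X))^2 + s^2 * (cos (2 * X))^2 = s^2" by (simp add: distrib_left[symmetric])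
  then have "s^2 * (cos (2 * X))^2 < (cos a)^2" using ca2 s1 by linarith
  then have "(s * cos (2 * X))^2 < (cos a)^2" by (simp add: power_mult_distrib)
  then have "\<bar>s * cos (2 * X)\<bar> < cos a" using ca abs_less_square_iff[of "s * cos (2 * X)" "cos a"] by simp
  moreover have "2 * cos a \<le> real k * cos a" using k ca by (intro mult_right_mono) auto
  moreover have "\<bar>(- 1) ^ j * (s * cos (2 * X))\<bar> = \<bar>s * cos (2 * X)\<bar>" by (simp add: abs_mult power_abs)
  ultimately have "0 < real k * cos a + 2 * ((- 1) ^ j * (s * cos (2 * X)))" by linarith
  moreover have "(- 1) ^ j * (real k * cos (real k * X) + 2 * s * cos (2 * X)) = real k * cos a + 2 * ((- 1) ^ j * (s * cos (2 * X)))"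
   unfolding ck by (simp add: distrib_left power_mult_distrib[symmetric])
  ultimately show "- ((- 1) ^ j * (real k * cos (real k * X) + 2 * s * cos (2 * X))) < 0" by linarith
 qed (use x nn in auto)
 then show ?thesis by simp
qed

lemma block_less: "(2 * real j - 1) * pi / (2 * real k) < (2 * real j + 1) * pi / (2 * real k)"
 using k by (intro divide_strict_right_mono mult_strict_right_mono) auto

text \<open>The crossing is kept as a function of c because the nodal curve of the block is X =
  \<xi> (cos (pi y)).\<close>

lemma crossing_exists:
 obtains \<xi> where "continuous_on {-1..1} \<xi>"
  "\<And>c. c \<in> {-1..1} ==> (2 * real j - 1) * pi / (2 * real k) < \<xi> c \<and> \<xi> c < (2 * real j + 1) * pi / (2 * real k)"
  "\<And>c X. c \<in> {-1..1} ==> (2 * real j - 1) * pi / (2 * real k) \<le> X ==> X \<le> (2 * real j + 1) * pi / (2 * real k) ==>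
   G c X = 0 \<longleftrightarrow> X = \<xi> c"
proof -
 define a where "a = (2 * real j - 1) * pi / (2 * real k)"
 define b where "b = (2 * real j + 1) * pi / (2 * real k)"
 have ab: "a < b" using block_less by (simp add: a_def b_def)
 have "\<exists>x. a < x \<and> x < b \<and> G c x = 0" if c: "c \<in> {-1..1}" for c
 proof -
  have c': "\<bar>c\<bar> \<le> 1" using c by auto
  have l: "(- 1) ^ j * G c a < 0" unfolding a_def by (rule G_left[OF c'])
  have r: "0 < (- 1) ^ j * G c b" unfolding b_def by (rule G_right[OF c'])
  have "\<exists>x\<ge>a. x \<le> b \<and> (- 1) ^ j * G c x = 0"
   by (rule IVT') (use l r ab in \<open>auto simp: G_def intro!: continuous_intros\<close>)
  then obtain x where x: "a \<le> x" "x \<le> b" "(- 1) ^ j * G c x = 0" by blast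
  have "x \<noteq> a" "x \<noteq> b" using l r x(3) by auto
  then show ?thesis using x by (intro exI[of _ x]) auto
 qed
 then obtain \<xi> where \<xi>: "\<And>c. c \<in> {-1..1} ==> a < \<xi> c \<and> \<xi> c < b \<and> G c (\<xi> c) = 0" by metis
 have pos: "0 < (- 1) ^ j * G c X" if "c \<in> {-1..1}" "\<xi> c < X" "X \<le> b" for c X
 proof -
  have "\<bar>c\<bar> \<le> 1" using that by auto
  then show ?thesis by (rule G_block[where x = "\<xi> c"]) (use that \<xi>[of c] in \<open>auto simp: a_def b_def\<close>)
 qed
 have neg: "(- 1) ^ j * G c X < 0" if "c \<in> {-1..1}" "a \<le> X" "X < \<xi> c" for c X
 proof (rule ccontr)
  have c': "\<bar>c\<bar> \<le> 1" using that by auto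
  assume "\<not> (- 1) ^ j * G c X < 0"
  then have "0 < (- 1) ^ j * G c (\<xi> c)"
   by (intro G_block[OF c', where x = X]) (use that \<xi>[of c] in \<open>auto simp: a_def b_def\<close>)
  then show False using \<xi>[of c] that by simp
 qed
 have cont: "continuous_on {-1..1} \<xi>"
 proof (rule continuous_on_unique_crossing[where F = "\<lambda>X c. (- 1) ^ j * G c X" and a = a and b = b])
  fix X show "continuous_on {-1..1} (\<lambda>c. (- 1) ^ j * G c X)" unfolding G_def by (intro continuous_intros)
 qed (use \<xi> pos neg in auto)
 show thesis
 proof (rule that[OF cont])
  fix c X :: real assume "c \<in> {-1..1}"
  then show "(2 * real j - 1) * pi / (2 * real k) < \<xi> c \<and> \<xi> c < (2 * real j + 1) * pi / (2 * real k)"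
   using \<xi>[of c] by (simp add: a_def b_def)
 next
  fix c X :: real assume X: "c \<in> {-1..1}" "(2 * real j - 1) * pi / (2 * real k) \<le> X" "X \<le> (2 * real j + 1) * pi / (2 * real k)"
  show "G c X = 0 \<longleftrightarrow> X = \<xi> c"
  proof
   assume G0: "G c X = 0"
   show "X = \<xi> c"
   proof (rule ccontr)
    assume "X \<noteq> \<xi> c"
    then consider "X < \<xi> c" | "\<xi> c < X" by linarith
    then show False
    proof cases
     case 1 then show False using neg[of c X] X G0 by (simp add: a_def)
    next
     case 2 then show False using pos[of c X] X G0 by (simp add: b_def)
    qed
   qed
  qed (use \<xi>[of c] X in simp)
 qed
qed

text \<open>The blocks 0 and k are only half inside [0, pi]; their crossings are the points 0 and
  pi, where G vanishes for every c. The argument rounds k X / pi to the nearest integer.\<close>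

lemma block_index:
 assumes "0 \<le> X" "X < pi"
 obtains i :: nat where "i \<le> k" "(2 * real i - 1) * pi / (2 * real k) \<le> X" "X < (2 * real i + 1) * pi / (2 * real k)"
proof -
 define f where "f = real k * X / pi + 1 / 2"
 define i where "i = nat \<lfloor>f\<rfloor>"
 have "0 \<le> real k * X / pi" using assms by simp
 then have f0: "0 \<le> f" by (simp add: f_def)
 then have i: "real i \<le> f" "f < real i + 1" by (simp_all add: i_def of_nat_nat floor_less_cancel; linarith)+
 have "real k * X / pi < real k" using assms k by (simp add: divide_less_eq)
 then have "real i < real k + 1" using i(1) by (simp add: f_def)
 then have "i \<le> k" by linarith
 moreover have "(2 * real i - 1) * pi / (2 * real k) \<le> X" "X < (2 * real i + 1) * pi / (2 * real k)"
  using i k by (simp_all add: f_def field_simps)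
 ultimately show thesis by (rule that)
qed

lemma block_mono:
 assumes "p \<le> q" shows "p * pi / (2 * real k) \<le> q * pi / (2 * real k)"
 using assms by (intro divide_right_mono mult_right_mono) auto

lemma block_strict_mono:
 assumes "p < q" shows "p * pi / (2 * real k) < q * pi / (2 * real k)"
 using assms k by (intro divide_strict_right_mono mult_strict_right_mono) auto

text \<open>The absolute value says that \<epsilon> G is positive for c = 1 or for c = -1. In a
  block with (-1)^j = \<epsilon> this persists to the right, in the next block to the left. So each
  component straddles the common end of two adjacent blocks, and it is indexed by the left one, j <
  k.\<close>

lemma pieces_lower_region:
 assumes e: "\<epsilon> = 1 \<or> \<epsilon> = (-1::real)"
 shows "pieces (card {j. j < k \<and> (- 1) ^ j = \<epsilon>}) {X. 0 < X \<and> X < pi \<and> 0 < \<epsilon> * Dir k X + \<bar>4 * \<tau> * cos X\<bar>}"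
proof -
 define S where "S = {X. 0 < X \<and> X < pi \<and> 0 < \<epsilon> * Dir k X + \<bar>4 * \<tau> * cos X\<bar>}"
 have S_iff: "X \<in> S \<longleftrightarrow> 0 < \<epsilon> * G 1 X \<or> 0 < \<epsilon> * G (-1) X" if X: "0 < X" "X < pi" for X
 proof -
  have s: "sin X > 0" using X by (rule sin_gt_zero)
  have "sin X * (\<epsilon> * Dir k X + \<bar>4 * \<tau> * cos X\<bar>) = \<epsilon> * (sin X * Dir k X) + \<bar>4 * \<tau> * cos X * sin X\<bar>"
   using s by (simp add: algebra_simps abs_mult)
  also have "... = \<epsilon> * sin (real k * X) + \<bar>2 * \<tau> * sin (2 * X)\<bar>"
   unfolding sin_mult_Dir sin_double by (simp add: ac_simps)
  finally have "0 < \<epsilon> * sin (real k * X) + \<bar>2 * \<tau> * sin (2 * X)\<bar> \<longleftrightarrow> 0 < \<epsilon> * Dir k X + \<bar>4 * \<tau> * cos X\<bar>"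
   using s by (metis zero_less_mult_pos mult_pos_pos)
  moreover have "0 < \<epsilon> * sin (real k * X) + \<bar>2 * \<tau> * sin (2 * X)\<bar> \<longleftrightarrow> 0 < \<epsilon> * G 1 X \<or> 0 < \<epsilon> * G (-1) X"
   unfolding G_def using e by auto
  ultimately show ?thesis unfolding S_def using X by simp
 qed
 have one: "\<bar>1::real\<bar> \<le> 1" "\<bar>-1::real\<bar> \<le> 1" by simp_all
 have oS: "open S"
  unfolding S_def by (intro open_Collect_conj open_Collect_less continuous_intros continuous_Dir)
 have S0: "0 < X" "X < pi" if "X \<in> S" for X using that by (auto simp: S_def)
 define l where "l j = (2 * real j - 1) * pi / (2 * real k)" for j
 define m where "m j = (2 * real j + 1) * pi / (2 * real k)" for j
 define E where "E j = S \<inter> {l j<..<(2 * real j + 3) * pi / (2 * real k)}" for j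
 have m_eq: "m j = l (Suc j)" "(2 * real j + 3) * pi / (2 * real k) = m (Suc j)" for j by (simp_all add: m_def l_def)
 have up: "x \<in> S" if "a \<in> S" "l j \<le> a" "a < x" "x \<le> m j" "(- 1) ^ j = \<epsilon>" "x < pi" for a x j
 proof -
  have a: "0 < a" "a < pi" using S0 that(1) by auto
  have *: "0 < \<epsilon> * G c x" if "\<bar>c\<bar> \<le> 1" "0 < \<epsilon> * G c a" for c
   using G_block[OF that(1), of j a x] that(2) \<open>l j \<le> a\<close> \<open>a < x\<close> \<open>x \<le> m j\<close> \<open>(- 1) ^ j = \<epsilon>\<close> by (simp add: l_def m_def)
  have "0 < \<epsilon> * G 1 x \<or> 0 < \<epsilon> * G (-1) x" using S_iff[OF a] that(1) *[OF one(1)] *[OF one(2)] by blast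
  then show ?thesis using S_iff[of x] a \<open>a < x\<close> \<open>x < pi\<close> by simp
 qed
 have down: "x \<in> S" if "b \<in> S" "l j \<le> x" "x < b" "b \<le> m j" "(- 1) ^ j = - \<epsilon>" "0 < x" for b x j
 proof -
  have b: "0 < b" "b < pi" using S0 that(1) by auto
  have *: "0 < \<epsilon> * G c x" if c: "\<bar>c\<bar> \<le> 1" "0 < \<epsilon> * G c b" for c
  proof (rule ccontr)
   assume "\<not> 0 < \<epsilon> * G c x"
   then have "0 < (- 1) ^ j * G c b"
    by (intro G_block[OF c(1), of j x]) (use \<open>\<not> 0 < \<epsilon> * G c x\<close> \<open>l j \<le> x\<close> \<open>x < b\<close> \<open>b \<le> m j\<close> \<open>(- 1) ^ j = - \<epsilon>\<close> in \<open>simp_all add: l_def m_def\<close>)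
   then show False using c(2) \<open>(- 1) ^ j = - \<epsilon>\<close> by simp
  qed
  have "0 < \<epsilon> * G 1 x \<or> 0 < \<epsilon> * G (-1) x" using S_iff[OF b] that(1) *[OF one(1)] *[OF one(2)] by blast
  then show ?thesis using S_iff[of x] b \<open>x < b\<close> \<open>0 < x\<close> by simp
 qed
 have "pieces (card {j. j < k \<and> (- 1) ^ j = \<epsilon>}) S"
 proof (rule pieces_family[where E = E])
  fix j assume j: "j \<in> {j. j < k \<and> (- 1) ^ j = \<epsilon>}"
  show "open (E j)" unfolding E_def using oS by (intro open_Int) auto
  show "connected (E j)"
  proof (rule connected_realI)
   fix a x b assume a: "a \<in> E j" "b \<in> E j" "a < x" "x < b"
   have ax: "l j < a" "b < m (Suc j)" "a \<in> S" "b \<in> S" using a unfolding E_def m_eq by auto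
   have xp: "0 < x" "x < pi" using S0[OF ax(3)] S0[OF ax(4)] a by linarith+
   have "x \<in> S"
   proof (cases "x \<le> m j")
    case True
    show ?thesis by (rule up[OF ax(3) _ a(3) True _ xp(2)]) (use ax j in auto)
   next
    case False
    show ?thesis by (rule down[OF ax(4), of "Suc j"]) (use False ax j a xp in \<open>auto simp: m_eq(1)[symmetric]\<close>)
   qed
   then show "x \<in> E j" unfolding E_def m_eq(2) using ax a by auto
  qed
  have mj: "0 < m j" "m j < pi"
  proof -
   show "0 < m j" using k by (simp add: m_def)
   have "real j + 1 \<le> real k" using j by simp
   then have "(2 * real j + 1) * pi / (2 * real k) < (2 * real k) * pi / (2 * real k)" by (intro block_strict_mono) simp
   then show "m j < pi" using k by (simp add: m_def)
  qed
  have "0 < \<epsilon> * G 1 (m j)" using G_right[OF one(1), of j] j by (simp add: m_def)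
  then have "m j \<in> S" using S_iff[OF mj] by simp
  moreover have "l j < m j" "m j < (2 * real j + 3) * pi / (2 * real k)"
   unfolding l_def m_def by (intro block_strict_mono; simp)+
  ultimately show "E j \<noteq> {}" unfolding E_def by auto
 next
  have dj: "E i \<inter> E j = {}" if "i < j" "(- 1) ^ i = \<epsilon>" "(- 1) ^ j = \<epsilon>" for i j
  proof -
   have "j \<noteq> Suc i" using that e by auto
   then have "Suc (Suc i) \<le> j" using that(1) by simp
   then have "real i + 2 \<le> real j" by linarith
   then have "(2 * real i + 3) * pi / (2 * real k) \<le> (2 * real j - 1) * pi / (2 * real k)" by (intro block_mono) simp
   then show ?thesis unfolding E_def l_def by auto
  qed
  fix i j assume ij: "i \<in> {j. j < k \<and> (- 1) ^ j = \<epsilon>}" "j \<in> {j. j < k \<and> (- 1) ^ j = \<epsilon>}" "i \<noteq> j"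
  then show "E i \<inter> E j = {}" using dj[of i j] dj[of j i] by (cases "i < j") auto
 next
  show "(\<Union>j\<in>{j. j < k \<and> (- 1) ^ j = \<epsilon>}. E j) = S"
  proof
   show "(\<Union>j\<in>{j. j < k \<and> (- 1) ^ j = \<epsilon>}. E j) \<subseteq> S" by (auto simp: E_def)
   show "S \<subseteq> (\<Union>j\<in>{j. j < k \<and> (- 1) ^ j = \<epsilon>}. E j)"
   proof
    fix X assume X: "X \<in> S"
    have Xp: "0 < X" "X < pi" using S0[OF X] by auto
    obtain c where c: "\<bar>c\<bar> \<le> 1" "0 < \<epsilon> * G c X" using S_iff[OF Xp] X one by blast
    obtain i where i: "i \<le> k" "l i \<le> X" "X < m i"
     using block_index[of X] Xp unfolding l_def m_def by (metis less_imp_le)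
    show "X \<in> (\<Union>j\<in>{j. j < k \<and> (- 1) ^ j = \<epsilon>}. E j)"
    proof (cases "(- 1) ^ i = \<epsilon>")
     case True
     have "X \<noteq> l i" using G_left[OF c(1), of i] c(2) True by (auto simp: l_def)
     then have "l i < X" using i by simp
     moreover have "m i \<le> (2 * real i + 3) * pi / (2 * real k)" unfolding m_def by (rule block_mono) simp
     \<comment> \<open>In block k positivity would persist up to pi, where G is 0.\<close>
     moreover have "i \<noteq> k"
     proof
      assume ik: "i = k"
      have "pi = (2 * real k) * pi / (2 * real k)" using k by simp
      also have "... \<le> m i" unfolding m_def ik by (rule block_mono) simp
      finally have "0 < (- 1) ^ i * G c pi"
       by (intro G_block[OF c(1), of i X]) (use i Xp c True in \<open>auto simp: l_def m_def\<close>)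
      moreover have "G c pi = 0" by (simp add: G_def)
      ultimately show False by simp
     qed
     ultimately have "X \<in> E i" "i < k" unfolding E_def using X i by auto
     then show ?thesis using True by blast
    next
     case False
     then have m1: "(- 1) ^ i = - \<epsilon>" using e by (cases "even i") auto
     \<comment> \<open>In block 0 the crossing is at X = 0, so to its right G already has the sign
       of (-1)^0, opposite to \<epsilon>.\<close>
     have "i \<noteq> 0"
     proof
      assume i0: "i = 0"
      have "l i \<le> 0 * pi / (2 * real k)" unfolding l_def i0 by (rule block_mono) simp
      then have "0 < (- 1) ^ i * G c X"
       by (intro G_block[OF c(1), of i 0]) (use i Xp in \<open>auto simp: l_def m_def G_def\<close>)
      then show False using c(2) m1 by simp
     qed
     then obtain j where j: "i = Suc j" by (cases i) auto
     have "l j < l i" unfolding l_def j by (rule block_strict_mono) simp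
     then have "X \<in> E j" unfolding E_def m_eq(2) using X i j by auto
     moreover have "(- 1) ^ j = \<epsilon>" using m1 j by simp
     ultimately show ?thesis using i(1) j by (intro UN_I[of j]) simp_all
    qed
   qed
  qed
 qed simp
 then show ?thesis by (simp add: S_def)
qed

lemma lower_many_domains:
 assumes nod: "nodal N 1 \<tau> C k u"
 shows "card (nodal_domains (rect N) u) = k"
proof -
 interpret nodal N 1 \<tau> C k u by (rule nod)
 have "card (nodal_domains (rect N) u) = card {j. j < k \<and> (- 1) ^ j = (1::real)} + card {j. j < k \<and> (- 1) ^ j = (-1::real)}"
  using pieces_lower_region[of 1] pieces_lower_region[of "-1"] by (intro card_nodal_domains) simp_all
 also have "... = card ({j. j < k \<and> (- 1) ^ j = (1::real)} \<union> {j. j < k \<and> (- 1) ^ j = (-1::real)})"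
  by (rule card_Un_disjoint[symmetric]) auto
 also have "{j. j < k \<and> (- 1) ^ j = (1::real)} \<union> {j. j < k \<and> (- 1) ^ j = (-1::real)} = {..<k}"
 proof (rule set_eqI)
  fix j show "j \<in> {j. j < k \<and> (- 1) ^ j = (1::real)} \<union> {j. j < k \<and> (- 1) ^ j = (-1::real)} \<longleftrightarrow> j \<in> {..<k}"
   by (cases "even j") auto
 qed
 finally show ?thesis by simp
qed

end

text \<open>On the vertical sides |Dir| = k \<ge> 4 > 4 |\<tau>|, so the nodal set of
  \<open>w0\<close> reaches neither these sides nor the corners.\<close>

lemma lower_H_sides:
 assumes nod: "nodal N 1 \<tau> C k u" and t: "\<bar>\<tau>\<bar> < 1" and x: "x = 0 \<or> x = N"
 shows "nodal.H N 1 \<tau> k x y \<noteq> 0"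
proof -
 interpret nodal N 1 \<tau> C k u by (rule nod)
 obtain \<sigma> \<rho> where sr: "\<sigma> = 1 \<or> \<sigma> = -1" "\<rho> = 1 \<or> \<rho> = -1" "Dir k (pi * x / N) = \<sigma> * real k" "cos (pi * x / N) = \<rho>"
  by (rule H_sides[OF x])
 have "\<bar>4 * \<tau> * \<rho> * cos (pi * y)\<bar> = 4 * (\<bar>\<tau>\<bar> * \<bar>cos (pi * y)\<bar>)" using sr(2) by (auto simp: abs_mult)
 also have "... \<le> 4 * (\<bar>\<tau>\<bar> * 1)" by (intro mult_left_mono) auto
 also have "... < real k" using t k by simp
 also have "real k = \<bar>\<sigma> * real k\<bar>" using sr(1) by auto
 finally show ?thesis unfolding H_def sr(3,4) by auto
qed

text \<open>Curve j is the graph of X = \<xi> j (cos (pi y)) over the full height, which is why it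
  meets top and bottom. The blocks 0 and k are left out since their crossings are the sides x = 0
  and x = N; the others keep the remaining k - 1 curves apart.\<close>

lemma lower_curves:
 assumes nod: "nodal N 1 \<tau> C k u" and t: "2 * \<bar>\<tau>\<bar> < 1"
 shows "\<exists>\<C> :: (real \<times> real) set set. finite \<C> \<and> card \<C> = k - 1 \<and> disjoint \<C> \<and> \<Union>\<C> = nodal_set (rect N) u \<and>
  (\<forall>C\<in>\<C>. (\<exists>g. arc g \<and> path_image g = C) \<and> C \<inter> {0..N} \<times> {1} \<noteq> {} \<and> C \<inter> {0..N} \<times> {0} \<noteq> {})"
proof -
 interpret nodal N 1 \<tau> C k u by (rule nod)
 define l where "l i = (2 * real i - 1) * pi / (2 * real k)" for i :: nat
 define m where "m i = (2 * real i + 1) * pi / (2 * real k)" for i :: nat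
 have "\<exists>\<xi>. continuous_on {-1..1} \<xi> \<and> (\<forall>c\<in>{-1..1}. l j < \<xi> c \<and> \<xi> c < m j \<and>
   (\<forall>X\<in>{l j..m j}. G k \<tau> c X = 0 \<longleftrightarrow> X = \<xi> c))" for j
  by (rule crossing_exists[OF k t, of j]) (auto simp: l_def m_def)
 then obtain \<xi> where \<xi>: "\<And>j. continuous_on {-1..1} (\<xi> j)"
  "\<And>j c. c \<in> {-1..1} ==> l j < \<xi> j c \<and> \<xi> j c < m j"
  "\<And>j c X. c \<in> {-1..1} ==> l j \<le> X ==> X \<le> m j ==> G k \<tau> c X = 0 \<longleftrightarrow> X = \<xi> j c"
  by (metis atLeastAtMost_iff)
 have c1: "cos (pi * y) \<in> {-1..1}" for y by simp
 define g where "g j y = (N * \<xi> j (cos (pi * y)) / pi, y)" for j :: nat and y :: real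
 have gX: "pi * fst (g j y) / N = \<xi> j (cos (pi * y))" for j y using N by (simp add: g_def)
 have cg: "continuous_on {0..1} (g j)" for j
  unfolding g_def by (intro continuous_intros continuous_on_compose2[OF \<xi>(1)]) auto
 have arc: "arc (g j)" for j
  unfolding arc_def path_def using cg by (auto simp: inj_on_def g_def)
 have HG: "H x y = 0 \<longleftrightarrow> G k \<tau> (cos (pi * y)) (pi * x / N) = 0" if "0 < x" "x < N" for x y
 proof -
  have "sin (pi * x / N) > 0" using X_range that by (intro sin_gt_zero) auto
  moreover have "G k \<tau> (cos (pi * y)) (pi * x / N) = sin (pi * x / N) * H x y"
   unfolding G_def[OF k t] H_def sin_mult_Dir[symmetric] sin_double by (simp add: algebra_simps)
  ultimately show ?thesis by simp
 qed
 have ml: "m i \<le> l j" if "i < j" for i j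
 proof -
  have "real i + 1 \<le> real j" using that by simp
  then show ?thesis unfolding l_def m_def by (intro block_mono[OF k t]) simp
 qed
 have rng: "0 < \<xi> j c" "\<xi> j c < pi" if j: "1 \<le> j" "j < k" and c: "c \<in> {-1..1}" for j c
 proof -
  have "0 * pi / (2 * real k) \<le> l j" unfolding l_def using j by (intro block_mono[OF k t]) simp
  then show "0 < \<xi> j c" using \<xi>(2)[OF c, of j] by simp
  have "real j + 1 \<le> real k" using j by simp
  then have "m j \<le> (2 * real k) * pi / (2 * real k)" unfolding m_def by (intro block_mono[OF k t]) simp
  then show "\<xi> j c < pi" using \<xi>(2)[OF c, of j] k by simp
 qed
 have grng: "0 < fst (g j y)" "fst (g j y) < N" if "1 \<le> j" "j < k" for j y
  using rng[OF that c1[of y]] N by (simp_all add: g_def divide_less_eq)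
 have gZ: "path_image (g j) \<subseteq> Z" if j: "1 \<le> j" "j < k" for j
  unfolding path_image_def
 proof (rule Z_closure_path[OF cg])
  fix y :: real assume y: "0 < y" "y < 1"
  have "G k \<tau> (cos (pi * y)) (\<xi> j (cos (pi * y))) = 0"
   using \<xi>(3)[OF c1, of j "\<xi> j (cos (pi * y))" y] \<xi>(2)[OF c1[of y], of j] by simp
  then have "H (fst (g j y)) y = 0" using HG[OF grng[OF j]] gX by simp
  then have "(fst (g j y), y) \<in> Z" using grng[OF j] y by (intro Z_I)
  then show "g j y \<in> Z" by (simp add: g_def)
 qed
 have Zg: "\<exists>j. 1 \<le> j \<and> j < k \<and> p \<in> path_image (g j)" if p: "p \<in> Z" for p
 proof -
  obtain x y where xy: "p = (x, y)" by (cases p)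
  note D = Z_D[OF p[unfolded xy]]
  have "x \<noteq> 0" "x \<noteq> N" using lower_H_sides[OF nod, of x y] t D(5) by auto
  then have x: "0 < x" "x < N" using D by auto
  define X where "X = pi * x / N"
  have X: "0 < X" "X < pi" using X_range x by (auto simp: X_def)
  have G0: "G k \<tau> (cos (pi * y)) X = 0" using HG[OF x] D(5) by (simp add: X_def)
  obtain i where i: "i \<le> k" "l i \<le> X" "X < m i"
   using block_index[OF k t, of X] X unfolding l_def m_def by (metis less_imp_le)
  have Xi: "X = \<xi> i (cos (pi * y))" using \<xi>(3)[OF c1, of i X y] i G0 by simp
  have "i \<noteq> 0"
  proof
   assume i0: "i = 0"
   have "l i \<le> 0 * pi / (2 * real k)" unfolding l_def i0 by (rule block_mono[OF k t]) simp
   then have "0 = \<xi> i (cos (pi * y))" using \<xi>(3)[OF c1, of i 0 y] i X by (simp add: G_def[OF k t])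
   then show False using Xi X by simp
  qed
  moreover have "i \<noteq> k"
  proof
   assume ik: "i = k"
   have "pi = (2 * real k) * pi / (2 * real k)" using k by simp
   also have "... \<le> m i" unfolding m_def ik by (rule block_mono[OF k t]) simp
   finally have "pi = \<xi> i (cos (pi * y))" using \<xi>(3)[OF c1, of i pi y] i X by (simp add: G_def[OF k t])
   then show False using Xi X by simp
  qed
  moreover have "p = g i y" using N unfolding g_def xy Xi[symmetric] X_def by simp
  then have "p \<in> path_image (g i)" using D(3,4) unfolding path_image_def by auto
  ultimately show ?thesis using i(1) by (intro exI[of _ i]) auto
 qed
 have dj: "path_image (g i) \<inter> path_image (g j) = {}" if "i < j" for i j
 proof -
  have "\<xi> i (cos (pi * y)) < \<xi> j (cos (pi * y))" for y
   using \<xi>(2)[OF c1[of y], of i] \<xi>(2)[OF c1[of y], of j] ml[OF that] by linarith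
  then have "N * \<xi> i (cos (pi * y)) / pi \<noteq> N * \<xi> j (cos (pi * y)) / pi" for y using N by (metis mult_cancel_left divide_cancel_right less_irrefl pi_neq_zero)
  then show ?thesis by (auto simp: path_image_def g_def)
 qed
 have dj': "path_image (g i) \<inter> path_image (g j) = {}" if "i \<noteq> j" for i j
  using dj[of i j] dj[of j i] that by (cases "i < j") auto
 define \<C> where "\<C> = (\<lambda>j. path_image (g j)) ` {1..<k}"
 have inj: "inj_on (\<lambda>j. path_image (g j)) {1..<k}"
 proof (rule inj_onI, rule ccontr)
  fix i j assume "path_image (g i) = path_image (g j)" "i \<noteq> j"
  then show False using dj'[of i j] path_image_nonempty[of "g j"] by simp
 qed
 have "finite \<C>" by (simp add: \<C>_def)
 moreover have "card \<C> = k - 1" unfolding \<C>_def card_image[OF inj] by simp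
 moreover have "disjoint \<C>"
 proof (rule disjointI)
  fix A B assume "A \<in> \<C>" "B \<in> \<C>" "A \<noteq> B"
  then obtain i j where "A = path_image (g i)" "B = path_image (g j)" "i \<noteq> j" unfolding \<C>_def by blast
  then show "A \<inter> B = {}" using dj'[of i j] by simp
 qed
 moreover have "\<Union>\<C> = Z" using gZ Zg unfolding \<C>_def by fastforce
 moreover have "\<forall>C\<in>\<C>. (\<exists>g. arc g \<and> path_image g = C) \<and> C \<inter> {0..N} \<times> {1} \<noteq> {} \<and> C \<inter> {0..N} \<times> {0} \<noteq> {}"
 proof
  fix C assume "C \<in> \<C>"
  then obtain j where j: "1 \<le> j" "j < k" "C = path_image (g j)" by (auto simp: \<C>_def)
  have "g j y \<in> C \<inter> {0..N} \<times> {y}" if "y \<in> {0..1}" for y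
   using grng[OF j(1,2), of y] that unfolding j(3) path_image_def by (auto simp: mem_Times_iff) (simp add: g_def)
  from this[of 1] this[of 0] have "C \<inter> {0..N} \<times> {1} \<noteq> {}" "C \<inter> {0..N} \<times> {0} \<noteq> {}" by auto
  moreover have "\<exists>g. arc g \<and> path_image g = C" using arc[of j] j(3) by (intro exI[of _ "g j"]) simp
  ultimately show "(\<exists>g. arc g \<and> path_image g = C) \<and> C \<inter> {0..N} \<times> {1} \<noteq> {} \<and> C \<inter> {0..N} \<times> {0} \<noteq> {}" by simp
 qed
 ultimately show ?thesis by blast
qed

text \<open>A degenerate point satisfies k^2 = 4 k^2 \<tau>^2 S2 + 16 \<tau>^2 C2 with S2 + C2 = 1.
  For 2 |\<tau>| < 1 the right side is smaller than k^2. Otherwise such points may occur, but not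
  with cos X = 0, because then S2 = 0 and the equation contradicts k |\<tau>| < 4; so the branch
  point lemma applies.\<close>

lemma lower_boundary_points:
 assumes nod: "nodal N 1 \<tau> C k u" and \<tau>: "\<tau> \<noteq> 0" "\<bar>\<tau>\<bar> < 1" and t: "real k * \<bar>\<tau>\<bar> < 4"
  and p: "p \<in> nodal_set (rect N) u \<inter> frontier (rect N)"
 shows "meets_orthogonally N (nodal_set (rect N) u) p \<or> boundary_branch_point (nodal_set (rect N) u) p"
  and "2 * \<bar>\<tau>\<bar> < 1 ==> meets_orthogonally N (nodal_set (rect N) u) p"
proof -
 interpret nodal N 1 \<tau> C k u by (rule nod)
 have "(real k * \<bar>\<tau>\<bar>)^2 < 4^2" using t by (intro power_strict_mono) auto
 then have t2: "(real k)^2 * \<tau>^2 < 16" by (simp add: power_mult_distrib)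
 have "(4::real)^2 \<le> (real k)^2" using k by (intro power_mono) auto
 then have k2: "16 \<le> (real k)^2" by simp
 obtain x y where xy: "p = (x, y)" "H x y = 0" "0 < x" "x < N" "y = 0 \<or> y = 1"
  using p
 proof (cases rule: frontier_cases)
  case (2 x y)
  then show thesis using lower_H_sides[OF nod \<tau>(2) 2(3), of y] by simp
 qed (rule that)
 define S2 where "S2 = (sin (2 * (pi * x / N)))^2"
 define C2 where "C2 = (cos (2 * (pi * x / N)))^2"
 have SC: "S2 + C2 = 1" "0 \<le> S2" "0 \<le> C2" by (simp_all add: S2_def C2_def)
 have deg: "(real k)^2 = 4 * (real k)^2 * \<tau>^2 * S2 + 16 * \<tau>^2 * C2" if "Hx x y = 0"
  using degenerate_horizontal[OF xy(3,4,5,2) that] by (simp add: S2_def C2_def)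
 show "meets_orthogonally N Z p \<or> boundary_branch_point Z p"
 proof (cases "Hx x y = 0")
  case False
  then show ?thesis unfolding xy(1) using meets_orthogonally_horizontal[OF xy(3,4,5,2)] by blast
 next
  case True
  have "cos (pi * x / N) \<noteq> 0"
  proof
   assume c: "cos (pi * x / N) = 0"
   have "S2 = 0" unfolding S2_def sin_double c by simp
   then have "(real k)^2 = 16 * \<tau>^2" using deg[OF True] SC by simp
   moreover have "16 * \<tau>^2 \<le> (real k)^2 * \<tau>^2" using k2 by (rule mult_right_mono) simp
   ultimately show False using t2 k2 by linarith
  qed
  then show ?thesis unfolding xy(1) using boundary_branch_point_horizontal[OF xy(3,4,5,2) True \<tau>(1)] by blast
 qed
 show "meets_orthogonally N Z p" if t1: "2 * \<bar>\<tau>\<bar> < 1"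
 proof -
  have "Hx x y \<noteq> 0"
  proof
   assume h: "Hx x y = 0"
   have "(2 * \<tau>)^2 < 1" by (rule abs_square_less_1[THEN iffD2]) (use t1 in \<open>simp add: abs_mult\<close>)
   then have q: "4 * \<tau>^2 < 1" by (simp add: power_mult_distrib)
   have "16 * (\<tau>^2 * C2) \<le> (real k)^2 * (\<tau>^2 * C2)" using k2 SC by (intro mult_right_mono) auto
   moreover have "0 \<le> (real k)^2 * (\<tau>^2 * C2)" using SC by simp
   moreover have "(real k)^2 * \<tau>^2 * S2 + (real k)^2 * \<tau>^2 * C2 = (real k)^2 * \<tau>^2"
    using SC(1) by (simp add: distrib_left[symmetric])
   moreover have "(real k)^2 * (4 * \<tau>^2) < (real k)^2 * 1" using q k by (intro mult_strict_left_mono) auto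
   ultimately show False using deg[OF h] by (simp add: mult.assoc)
  qed
  then show ?thesis unfolding xy(1) by (rule meets_orthogonally_horizontal[OF xy(3,4,5,2)])
 qed
qed

text \<open>With d = X - i pi / (2 k) one has |sin (k X)| = |cos (k d)| \<ge> 1 - (k d)^2 / 2, while
  on the nodal set |sin (k X)| is at most 2 |\<tau>|.\<close>

lemma lower_strip:
 assumes nod: "nodal N 1 \<tau> C k u" and z: "(x, y) \<in> nodal_set (rect N) u" and i: "odd i"
 shows "2 * (1 - 2 * \<bar>\<tau>\<bar>) \<le> (real k * (pi * \<bar>x - real i * N / (2 * real k)\<bar> / N))^2"
proof -
 interpret nodal N 1 \<tau> C k u by (rule nod)
 define X where "X = pi * x / N"
 define d where "d = X - real i * pi / (2 * real k)"
 have ad: "pi * \<bar>x - real i * N / (2 * real k)\<bar> / N = \<bar>d\<bar>"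
 proof -
  have "d = pi * (x - real i * N / (2 * real k)) / N" using N k by (simp add: d_def X_def field_simps)
  then show ?thesis using N by (simp add: abs_mult)
 qed
 have "Dir k X + 4 * \<tau> * cos X * cos (pi * y) = 0" using Z_D(5)[OF z] unfolding H_def X_def by simp
 then have "sin X * Dir k X = - (sin X * (4 * \<tau> * cos X * cos (pi * y)))" by (simp add: add_eq_0_iff)
 then have "sin (real k * X) = - (2 * \<tau> * (sin (2 * X) * cos (pi * y)))"
  unfolding sin_mult_Dir sin_double by (simp add: algebra_simps)
 then have "\<bar>sin (real k * X)\<bar> = 2 * \<bar>\<tau>\<bar> * (\<bar>sin (2 * X)\<bar> * \<bar>cos (pi * y)\<bar>)" by (simp add: abs_mult)
 also have "... \<le> 2 * \<bar>\<tau>\<bar> * (1 * 1)" by (intro mult_left_mono mult_mono) auto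
 finally have up: "\<bar>sin (real k * X)\<bar> \<le> 2 * \<bar>\<tau>\<bar>" by simp
 have "real k * X = real k * d + real i * (pi / 2)" using k by (simp add: d_def field_simps)
 moreover have "cos (real i * (pi / 2)) = 0" by (rule cos_odd_half_pi[OF i])
 ultimately have "sin (real k * X) = cos (real k * d) * sin (real i * (pi / 2))" by (simp add: sin_add)
 then have "\<bar>sin (real k * X)\<bar> = \<bar>cos (real k * d)\<bar>" using sin_odd_half_pi[OF i] by (auto simp: abs_mult)
 then have "1 - (real k * d)^2 / 2 \<le> 2 * \<bar>\<tau>\<bar>" using one_minus_cos_le[of "real k * d"] up by linarith
 moreover have "2 * (1 - 2 * b) \<le> a" if "1 - a / 2 \<le> 2 * b" for a b :: real using that by simp
 ultimately have "2 * (1 - 2 * \<bar>\<tau>\<bar>) \<le> (real k * d)^2" by blast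
 also have "... = (real k * \<bar>d\<bar>)^2" by (simp add: power_mult_distrib)
 finally show ?thesis unfolding ad .
qed

subsection \<open>The lower branch for five, six and seven modes\<close>

text \<open>The derivative can change sign only from minus to plus. A value above both neighbours
  would produce a positive mean value followed by a negative one.\<close>

lemma quasiconvex_if_deriv:
 fixes h h' :: "real => real"
 assumes d: "\<And>x. a < x ==> x < b ==> (h has_real_derivative h' x) (at x)"
  and s: "\<And>x y. a < x ==> x < y ==> y < b ==> 0 \<le> h' x ==> 0 < h' y"
  and x: "a < x" "x < y" "y < z" "z < b"
 shows "h y \<le> max (h x) (h z)"
proof (rule ccontr)
 assume n: "\<not> h y \<le> max (h x) (h z)"
 have "\<exists>\<xi>. x < \<xi> \<and> \<xi> < y \<and> h y - h x = (y - x) * h' \<xi>"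
  by (rule MVT2[OF x(2)]) (rule d; use x in simp)
 then obtain \<xi> where \<xi>: "x < \<xi>" "\<xi> < y" "h y - h x = (y - x) * h' \<xi>" by blast
 have "\<exists>\<zeta>. y < \<zeta> \<and> \<zeta> < z \<and> h z - h y = (z - y) * h' \<zeta>"
  by (rule MVT2[OF x(3)]) (rule d; use x in simp)
 then obtain \<zeta> where \<zeta>: "y < \<zeta>" "\<zeta> < z" "h z - h y = (z - y) * h' \<zeta>" by blast
 have "0 < (y - x) * h' \<xi>" using n \<xi>(3) by linarith
 then have "0 < h' \<xi>" using x by (simp add: zero_less_mult_iff)
 then have "0 < h' \<zeta>" using x \<xi> \<zeta> by (intro s[of \<xi> \<zeta>]) simp_all
 then have "0 < (z - y) * h' \<zeta>" using x by simp
 then show False using n \<zeta>(3) by linarith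
qed

lemma pieces_sublevel:
 fixes h :: "real => real"
 assumes c: "continuous_on {a<..<b} h" and q: "\<And>x y z. a < x ==> x < y ==> y < z ==> z < b ==> h y \<le> max (h x) (h z)"
  and m: "a < m" "m < b" "h m < v"
 shows "pieces 1 {z. a < z \<and> z < b \<and> h z < v}"
proof (rule pieces_1)
 have "open ({a<..<b} \<inter> h -` {..<v})" by (rule continuous_open_preimage[OF c]) auto
 moreover have "{a<..<b} \<inter> h -` {..<v} = {z. a < z \<and> z < b \<and> h z < v}" by auto
 ultimately show "open {z. a < z \<and> z < b \<and> h z < v}" by simp
 show "m \<in> {z. a < z \<and> z < b \<and> h z < v}" using m by simp
 fix x y z assume a: "x \<in> {z. a < z \<and> z < b \<and> h z < v}" "z \<in> {z. a < z \<and> z < b \<and> h z < v}" "x < y" "y < z"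
 then have "h y \<le> max (h x) (h z)" by (intro q) simp_all
 then show "y \<in> {z. a < z \<and> z < b \<and> h z < v}" using a by auto
qed

text \<open>The hypothesis weakens quasiconvexity: it is asked only to the right of some value above
  v. This admits k = 7, where h first increases from minus infinity and is shown quasiconvex only
  farther to the right.\<close>

lemma superlevel_split:
 fixes h :: "real => real"
 assumes c: "continuous_on {0<..<1} h"
  and q: "\<And>w x y z. 0 < w ==> w < x ==> x < y ==> y < z ==> z < 1 ==> v < h w ==> h x \<le> v ==> h z \<le> v ==> h y \<le> v"
  and p: "0 < p" "v < h p" and b: "b < 1" "\<And>z. b \<le> z ==> z < 1 ==> v < h z"
 obtains "\<And>z. p \<le> z ==> z < 1 ==> v < h z"
 | z0 where "p < z0" "z0 < 1" "h z0 \<le> v" "pieces 1 {z. z0 < z \<and> z < 1 \<and> v < h z}"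
  "\<And>x y z. 0 < x ==> x < y ==> y < z ==> z < z0 ==> v < h x ==> v < h z ==> v < h y"
proof (cases "\<forall>z. p \<le> z \<and> z < 1 \<longrightarrow> v < h z")
 case True
 then show thesis using that(1) by blast
next
 case False
 then obtain z0 where z0: "p \<le> z0" "z0 < 1" "h z0 \<le> v" by (auto simp: not_less)
 then have pz: "p < z0" using p by (cases "z0 = p") auto
 have zb: "z0 < b" using b(2)[of z0] z0 by linarith
 show thesis
 proof (rule that(2)[OF pz z0(2,3)])
  show "pieces 1 {z. z0 < z \<and> z < 1 \<and> v < h z}"
  proof (rule pieces_1)
   have "continuous_on {z0<..<1} h" by (rule continuous_on_subset[OF c]) (use p pz in auto)
   then have "open ({z0<..<1} \<inter> h -` {v<..})" by (rule continuous_open_preimage) auto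
   moreover have "{z0<..<1} \<inter> h -` {v<..} = {z. z0 < z \<and> z < 1 \<and> v < h z}" by auto
   ultimately show "open {z. z0 < z \<and> z < 1 \<and> v < h z}" by simp
   show "b \<in> {z. z0 < z \<and> z < 1 \<and> v < h z}" using b zb by simp
   fix x y z assume a: "x \<in> {z. z0 < z \<and> z < 1 \<and> v < h z}" "z \<in> {z. z0 < z \<and> z < 1 \<and> v < h z}" "x < y" "y < z"
   have "v < h y"
   proof (rule ccontr)
    assume "\<not> v < h y"
    then have "h x \<le> v" using p pz z0 a by (intro q[of p z0 x y]) simp_all
    then show False using a by simp
   qed
   then show "y \<in> {z. z0 < z \<and> z < 1 \<and> v < h z}" using a by simp
  qed
 next
  fix x y z assume a: "0 < x" "x < y" "y < z" "z < z0" "v < h x" "v < h z"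
  show "v < h y"
  proof (rule ccontr)
   assume "\<not> v < h y"
   then have "h z \<le> v" using z0 a by (intro q[of x y z z0]) simp_all
   then show False using a by simp
  qed
 qed
qed

text \<open>Up to p the superlevel set is an interval that reaches p; beyond p it either continues
  to 1 or is interrupted once.\<close>

lemma pieces_superlevel:
 fixes h :: "real => real"
 assumes c: "continuous_on {0<..<1} h"
  and q: "\<And>w x y z. 0 < w ==> w < x ==> x < y ==> y < z ==> z < 1 ==> v < h w ==> h x \<le> v ==> h z \<le> v ==> h y \<le> v"
  and p: "0 < p" "p < 1" "v < h p" and b: "b < 1" "\<And>z. b \<le> z ==> z < 1 ==> v < h z"
  and mono: "\<And>x y. 0 < x ==> x < y ==> y \<le> p ==> v < h x ==> v < h y"
 shows "pieces 1 {z. 0 < z \<and> z < 1 \<and> v < h z} \<or> pieces 2 {z. 0 < z \<and> z < 1 \<and> v < h z}"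
proof -
 have op: "open {z. 0 < z \<and> z < e \<and> v < h z}" if "e \<le> 1" for e
 proof -
  have "continuous_on {0<..<e} h" by (rule continuous_on_subset[OF c]) (use that in auto)
  then have "open ({0<..<e} \<inter> h -` {v<..})" by (rule continuous_open_preimage) auto
  moreover have "{0<..<e} \<inter> h -` {v<..} = {z. 0 < z \<and> z < e \<and> v < h z}" by auto
  ultimately show ?thesis by simp
 qed
 show ?thesis
 proof (rule superlevel_split[OF c q p(1,3) b])
  assume full: "\<And>z. p \<le> z ==> z < 1 ==> v < h z"
  have "pieces 1 {z. 0 < z \<and> z < 1 \<and> v < h z}"
  proof (rule pieces_1[OF op])
   show "p \<in> {z. 0 < z \<and> z < 1 \<and> v < h z}" using p by simp
   fix x y z assume a: "x \<in> {z. 0 < z \<and> z < 1 \<and> v < h z}" "z \<in> {z. 0 < z \<and> z < 1 \<and> v < h z}" "x < y" "y < z"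
   have "v < h y" using full[of y] mono[of x y] a by (cases "p \<le> y") simp_all
   then show "y \<in> {z. 0 < z \<and> z < 1 \<and> v < h z}" using a by simp
  qed simp
  then show ?thesis by simp
 next
  fix z0 assume split: "p < z0" "z0 < 1" "h z0 \<le> v" "pieces 1 {z. z0 < z \<and> z < 1 \<and> v < h z}"
   "\<And>x y z. 0 < x ==> x < y ==> y < z ==> z < z0 ==> v < h x ==> v < h z ==> v < h y"
  have "pieces 1 {z. 0 < z \<and> z < z0 \<and> v < h z}"
  proof (rule pieces_1[OF op])
   show "p \<in> {z. 0 < z \<and> z < z0 \<and> v < h z}" using p split by simp
   fix x y z assume a: "x \<in> {z. 0 < z \<and> z < z0 \<and> v < h z}" "z \<in> {z. 0 < z \<and> z < z0 \<and> v < h z}" "x < y" "y < z"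
   then have "v < h y" by (intro split(5)[of x y z]) simp_all
   then show "y \<in> {z. 0 < z \<and> z < z0 \<and> v < h z}" using a by simp
  qed (use split in simp)
  then have "pieces (1 + 1) ({z. 0 < z \<and> z < z0 \<and> v < h z} \<union> {z. z0 < z \<and> z < 1 \<and> v < h z})"
   by (rule pieces_Un[OF _ split(4)]) auto
  moreover have "{z. 0 < z \<and> z < z0 \<and> v < h z} \<union> {z. z0 < z \<and> z < 1 \<and> v < h z} = {z. 0 < z \<and> z < 1 \<and> v < h z}"
  proof (rule set_eqI)
   fix z show "z \<in> {z. 0 < z \<and> z < z0 \<and> v < h z} \<union> {z. z0 < z \<and> z < 1 \<and> v < h z} \<longleftrightarrow> z \<in> {z. 0 < z \<and> z < 1 \<and> v < h z}"
    using split(1,2,3) p by (cases z z0 rule: linorder_cases) auto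
  qed
  ultimately show ?thesis by (simp add: numeral_2_eq_2)
 qed
qed

text \<open>The piece around 0 is its own mirror image and counts once, the n pieces beyond e count
  twice.\<close>

lemma pieces_symmetric_0:
 assumes o: "open S" and sym: "\<And>x. x \<in> S ==> - x \<in> (S :: real set)" and S0: "0 \<in> S"
  and e: "0 < e" "e \<notin> S" and conv: "\<And>w z. z \<in> S ==> 0 < w ==> w < z ==> z < e ==> w \<in> S"
  and p: "pieces n {z\<in>S. e < z}"
 shows "pieces (2 * n + 1) S"
proof -
 have sym': "- x \<in> S \<longleftrightarrow> x \<in> S" for x using sym[of x] sym[of "- x"] by auto
 have "pieces 1 {z\<in>S. - e < z \<and> z < e}"
 proof (rule pieces_1)
  have "open (S \<inter> {-e<..<e})" using o by (intro open_Int) simp_all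
  moreover have "S \<inter> {-e<..<e} = {z\<in>S. - e < z \<and> z < e}" by auto
  ultimately show "open {z\<in>S. - e < z \<and> z < e}" by simp
  show "0 \<in> {z\<in>S. - e < z \<and> z < e}" using S0 e by simp
  fix a x b assume a: "a \<in> {z\<in>S. - e < z \<and> z < e}" "b \<in> {z\<in>S. - e < z \<and> z < e}" "a < x" "x < b"
  consider "x = 0" | "0 < x" | "x < 0" by linarith
  then have "x \<in> S"
  proof cases
   case 2 then show ?thesis using a by (intro conv[of b x]) simp_all
  next
   case 3
   then have "- x \<in> S" using a sym[of a] by (intro conv[of "- a" "- x"]) simp_all
   then show ?thesis using sym' by simp
  qed (use S0 in simp)
  then show "x \<in> {z\<in>S. - e < z \<and> z < e}" using a by simp
 qed
 moreover have L: "pieces n {x. 0 - x \<in> {z\<in>S. e < z}}" by (rule pieces_reflect[OF p])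
 ultimately have "pieces (n + 1) ({x. 0 - x \<in> {z\<in>S. e < z}} \<union> {z\<in>S. - e < z \<and> z < e})"
  by (intro pieces_Un) auto
 from this p have "pieces (n + 1 + n) (({x. 0 - x \<in> {z\<in>S. e < z}} \<union> {z\<in>S. - e < z \<and> z < e}) \<union> {z\<in>S. e < z})"
  by (rule pieces_Un) (use e in auto)
 moreover have "({x. 0 - x \<in> {z\<in>S. e < z}} \<union> {z\<in>S. - e < z \<and> z < e}) \<union> {z\<in>S. e < z} = S"
 proof (rule set_eqI)
  fix z
  have "z \<noteq> e \<and> z \<noteq> - e" if "z \<in> S" using that e(2) sym[of z] by auto
  then show "z \<in> ({x. 0 - x \<in> {z\<in>S. e < z}} \<union> {z\<in>S. - e < z \<and> z < e}) \<union> {z\<in>S. e < z} \<longleftrightarrow> z \<in> S"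
   by (auto simp: sym')
 qed
 moreover have "n + 1 + n = 2 * n + 1" by simp
 ultimately show ?thesis by metis
qed

text \<open>After the substitution z = cos X the question is how a Chebyshev polynomial U compares
  with the two wedges 4 |\<tau>| |z| and -4 |\<tau>| |z|.\<close>

lemma lower_card:
 assumes nod: "nodal N 1 \<tau> C k u" and U: "\<And>X. Dir k X = U (cos X)"
  and m: "pieces m {z. -1 < z \<and> z < 1 \<and> 0 < U z + 4 * \<bar>\<tau>\<bar> * \<bar>z\<bar>}"
  and n: "pieces n {z. -1 < z \<and> z < 1 \<and> 0 < - U z + 4 * \<bar>\<tau>\<bar> * \<bar>z\<bar>}"
 shows "card (nodal_domains (rect N) u) = m + n"
proof -
 interpret nodal N 1 \<tau> C k u by (rule nod)
 have c: "-1 < cos X \<and> cos X < 1" if "0 < X" "X < pi" for X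
  using cos_monotone_0_pi[of 0 X] cos_monotone_0_pi[of X pi] that by simp
 have pull: "pieces l {X. 0 < X \<and> X < pi \<and> P (cos X)}" if "pieces l {z. -1 < z \<and> z < 1 \<and> P z}" for l P
 proof -
  have "pieces l {X. 0 < X \<and> X < pi \<and> cos X \<in> {z. -1 < z \<and> z < 1 \<and> P z}}"
   by (rule pieces_cos[OF that]) auto
  moreover have "{X. 0 < X \<and> X < pi \<and> cos X \<in> {z. -1 < z \<and> z < 1 \<and> P z}} = {X. 0 < X \<and> X < pi \<and> P (cos X)}"
   using c by auto
  ultimately show ?thesis by simp
 qed
 show ?thesis
 proof (rule card_nodal_domains)
  show "pieces m {X. 0 < X \<and> X < pi \<and> 0 < 1 * Dir k X + \<bar>4 * \<tau> * cos X\<bar>}"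
   using pull[OF m] by (simp add: U abs_mult)
  show "pieces n {X. 0 < X \<and> X < pi \<and> 0 < - (1 * Dir k X) + \<bar>4 * \<tau> * cos X\<bar>}"
   using pull[OF n] by (simp add: U abs_mult)
 qed
qed

lemma cos_4: "cos (4 * X) = 8 * cos X ^ 4 - 8 * (cos X)^2 + (1::real)"
proof -
 have "cos (4 * X) = 2 * (cos (2 * X))^2 - 1" using cos_double_cos[of "2 * X"] by simp
 then show ?thesis unfolding cos_double_cos by (simp add: power2_eq_square power4_eq_xxxx algebra_simps)
qed

lemma Dir_cos:
 "Dir 3 X = 4 * (cos X)^2 - 1"
 "Dir 5 X = 16 * cos X ^ 4 - 12 * (cos X)^2 + 1"
 "Dir 6 X = cos X * (32 * cos X ^ 4 - 32 * (cos X)^2 + 6)"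
 "Dir 7 X = 64 * cos X ^ 6 - 80 * cos X ^ 4 + 24 * (cos X)^2 - 1"
proof -
 have neg: "cos (- (a * X)) = cos (a * X)" for a by simp
 have D3: "Dir 3 Y = 4 * (cos Y)^2 - 1" for Y
 proof -
  have "Dir 3 Y = 1 + 2 * cos (2 * Y)" by (simp add: Dir_def lessThan_nat_numeral lessThan_Suc)
  then show ?thesis by (simp add: cos_double_cos)
 qed
 then show "Dir 3 X = 4 * (cos X)^2 - 1" .
 have "Dir 5 X = 1 + 2 * cos (2 * X) + 2 * cos (4 * X)" by (simp add: Dir_def lessThan_nat_numeral lessThan_Suc)
 then show "Dir 5 X = 16 * cos X ^ 4 - 12 * (cos X)^2 + 1" unfolding cos_4 by (simp add: cos_double_cos)
 have "Dir 6 X = 2 * cos X * Dir 3 (2 * X)" using Dir_double[of 3 X] by simp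
 then show "Dir 6 X = cos X * (32 * cos X ^ 4 - 32 * (cos X)^2 + 6)"
  unfolding D3 cos_double_cos by (simp add: power2_eq_square power4_eq_xxxx algebra_simps)
 have "Dir 7 X = 1 + 2 * cos (2 * X) + 2 * cos (4 * X) + 2 * cos (6 * X)"
  by (simp add: Dir_def lessThan_nat_numeral lessThan_Suc)
 moreover have "cos (6 * X) = 32 * cos X ^ 6 - 48 * cos X ^ 4 + 18 * (cos X)^2 - 1"
 proof -
  define q where "q = (cos X)^2"
  have "cos (6 * X) = 4 * (2 * q - 1) ^ 3 - 3 * (2 * q - 1)"
   using cos_treble_cos[of "2 * X"] unfolding q_def cos_double_cos by simp
  also have "... = 32 * q ^ 3 - 48 * q^2 + 18 * q - 1"
   by (simp add: power2_eq_square power3_eq_cube algebra_simps)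
  finally have "cos (6 * X) = 32 * q ^ 3 - 48 * q^2 + 18 * q - 1" .
  moreover have "q ^ 3 = cos X ^ 6" "q^2 = cos X ^ 4" by (simp_all add: q_def power_mult[symmetric])
  ultimately show ?thesis by (simp add: q_def)
 qed
 ultimately show "Dir 7 X = 64 * cos X ^ 6 - 80 * cos X ^ 4 + 24 * (cos X)^2 - 1"
  unfolding cos_4 cos_double_cos by simp
qed

text \<open>Taylor form of a cubic, used to certify its sign on an interval from exact coefficients
  at a rational point.\<close>

lemma cubic_shift:
 fixes a :: real
 shows "p * (a + e) ^ 3 + q * (a + e)^2 + r * (a + e) + s =
  (p * a ^ 3 + q * a^2 + r * a + s) + e * ((3 * p * a^2 + 2 * q * a + r) + (3 * p * a + q) * e + p * e^2)"
 by (simp add: power2_eq_square power3_eq_cube algebra_simps)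

text \<open>U is even. With h z = U z / z for z > 0 the two conditions become h > -t and h < t. h is
  quasiconvex, positive near 0 and near 1 and negative in between. So h < t gives one interval on
  each side of 0. The condition h > -t, which also holds around 0, gives a single interval, or three
  if it fails somewhere. The totals are 3 and 5.\<close>

lemma lower_domains_5:
 assumes nod: "nodal N 1 \<tau> C 5 u" and \<tau>: "\<tau> \<noteq> 0"
 shows "card (nodal_domains (rect N) u) \<in> {5, 3}"
proof -
 define t where "t = 4 * \<bar>\<tau>\<bar>"
 have t: "0 < t" using \<tau> by (simp add: t_def)
 define U where "U z = 16 * z ^ 4 - 12 * z^2 + (1::real)" for z
 define h where "h z = 16 * z ^ 3 - 12 * z + 1 / z" for z :: real
 define h' where "h' z = 48 * z^2 - 12 - 1 / z^2" for z :: real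
 have Uh: "U z = z * h z" if "0 < z" for z
  using that by (simp add: U_def h_def field_simps power2_eq_square power3_eq_cube power4_eq_xxxx)
 have Usym: "U (- z) = U z" for z by (simp add: U_def)
 have cU: "continuous_on A U" for A unfolding U_def by (intro continuous_intros)
 have ch: "continuous_on {0<..<1} h" unfolding h_def by (intro continuous_intros) auto
 have dh: "(h has_real_derivative h' x) (at x)" if "0 < x" for x
  unfolding h_def[abs_def] h'_def using that by (auto intro!: derivative_eq_intros simp: power2_eq_square)
 have h'_mono: "0 < h' y" if "0 < x" "x < y" "0 \<le> h' x" for x y
 proof -
  have "x^2 < y^2" using that by (intro power_strict_mono) auto
  moreover have "1 / y^2 < 1 / x^2" using calculation that by (intro divide_strict_left_mono) auto
  ultimately show ?thesis using that(3) unfolding h'_def by linarith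
 qed
 have qc: "h y \<le> max (h x) (h z)" if "0 < x" "x < y" "y < z" "z < 1" for x y z
  by (rule quasiconvex_if_deriv[where h' = h', OF dh h'_mono that]) simp_all
 have small: "0 < h z" if "0 < z" "z \<le> 1/5" for z
 proof -
  have "5 \<le> 1 / z" using that by (simp add: field_simps)
  moreover have "0 < z ^ 3" using that by simp
  ultimately show ?thesis unfolding h_def using that by linarith
 qed
 have large: "0 < h z" if "9/10 \<le> z" for z
 proof -
  have "(9/10)^2 \<le> z^2" using that by (intro power_mono) auto
  then have "z * (9/10)^2 \<le> z * z^2" using that by (intro mult_left_mono) auto
  then have "12 * z \<le> 16 * z ^ 3" using that by (simp add: power2_eq_square power3_eq_cube)
  moreover have "0 < 1 / z" using that by simp
  ultimately show ?thesis unfolding h_def by linarith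
 qed
 define S where "S = {z. -1 < z \<and> z < 1 \<and> 0 < U z + t * \<bar>z\<bar>}"
 define T where "T = {z. -1 < z \<and> z < 1 \<and> 0 < - U z + t * \<bar>z\<bar>}"
 have fac: "0 < U z + t * \<bar>z\<bar> \<longleftrightarrow> - t < h z" "0 < - U z + t * \<bar>z\<bar> \<longleftrightarrow> h z < t" if "0 < z" for z
 proof -
  have "U z + t * \<bar>z\<bar> = z * (h z + t)" "- U z + t * \<bar>z\<bar> = z * (t - h z)" using that by (simp_all add: Uh algebra_simps)
  then show "0 < U z + t * \<bar>z\<bar> \<longleftrightarrow> - t < h z" "0 < - U z + t * \<bar>z\<bar> \<longleftrightarrow> h z < t"
   using that by (auto simp: zero_less_mult_iff)
 qed
 have S_iff: "z \<in> S \<longleftrightarrow> z < 1 \<and> - t < h z" if "0 < z" for z using fac(1)[OF that] that by (auto simp: S_def)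
 have T_iff: "z \<in> T \<longleftrightarrow> z < 1 \<and> h z < t" if "0 < z" for z using fac(2)[OF that] that by (auto simp: T_def)
 have "pieces (2 * 1) T"
 proof (rule pieces_symmetric[where b = 0])
  show "0 - x \<in> T" if "x \<in> T" for x using that by (simp add: T_def Usym)
  show "0 / 2 \<notin> T" by (simp add: T_def U_def)
  \<comment> \<open>h is negative at 6/10, hence below t for every admissible t.\<close>
  have "pieces 1 {z. 0 < z \<and> z < 1 \<and> h z < t}"
   by (rule pieces_sublevel[OF ch qc, where m = "6/10"]) (use t in \<open>auto simp: h_def power3_eq_cube\<close>)
  moreover have "{z. 0 < z \<and> z < 1 \<and> h z < t} = {x\<in>T. 0 / 2 < x}" using T_iff by auto
  ultimately show "pieces 1 {x\<in>T. x < 0 / 2} \<or> pieces 1 {x\<in>T. 0 / 2 < x}" by simp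
 qed
 then have pT: "pieces 2 T" by simp
 have oS: "open S"
  unfolding S_def by (intro open_Collect_conj open_Collect_less continuous_intros cU)
 have S0: "0 \<in> S" by (simp add: S_def U_def)
 have symS: "- x \<in> S" if "x \<in> S" for x using that by (simp add: S_def Usym)
 have q': "h y \<le> - t" if "0 < w" "w < x" "x < y" "y < z" "z < 1" "- t < h w" "h x \<le> - t" "h z \<le> - t" for w x y z
  using qc[of x y z] that by simp
 have p5: "0 < (1/5::real)" "- t < h (1/5)" using small[of "1/5"] t by simp_all
 have b5: "(9/10::real) < 1" "- t < h z" if "9/10 \<le> z" "z < 1" for z using large[of z] t that by simp_all
 have "pieces 1 S \<or> pieces 3 S"
 proof (rule superlevel_split[where h = h and v = "- t" and p = "1/5" and b = "9/10", OF ch])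
  show "h y \<le> - t" if "0 < w" "w < x" "x < y" "y < z" "z < 1" "- t < h w" "h x \<le> - t" "h z \<le> - t" for w x y z
   by (rule q'[OF that])
  show "0 < (1/5::real)" "- t < h (1/5)" by (rule p5)+
  show "(9/10::real) < 1" by simp
  show "- t < h z" if "9/10 \<le> z" "z < 1" for z by (rule b5(2)[OF that])
 next
  assume full: "\<And>z. 1/5 \<le> z ==> z < 1 ==> - t < h z"
  have P: "z \<in> S" if "0 < z" "z < 1" for z
   using full[of z] small[of z] S_iff[of z] that t by (cases "1/5 \<le> z") simp_all
  have "z \<in> S" if "-1 < z" "z < 1" for z
  proof (cases z "0::real" rule: linorder_cases)
   case less
   then show ?thesis using P[of "- z"] symS[of "- z"] that by simp
  qed (use P[of z] S0 that in auto)
  then have "S = {-1<..<1}" unfolding S_def by auto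
  then have "pieces 1 S" using oS by (intro pieces_1[of _ 0]) auto
  then show ?thesis by simp
 next
  fix z0 assume z0: "1/5 < z0" "z0 < 1" "h z0 \<le> - t" "pieces 1 {z. z0 < z \<and> z < 1 \<and> - t < h z}"
   "\<And>x y z. 0 < x ==> x < y ==> y < z ==> z < z0 ==> - t < h x ==> - t < h z ==> - t < h y"
  have "pieces (2 * 1 + 1) S"
  proof (rule pieces_symmetric_0[OF oS symS S0, of z0])
   show "0 < z0" using z0 by simp
   show "z0 \<notin> S" using S_iff[of z0] z0 by simp
   have "{z. z0 < z \<and> z < 1 \<and> - t < h z} = {z\<in>S. z0 < z}" using S_iff z0(1) by fastforce
   then show "pieces 1 {z\<in>S. z0 < z}" using z0(4) by simp
   fix w z assume a: "z \<in> S" "0 < w" "w < z" "z < z0"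
   have "- t < h w"
   proof (cases "w \<le> 1/5")
    case True then show ?thesis using small[of w] a t by simp
   next
    case False
    show ?thesis by (rule z0(5)[of "1/5" w z]) (use False a S_iff[of z] p5 in auto)
   qed
   then show "w \<in> S" using S_iff[of w] a z0 by simp
  qed
  then show ?thesis by (simp add: numeral_3_eq_3)
 qed
 moreover have "card (nodal_domains (rect N) u) = m + 2" if "pieces m S" for m
  by (rule lower_card[OF nod, of U]) (use that pT Dir_cos(2) in \<open>simp_all add: S_def T_def U_def t_def\<close>)
 ultimately show ?thesis by force
qed

text \<open>U z = z h z is odd with h even. Hence the negative half of one region is the mirror
  image of the positive half of the other. A has one or two pieces, B has one, and each region has
  those of A and B together: 2 + 2 or 3 + 3.\<close>

lemma lower_domains_6:
 assumes nod: "nodal N 1 \<tau> C 6 u" and \<tau>: "\<tau> \<noteq> 0"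
 shows "card (nodal_domains (rect N) u) \<in> {6, 4}"
proof -
 define t where "t = 4 * \<bar>\<tau>\<bar>"
 have t: "0 < t" using \<tau> by (simp add: t_def)
 define h where "h z = 32 * z ^ 4 - 32 * z^2 + 6" for z :: real
 define h' where "h' z = 64 * z * (2 * z^2 - 1)" for z :: real
 have hsym: "h (- z) = h z" for z by (simp add: h_def)
 have ch: "continuous_on {0<..<1} h" unfolding h_def by (intro continuous_intros)
 have dh: "(h has_real_derivative h' x) (at x)" for x
  unfolding h_def[abs_def] h'_def by (auto intro!: derivative_eq_intros simp: power2_eq_square power3_eq_cube algebra_simps)
 have h'_mono: "0 < h' y" if "0 < x" "x < y" "0 \<le> h' x" for x y
 proof -
  have "x^2 < y^2" using that by (intro power_strict_mono) auto
  moreover have "0 \<le> 2 * x^2 - 1" using that(1,3) unfolding h'_def by (simp add: zero_le_mult_iff)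
  ultimately have "0 < 2 * y^2 - 1" by linarith
  then show ?thesis unfolding h'_def using that by simp
 qed
 have qc: "h y \<le> max (h x) (h z)" if "0 < x" "x < y" "y < z" "z < 1" for x y z
  by (rule quasiconvex_if_deriv[where h' = h', OF dh h'_mono that])
 have hq: "h z = 6 - 32 * (z^2 * (1 - z^2))" for z by (simp add: h_def power2_eq_square power4_eq_xxxx algebra_simps)
 have small: "0 < h z" if "0 < z" "z \<le> 1/10" for z
 proof -
  have "z^2 \<le> (1/10)^2" using that by (intro power_mono) auto
  then have "32 * z^2 < 6" by (simp add: power2_eq_square)
  moreover have "0 \<le> z ^ 4" by simp
  ultimately show ?thesis unfolding h_def by linarith
 qed
 have large: "0 < h z" if "95/100 \<le> z" "z < 1" for z
 proof -
  have "(95/100)^2 \<le> z^2" "z^2 < 1" using that by (auto intro: power_mono simp: abs_square_less_1)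
  then have "z^2 * (1 - z^2) \<le> 1 * (1 - (95/100)^2)" by (intro mult_mono) auto
  then show ?thesis unfolding hq by (simp add: power2_eq_square)
 qed
 have q': "h y \<le> - t" if "0 < w" "w < x" "x < y" "y < z" "z < 1" "- t < h w" "h x \<le> - t" "h z \<le> - t" for w x y z
  using qc[of x y z] that by simp
 define A where "A = {z. 0 < z \<and> z < 1 \<and> - t < h z}"
 define B where "B = {z. 0 < z \<and> z < 1 \<and> h z < t}"
 have pB: "pieces 1 B"
  unfolding B_def by (rule pieces_sublevel[OF ch qc, where m = "7/10"]) (use t in \<open>auto simp: h_def power2_eq_square power4_eq_xxxx\<close>)
 have pA: "pieces 1 A \<or> pieces 2 A"
  unfolding A_def
 proof (rule pieces_superlevel[where h = h and v = "- t" and p = "1/10" and b = "95/100", OF ch])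
  show "h y \<le> - t" if "0 < w" "w < x" "x < y" "y < z" "z < 1" "- t < h w" "h x \<le> - t" "h z \<le> - t" for w x y z
   by (rule q'[OF that])
  show "- t < h (1/10)" using small[of "1/10"] t by simp
  show "- t < h z" if "95/100 \<le> z" "z < 1" for z using large[OF that] t by simp
  show "- t < h y" if "0 < x" "x < y" "y \<le> 1/10" for x y using small[of y] t that by simp
 qed simp_all
 define S where "S = {z. -1 < z \<and> z < 1 \<and> 0 < z * h z + t * \<bar>z\<bar>}"
 define T where "T = {z. -1 < z \<and> z < 1 \<and> 0 < - (z * h z) + t * \<bar>z\<bar>}"
 have S_eq: "S = A \<union> {x. 0 - x \<in> B}"
 proof (rule set_eqI)
  fix z show "z \<in> S \<longleftrightarrow> z \<in> A \<union> {x. 0 - x \<in> B}"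
  proof (cases z "0::real" rule: linorder_cases)
   case less
   have "z * h z + t * \<bar>z\<bar> = - z * (t - h z)" using less by (simp add: algebra_simps)
   then have "0 < z * h z + t * \<bar>z\<bar> \<longleftrightarrow> h z < t" using less by (simp only: zero_less_mult_iff) auto
   then show ?thesis using less by (auto simp: S_def A_def B_def hsym)
  next
   case greater
   have "z * h z + t * \<bar>z\<bar> = z * (h z + t)" using greater by (simp add: algebra_simps)
   then have "0 < z * h z + t * \<bar>z\<bar> \<longleftrightarrow> - t < h z" using greater by (auto simp: zero_less_mult_iff)
   then show ?thesis using greater by (auto simp: S_def A_def B_def)
  qed (simp add: S_def A_def B_def)
 qed
 have T_eq: "T = {x. 0 - x \<in> S}" by (auto simp: S_def T_def hsym)
 have pS: "pieces (m + 1) S" if "pieces m A" for m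
  unfolding S_eq by (rule pieces_Un[OF that pieces_reflect[OF pB]]) (auto simp: A_def B_def)
 have "card (nodal_domains (rect N) u) = (m + 1) + (m + 1)" if "pieces m A" for m
 proof (rule lower_card[OF nod, of "\<lambda>z. z * h z"])
  show "Dir 6 X = cos X * h (cos X)" for X unfolding Dir_cos(3) h_def ..
  show "pieces (m + 1) {z. -1 < z \<and> z < 1 \<and> 0 < z * h z + 4 * \<bar>\<tau>\<bar> * \<bar>z\<bar>}"
   using pS[OF that] by (simp add: S_def t_def)
  show "pieces (m + 1) {z. -1 < z \<and> z < 1 \<and> 0 < - (z * h z) + 4 * \<bar>\<tau>\<bar> * \<bar>z\<bar>}"
   using pieces_reflect[OF pS[OF that], of 0] unfolding T_eq[symmetric] by (simp add: T_def t_def)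
 qed
 then show ?thesis using pA by force
qed

text \<open>On the positive axis h increases from minus infinity up to 0.39, exceeds t between 0.39
  and 0.43, and is quasiconvex beyond, with a negative value at 0.75. So h < t gives a piece around
  0 and one farther out on each side, h > -t one or two on each side: 3 + 2 or 3 + 4. The bound t <
  16/7, which is 7 |\<tau>| < 4, is what the middle interval relies on.\<close>

lemma lower_domains_7:
 assumes nod: "nodal N 1 \<tau> C 7 u" and \<tau>: "\<tau> \<noteq> 0" and t7: "7 * \<bar>\<tau>\<bar> < 4"
 shows "card (nodal_domains (rect N) u) \<in> {7, 5}"
proof -
 define t where "t = 4 * \<bar>\<tau>\<bar>"
 have t: "0 < t" "t < 16/7" using \<tau> t7 by (simp_all add: t_def)
 define U where "U z = 64 * z ^ 6 - 80 * z ^ 4 + 24 * z^2 - (1::real)" for z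
 define h where "h z = 64 * z ^ 5 - 80 * z ^ 3 + 24 * z - 1 / z" for z :: real
 define P where "P q = 64 * q ^ 3 - 80 * q^2 + 24 * q - 1" for q :: real
 \<comment> \<open>z^2 times the derivative of h, as a polynomial in q = z^2. It is shown positive
   up to 0.39^2, negative from 0.18 to 0.45, and increasing from there on; 0.18 is just below
   0.43^2.\<close>
 define \<kappa> where "\<kappa> q = 320 * q ^ 3 - 240 * q^2 + 24 * q + 1" for q :: real
 define h' where "h' z = \<kappa> (z^2) / z^2" for z :: real
 have pw: "z ^ 6 = z\<^sup>2 ^ 3" "z ^ 4 = (z^2)^2" for z :: real by (simp_all add: power_mult[symmetric])
 have UP: "U z = P (z^2)" for z unfolding U_def P_def pw ..
 have Uh: "U z = z * h z" if "0 < z" for z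
 proof -
  have "z * h z = 64 * z ^ 6 - 80 * z ^ 4 + 24 * z^2 - z * (1 / z)"
   unfolding h_def by (simp add: algebra_simps power_numeral_reduce)
  then show ?thesis using that by (simp add: U_def)
 qed
 have hP: "h z = P (z^2) / z" if "0 < z" for z using Uh[OF that] UP[of z] that by (simp add: field_simps)
 have Usym: "U (- z) = U z" for z by (simp add: U_def)
 have cU: "continuous_on A U" for A unfolding U_def by (intro continuous_intros)
 have ch: "continuous_on {0<..<1} h" unfolding h_def by (intro continuous_intros) auto
 have dh: "(h has_real_derivative h' x) (at x)" if "0 < x" for x
 proof -
  have "(h has_real_derivative 64 * (5 * x ^ 4) - 80 * (3 * x^2) + 24 + 1 / x^2) (at x)"
   unfolding h_def[abs_def] using that by (auto intro!: derivative_eq_intros simp: power2_eq_square)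
  moreover have "64 * (5 * x ^ 4) - 80 * (3 * x^2) + 24 + 1 / x^2 = h' x"
  proof -
   define q where "q = x^2"
   have "q \<noteq> 0" using that by (simp add: q_def)
   then have "320 * q^2 - 240 * q + 24 + 1 / q = \<kappa> q / q"
    by (simp add: \<kappa>_def field_simps power2_eq_square power3_eq_cube)
   then show ?thesis unfolding h'_def q_def pw(2) by simp
  qed
  ultimately show ?thesis by simp
 qed
 \<comment> \<open>1521/10000 is 0.39^2. Up to 1/10 the quadratic and linear terms group to
   something nonnegative. From there the shifted cubic starts at 1.32 and loses at most about
   1.14.\<close>
 have \<kappa>_pos: "0 < \<kappa> q" if q: "0 < q" "q \<le> 1521/10000" for q
 proof (cases "q \<le> 1/10")
  case True
  have "\<kappa> q = 320 * q ^ 3 + 24 * q * (1 - 10 * q) + 1" by (simp add: \<kappa>_def power2_eq_square algebra_simps)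
  moreover have "0 \<le> 24 * q * (1 - 10 * q)" using q True by simp
  moreover have "0 < q ^ 3" using q by simp
  ultimately show ?thesis by linarith
 next
  case False
  define e where "e = q - 1/10"
  have e: "0 < e" "e \<le> 521/10000" "q = 1/10 + e" using q False by (simp_all add: e_def)
  have "\<kappa> q = 132/100 + e * (- (144/10) + (- 144) * e + 320 * e^2)"
   using cubic_shift[of 320 "1/10" e "-240" 24 1] by (simp add: \<kappa>_def e(3) power_divide)
  moreover have "e * (- (144/10) + (- 144) * e + 320 * e^2) = 320 * (e * e^2) - e * (144/10 + 144 * e)"
   by (simp add: algebra_simps)
  moreover have "e * (144/10 + 144 * e) \<le> 521/10000 * (144/10 + 144 * (521/10000))"
   using e by (intro mult_mono) auto
  moreover have "0 < e * e^2" using e by simp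
  moreover have "0 < c" if "c = 132/100 + x" "x = 320 * y - w" "w \<le> 521/10000 * (144/10 + 144 * (521/10000))" "0 < y" for c x y w :: real
   using that by simp
  ultimately show ?thesis by blast
 qed
 have \<kappa>_neg: "\<kappa> q < 0" if q: "18/100 \<le> q" "q \<le> 45/100" for q
 proof -
  \<comment> \<open>Linear interpolation of \<kappa> at 18/100 and 45/100, minus a remainder that is
    nonnegative between them; the linear part is already negative.\<close>
  have "\<kappa> q = (41104/10000 - 26112/1000 * q) - (320 * q - 384/10) * ((q - 18/100) * (45/100 - q))"
   by (simp add: \<kappa>_def power2_eq_square power3_eq_cube algebra_simps)
  moreover have "0 \<le> (320 * q - 384/10) * ((q - 18/100) * (45/100 - q))" using q by (intro mult_nonneg_nonneg) auto
  ultimately show ?thesis using q by linarith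
 qed
 have \<kappa>_mono: "0 < \<kappa> q'" if q: "18/100 \<le> q" "q < q'" "0 \<le> \<kappa> q" for q q'
 proof -
  have "45/100 < q" using \<kappa>_neg[of q] q by linarith
  then obtain a b where ab: "q = 45/100 + a" "q' = 45/100 + b" "0 < a" "a < b"
   using that[of "q - 45/100" "q' - 45/100"] q(2) by simp
  have K: "\<kappa> (45/100 + e) = - (764/100) + e * (24/10 + 192 * e + 320 * e^2)" for e
   using cubic_shift[of 320 "45/100" e "-240" 24 1] by (simp add: \<kappa>_def power_divide)
  have "a^2 < b^2" using ab by (intro power_strict_mono) auto
  then have "a * (24/10 + 192 * a + 320 * a^2) < b * (24/10 + 192 * b + 320 * b^2)"
   using ab(3,4) by (intro mult_strict_mono) (auto intro!: add_pos_nonneg add_nonneg_nonneg)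
  then show ?thesis using q(3) unfolding ab(1,2) K by linarith
 qed
 have h'_mono: "0 < h' y" if "43/100 < x" "x < y" "y < 1" "0 \<le> h' x" for x y
 proof -
  have "(43/100)^2 \<le> x^2" "x^2 < y^2" using that by (auto intro: power_mono power_strict_mono)
  moreover have "0 \<le> \<kappa> (x^2)" using that unfolding h'_def by (simp add: zero_le_divide_iff)
  ultimately have "0 < \<kappa> (y^2)" by (intro \<kappa>_mono[of "x^2"]) (auto simp: power2_eq_square)
  then show ?thesis unfolding h'_def using that by simp
 qed
 have qc: "h y \<le> max (h x) (h z)" if "43/100 < x" "x < y" "y < z" "z < 1" for x y z
  by (rule quasiconvex_if_deriv[where h' = h', OF dh h'_mono that]) simp_all
 have inc: "h x < h y" if "0 < x" "x < y" "y \<le> 39/100" for x y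
 proof (rule DERIV_pos_imp_increasing[OF that(2)])
  fix z assume z: "x \<le> z" "z \<le> y"
  have z0: "0 < z" using z that by simp
  have "z^2 \<le> (39/100)^2" using z z0 that by (intro power_mono) auto
  then have "0 < \<kappa> (z^2)" using z0 by (intro \<kappa>_pos) (auto simp: power2_eq_square)
  then have "0 < h' z" unfolding h'_def using z0 by simp
  then show "\<exists>d. (h has_real_derivative d) (at z) \<and> 0 < d" using dh[OF z0] by blast
 qed
 have mid: "t < h z" if z: "39/100 \<le> z" "z \<le> 43/100" for z
 proof -
  define e where "e = z^2 - 1521/10000"
  have "(39/100)^2 \<le> z^2" "z^2 \<le> (43/100)^2" using z by (auto intro: power_mono)
  then have e: "0 \<le> e" "e \<le> 328/10000" by (simp_all add: e_def power2_eq_square)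
  have ze: "z^2 = 1521/10000 + e" by (simp add: e_def)
  \<comment> \<open>The value of P at 0.39^2, about 1.025, exceeds 16/7 times 0.43, about 0.983, and
    the increment is nonnegative for e up to 0.43^2 - 0.39^2 = 0.0328.\<close>
  have "P (z^2) = 1024846800704/1000000000000 + e * (410580672/100000000 + (- (507968/10000)) * e + 64 * e^2)"
   using cubic_shift[of 64 "1521/10000" e "-80" 24 "-1"] by (simp add: P_def ze power_divide)
  moreover have "0 \<le> 410580672/100000000 + (- (507968/10000)) * e" using e by simp
  from mult_nonneg_nonneg[OF e(1) add_nonneg_nonneg[OF this, of "64 * e^2"]]
  have "0 \<le> e * (410580672/100000000 + (- (507968/10000)) * e + 64 * e^2)" by simp
  moreover have "16/7 * z \<le> 16/7 * (43/100)" using z by simp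
  ultimately have "16/7 * z < P (z^2)" by linarith
  then have "16/7 < h z" using z by (simp add: hP less_divide_eq)
  then show ?thesis using t by simp
 qed
 have large: "0 < h z" if z: "95/100 \<le> z" "z < 1" for z
 proof -
  have "(95/100)^2 \<le> z^2" using z by (intro power_mono) auto
  then have q: "9/10 \<le> z^2" by (simp add: power2_eq_square)
  define e where "e = z^2 - 9/10"
  have e: "0 \<le> e" "z^2 = 9/10 + e" using q by (simp_all add: e_def)
  have "P (z^2) = 2456/1000 + e * (3552/100 + 928/10 * e + 64 * e^2)"
   using cubic_shift[of 64 "9/10" e "-80" 24 "-1"] by (simp add: P_def e(2) power_divide)
  moreover have "0 \<le> e * (3552/100 + 928/10 * e + 64 * e^2)" using e by simp
  ultimately have "0 < P (z^2)" by linarith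
  then show ?thesis using z by (simp add: hP)
 qed
 \<comment> \<open>Left of 0.43 a value at most -t cannot follow one above -t, because h first
   increases and then exceeds t. So x lies to the right, where h is quasiconvex.\<close>
 have q': "h y \<le> - t" if "0 < w" "w < x" "x < y" "y < z" "z < 1" "- t < h w" "h x \<le> - t" "h z \<le> - t" for w x y z
 proof -
  have "43/100 < x"
  proof (rule ccontr)
   assume "\<not> 43/100 < x"
   then consider "x \<le> 39/100" | "39/100 \<le> x" "x \<le> 43/100" by linarith
   then show False
   proof cases
    case 1 then show False using inc[of w x] that by simp
   next
    case 2 then show False using mid[of x] that t by simp
   qed
  qed
  then show ?thesis using qc[of x y z] that by simp
 qed
 define S where "S = {z. -1 < z \<and> z < 1 \<and> 0 < U z + t * \<bar>z\<bar>}"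
 define T where "T = {z. -1 < z \<and> z < 1 \<and> 0 < - U z + t * \<bar>z\<bar>}"
 have fac: "0 < U z + t * \<bar>z\<bar> \<longleftrightarrow> - t < h z" "0 < - U z + t * \<bar>z\<bar> \<longleftrightarrow> h z < t" if "0 < z" for z
 proof -
  have "U z + t * \<bar>z\<bar> = z * (h z + t)" "- U z + t * \<bar>z\<bar> = z * (t - h z)" using that by (simp_all add: Uh algebra_simps)
  then show "0 < U z + t * \<bar>z\<bar> \<longleftrightarrow> - t < h z" "0 < - U z + t * \<bar>z\<bar> \<longleftrightarrow> h z < t"
   using that by (auto simp: zero_less_mult_iff)
 qed
 have S_iff: "z \<in> S \<longleftrightarrow> z < 1 \<and> - t < h z" if "0 < z" for z using fac(1)[OF that] that by (auto simp: S_def)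
 have T_iff: "z \<in> T \<longleftrightarrow> z < 1 \<and> h z < t" if "0 < z" for z using fac(2)[OF that] that by (auto simp: T_def)
 have oT: "open T"
  unfolding T_def by (intro open_Collect_conj open_Collect_less continuous_intros cU)
 have "pieces (2 * 1 + 1) T"
 proof (rule pieces_symmetric_0[OF oT, of "4/10"])
  show "- x \<in> T" if "x \<in> T" for x using that by (simp add: T_def Usym)
  show "0 \<in> T" by (simp add: T_def U_def)
  show "4/10 \<notin> T" using mid[of "4/10"] T_iff[of "4/10"] by simp
  show "w \<in> T" if a: "z \<in> T" "0 < w" "w < z" "z < 4/10" for w z
  proof -
   have hz: "h z < t" using T_iff[of z] a by simp
   then have "z < 39/100" using mid[of z] a by linarith
   then have "h w < h z" using a by (intro inc) simp_all
   then show ?thesis using T_iff[of w] hz a by simp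
  qed
  have "pieces 1 {z. 43/100 < z \<and> z < 1 \<and> h z < t}"
  proof (rule pieces_sublevel[OF _ qc, where m = "75/100"])
   show "continuous_on {43/100<..<1} h" by (rule continuous_on_subset[OF ch]) auto
   show "h (75/100) < t" using t by (simp add: h_def power_numeral_reduce)
  qed simp_all
  moreover have "{z. 43/100 < z \<and> z < 1 \<and> h z < t} = {z\<in>T. 4/10 < z}"
  proof (rule set_eqI)
   fix z
   have "43/100 < z" if "4/10 < z" "h z < t"
   proof (rule ccontr)
    assume "\<not> 43/100 < z"
    then show False using mid[of z] that by simp
   qed
   then show "z \<in> {z. 43/100 < z \<and> z < 1 \<and> h z < t} \<longleftrightarrow> z \<in> {z\<in>T. 4/10 < z}"
    using T_iff[of z] by auto
  qed
  ultimately show "pieces 1 {z\<in>T. 4/10 < z}" by simp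
 qed simp
 then have pT: "pieces 3 T" by (simp add: numeral_3_eq_3)
 have "pieces 1 {z. 0 < z \<and> z < 1 \<and> - t < h z} \<or> pieces 2 {z. 0 < z \<and> z < 1 \<and> - t < h z}"
 proof (rule pieces_superlevel[where h = h and v = "- t" and p = "39/100" and b = "95/100", OF ch])
  show "h y \<le> - t" if "0 < w" "w < x" "x < y" "y < z" "z < 1" "- t < h w" "h x \<le> - t" "h z \<le> - t" for w x y z
   by (rule q'[OF that])
  show "- t < h (39/100)" using mid[of "39/100"] t by simp
  show "- t < h z" if "95/100 \<le> z" "z < 1" for z using large[OF that] t by simp
  show "- t < h y" if "0 < x" "x < y" "y \<le> 39/100" "- t < h x" for x y using inc[OF that(1-3)] that(4) by simp
 qed simp_all
 moreover have "{z. 0 < z \<and> z < 1 \<and> - t < h z} = {x\<in>S. 0 / 2 < x}" using S_iff by auto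
 moreover have "pieces (2 * n) S" if "pieces n {x\<in>S. 0 / 2 < x}" for n
 proof (rule pieces_symmetric[where b = 0])
  show "0 - x \<in> S" if "x \<in> S" for x using that by (simp add: S_def Usym)
  show "0 / 2 \<notin> S" by (simp add: S_def U_def)
 qed (use that in simp)
 ultimately have "pieces (2 * 1) S \<or> pieces (2 * 2) S" by metis
 moreover have "card (nodal_domains (rect N) u) = m + 3" if "pieces m S" for m
  by (rule lower_card[OF nod, of U]) (use that pT Dir_cos(4) in \<open>simp_all add: S_def T_def U_def t_def\<close>)
 ultimately show ?thesis by force
qed

section \<open>The choice of the constant and the assembly of the four claims\<close>

text \<open>The interface between analysis and geometry: from here on \<phi> enters only through
  \<open>Lam \<phi>\<close> and the bounds on \<tau>.\<close>

lemma nodal_forms: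
 assumes adm: "admissible \<phi>" and N: "N > 0" and k: "k \<ge> 4" and kN: "(real k)^2 = 3 * N^2 + 4"
  and lim: "limiting_eigenfunctions \<phi> N v0 w0"
 obtains \<tau> c c' where "nodal N (- \<tau>) 1 c k v0" "nodal N 1 \<tau> c' k w0" "\<bar>\<tau>\<bar> < 1"
  "real k * \<bar>\<tau>\<bar> \<le> 4 * (1 - (Lam \<phi>)^2 / 24)" "\<bar>Lam \<phi>\<bar> \<le> real k * \<bar>\<tau>\<bar>"
proof -
 obtain \<phi>1 \<phi>2 where P: "profile \<phi> \<phi>1 \<phi>2 N" using admissible_imp_profile[OF adm N] by blast
 note c\<phi> = profile.continuous_\<phi>(1)[OF P] and b\<phi> = profile.\<phi>_bounds(1,2)[OF P]
 have L0: "Lam \<phi> \<noteq> 0" using adm by (simp add: admissible_def)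
 have k3: "k \<ge> 3" using k by simp
 have AB: "4 * integral {0..1} (\<lambda>y. \<phi> y * (sin (2 * (pi * y)))^2) <
   (real k)^2 * integral {0..1} (\<lambda>y. \<phi> y * (sin (pi * y))^2)"
  by (rule angle_constants(1)[OF c\<phi> _ _ L0 k]) (use b\<phi> in auto)
 show thesis
 proof (rule limiting_eigenfunctions_form[OF adm N k3 kN lim AB])
  fix \<tau> c c' assume T: "\<bar>\<tau>\<bar> < 1"
  "2 * real k * Lam \<phi> * (1 - \<tau>^2) = ((real k)^2 * integral {0..1} (\<lambda>y. \<phi> y * (sin (pi * y))^2) -
   4 * integral {0..1} (\<lambda>y. \<phi> y * (sin (2 * (pi * y)))^2)) * \<tau>"
  "c \<noteq> 0" "c' \<noteq> 0"
  and V: "\<And>x y. 0 < x ==> x < N ==> 0 < y ==> y < 1 ==>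
   v0 (x, y) = c * (sin (2 * (pi * x / N)) * sin (2 * (pi * y)) - \<tau> * sin (real k * (pi * x / N)) * sin (pi * y))"
  and W: "\<And>x y. 0 < x ==> x < N ==> 0 < y ==> y < 1 ==>
   w0 (x, y) = c' * (sin (real k * (pi * x / N)) * sin (pi * y) + \<tau> * sin (2 * (pi * x / N)) * sin (2 * (pi * y)))"
  have "real k * \<bar>\<tau>\<bar> \<le> 4 * (1 - (Lam \<phi>)^2 / 24) \<and> \<bar>Lam \<phi>\<bar> \<le> real k * \<bar>\<tau>\<bar>"
   by (rule angle_constants(2)[OF c\<phi> _ _ L0 k T(1,2)]) (use b\<phi> in auto)
  moreover have "nodal N (- \<tau>) 1 c k v0"
  proof
   fix x y assume "0 < x" "x < N" "0 < y" "y < (1::real)"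
   from V[OF this] show "v0 (x, y) = c * sin (pi * x / N) * sin (pi * y) *
     (- \<tau> * Dir k (pi * x / N) + 4 * 1 * cos (pi * x / N) * cos (pi * y))"
    unfolding sin_mult_Dir[symmetric] sin_double by (simp add: algebra_simps)
  qed (use N k T in auto)
  moreover have "nodal N 1 \<tau> c' k w0"
  proof
   fix x y assume "0 < x" "x < N" "0 < y" "y < (1::real)"
   from W[OF this] show "w0 (x, y) = c' * sin (pi * x / N) * sin (pi * y) *
     (1 * Dir k (pi * x / N) + 4 * \<tau> * cos (pi * x / N) * cos (pi * y))"
    unfolding sin_mult_Dir[symmetric] sin_double by (simp add: algebra_simps)
  qed (use N k T in auto)
  ultimately show thesis using that T(1) by blast
 qed
qed

text \<open>k \<ge> 4 and the resonance give N \<ge> 2, hence k \<le> 2 N. With pi < 4 this turns a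
  distance in x into a phase by the factor 8, free of k and N; this is why \<open>c0\<close> depends
  on neither.\<close>

lemma scaled_distance_le:
 assumes N: "N > 0" and k: "k \<ge> 4" and kN: "(real k)^2 = 3 * N^2 + 4" and d: "\<bar>d\<bar> \<le> e"
 shows "real k * (pi * \<bar>d\<bar> / N) \<le> 8 * e"
proof -
 have "(4::real)^2 \<le> (real k)^2" using k by (intro power_mono) auto
 then have "(real k)^2 \<le> (2 * N)^2" using kN by (simp add: power_mult_distrib)
 then have "real k \<le> 2 * N" by (rule power2_le_imp_le) (use N in simp)
 then have kN2: "real k / N \<le> 2" using N by (simp add: divide_le_eq)
 have "pi * \<bar>d\<bar> \<le> 4 * e" using pi_less_4 d by (intro mult_mono) auto
 from mult_mono[OF kN2 this] have "real k / N * (pi * \<bar>d\<bar>) \<le> 2 * (4 * e)" by simp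
 then show ?thesis by simp
qed

theorem theorem1p3:
  "\<exists>c0 :: real \<Rightarrow> real.
     (\<forall>L. L \<noteq> 0 \<longrightarrow> 0 < c0 L \<and> c0 L < 1/2) \<and>
     (\<forall>(k::nat) (N::real) (\<phi> :: real \<Rightarrow> real)
        (v0 :: real \<times> real \<Rightarrow> real) (w0 :: real \<times> real \<Rightarrow> real).
        k \<ge> 3 \<and> N > 0 \<and> (real k)\<^sup>2 = 3 * N\<^sup>2 + 4 \<and>
        admissible \<phi> \<and> limiting_eigenfunctions \<phi> N v0 w0 \<longrightarrow>
        (k \<ge> 4 \<and> even k \<longrightarrow>
           card (nodal_domains (rect N) v0) = 4 \<and>
           (\<exists>ybar. c0 (Lam \<phi>) \<le> ybar \<and> ybar \<le> 1 - c0 (Lam \<phi>) \<and>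
              crossing_at (nodal_set (rect N) v0) (N / 2, ybar)) \<and>
           (\<forall>p \<in> nodal_set (rect N) v0 \<inter> frontier (rect N).
              meets_orthogonally N (nodal_set (rect N) v0) p)) \<and>
        (k \<ge> 5 \<and> odd k \<longrightarrow>
           card (nodal_domains (rect N) v0) = 3 \<and>
           nodal_set (rect N) v0 \<inter> {(x, y). \<bar>x - N / 2\<bar> < c0 (Lam \<phi>)} = {} \<and>
           (\<forall>p \<in> nodal_set (rect N) v0 \<inter> frontier (rect N).
              meets_orthogonally N (nodal_set (rect N) v0) p)) \<and>
        (k \<ge> 8 \<longrightarrow>
           (\<exists>\<C> :: (real \<times> real) set set.
              finite \<C> \<and> card \<C> = k - 1 \<and> disjoint \<C> \<and> \<Union>\<C> = nodal_set (rect N) w0 \<and>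
              (\<forall>C\<in>\<C>. (\<exists>g. arc g \<and> path_image g = C) \<and>
                 C \<inter> {0..N} \<times> {1} \<noteq> {} \<and> C \<inter> {0..N} \<times> {0} \<noteq> {})) \<and>
           card (nodal_domains (rect N) w0) = k \<and>
           nodal_set (rect N) w0 \<inter>
             (\<Union>j \<in> {j \<in> {1..2 * k - 1}. odd j}.
                {(x, y). \<bar>x - real j * N / (2 * real k)\<bar> < c0 (Lam \<phi>)}) = {} \<and>
           (\<forall>p \<in> nodal_set (rect N) w0 \<inter> frontier (rect N).
              meets_orthogonally N (nodal_set (rect N) w0) p)) \<and>
        (k \<in> {5, 6, 7} \<longrightarrow>
           card (nodal_domains (rect N) w0) \<in> {k, k - 2} \<and>
           (\<forall>p \<in> nodal_set (rect N) w0 \<inter> frontier (rect N).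
              meets_orthogonally N (nodal_set (rect N) w0) p \<or>
              boundary_branch_point (nodal_set (rect N) w0) p)))"
proof -
 \<comment> \<open>1/4 keeps the value below 1/2. The fraction |L| / 100 is small enough for three
   comparisons: 1 - L^2 / 1250 against 1 - L^2 / 24 for the height of the crossing, 0.64 |L| against
   |L| for the strip of \<open>v0\<close>, and 4 L^2 / 625 against L^2 / 12 for the strips of
   \<open>w0\<close>.\<close>
 define c0 where "c0 L = min (1/4) (\<bar>L\<bar> / 100)" for L :: real
 have c0: "c0 L \<le> \<bar>L\<bar> / 100" for L by (simp add: c0_def)
 have main: "(k \<ge> 4 \<and> even k \<longrightarrow>
      card (nodal_domains (rect N) v0) = 4 \<and>
      (\<exists>ybar. c0 (Lam \<phi>) \<le> ybar \<and> ybar \<le> 1 - c0 (Lam \<phi>) \<and>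
       crossing_at (nodal_set (rect N) v0) (N / 2, ybar)) \<and>
      (\<forall>p \<in> nodal_set (rect N) v0 \<inter> frontier (rect N).
       meets_orthogonally N (nodal_set (rect N) v0) p)) \<and>
    (k \<ge> 5 \<and> odd k \<longrightarrow>
      card (nodal_domains (rect N) v0) = 3 \<and>
      nodal_set (rect N) v0 \<inter> {(x, y). \<bar>x - N / 2\<bar> < c0 (Lam \<phi>)} = {} \<and>
      (\<forall>p \<in> nodal_set (rect N) v0 \<inter> frontier (rect N).
       meets_orthogonally N (nodal_set (rect N) v0) p)) \<and>
    (k \<ge> 8 \<longrightarrow>
      (\<exists>\<C> :: (real \<times> real) set set.
       finite \<C> \<and> card \<C> = k - 1 \<and> disjoint \<C> \<and> \<Union>\<C> = nodal_set (rect N) w0 \<and>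
       (\<forall>C\<in>\<C>. (\<exists>g. arc g \<and> path_image g = C) \<and>
         C \<inter> {0..N} \<times> {1} \<noteq> {} \<and> C \<inter> {0..N} \<times> {0} \<noteq> {})) \<and>
      card (nodal_domains (rect N) w0) = k \<and>
      nodal_set (rect N) w0 \<inter>
       (\<Union>j \<in> {j \<in> {1..2 * k - 1}. odd j}.
        {(x, y). \<bar>x - real j * N / (2 * real k)\<bar> < c0 (Lam \<phi>)}) = {} \<and>
      (\<forall>p \<in> nodal_set (rect N) w0 \<inter> frontier (rect N).
       meets_orthogonally N (nodal_set (rect N) w0) p)) \<and>
    (k \<in> {5, 6, 7} \<longrightarrow>
      card (nodal_domains (rect N) w0) \<in> {k, k - 2} \<and>
      (\<forall>p \<in> nodal_set (rect N) w0 \<inter> frontier (rect N).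
       meets_orthogonally N (nodal_set (rect N) w0) p \<or>
       boundary_branch_point (nodal_set (rect N) w0) p))" (is "(_ \<longrightarrow> ?i) \<and> (_ \<longrightarrow> ?ii) \<and> (_ \<longrightarrow> ?iii) \<and> (_ \<longrightarrow> ?iv)")
  if A: "k \<ge> 3 \<and> N > 0 \<and> (real k)^2 = 3 * N^2 + 4 \<and> admissible \<phi> \<and> limiting_eigenfunctions \<phi> N v0 w0"
  for k N \<phi> v0 w0
 proof (cases "k \<ge> 4")
  \<comment> \<open>Here k = 3 and the premises of all four claims fail.\<close>
  case False
  then show ?thesis by simp
 next
  case k: True
  have N: "N > 0" and kN: "(real k)^2 = 3 * N^2 + 4" and adm: "admissible \<phi>" and lim: "limiting_eigenfunctions \<phi> N v0 w0"
   using A by blast+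
  obtain \<tau> c c' where V: "nodal N (- \<tau>) 1 c k v0" and W: "nodal N 1 \<tau> c' k w0" and \<tau>1: "\<bar>\<tau>\<bar> < 1"
   and up: "real k * \<bar>\<tau>\<bar> \<le> 4 * (1 - (Lam \<phi>)^2 / 24)" and lo: "\<bar>Lam \<phi>\<bar> \<le> real k * \<bar>\<tau>\<bar>"
   by (rule nodal_forms[OF adm N k kN lim])
  define L where "L = Lam \<phi>"
  have L0: "L \<noteq> 0" using adm by (simp add: admissible_def L_def)
  then have L2: "0 < L^2" by simp
  have up': "real k * \<bar>\<tau>\<bar> \<le> 4 - L^2 / 6" using up by (simp add: L_def)
  have t4: "real k * \<bar>\<tau>\<bar> < 4" using up' L2 by linarith
  have \<tau>0: "\<tau> \<noteq> 0" using lo L0 by (auto simp: L_def)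
  have L4: "\<bar>L\<bar> < 4" using lo t4 by (simp add: L_def)
  have near: "real k * (pi * \<bar>d\<bar> / N) \<le> 8 * (\<bar>L\<bar> / 100)" if "\<bar>d\<bar> < c0 L" for d
   by (rule scaled_distance_le[OF N k kN]) (use that c0[of L] in linarith)
  have orth: "\<forall>p \<in> nodal_set (rect N) v0 \<inter> frontier (rect N). meets_orthogonally N (nodal_set (rect N) v0) p"
   using upper_meets_orthogonally[OF V t4] by blast
  have i: ?i if ev: "even k"
  proof -
   obtain y0 where y0: "0 < y0" "y0 < 1" "\<bar>cos (pi * y0)\<bar> \<le> real k * \<bar>\<tau>\<bar> / 4"
    "crossing_at (nodal_set (rect N) v0) (N / 2, y0)"
    by (rule upper_even_crossing[OF V t4 ev])
   \<comment> \<open>A smaller z would make cos (pi z) at least 1 - L^2 / 1250, above the bound 1 -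
     L^2 / 24. It is applied to y0 and to 1 - y0.\<close>
   have far: "c0 L \<le> z" if z: "0 < z" "\<bar>cos (pi * z)\<bar> \<le> real k * \<bar>\<tau>\<bar> / 4" for z
   proof (rule ccontr)
    assume "\<not> c0 L \<le> z"
    then have "z \<le> \<bar>L\<bar> / 100" using c0[of L] by linarith
    then have "pi * z \<le> 4 * (\<bar>L\<bar> / 100)" using pi_less_4 z by (intro mult_mono) auto
    then have "(pi * z)^2 \<le> (4 * (\<bar>L\<bar> / 100))^2" using z by (intro power_mono) auto
    then have "(pi * z)^2 \<le> L^2 / 625" by (simp add: power_mult_distrib power_divide)
    then show False using one_minus_cos_le[of "pi * z"] z(2) up' L2 by linarith
   qed
   have "cos (pi * (1 - y0)) = - cos (pi * y0)" by (simp add: right_diff_distrib cos_diff)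
   then have "c0 L \<le> 1 - y0" using y0 by (intro far) simp_all
   then have "c0 (Lam \<phi>) \<le> y0 \<and> y0 \<le> 1 - c0 (Lam \<phi>)" using far[of y0] y0 by (simp add: L_def)
   then show ?thesis using y0(4) orth upper_even_domains[OF V t4 ev] by blast
  qed
  have ii: ?ii if od: "odd k"
  proof -
   have "nodal_set (rect N) v0 \<inter> {(x, y). \<bar>x - N / 2\<bar> < c0 (Lam \<phi>)} = {}"
   proof (rule ccontr)
    assume "nodal_set (rect N) v0 \<inter> {(x, y). \<bar>x - N / 2\<bar> < c0 (Lam \<phi>)} \<noteq> {}"
    then obtain x y where xy: "(x, y) \<in> nodal_set (rect N) v0" "\<bar>x - N / 2\<bar> < c0 L" by (auto simp: L_def)
    have "real k * (pi * \<bar>x - N / 2\<bar> / N) < 1" using near[OF xy(2)] L4 by linarith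
    from upper_odd_strip[OF V od xy(1) this] show False using near[OF xy(2)] lo L0 unfolding L_def[symmetric] by simp
   qed
   then show ?thesis using orth upper_odd_domains[OF V t4 \<tau>0 od] by blast
  qed
  have iii: ?iii if k8: "k \<ge> 8"
  proof -
   \<comment> \<open>This is where k \<ge> 8 enters: k |\<tau>| \<le> 4 - L^2 / 6 becomes the block
     condition 2 |\<tau>| < 1, with a gap of L^2 / 24.\<close>
   have "8 * \<bar>\<tau>\<bar> \<le> real k * \<bar>\<tau>\<bar>" using k8 by (intro mult_right_mono) auto
   then have t12: "2 * \<bar>\<tau>\<bar> \<le> 1 - L^2 / 24" using up' by linarith
   then have t1: "2 * \<bar>\<tau>\<bar> < 1" using L2 by linarith
   have strip: "nodal_set (rect N) w0 \<inter> (\<Union>j \<in> {j \<in> {1..2 * k - 1}. odd j}.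
     {(x, y). \<bar>x - real j * N / (2 * real k)\<bar> < c0 (Lam \<phi>)}) = {}"
   proof (rule ccontr)
    assume "nodal_set (rect N) w0 \<inter> (\<Union>j \<in> {j \<in> {1..2 * k - 1}. odd j}.
     {(x, y). \<bar>x - real j * N / (2 * real k)\<bar> < c0 (Lam \<phi>)}) \<noteq> {}"
    then obtain x y j where xy: "(x, y) \<in> nodal_set (rect N) w0" "odd j" "\<bar>x - real j * N / (2 * real k)\<bar> < c0 L"
     by (auto simp: L_def)
    have "2 * (1 - 2 * \<bar>\<tau>\<bar>) \<le> (real k * (pi * \<bar>x - real j * N / (2 * real k)\<bar> / N))^2"
     by (rule lower_strip[OF W xy(1,2)])
    also have "... \<le> (8 * (\<bar>L\<bar> / 100))^2" using N by (intro power_mono near xy(3)) auto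
    also have "... = 4 / 625 * L^2" by (simp add: power_mult_distrib power_divide)
    finally have "2 * (1 - 2 * \<bar>\<tau>\<bar>) \<le> 4 / 625 * L^2" .
    moreover have False if "2 * (1 - 2 * b) \<le> 4 / 625 * q" "2 * b \<le> 1 - q / 24" "0 < q" for b q :: real
     using that by simp
    ultimately show False using t12 L2 by blast
   qed
   show ?thesis
    using lower_curves[OF W t1] lower_many_domains[OF k t1 W] strip lower_boundary_points(2)[OF W \<tau>0 \<tau>1 t4 _ t1] by blast
  qed
  have iv: ?iv if k567: "k \<in> {5, 6, 7}"
  proof -
   from k567 consider "k = 5" | "k = 6" | "k = 7" by blast
   then have "card (nodal_domains (rect N) w0) \<in> {k, k - 2}"
   proof cases
    case 1 then show ?thesis using lower_domains_5[OF W[unfolded 1] \<tau>0] by simp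
   next
    case 2 then show ?thesis using lower_domains_6[OF W[unfolded 2] \<tau>0] by simp
   next
    case 3 then show ?thesis using lower_domains_7[OF W[unfolded 3] \<tau>0] t4 by simp
   qed
   then show ?thesis using lower_boundary_points(1)[OF W \<tau>0 \<tau>1 t4] by blast
  qed
  show ?thesis using i ii iii iv by blast
 qed
 have "\<forall>L. L \<noteq> 0 \<longrightarrow> 0 < c0 L \<and> c0 L < 1/2" by (auto simp: c0_def min_less_iff_disj)
 then show ?thesis by (rule exI[of _ c0, OF conjI]) (intro allI impI, rule main)
qed

end
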